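(* Let $\nu$ be a positive smooth measure on $E$ and let $B$ be a PCAF of $\mathbb X$ with exceptional set $N\subset N_\nu$ such that $B$ is in the Revuz correspondence with $\nu$ and the function $\phi^1_B(x)=E_x\int_0^\zeta e^{-t}e^{-B_t}\,dt$, $x\in E$, is finely continuous. Then $N=N_\nu$, and for every $x\in E$, $P_x(A^\nu_t=B_t \text{ for all } t>0)=1$.
   Context: Setting. $E$ is a locally compact separable metric space, $m$ a Radon measure on $E$ with full support, $A$ a non-positive self-adjoint operator on $L^2(E;m)$ generating a strongly continuous Markov semigroup of contractions $(T_t)_{t\ge0}$, and $(\mathcal E,D(\mathcal E))$ the associated symmetric Dirichlet form ($\mathcal E(u,v)=(-Au,v)$ for $u\in D(A)\subset D(\mathcal E)$, $v\in D(\mathcal E)$), assumed regular and transient. $\mathbb X=((X_t),(P_x)_{x\in E\cup\{\Delta\}},(\mathcal F_t))$ is a Hunt process with cemetery $\Delta$, lifetime $\zeta$ and shifts $\theta_t$ such that $T_tf(x)=E_xf(X_t)$ for $m$-a.e. $x$, $f\in\mathcal B(E)\cap L^2(E;m)$ (functions are extended by $f(\Delta)=0$). $\mathcal B(E)$, $\mathcal B^+(E)$ are the Borel, resp. non-negative Borel, functions on $E$. $P_tf(x)=E_xf(X_t)$, $R_\alpha f(x)=E_x\int_0^\zeta e^{-\alpha t}f(X_t)\,dt$ for $\alpha\ge0$, $R=R_0$. Absolute continuity condition (assumed): for bounded $f\in\mathcal B^+(E)$ with $\int f\,dm=0$ one has $P_tf(x)=0$ for all $t>0$, $x\in E$. A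 function $f\in\mathcal B^+(E)$ is excessive if $\sup_{\alpha>0}\alpha R_\alpha f=f$ on $E$. $G\ge0$ (the Green function) is the Borel function on $E\times E$ with $G(x,\cdot),G(\cdot,y)$ excessive and $Rf(x)=\int_E G(x,y)f(y)\,m(dy)$ for all $x\in E$, $f\in\mathcal B^+(E)$. $R\mu(x)=\int_E G(x,y)\,\mu(dy)$ for positive Borel measures $\mu$. The fine topology is the smallest topology on $E$ making all excessive functions continuous; finely open/continuous refer to it. Capacity and smooth measures. $\mathrm{Cap}(U)=\inf\{\mathcal E(u,u):u\in D(\mathcal E),\ u\ge \mathbf 1_U\ m\text{-a.e.}\}$ for open $U$, and $\mathrm{Cap}(B)=\inf\{\mathrm{Cap}(U):U\supset B\text{ open}\}$. A set is polar iff its capacity is zero. A positive Borel measure $\nu$ on $E$ is smooth if it charges no set of zero capacity and there is an increasing sequence of closed sets $F_n$ with $\nu(F_n)<\infty$ and $\mathrm{Cap}(K\setminus F_n)\to0$ for every compact $K\subset E$. A smooth positive measure $\mu$ is strictly smooth if there are increasing Borel sets $B_n$ with $\bigcup_nB_n=E$ and $R(\mathbf 1_{B_n}\cdot\mu)$ bounded for every $n$. PCAF. An $(\mathcal F_t)$-adapted process $A=(A_t)_{t\ge0}$ is a positive continuous additive functional (PCAF) of $\mathbb X$ with exceptional set $N$ if $N$ is polar and there is $\Lambda\in\mathcal F_\infty$ such that: $P_x(\Lambda)=1$ for $x\in E\setminus N$; $P_x(A_0=0)=1$ for $x\in E\setminus N$ and $A_t(\omega)\ge0$ for $t\ge0,\omega\in\Lambda$;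 $\theta_t(\Lambda)\subset\Lambda$ for $t>0$ and $A_{t+s}(\omega)=A_t(\omega)+A_s(\theta_t\omega)$ for $s,t\ge0$, $\omega\in\Lambda$; $A_t(\omega)<\infty$ for $t<\zeta(\omega)$ and $A_t(\omega)=A_{\zeta(\omega)}(\omega)$ for $t\ge\zeta(\omega)$, $\omega\in\Lambda$; $t\mapsto A_t(\omega)$ is continuous on $[0,\infty)$ for $\omega\in\Lambda$. It is a strict PCAF if $N=\emptyset$. The Revuz correspondence (duality) between a PCAF $A$ and a positive smooth measure $\nu$ is the relation $\lim_{t\to0^+}\frac1tE_m\int_0^tf(X_s)\,dA_s=\int_Ef\,d\nu$, $f\in\mathcal B^+(E)$ ($E_m=\int_EE_x\,m(dx)$); for strict PCAFs it is equivalent to $E_x\int_0^\zeta f(X_t)\,dA_t=\int_E G(x,y)f(y)\,\nu(dy)$ for all $x\in E$, $f\in\mathcal B^+(E)$. The sets $E_\nu,N_\nu$ and the functional $A^\nu$. $E_\nu$ is the set of $x\in E$ having a finely open neighborhood $V_x$ with $\int_{V_x}G(x,y)\,\nu(dy)<\infty$; $N_\nu=E\setminus E_\nu$. $A^\nu$ is the PCAF of $\mathbb X$ with exceptional set $N_\nu$ defined by $A^\nu_t=\sup_{n\ge1}A^n_t$, where $\{\nu_n\}$ is a sequence of positive strictly smooth measures increasing to $\nu$ and $A^n$ is the strict PCAF in the Revuz correspondence with $\nu_n$ (such a sequence always exists). It satisfies $P_x(A^\nu_t=\infty,\ t>0)=1$ for $x\in N_\nu$, with the convention $e^{-\infty}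=0$.
   Formalization: Added hypothesis: for each x in N, t ↦ B_t is nondecreasing on (0,∞) P_x-a.s.; the PCAF definition says nothing about B under P_x for x in N, and without this the final equality can fail there (alter B at one fixed time when X_0 is in N). *)

theory Defs
  imports "HOL-Probability.Probability"
begin

section \<open>Symmetric Dirichlet forms on \<open>L\<^sup>2(E; m)\<close>\<close>

text \<open>
  Elements of \<open>L\<^sup>2(E; m)\<close> are represented by square integrable Borel functions; operators and
  forms act on representatives and are required to respect equality \<open>m\<close>-almost everywhere.
\<close>

definition L2 :: "'e measure \<Rightarrow> ('e \<Rightarrow> real) set" where
  "L2 m = {u \<in> borel_measurable m. integrable m (\<lambda>x. (u x)\<^sup>2)}"

definition L2_inner :: "'e measure \<Rightarrow> ('e \<Rightarrow> real) \<Rightarrow> ('e \<Rightarrow> real) \<Rightarrow> real" where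
  "L2_inner m u v = (\<integral>x. u x * v x \<partial>m)"

definition L2_norm :: "'e measure \<Rightarrow> ('e \<Rightarrow> real) \<Rightarrow> real" where
  "L2_norm m u = sqrt (L2_inner m u u)"

definition L2_subspace :: "'e measure \<Rightarrow> ('e \<Rightarrow> real) set \<Rightarrow> bool" where
  "L2_subspace m D \<longleftrightarrow> D \<subseteq> L2 m \<and> (\<lambda>_. 0) \<in> D
     \<and> (\<forall>u\<in>D. \<forall>v\<in>L2 m. (AE x in m. u x = v x) \<longrightarrow> v \<in> D)
     \<and> (\<forall>u\<in>D. \<forall>v\<in>D. \<forall>a b. (\<lambda>x. a * u x + b * v x) \<in> D)"

definition L2_dense :: "'e measure \<Rightarrow> ('e \<Rightarrow> real) set \<Rightarrow> bool" where
  "L2_dense m D \<longleftrightarrow> (\<forall>u\<in>L2 m. \<forall>\<epsilon>>0. \<exists>v\<in>D. L2_norm m (\<lambda>x. u x - v x) < \<epsilon>)"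

definition linear_operator ::
  "'e measure \<Rightarrow> ('e \<Rightarrow> real) set \<Rightarrow> (('e \<Rightarrow> real) \<Rightarrow> 'e \<Rightarrow> real) \<Rightarrow> bool" where
  "linear_operator m D L \<longleftrightarrow> L2_subspace m D \<and> L ` D \<subseteq> L2 m
     \<and> (\<forall>u\<in>D. \<forall>v\<in>D. (AE x in m. u x = v x) \<longrightarrow> (AE x in m. L u x = L v x))
     \<and> (\<forall>u\<in>D. \<forall>v\<in>D. \<forall>a b. AE x in m. L (\<lambda>x. a * u x + b * v x) x = a * L u x + b * L v x)"

text \<open>The last conjunct says that the graph of the adjoint \<open>L\<^sup>*\<close> is the graph of \<open>L\<close>.\<close>

definition self_adjoint ::
  "'e measure \<Rightarrow> ('e \<Rightarrow> real) set \<Rightarrow> (('e \<Rightarrow> real) \<Rightarrow> 'e \<Rightarrow> real) \<Rightarrow> bool" where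
  "self_adjoint m D L \<longleftrightarrow> linear_operator m D L \<and> L2_dense m D
     \<and> (\<forall>v\<in>L2 m. \<forall>w\<in>L2 m. (\<forall>u\<in>D. L2_inner m (L u) v = L2_inner m u w)
           \<longleftrightarrow> v \<in> D \<and> (AE x in m. L v x = w x))"

definition non_positive ::
  "'e measure \<Rightarrow> ('e \<Rightarrow> real) set \<Rightarrow> (('e \<Rightarrow> real) \<Rightarrow> 'e \<Rightarrow> real) \<Rightarrow> bool" where
  "non_positive m D L \<longleftrightarrow> (\<forall>u\<in>D. L2_inner m (L u) u \<le> 0)"

definition markov_semigroup ::
  "'e measure \<Rightarrow> (real \<Rightarrow> ('e \<Rightarrow> real) \<Rightarrow> 'e \<Rightarrow> real) \<Rightarrow> bool" where
  "markov_semigroup m T \<longleftrightarrow>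
     (\<forall>t\<ge>0. linear_operator m (L2 m) (T t)
        \<and> (\<forall>u\<in>L2 m. L2_norm m (T t u) \<le> L2_norm m u)
        \<and> (\<forall>u\<in>L2 m. (AE x in m. 0 \<le> u x \<and> u x \<le> 1) \<longrightarrow> (AE x in m. 0 \<le> T t u x \<and> T t u x \<le> 1)))
     \<and> (\<forall>u\<in>L2 m. AE x in m. T 0 u x = u x)
     \<and> (\<forall>s\<ge>0. \<forall>t\<ge>0. \<forall>u\<in>L2 m. AE x in m. T (s + t) u x = T s (T t u) x)
     \<and> (\<forall>u\<in>L2 m. ((\<lambda>t. L2_norm m (\<lambda>x. T t u x - u x)) \<longlongrightarrow> 0) (at_right 0))"

definition generates ::
  "'e measure \<Rightarrow> ('e \<Rightarrow> real) set \<Rightarrow> (('e \<Rightarrow> real) \<Rightarrow> 'e \<Rightarrow> real)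
     \<Rightarrow> (real \<Rightarrow> ('e \<Rightarrow> real) \<Rightarrow> 'e \<Rightarrow> real) \<Rightarrow> bool" where
  "generates m D L T \<longleftrightarrow>
     (\<forall>u\<in>L2 m. \<forall>w\<in>L2 m.
        ((\<lambda>t. L2_norm m (\<lambda>x. (T t u x - u x) / t - w x)) \<longlongrightarrow> 0) (at_right 0)
          \<longleftrightarrow> u \<in> D \<and> (AE x in m. L u x = w x))"

definition form1 ::
  "'e measure \<Rightarrow> (('e \<Rightarrow> real) \<Rightarrow> ('e \<Rightarrow> real) \<Rightarrow> real) \<Rightarrow> ('e \<Rightarrow> real) \<Rightarrow> ('e \<Rightarrow> real) \<Rightarrow> real" where
  "form1 m \<E> u v = \<E> u v + L2_inner m u v"

definition dirichlet_form ::
  "'e measure \<Rightarrow> (('e \<Rightarrow> real) \<Rightarrow> ('e \<Rightarrow> real) \<Rightarrow> real) \<Rightarrow> ('e \<Rightarrow> real) set \<Rightarrow> bool" where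
  "dirichlet_form m \<E> D \<longleftrightarrow> L2_subspace m D \<and> L2_dense m D
     \<and> (\<forall>u\<in>D. \<forall>v\<in>D. \<forall>w\<in>D. (AE x in m. u x = v x) \<longrightarrow> \<E> u w = \<E> v w)
     \<and> (\<forall>u\<in>D. \<forall>v\<in>D. \<forall>w\<in>D. \<forall>a b. \<E> (\<lambda>x. a * u x + b * v x) w = a * \<E> u w + b * \<E> v w)
     \<and> (\<forall>u\<in>D. \<forall>v\<in>D. \<E> u v = \<E> v u)
     \<and> (\<forall>u\<in>D. 0 \<le> \<E> u u)
     \<and> (\<forall>u. (\<forall>n::nat. u n \<in> D)
          \<and> (\<forall>\<epsilon>>0. \<exists>n\<^sub>0. \<forall>i\<ge>n\<^sub>0. \<forall>j\<ge>n\<^sub>0. form1 m \<E> (\<lambda>x. u i x - u j x) (\<lambda>x. u i x - u j x) < \<epsilon>)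
          \<longrightarrow> (\<exists>v\<in>D. (\<lambda>n. form1 m \<E> (\<lambda>x. u n x - v x) (\<lambda>x. u n x - v x)) \<longlonglongrightarrow> 0))
     \<and> (\<forall>u\<in>D. (\<lambda>x. min (max (u x) 0) 1) \<in> D
          \<and> \<E> (\<lambda>x. min (max (u x) 0) 1) (\<lambda>x. min (max (u x) 0) 1) \<le> \<E> u u)"

definition compactly_supported :: "('e::topological_space \<Rightarrow> real) set" where
  "compactly_supported = {f. continuous_on UNIV f \<and> (\<exists>K. compact K \<and> (\<forall>x. x \<notin> K \<longrightarrow> f x = 0))}"

definition regular_form ::
  "'e::topological_space measure \<Rightarrow> (('e \<Rightarrow> real) \<Rightarrow> ('e \<Rightarrow> real) \<Rightarrow> real) \<Rightarrow> ('e \<Rightarrow> real) set \<Rightarrow> bool" where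
  "regular_form m \<E> D \<longleftrightarrow>
     (\<forall>u\<in>D. \<forall>\<epsilon>>0. \<exists>v\<in>D \<inter> compactly_supported. form1 m \<E> (\<lambda>x. u x - v x) (\<lambda>x. u x - v x) < \<epsilon>)
     \<and> (\<forall>f\<in>compactly_supported. \<forall>\<epsilon>>0. \<exists>v\<in>D \<inter> compactly_supported. \<forall>x. \<bar>f x - v x\<bar> < \<epsilon>)"

text \<open>Transience in the sense of Fukushima, Oshima and Takeda: existence of a reference function.\<close>

definition transient_form ::
  "'e measure \<Rightarrow> (('e \<Rightarrow> real) \<Rightarrow> ('e \<Rightarrow> real) \<Rightarrow> real) \<Rightarrow> ('e \<Rightarrow> real) set \<Rightarrow> bool" where
  "transient_form m \<E> D \<longleftrightarrow>
     (\<exists>g. integrable m g \<and> (\<exists>C. \<forall>x. \<bar>g x\<bar> \<le> C) \<and> (AE x in m. 0 < g x)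
        \<and> (\<forall>u\<in>D. (\<integral>x. \<bar>u x\<bar> * g x \<partial>m) \<le> sqrt (\<E> u u)))"


section \<open>Capacity and smooth measures\<close>

definition cap_open ::
  "'e measure \<Rightarrow> (('e \<Rightarrow> real) \<Rightarrow> ('e \<Rightarrow> real) \<Rightarrow> real) \<Rightarrow> ('e \<Rightarrow> real) set \<Rightarrow> 'e set \<Rightarrow> ennreal" where
  "cap_open m \<E> D U = (INF u\<in>{u \<in> D. AE x in m. indicator U x \<le> u x}. ennreal (\<E> u u))"

definition capacity ::
  "'e::topological_space measure \<Rightarrow> (('e \<Rightarrow> real) \<Rightarrow> ('e \<Rightarrow> real) \<Rightarrow> real) \<Rightarrow> ('e \<Rightarrow> real) set
     \<Rightarrow> 'e set \<Rightarrow> ennreal" where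
  "capacity m \<E> D S = (INF U\<in>{U. open U \<and> S \<subseteq> U}. cap_open m \<E> D U)"

definition polar ::
  "'e::topological_space measure \<Rightarrow> (('e \<Rightarrow> real) \<Rightarrow> ('e \<Rightarrow> real) \<Rightarrow> real) \<Rightarrow> ('e \<Rightarrow> real) set
     \<Rightarrow> 'e set \<Rightarrow> bool" where
  "polar m \<E> D S \<longleftrightarrow> capacity m \<E> D S = 0"

definition smooth_measure ::
  "'e::topological_space measure \<Rightarrow> (('e \<Rightarrow> real) \<Rightarrow> ('e \<Rightarrow> real) \<Rightarrow> real) \<Rightarrow> ('e \<Rightarrow> real) set
     \<Rightarrow> 'e measure \<Rightarrow> bool" where
  "smooth_measure m \<E> D \<nu> \<longleftrightarrow> sets \<nu> = sets borel
     \<and> (\<forall>S\<in>sets borel. capacity m \<E> D S = 0 \<longrightarrow> emeasure \<nu> S = 0)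
     \<and> (\<exists>F :: nat \<Rightarrow> 'e set. incseq F \<and> (\<forall>n. closed (F n)) \<and> (\<forall>n. emeasure \<nu> (F n) < \<infinity>)
          \<and> (\<forall>K. compact K \<longrightarrow> (\<lambda>n. capacity m \<E> D (K - F n)) \<longlonglongrightarrow> 0))"

definition potential :: "('e \<Rightarrow> 'e \<Rightarrow> ennreal) \<Rightarrow> 'e measure \<Rightarrow> 'e \<Rightarrow> ennreal" where
  "potential G \<mu> x = (\<integral>\<^sup>+y. G x y \<partial>\<mu>)"

definition strictly_smooth ::
  "'e::topological_space measure \<Rightarrow> (('e \<Rightarrow> real) \<Rightarrow> ('e \<Rightarrow> real) \<Rightarrow> real) \<Rightarrow> ('e \<Rightarrow> real) set
     \<Rightarrow> ('e \<Rightarrow> 'e \<Rightarrow> ennreal) \<Rightarrow> 'e measure \<Rightarrow> bool" where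
  "strictly_smooth m \<E> D G \<mu> \<longleftrightarrow> smooth_measure m \<E> D \<mu>
     \<and> (\<exists>S :: nat \<Rightarrow> 'e set. incseq S \<and> (\<forall>n. S n \<in> sets borel) \<and> (\<Union>n. S n) = UNIV
          \<and> (\<forall>n. \<exists>C::real. \<forall>x. potential G (density \<mu> (indicator (S n))) x \<le> ennreal C))"


section \<open>Hunt processes\<close>

text \<open>
  The state space is \<open>E\<close> with the cemetery \<open>\<Delta> = None\<close> adjoined. Its topology is that of the
  one-point compactification of \<open>E\<close>, in which \<open>None\<close> is isolated when \<open>E\<close> is compact.
\<close>

abbreviation cemetery_topology :: "'e::topological_space option topology" where
  "cemetery_topology \<equiv> Alexandroff_compactification euclidean"

definition cemetery_borel :: "'e::topological_space option measure" where
  "cemetery_borel = sigma UNIV {S. Some -` S \<in> sets borel}"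

text \<open>The convention \<open>f(\<Delta>) = 0\<close>.\<close>

definition ext0 :: "('e \<Rightarrow> 'b::zero) \<Rightarrow> 'e option \<Rightarrow> 'b" where
  "ext0 f = case_option 0 f"

text \<open>Time runs through \<open>[0, \<infinity>]\<close>, with \<open>X\<^sub>\<infinity> = \<Delta>\<close>.\<close>

definition lifetime :: "(ennreal \<Rightarrow> 'w \<Rightarrow> 'e option) \<Rightarrow> 'w \<Rightarrow> ennreal" where
  "lifetime X \<omega> = Inf {t. X t \<omega> = None}"

definition natural_filtration ::
  "(ennreal \<Rightarrow> 'w \<Rightarrow> 'e::topological_space option) \<Rightarrow> ennreal \<Rightarrow> 'w measure" where
  "natural_filtration X t = sigma UNIV {X s -` S | s S. s \<le> t \<and> S \<in> sets cemetery_borel}"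

text \<open>
  \<open>P\<^sub>x\<close> is a measure on the \<open>\<sigma>\<close>-field generated by \<open>X\<close>; \<open>P\<^sub>\<mu> = \<integral> P\<^sub>x \<mu>(dx)\<close> is the monadic bind of \<open>\<mu>\<close> and \<open>P\<close>.
  The filtration \<open>(\<F>\<^sub>t)\<close> is the minimum completed admissible filtration: the natural filtration is
  augmented by all \<open>P\<^sub>\<mu>\<close>-null sets, and the results are intersected over all initial laws \<open>\<mu>\<close>.
  For functionals measurable with respect to it, \<open>E\<^sub>x\<close> is the integral under \<^term>\<open>completion (P x)\<close>.
\<close>

definition process_filtration ::
  "(ennreal \<Rightarrow> 'w \<Rightarrow> 'e::topological_space option) \<Rightarrow> ('e option \<Rightarrow> 'w measure)
     \<Rightarrow> ennreal \<Rightarrow> 'w measure" where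
  "process_filtration X P t = sigma UNIV
     (\<Inter>\<mu>\<in>space (prob_algebra cemetery_borel).
        sigma_sets UNIV (sets (natural_filtration X t) \<union> null_sets (completion (\<mu> \<bind> P))))"

locale hunt_process =
  fixes X :: "ennreal \<Rightarrow> 'w \<Rightarrow> 'e::{metric_space, second_countable_topology} option"
    and P :: "'e option \<Rightarrow> 'w measure"
    and \<theta> :: "ennreal \<Rightarrow> 'w \<Rightarrow> 'w"
  assumes kernel: "P \<in> cemetery_borel \<rightarrow>\<^sub>M prob_algebra (natural_filtration X \<infinity>)"
    and normal: "\<And>x. AE \<omega> in P x. X 0 \<omega> = x"
    and X_infinity: "\<And>\<omega>. X \<infinity> \<omega> = None"
    and absorbed: "\<And>t \<omega>. lifetime X \<omega> \<le> t \<Longrightarrow> X t \<omega> = None"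
    and shift: "\<And>s t \<omega>. t < \<infinity> \<Longrightarrow> X s (\<theta> t \<omega>) = X (s + t) \<omega>"
    and right_continuous: "\<And>t \<omega>. t < \<infinity> \<Longrightarrow>
           limitin cemetery_topology (\<lambda>s. X s \<omega>) (X t \<omega>) (at_right t)"
    and left_limits: "\<And>t \<omega>. 0 < t \<Longrightarrow> t < \<infinity> \<Longrightarrow>
           \<exists>l. limitin cemetery_topology (\<lambda>s. X s \<omega>) l (at_left t)"
    and filtration_right_continuous: "\<And>t. t < \<infinity> \<Longrightarrow>
           sets (process_filtration X P t) = (\<Inter>s\<in>{t<..}. sets (process_filtration X P s))"
    and strong_markov: "\<And>\<mu> \<sigma> t S. \<mu> \<in> space (prob_algebra cemetery_borel) \<Longrightarrow>
           stopping_time (process_filtration X P) \<sigma> \<Longrightarrow> t < \<infinity> \<Longrightarrow> S \<in> sets cemetery_borel \<Longrightarrow>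
           AE \<omega> in completion (\<mu> \<bind> P).
             real_cond_exp (completion (\<mu> \<bind> P))
               (filtration.pre_sigma UNIV (process_filtration X P) \<sigma>)
               (indicator {\<omega>'. X (\<sigma> \<omega>' + t) \<omega>' \<in> S}) \<omega>
             = measure (P (X (\<sigma> \<omega>) \<omega>)) {\<omega>'. X t \<omega>' \<in> S}"
    and quasi_left_continuous: "\<And>\<mu> \<sigma> \<sigma>s. \<mu> \<in> space (prob_algebra cemetery_borel) \<Longrightarrow>
           (\<And>n::nat. stopping_time (process_filtration X P) (\<sigma>s n)) \<Longrightarrow>
           (\<And>\<omega>. incseq (\<lambda>n. \<sigma>s n \<omega>)) \<Longrightarrow> (\<And>\<omega>. \<sigma> \<omega> = (SUP n. \<sigma>s n \<omega>)) \<Longrightarrow>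
           AE \<omega> in \<mu> \<bind> P. \<sigma> \<omega> < \<infinity> \<longrightarrow>
             limitin cemetery_topology (\<lambda>n. X (\<sigma>s n \<omega>) \<omega>) (X (\<sigma> \<omega>) \<omega>) sequentially"

definition transition ::
  "(ennreal \<Rightarrow> 'w \<Rightarrow> 'e option) \<Rightarrow> ('e option \<Rightarrow> 'w measure) \<Rightarrow> ennreal
     \<Rightarrow> ('e \<Rightarrow> ennreal) \<Rightarrow> 'e \<Rightarrow> ennreal" where
  "transition X P t f x = (\<integral>\<^sup>+\<omega>. ext0 f (X t \<omega>) \<partial>P (Some x))"

definition resolvent ::
  "(ennreal \<Rightarrow> 'w \<Rightarrow> 'e option) \<Rightarrow> ('e option \<Rightarrow> 'w measure) \<Rightarrow> real
     \<Rightarrow> ('e \<Rightarrow> ennreal) \<Rightarrow> 'e \<Rightarrow> ennreal" where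
  "resolvent X P \<alpha> f x =
     (\<integral>\<^sup>+\<omega>. (\<integral>\<^sup>+t\<in>{t. 0 \<le> t \<and> ennreal t < lifetime X \<omega>}.
         ennreal (exp (- \<alpha> * t)) * ext0 f (X (ennreal t) \<omega>) \<partial>lborel) \<partial>P (Some x))"

definition excessive ::
  "(ennreal \<Rightarrow> 'w \<Rightarrow> 'e::topological_space option) \<Rightarrow> ('e option \<Rightarrow> 'w measure)
     \<Rightarrow> ('e \<Rightarrow> ennreal) \<Rightarrow> bool" where
  "excessive X P f \<longleftrightarrow> f \<in> borel_measurable borel
     \<and> (\<forall>x. (SUP \<alpha>\<in>{0<..}. ennreal \<alpha> * resolvent X P \<alpha> f x) = f x)"

definition fine_topology ::
  "(ennreal \<Rightarrow> 'w \<Rightarrow> 'e::topological_space option) \<Rightarrow> ('e option \<Rightarrow> 'w measure) \<Rightarrow> 'e topology" where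
  "fine_topology X P = topology_generated_by {f -` U | f U. excessive X P f \<and> open U}"


section \<open>The standing assumptions\<close>

text \<open>
  On a locally compact separable metric space, Borel measures that are finite on compact sets are
  Radon. The conditions \<open>form_domain\<close> and \<open>form_generator\<close> determine the closed form
  \<open>(\<E>, D)\<close> uniquely from the generator \<open>(L, DL)\<close>.
\<close>

locale symmetric_hunt_process = hunt_process X P \<theta>
  for X :: "ennreal \<Rightarrow> 'w \<Rightarrow> 'e::{metric_space, second_countable_topology} option"
    and P :: "'e option \<Rightarrow> 'w measure"
    and \<theta> :: "ennreal \<Rightarrow> 'w \<Rightarrow> 'w" +
  fixes m :: "'e measure"
    and DL :: "('e \<Rightarrow> real) set" and L :: "('e \<Rightarrow> real) \<Rightarrow> 'e \<Rightarrow> real"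
    and T :: "real \<Rightarrow> ('e \<Rightarrow> real) \<Rightarrow> 'e \<Rightarrow> real"
    and \<E> :: "('e \<Rightarrow> real) \<Rightarrow> ('e \<Rightarrow> real) \<Rightarrow> real" and D :: "('e \<Rightarrow> real) set"
    and G :: "'e \<Rightarrow> 'e \<Rightarrow> ennreal"
  assumes locally_compact: "locally_compact_space (euclidean :: 'e topology)"
    and sets_m: "sets m = sets borel"
    and m_radon: "\<And>K. compact K \<Longrightarrow> emeasure m K < \<infinity>"
    and m_full_support: "\<And>U. open U \<Longrightarrow> U \<noteq> {} \<Longrightarrow> 0 < emeasure m U"
    and L_self_adjoint: "self_adjoint m DL L"
    and L_non_positive: "non_positive m DL L"
    and T_markov: "markov_semigroup m T"
    and L_generates: "generates m DL L T"
    and form: "dirichlet_form m \<E> D"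
    and form_domain: "DL \<subseteq> D"
    and form_generator: "\<And>u v. u \<in> DL \<Longrightarrow> v \<in> D \<Longrightarrow> \<E> u v = L2_inner m (\<lambda>x. - L u x) v"
    and regular: "regular_form m \<E> D"
    and transient: "transient_form m \<E> D"
    and associated: "\<And>t f. 0 \<le> t \<Longrightarrow> f \<in> L2 m \<Longrightarrow>
           AE x in m. integrable (P (Some x)) (\<lambda>\<omega>. ext0 f (X (ennreal t) \<omega>))
             \<and> T t f x = (\<integral>\<omega>. ext0 f (X (ennreal t) \<omega>) \<partial>P (Some x))"
    and absolute_continuity: "\<And>f C t x. f \<in> borel_measurable borel \<Longrightarrow>
           (\<forall>y. f y \<le> ennreal C) \<Longrightarrow> (\<integral>\<^sup>+y. f y \<partial>m) = 0 \<Longrightarrow> 0 < t \<Longrightarrow> t < \<infinity> \<Longrightarrow>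
           transition X P t f x = 0"
    and green_measurable: "case_prod G \<in> borel_measurable borel"
    and green_excessive: "\<And>x. excessive X P (G x)" "\<And>y. excessive X P (\<lambda>x. G x y)"
    and green: "\<And>f x. f \<in> borel_measurable borel \<Longrightarrow>
           resolvent X P 0 f x = (\<integral>\<^sup>+y. G x y * f y \<partial>m)"


section \<open>Positive continuous additive functionals\<close>

text \<open>
  Apart from adaptedness, nothing is required of \<open>A\<close> under \<open>P\<^sub>x\<close> for \<open>x\<close> in the exceptional set
  \<open>N\<close>; in particular the paths need not be monotone there, whereas for \<open>x\<close> outside \<open>N\<close>
  monotonicity follows from additivity. Non-negativity is part of the type.
\<close>

definition PCAF ::
  "'e::topological_space measure \<Rightarrow> (('e \<Rightarrow> real) \<Rightarrow> ('e \<Rightarrow> real) \<Rightarrow> real) \<Rightarrow> ('e \<Rightarrow> real) set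
     \<Rightarrow> (ennreal \<Rightarrow> 'w \<Rightarrow> 'e option) \<Rightarrow> ('e option \<Rightarrow> 'w measure) \<Rightarrow> (ennreal \<Rightarrow> 'w \<Rightarrow> 'w)
     \<Rightarrow> 'e set \<Rightarrow> (ennreal \<Rightarrow> 'w \<Rightarrow> ennreal) \<Rightarrow> bool" where
  "PCAF m \<E> D X P \<theta> N A \<longleftrightarrow> polar m \<E> D N
     \<and> (\<forall>t<\<infinity>. A t \<in> borel_measurable (process_filtration X P t))
     \<and> (\<exists>\<Lambda>\<in>sets (process_filtration X P \<infinity>).
          (\<forall>x\<in>- N. AE \<omega> in P (Some x). \<omega> \<in> \<Lambda>)
        \<and> (\<forall>x\<in>- N. AE \<omega> in P (Some x). A 0 \<omega> = 0)
        \<and> (\<forall>t. 0 < t \<and> t < \<infinity> \<longrightarrow> \<theta> t ` \<Lambda> \<subseteq> \<Lambda>)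
        \<and> (\<forall>\<omega>\<in>\<Lambda>. \<forall>s<\<infinity>. \<forall>t<\<infinity>. A (t + s) \<omega> = A t \<omega> + A s (\<theta> t \<omega>))
        \<and> (\<forall>\<omega>\<in>\<Lambda>. \<forall>t<lifetime X \<omega>. A t \<omega> < \<infinity>)
        \<and> (\<forall>\<omega>\<in>\<Lambda>. \<forall>t<\<infinity>. lifetime X \<omega> \<le> t \<longrightarrow> A t \<omega> = A (lifetime X \<omega>) \<omega>)
        \<and> (\<forall>\<omega>\<in>\<Lambda>. continuous_on {..<\<infinity>} (\<lambda>t. A t \<omega>)))"

text \<open>
  \<open>\<integral>\<^sub>0\<^sup>t f(X\<^sub>s) dA\<^sub>s\<close>. Since \<open>f(\<Delta>) = 0\<close>, only times before the lifetime contribute. As \<open>A\<close> may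
  become infinite at the lifetime, the Lebesgue-Stieltjes integral over \<open>[0, t] \<inter> [0, \<zeta>)\<close> is
  obtained as the supremum of the integrals over \<open>[0, r]\<close>, on which \<open>A\<close> is finite. The path is
  extended by \<open>A\<^sub>0\<close> to negative times because \<^term>\<open>ennreal s = 0\<close> for negative \<open>s\<close>.
\<close>

definition functional_integral ::
  "(ennreal \<Rightarrow> 'w \<Rightarrow> 'e option) \<Rightarrow> (ennreal \<Rightarrow> 'w \<Rightarrow> ennreal) \<Rightarrow> ('e \<Rightarrow> ennreal)
     \<Rightarrow> ennreal \<Rightarrow> 'w \<Rightarrow> ennreal" where
  "functional_integral X A f t \<omega> =
     (SUP r\<in>{r. 0 \<le> r \<and> ennreal r \<le> t \<and> ennreal r < lifetime X \<omega>}.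
        \<integral>\<^sup>+s\<in>{0..r}. ext0 f (X (ennreal s) \<omega>)
          \<partial>interval_measure (\<lambda>s. enn2real (A (ennreal (min s r)) \<omega>)))"

definition revuz ::
  "'e::topological_space measure \<Rightarrow> (ennreal \<Rightarrow> 'w \<Rightarrow> 'e option) \<Rightarrow> ('e option \<Rightarrow> 'w measure)
     \<Rightarrow> (ennreal \<Rightarrow> 'w \<Rightarrow> ennreal) \<Rightarrow> 'e measure \<Rightarrow> bool" where
  "revuz m X P A \<nu> \<longleftrightarrow>
     (\<forall>f\<in>borel_measurable borel.
        ((\<lambda>t::real. (\<integral>\<^sup>+x. (\<integral>\<^sup>+\<omega>. functional_integral X A f (ennreal t) \<omega> \<partial>completion (P (Some x))) \<partial>m)
            / ennreal t) \<longlongrightarrow> (\<integral>\<^sup>+x. f x \<partial>\<nu>)) (at_right 0))"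

text \<open>Finely open sets need not be Borel, but the fine topology has a base of Borel sets, so
  restricting to Borel neighborhoods \<open>V\<close> would define the same set.\<close>

definition finite_potential_set ::
  "(ennreal \<Rightarrow> 'w \<Rightarrow> 'e::topological_space option) \<Rightarrow> ('e option \<Rightarrow> 'w measure)
     \<Rightarrow> ('e \<Rightarrow> 'e \<Rightarrow> ennreal) \<Rightarrow> 'e measure \<Rightarrow> 'e set" where
  "finite_potential_set X P G \<nu> = {x. \<exists>V. openin (fine_topology X P) V \<and> x \<in> V \<and> (\<integral>\<^sup>+y\<in>V. G x y \<partial>\<nu>) < \<infinity>}"

abbreviation singular_set ::
  "(ennreal \<Rightarrow> 'w \<Rightarrow> 'e::topological_space option) \<Rightarrow> ('e option \<Rightarrow> 'w measure)
     \<Rightarrow> ('e \<Rightarrow> 'e \<Rightarrow> ennreal) \<Rightarrow> 'e measure \<Rightarrow> 'e set" where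
  "singular_set X P G \<nu> \<equiv> - finite_potential_set X P G \<nu>"

text \<open>
  \<open>A\<close> is a version of \<open>A\<^sup>\<nu>\<close>. The functionals \<open>A\<^sup>n\<close>, and hence \<open>A\<^sup>\<nu>\<close>, are only determined up to
  almost sure equality.
\<close>

definition canonical_functional ::
  "'e::topological_space measure \<Rightarrow> (('e \<Rightarrow> real) \<Rightarrow> ('e \<Rightarrow> real) \<Rightarrow> real) \<Rightarrow> ('e \<Rightarrow> real) set
     \<Rightarrow> (ennreal \<Rightarrow> 'w \<Rightarrow> 'e option) \<Rightarrow> ('e option \<Rightarrow> 'w measure) \<Rightarrow> (ennreal \<Rightarrow> 'w \<Rightarrow> 'w)
     \<Rightarrow> ('e \<Rightarrow> 'e \<Rightarrow> ennreal) \<Rightarrow> 'e measure \<Rightarrow> (ennreal \<Rightarrow> 'w \<Rightarrow> ennreal) \<Rightarrow> bool" where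
  "canonical_functional m \<E> D X P \<theta> G \<nu> A \<longleftrightarrow>
     (\<exists>(\<nu>s :: nat \<Rightarrow> 'e measure) As.
        (\<forall>n. strictly_smooth m \<E> D G (\<nu>s n))
      \<and> (\<forall>S\<in>sets borel. incseq (\<lambda>n. emeasure (\<nu>s n) S) \<and> emeasure \<nu> S = (SUP n. emeasure (\<nu>s n) S))
      \<and> (\<forall>n. PCAF m \<E> D X P \<theta> {} (As n) \<and> revuz m X P (As n) (\<nu>s n))
      \<and> (\<forall>t \<omega>. A t \<omega> = (SUP n. As n t \<omega>)))"

definition exp_neg :: "ennreal \<Rightarrow> ennreal" where
  "exp_neg a = (if a = \<infinity> then 0 else ennreal (exp (- enn2real a)))"

definition phi1 ::
  "(ennreal \<Rightarrow> 'w \<Rightarrow> 'e option) \<Rightarrow> ('e option \<Rightarrow> 'w measure) \<Rightarrow> (ennreal \<Rightarrow> 'w \<Rightarrow> ennreal)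
     \<Rightarrow> 'e \<Rightarrow> ennreal" where
  "phi1 X P B x =
     (\<integral>\<^sup>+\<omega>. (\<integral>\<^sup>+t\<in>{t. 0 \<le> t \<and> ennreal t < lifetime X \<omega>}.
         ennreal (exp (- t)) * exp_neg (B (ennreal t) \<omega>) \<partial>lborel) \<partial>completion (P (Some x)))"

end

theory Submission
 imports Defs
begin

text \<open>
 Let \<open>\<phi> = phi1 X P B\<close>. Additivity makes \<open>B\<close> finite and increasing off \<open>N\<close>, so \<open>\<phi> > 0\<close> there. Conversely, suppose
 \<open>\<phi> x > 0\<close>. By fine continuity, on a finely open neighborhood \<open>V\<close> of \<open>x\<close> the path spends, before \<open>B\<close> exceeds a level \<open>l\<close>,
 an expected time bounded below in a set carried by some \<open>g\<close> with finite potential. The strong Markov property on the clock of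
 \<open>B\<close>, the symmetry of the transition function and a second moment bound for \<open>\<integral> 1\<^sub>V(X) dB\<close> over short times then give
 \<open>\<integral>\<^sub>V G(x, y) \<nu>(dy) \<le> l \<integral> G(x, y) g(y) m(dy) < \<infinity>\<close>. Hence \<open>N\<close> is the singular set.

 If \<open>\<mu> \<le> \<nu>\<close> are the Revuz measures of \<open>A\<close> and \<open>B\<close>, the starting points from which \<open>q B\<^sub>t \<le> A\<^sub>t\<close> for arbitrarily small \<open>t\<close>,
 with \<open>q > 1\<close>, are singled out by the zero-one law. A growth lemma for measures on the line shows that they carry no
 mass, and then that \<open>dA \<le> dB\<close>. As \<open>t \<mapsto> E\<^sub>m (B\<^sub>t - A\<^sup>n\<^sub>t)\<close> is subadditive with slope the total mass of \<open>\<nu> - \<nu>\<^sub>n\<close> at \<open>0\<close>, the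
 functionals \<open>A\<^sup>n\<close> increase to \<open>B\<close> for almost every starting point. Absolute continuity extends this to the path after any
 positive time from any starting point. Letting that time tend to \<open>0\<close> gives \<open>A = B\<close> off \<open>N\<close>. On \<open>N\<close>, where \<open>\<phi> = 0\<close>, fine
 continuity yields \<open>E\<^sub>x \<phi>(X\<^sub>s) \<rightarrow> 0\<close> along a sequence \<open>s \<rightarrow> 0\<close>, and this forces \<open>A = \<infinity>\<close> at once.\<close>

text \<open>Two obstacles shape the proof. First, the Revuz relation speaks about small times under
  \<open>m\<close> only, so \<open>E_x \<integral> f(X) dB\<close> is not at hand for a single
  \<open>x\<close>. To bound \<open>\<integral>_V q d\<nu>\<close> for excessive \<open>q\<close>,
  one estimates \<open>E_m \<integral>_0^d h(X_s) dB_s\<close> to first order in \<open>d\<close>,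
  where \<open>h\<close> is a 1-potential below \<open>q\<close>. The occupation bound involves
  \<open>h\<close> at time 0, the Markov property produces \<open>h\<close> at time
  \<open>d\<close>, and AM-GM exchanges the two at a price quadratic in the mass collected up to
  \<open>d\<close>, plus an arbitrarily small multiple of \<open>d\<close>. The second moment is
  \<open>o(d)\<close>, so the price vanishes. Second, functionals are measurable only up to
  completion, and \<open>x \<mapsto> E_x F\<close> need not be Borel. Each such \<open>F\<close> is
  replaced by a raw functional off a raw set that is null from \<open>m\<close>-almost or
  \<open>\<nu>\<close>-almost every start. Absolute continuity disposes of the first kind after any
  positive time, and the second kind is avoided at \<open>dB\<close>-almost every time. Integrals
  against \<open>dB\<close> become Lebesgue integrals over levels of the inverse clock, because the
  inverse at a fixed level is a stopping time.\<close>

abbreviation (input) "bm \<equiv> borel_measurable"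
abbreviation (input) "Bor \<equiv> bm borel"
abbreviation (input) "en \<equiv> ennreal"
abbreviation (input) "ind \<equiv> indicator"
abbreviation (input) infy :: "'a::infinity" where "infy \<equiv> \<infinity>"
abbreviation (input) ee :: "real => ennreal" where "ee x \<equiv> en (exp x)"
abbreviation (input) pm (infixr "OM" 80) where "A OM B \<equiv> A \<Otimes>\<^sub>M B"
abbreviation (input) lims (infix "->>" 60) where "f ->> l \<equiv> f \<longlonglongrightarrow> l"
abbreviation (input) "emu \<equiv> emeasure"
abbreviation (input) "ip \<equiv> L2_inner"
abbreviation (input) "CP \<equiv> completion"
abbreviation (input) "rs n \<equiv> 1 / real (Suc n)"
abbreviation (input) mfun (infixr "MM" 60) where "A MM B \<equiv> A \<rightarrow>\<^sub>M B"
abbreviation (input) nn where "nn M f \<equiv> \<integral>\<^sup>+x. f x \<partial>M"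
abbreviation (input) sn where "sn M A f \<equiv> \<integral>\<^sup>+x\<in>A. f x \<partial>M"
abbreviation (input) "nl \<equiv> nn (lborel :: real measure)"
abbreviation (input) "sl \<equiv> sn (lborel :: real measure)"
lemmas mcomp = measurable_compose
 and spind = split_indicator
 and evmono = eventually_mono
 and mlmono = mult_left_mono
 and mrmono = mult_right_mono
 and ncong = nn_integral_cong
 and ncmult = nn_integral_cmult
 and ncongAE = nn_integral_cong_AE
 and ncompl = nn_integral_completion
 and nmono = nn_integral_mono
 and nmonoAE = nn_integral_mono_AE
 and nmcSUP = nn_integral_monotone_convergence_SUP
 and nadd = nn_integral_add
 and bmtimes = borel_measurable_times_ennreal
 and bmind = borel_measurable_indicator
 and ncmind = nn_integral_cmult_indicator
 and mcongs = measurable_cong_sets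
 and memeas = measurable_emeasure_subprob_algebra
 and AEall = AE_all_countable
 and neqint = nn_integral_eq_integral
 and SUPml = SUP_mult_left_ennreal
 and SUPmr = SUP_mult_right_ennreal
 and ennat = ennreal_of_nat_eq_real_of_nat
 and enmlt = ennreal_mult_less_top
 and oodef = infinity_ennreal_def
 and msets = measurable_sets
 and n0AE = nn_integral_0_iff_AE
 and ndens = nn_integral_density
 and naffine = nn_integral_real_affine
 and menn = measurable_ennreal
 and mPair = measurable_Pair
 and msnd = measurable_snd
 and mfst = measurable_fst

section \<open>Growth comparison of measures on the line\<close>

text \<open>Continuous induction along the line takes the place of a covering theorem. With
  \<open>g t\<close> the excess of \<open>a\<close> on \<open>U\<close> over \<open>q\<close> times
  \<open>b\<close> on \<open>K\<close> up to \<open>t\<close>, the set where \<open>g\<close> is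
  nonnegative has no last point: at a point of \<open>K\<close> the hypothesis supplies a step to
  the right, which \<open>U\<close> contains when it is short, and off \<open>K\<close> only
  \<open>a\<close> can grow.\<close>

lemma measure_le_compact:
 fixes a b :: "real measure" and q :: real
 assumes fa: "finite_measure a" and fb: "finite_measure b"
 and sa[measurable_cong]: "sets a = sets borel" and sb[measurable_cong]: "sets b = sets borel"
 and atom: "!!s. measure b {s} = 0" and q: "0 <= q"
 and K: "compact K" and U: "open U" "K <= U"
 and step: "!!s d. s : K ==> 0 < d ==> EX e>0. e < d & q * measure b {s<..s+e} <= measure a {s<..s+e}"
 shows "q * measure b K <= measure a U"
proof -
 interpret A: finite_measure a by fact
 interpret B: finite_measure b by fact
 have [measurable]: "K : sets borel" "U : sets borel"
 using K U by (auto intro: borel_compact)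
 define g where "g t = measure a (U Int {..t}) - q * measure b (K Int {..t})" for t
 have g_mono: "g t <= g u" if "t <= u" "q * measure b (K Int {t<..u}) <= measure a (U Int {t<..u})" for t u
 proof -
 have "measure a (U Int {..u}) = measure a (U Int {..t}) + measure a (U Int {t<..u})"
 using that(1) by (subst A.finite_measure_Union[symmetric]) (auto intro!: arg_cong[where f="measure a"] simp: sa)
 moreover have "measure b (K Int {..u}) = measure b (K Int {..t}) + measure b (K Int {t<..u})"
 using that(1) by (subst B.finite_measure_Union[symmetric]) (auto intro!: arg_cong[where f="measure b"] simp: sb)
 ultimately show ?thesis using that(2) by (simp add: g_def algebra_simps)
 qed
 obtain R where R: "!!x. x : K ==> \<bar>x\<bar> <= R"
 using compact_imp_bounded[OF K] by (auto simp: bounded_real)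
 have "g t >= 0" for t
 proof (rule ccontr)
 assume "~ g t >= 0"
 hence neg: "g t < 0" by simp
 define T where "T = {s. s <= t & 0 <= g s}"
 have low: "g s >= 0" if "s < - R" for s
 proof -
 have "K Int {..s} = {}" using R that by force
 thus ?thesis by (simp add: g_def)
 qed
 have "min t (-R - 1) : T"
 using low by (auto simp: T_def)
 hence Tne: "T ~= {}" by auto
 have Tbdd: "bdd_above T" by (auto simp: T_def bdd_above_def)
 define s where "s = Sup T"
 have st: "s <= t" unfolding s_def by (rule cSup_least[OF Tne]) (auto simp: T_def)
 obtain X where X: "!!n. X n : T" "X ->> s"
 using closure_contains_Sup[OF Tne Tbdd] unfolding s_def[symmetric] closure_sequential by auto
 have Xs: "X n <= s" for n unfolding s_def by (rule cSup_upper[OF X(1) Tbdd])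
 \<comment> \<open>From \<open>X n\<close> to \<open>s\<close> the \<open>b\<close>-part grows at
   most by the mass of \<open>{X n<..s}\<close>, which vanishes because \<open>s\<close> is not an
   atom. Hence \<open>g\<close> is nonnegative at the supremum too.\<close>
 have lim: "(%n. measure b (K Int {X n<..s})) ->> 0"
 proof -
 define D where "D n = {s - rs n<..s}" for n
 have "(%n. measure b (D n)) ->> measure b (\<Inter>n. D n)"
 proof (rule B.finite_Lim_measure_decseq)
 show "decseq D"
 proof (rule decseq_SucI)
 fix n
 have "1 / real (Suc (Suc n)) <= rs n" by (rule frac_le) auto
 thus "D (Suc n) <= D n" unfolding D_def by (intro subsetI) auto
 qed
 qed (auto simp: D_def sb)
 moreover have "(\<Inter>n. D n) = {s}"
 proof safe
 fix x assume "x : (\<Inter>n. D n)"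
 hence *: "s - rs n < x" "x <= s" for n by (auto simp: D_def)
 have "(%n. s - rs n) ->> s - 0"
 by (intro tendsto_intros LIMSEQ_Suc[OF lim_1_over_n])
 hence "s <= x" by (intro LIMSEQ_le_const2[of _ "s"]) (use * less_imp_le in auto)
 thus "x = s" using * by auto
 qed (auto simp: D_def)
 ultimately have D0: "(%n. measure b (D n)) ->> 0" using atom by simp
 show ?thesis
 proof (rule LIMSEQ_I)
 fix r :: real assume "0 < r"
 obtain n0 where n0: "measure b (D n0) < r"
 using LIMSEQ_D[OF D0 \<open>0 < r\<close>] by (auto simp: abs_of_nonneg)
 obtain N where N: "!!n. n >= N ==> \<bar>X n - s\<bar> < rs n0"
 using LIMSEQ_D[OF X(2), of "rs n0"] by auto
 show "EX N. ALL n>=N. norm (measure b (K Int {X n<..s}) - 0) < r"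
 proof (intro exI allI impI)
 fix n assume "N <= n"
 hence "K Int {X n<..s} <= D n0" using N[of n] by (auto simp: D_def)
 hence "measure b (K Int {X n<..s}) <= measure b (D n0)"
 by (intro B.finite_measure_mono) (auto simp: D_def sb)
 thus "norm (measure b (K Int {X n<..s}) - 0) < r" using n0 by simp
 qed
 qed
 qed
 have "0 <= g s"
 proof -
 have "- q * measure b (K Int {X n<..s}) <= g s" for n
 proof -
 have "measure a (U Int {..X n}) <= measure a (U Int {..s})"
 by (rule A.finite_measure_mono) (use Xs[of n] in \<open>auto simp: sa\<close>)
 moreover have "measure b (K Int {..s}) = measure b (K Int {..X n}) + measure b (K Int {X n<..s})"
 using Xs[of n] by (subst B.finite_measure_Union[symmetric]) (auto intro!: arg_cong[where f="measure b"] simp: sb)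
 moreover have "0 <= g (X n)" using X(1)[of n] by (simp add: T_def)
 ultimately show ?thesis by (simp add: g_def algebra_simps)
 qed
 moreover have "(%n. - q * measure b (K Int {X n<..s})) ->> - q * 0"
 by (intro tendsto_intros lim)
 ultimately show ?thesis by (intro LIMSEQ_le_const2[of _ 0]) auto
 qed
 hence "s < t" using st neg by (metis less_le not_less)
 have "EX u>s. u <= t & g s <= g u"
 proof (cases "s : K")
 case True
 then obtain d where d: "d > 0" "ball s d <= U" using U openE by blast
 obtain e where e: "e > 0" "e < min d (t - s)" "q * measure b {s<..s+e} <= measure a {s<..s+e}"
 using step[OF True, of "min d (t - s)"] d \<open>s < t\<close> by auto
 have "U Int {s<..s+e} = {s<..s+e}" using d e by (auto simp: dist_real_def ball_def subset_iff)
 moreover have "q * measure b (K Int {s<..s+e}) <= q * measure b {s<..s+e}"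
 by (intro mlmono B.finite_measure_mono q) (auto simp: sb)
 ultimately show ?thesis using e
 by (intro exI[of _ "s+e"] conjI g_mono) auto
 next
 case False
 have "open (- K)" using K compact_imp_closed by blast
 then obtain d where d: "d > 0" "ball s d <= - K" using False openE by blast
 define u where "u = min (s + d / 2) t"
 have "K Int {s<..u} = {}" using d by (auto simp: dist_real_def ball_def subset_iff u_def)
 thus ?thesis using \<open>s < t\<close> d by (intro exI[of _ u] conjI g_mono) (auto simp: u_def)
 qed
 then obtain u where "u > s" "u : T" using \<open>0 <= g s\<close> by (auto simp: T_def)
 thus False using cSup_upper[OF _ Tbdd, of u] by (simp add: s_def)
 qed
 from this[of R] have "q * measure b (K Int {..R}) <= measure a (U Int {..R})" by (simp add: g_def)
 moreover have "K Int {..R} = K" using R by force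
 moreover have "measure a (U Int {..R}) <= measure a U"
 by (rule A.finite_measure_mono) (auto simp: sa)
 ultimately show ?thesis by simp
qed

text \<open>Inner regularity of \<open>b\<close> and outer regularity of \<open>a\<close> reduce
  \<open>W\<close> to a compact set inside an open one, where the growth steps have room.\<close>

lemma emeasure_le_of_growth:
 fixes a b :: "real measure" and q :: real
 assumes fa: "finite_measure a" and fb: "finite_measure b"
 and sa: "sets a = sets borel" and sb: "sets b = sets borel"
 and atom: "!!s. measure b {s} = 0" and q: "0 <= q"
 and W: "W : sets borel"
 and step: "!!s d. s : W ==> 0 < d ==> EX e>0. e < d & q * measure b {s<..s+e} <= measure a {s<..s+e}"
 shows "en q * emu b W <= emu a W"
proof -
 interpret A: finite_measure a by fact
 interpret B: finite_measure b by fact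
 have K: "en q * emu b K <= emu a K" if "compact K" "K <= W" for K
 proof -
 have "emu a K = (INF U\<in> {U. K <= U & open U}. emu a U)"
 by (rule outer_regular) (use sa that in \<open>auto intro: borel_compact\<close>)
 moreover have "en q * emu b K <= emu a U" if "K <= U" "open U" for U
 proof -
 have "q * measure b K <= measure a U"
 using measure_le_compact[OF fa fb sa sb atom q \<open>compact K\<close> \<open>open U\<close> \<open>K <= U\<close>] step \<open>K <= W\<close> by blast
 thus ?thesis
 using q by (simp add: A.emeasure_eq_measure B.emeasure_eq_measure flip: ennreal_mult)
 qed
 ultimately show ?thesis by (auto intro: INF_greatest)
 qed
 have "emu b W = (SUP K\<in> {K. K <= W & compact K}. emu b K)"
 by (rule inner_regular) (use sb W in auto)
 hence "en q * emu b W = (SUP K\<in> {K. K <= W & compact K}. en q * emu b K)"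
 by (simp add: SUPml)
 also have "... <= emu a W"
 by (rule SUP_least) (use K W sa in \<open>auto intro!: order_trans[OF K] emeasure_mono\<close>)
 finally show ?thesis .
qed

section \<open>Measurability of paths\<close>

lemma sets_cemetery_borel: "sets cemetery_borel = {S. Some -` S : sets borel}"
 and space_cemetery_borel[simp]: "space cemetery_borel = UNIV"
proof -
 have "sigma_algebra UNIV {S. Some -` S : sets (borel :: 'a measure)}"
 by (auto simp: sigma_algebra_iff2 vimage_Diff vimage_UN intro: sets.countable_nat_UN)
 thus "sets (cemetery_borel :: 'a option measure) = {S. Some -` S : sets borel}"
 unfolding cemetery_borel_def by (rule sigma_algebra.sets_measure_of_eq)
qed (simp add: cemetery_borel_def space_measure_of_conv)

lemma measurable_Some[measurable]: "Some : borel MM cemetery_borel"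
 by (rule measurableI) (auto simp: sets_cemetery_borel)

lemma measurable_from_cemetery:
 assumes "(%x. k (Some x)) : borel MM N" "k None : space N"
 shows "k : cemetery_borel MM N"
proof (rule measurableI)
 show "k x : space N" for x
 using assms measurable_space[OF assms(1)] by (cases x) auto
 show "k -` A Int space cemetery_borel : sets cemetery_borel" if "A : sets N" for A
 using msets[OF assms(1) that] by (simp add: sets_cemetery_borel vimage_def)
qed

lemma ext0_simps[simp]: "ext0 f None = 0" "ext0 f (Some x) = f x"
 by (auto simp: ext0_def)

lemma mext0[measurable]:
 fixes f :: "'e::topological_space => 'b::{zero,topological_space}"
 assumes "f : Bor"
 shows "ext0 f : bm cemetery_borel"
 by (rule measurable_from_cemetery) (use assms in auto)

lemma measurable_cemeteryI:
 fixes f :: "'a => 'e::topological_space option"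
 assumes U: "!!U. open U ==> f -` Some ` U Int space M : sets M"
 shows "f : M MM cemetery_borel"
proof (rule measurableI)
 have B: "f -` Some ` B Int space M : sets M" if "B : sigma_sets UNIV {S. open S}" for B
 using that
 proof (induction)
 case (Basic a) thus ?case using U by auto
 next
 case (Compl a)
 have "f -` Some ` (UNIV - a) Int space M = (f -` Some ` UNIV Int space M) - (f -` Some ` a Int space M)"
 by auto
 thus ?case using Compl U[of UNIV] by auto
 next
 case (Union a)
 have "f -` Some ` (\<Union>i. a i) Int space M = (\<Union>i. f -` Some ` a i Int space M)" by auto
 also have "... : sets M" using Union by (intro sets.countable_nat_UN) auto
 finally show ?case .
 qed simp
 fix S assume "S : sets (cemetery_borel :: 'e option measure)"
 hence "Some -` S : sigma_sets UNIV {S. open S}"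
 by (simp add: sets_cemetery_borel borel_def)
 hence 1: "f -` Some ` (Some -` S) Int space M : sets M" by (rule B)
 have 2: "space M - (f -` Some ` UNIV Int space M) : sets M" using U[of UNIV] by auto
 have "f -` S Int space M = (f -` Some ` (Some -` S) Int space M) Un
 (if None : S then space M - (f -` Some ` UNIV Int space M) else {})" (is "?A = ?B")
 proof (rule set_eqI)
 fix w show "w : ?A \<longleftrightarrow> w : ?B" by (cases "f w") auto
 qed
 thus "f -` S Int space M : sets M" using 1 2 by auto
qed simp

text \<open>An open set is where the distance to its complement is positive, and \<open>ext0\<close>
  sends the cemetery to 0, so the cemetery is never counted. The full set is treated apart because
  \<open>infdist\<close> to the empty set is 0.\<close>

lemma measurable_cemetery_ext0I:
 fixes f :: "'a => 'e::metric_space option"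
 assumes "!!g::'e => real. continuous_on UNIV g ==> (%w. ext0 g (f w)) : bm M"
 shows "f : M MM cemetery_borel"
proof (rule measurable_cemeteryI)
 fix U :: "'e set" assume U: "open U"
 show "f -` Some ` U Int space M : sets M"
 proof (cases "U = UNIV")
 case True
 have "(%w. ext0 (%_. 1::real) (f w)) : bm M"
 by (rule assms) auto
 hence "{w : space M. ext0 (%_. 1::real) (f w) = 1} : sets M" by measurable
 also have "{w : space M. ext0 (%_. 1::real) (f w) = 1} = f -` Some ` U Int space M"
 proof -
 have "(ext0 (%_. 1::real) y = 1) = (y : Some ` U)" for y :: "'e option"
 using True by (cases y) auto
 thus ?thesis by auto
 qed
 finally show ?thesis .
 next
 case False
 let ?g = "%x. infdist x (- U)"
 have "(%w. ext0 ?g (f w)) : bm M"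
 by (rule assms) (intro continuous_intros)
 hence "{w : space M. 0 < ext0 ?g (f w)} : sets M" by measurable
 also have "{w : space M. 0 < ext0 ?g (f w)} = f -` Some ` U Int space M"
 proof -
 have "closed (- U)" "- U ~= {}" using U False by auto
 hence "0 < ?g x \<longleftrightarrow> x : U" for x
 using in_closed_iff_infdist_zero[of "- U" x] infdist_nonneg[of x "- U"] by (auto simp: less_le)
 hence "(0 < ext0 ?g y) = (y : Some ` U)" for y :: "'e option"
 by (cases y) auto
 thus ?thesis by auto
 qed
 finally show ?thesis .
 qed
qed

text \<open>Adding 1 to the floor makes the approximation strictly larger than \<open>s\<close>, so
  right continuity, which concerns times after \<open>s\<close>, can be used along it.\<close>

definition dyadic_above :: "nat => ennreal => ennreal" where
 "dyadic_above n s = (if s = infy then infy else en ((real_of_int \<lfloor>enn2real s * 2^n\<rfloor> + 1) / 2^n))"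

lemma dyadic_above_gt: "s < infy ==> s < dyadic_above n s"
proof (cases s)
 case (real r)
 have "r * 2^n < real_of_int \<lfloor>r * 2^n\<rfloor> + 1" by linarith
 hence "r < (real_of_int \<lfloor>r * 2^n\<rfloor> + 1) / 2^n" by (simp add: field_simps)
 thus ?thesis using real by (simp add: dyadic_above_def ennreal_lessI)
qed simp

lemma dyadic_above_tendsto: "(%n. dyadic_above n s) ->> s"
proof (cases s)
 case (real r)
 have "(%n. (real_of_int \<lfloor>r * 2^n\<rfloor> + 1) / 2^n) ->> r"
 proof (rule tendsto_sandwich[of "%_. r" _ _ "%n. r + 1 / 2^n"])
 show "\<forall>\<^sub>F n in sequentially. r <= (real_of_int \<lfloor>r * 2 ^ n\<rfloor> + 1) / 2 ^ n"
 proof (rule always_eventually, rule allI)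
 fix n :: nat
 have "r * 2^n < real_of_int \<lfloor>r * 2^n\<rfloor> + 1" by linarith
 thus "r <= (real_of_int \<lfloor>r * 2 ^ n\<rfloor> + 1) / 2 ^ n" by (simp add: field_simps)
 qed
 show "\<forall>\<^sub>F n in sequentially. (real_of_int \<lfloor>r * 2 ^ n\<rfloor> + 1) / 2 ^ n <= r + 1 / 2^n"
 proof (rule always_eventually, rule allI)
 fix n :: nat
 have "real_of_int \<lfloor>r * 2^n\<rfloor> <= r * 2^n" by linarith
 thus "(real_of_int \<lfloor>r * 2 ^ n\<rfloor> + 1) / 2 ^ n <= r + 1 / 2^n" by (simp add: field_simps)
 qed
 have "(%n. r + (1/2)^n) ->> r + 0" by (intro tendsto_intros LIMSEQ_realpow_zero) auto
 thus "(%n. r + 1 / 2^n) ->> r" by (simp add: power_one_over)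
 qed simp
 hence "(%n. en ((real_of_int \<lfloor>r * 2^n\<rfloor> + 1) / 2^n)) ->> en r"
 by (rule tendsto_ennrealI)
 thus ?thesis using real by (simp add: dyadic_above_def)
qed (simp add: dyadic_above_def)

lemma measurable_dyadic_above:
 "dyadic_above n : Bor"
 unfolding dyadic_above_def by measurable

context hunt_process
begin

abbreviation "FF \<equiv> process_filtration X P"
abbreviation "NF \<equiv> natural_filtration X"
abbreviation "PS x \<equiv> P (Some x)"
abbreviation "cb \<equiv> cemetery_borel"
abbreviation "th \<equiv> \<theta>"

lemma space_NF[simp]: "space (NF t) = UNIV"
 by (simp add: natural_filtration_def space_measure_of_conv)

lemma space_FF[simp]: "space (FF t) = UNIV"
 by (simp add: process_filtration_def space_measure_of_conv)

lemma UNIV_FF[simp]: "UNIV : sets (FF t)" and UNIV_NF[simp]: "UNIV : sets (NF t)"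
 using sets.top[of "FF t"] sets.top[of "NF t"] by simp_all

lemma sets_NF: "sets (NF t) = sigma_sets UNIV {X s -` S | s S. s <= t & S : sets cemetery_borel}"
 by (simp add: natural_filtration_def)

lemma mXNF: "s <= t ==> X s : NF t MM cemetery_borel"
 by (rule measurableI) (auto simp: sets_NF)

lemma NF_mono: "s <= t ==> sets (NF s) <= sets (NF t)"
 unfolding sets_NF by (rule sigma_sets_mono') (auto intro: order_trans)

lemma sets_P[simp, measurable_cong]: "sets (P x) = sets (NF infy)"
 using measurable_space[OF kernel, of x] by (simp add: space_prob_algebra)

lemma space_P[simp]: "space (P x) = UNIV"
 using sets_eq_imp_space_eq[OF sets_P] by simp

lemma prob_space_P: "prob_space (P x)"
 using measurable_space[OF kernel, of x] by (simp add: space_prob_algebra)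

lemma kernel_sub: "P : cemetery_borel MM subprob_algebra (NF infy)"
 using kernel by (rule measurable_prob_algebraD)

lemma measurable_E:
 assumes "F : bm (NF infy)"
 shows "(%y. nn (P y) (%v. F v)) : bm cemetery_borel"
 by (rule mcomp[OF kernel_sub nn_integral_measurable_subprob_algebra]) (use assms in auto)

lemma measurable_E_Some:
 assumes "F : bm (NF infy)"
 shows "(%y. nn (PS y) (%v. F v)) : Bor"
 using mcomp[OF measurable_Some measurable_E[OF assms]] .

lemma return_in: "return cemetery_borel x : space (prob_algebra cemetery_borel)"
 by (simp add: space_prob_algebra prob_space_return)

lemma bind_return_P: "return cemetery_borel x \<bind> P = P x"
 by (rule bind_return[OF kernel_sub]) simp

lemma sets_bind_P: "u : space (prob_algebra cemetery_borel) ==> sets (u \<bind> P) = sets (NF infy)"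
 by (rule sets_bind) (auto simp: space_prob_algebra prob_space.not_empty)

lemma space_bind_P: "u : space (prob_algebra cemetery_borel) ==> space (u \<bind> P) = UNIV"
 using sets_eq_imp_space_eq[OF sets_bind_P] by simp

text \<open>An intersection of sigma-fields is a sigma-field, so the generated field is the
  intersection itself.\<close>

lemma sets_FF:
 "sets (FF t) = (\<Inter>u\<in>space (prob_algebra cemetery_borel).
 sigma_sets UNIV (sets (NF t) Un null_sets (completion (u \<bind> P))))" (is "_ = \<Inter>(?f ` ?I)")
proof -
 have ne: "?I ~= {}" using return_in by auto
 have "sigma_algebra UNIV (?f u)" if "u : ?I" for u
 by (rule sigma_algebra_sigma_sets) auto
 hence "sigma_algebra UNIV (\<Inter>(?f ` ?I))"
 using ne unfolding sigma_algebra_iff2 by (auto 0 3 simp: subset_iff image_subset_iff)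
 thus ?thesis
 unfolding process_filtration_def by (rule sigma_algebra.sets_measure_of_eq)
qed

lemma FF_sub_completion:
 assumes "u : space (prob_algebra cemetery_borel)"
 shows "sets (FF t) <= sets (completion (u \<bind> P))"
proof -
 have "sets (NF t) <= sets (u \<bind> P)"
 using NF_mono[of t infy] sets_bind_P[OF assms] by auto
 hence "sets (NF t) Un null_sets (completion (u \<bind> P)) <= sets (completion (u \<bind> P))"
 by auto
 hence "sigma_sets (space (completion (u \<bind> P))) (sets (NF t) Un null_sets (completion (u \<bind> P))) <= sets (completion (u \<bind> P))"
 by (rule sets.sigma_sets_subset)
 thus ?thesis using assms by (auto simp: sets_FF space_bind_P)
qed

lemma FF_sub_P: "sets (FF t) <= sets (completion (P x))"
 using FF_sub_completion[OF return_in, of t x] by (simp add: bind_return_P)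

lemma NF_sub_FF: "sets (NF t) <= sets (FF t)"
 by (auto simp: sets_FF)

lemma FF_mono: "s <= t ==> sets (FF s) <= sets (FF t)"
proof -
 assume "s <= t"
 have "sigma_sets UNIV (sets (NF s) Un N) <= sigma_sets UNIV (sets (NF t) Un N)" for N
 by (rule sigma_sets_mono') (use NF_mono[OF \<open>s <= t\<close>] in auto)
 thus ?thesis unfolding sets_FF by (intro INF_mono) blast
qed

sublocale filtration UNIV FF
 by standard (auto intro: FF_mono[THEN subsetD])

lemma mFFm: "f : FF s MM N ==> s <= t ==> f : FF t MM N"
 by (rule measurable_from_subalg[rotated], assumption) (simp add: subalgebra_def FF_mono)

lemma measurable_NF_FF: "f : NF t MM N ==> f : FF t MM N"
 by (rule measurable_from_subalg[rotated], assumption) (simp add: subalgebra_def NF_sub_FF)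

lemma mFFc: "f : FF t MM N ==> f : completion (P x) MM N"
 by (rule measurable_from_subalg[rotated], assumption) (simp add: subalgebra_def FF_sub_P)

lemma X_eq_None_iff: "X t v = None \<longleftrightarrow> lifetime X v <= t"
 using absorbed by (auto simp: lifetime_def intro: Inf_lower)

lemma lt_iff: "t < lifetime X v \<longleftrightarrow> X t v ~= None"
 by (simp add: X_eq_None_iff not_le)

lemma X_None_mono: "X s v = None ==> s <= t ==> X t v = None"
 by (auto simp: X_eq_None_iff)

lemma ext0_right_continuous:
 fixes f :: "'e => real"
 assumes f: "continuous_on UNIV f" and t: "t < infy"
 shows "((%s. ext0 f (X s v)) \<longlongrightarrow> ext0 f (X t v)) (at_right t)"
proof (cases "X t v")
 case None
 have "\<forall>\<^sub>F s in at_right t. ext0 f (X s v) = 0"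
 by (rule eventually_at_rightI[OF _ t]) (use X_None_mono[OF None] less_imp_le in fastforce)
 thus ?thesis using None by (simp add: tendsto_eventually)
next
 case (Some x)
 show ?thesis unfolding Some ext0_simps
 proof (rule topological_tendstoI)
 fix S assume S: "open S" "f x : S"
 have "open (f -` S)" using f S(1) by (simp add: continuous_on_open_vimage)
 hence "openin cemetery_topology (Some ` (f -` S))"
 by (simp add: openin_Alexandroff_compactification_image_Some)
 moreover have "X t v : Some ` (f -` S)" using S Some by auto
 ultimately have "\<forall>\<^sub>F s in at_right t. X s v : Some ` (f -` S)"
 using right_continuous[OF t, of v] by (auto simp: limitin_def)
 thus "\<forall>\<^sub>F s in at_right t. ext0 f (X s v) : S"
 by (rule evmono) auto
 qed
qed

text \<open>Progressive measurability: right continuity makes the position a limit along strictly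
  larger dyadic times, and capping these at \<open>t\<close> keeps everything within
  \<open>NF t\<close>.\<close>

lemma measurable_X_min:
 "(%(s, v). X (min s t) v) : borel OM NF t MM cemetery_borel"
proof (rule measurable_cemetery_ext0I)
 fix g :: "'e => real" assume g: "continuous_on UNIV g"
 hence [measurable]: "g : Bor" by (rule borel_measurable_continuous_onI)
 note [measurable] = measurable_dyadic_above
 have D: "(%(s, v). X (min (dyadic_above n s) t) v) : borel OM NF t MM cemetery_borel" for n
 proof -
 let ?h = "%(i::int) p. X (min (en ((real_of_int i + 1) / 2^n)) t) (snd p)"
 have [measurable]: "?h i : (borel :: ennreal measure) OM NF t MM cemetery_borel" for i
 by (rule mcomp[OF msnd mXNF]) simp
 have [measurable]: "(%p. X (min infy t) (snd p)) : (borel :: ennreal measure) OM NF t MM cemetery_borel"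
 by (rule mcomp[OF msnd mXNF]) simp
 have [measurable]: "(%p. ?h \<lfloor>enn2real (fst p) * 2^n\<rfloor> p) : borel OM NF t MM cemetery_borel"
 by (rule measurable_compose_countable) measurable
 have "(%p. if fst p = infy then X (min infy t) (snd p) else ?h \<lfloor>enn2real (fst p) * 2^n\<rfloor> p)
 : borel OM NF t MM cemetery_borel"
 by measurable
 also have "(%p. if fst p = infy then X (min infy t) (snd p) else ?h \<lfloor>enn2real (fst p) * 2^n\<rfloor> p)
 = (%(s, v). X (min (dyadic_above n s) t) v)"
 by (auto simp: dyadic_above_def fun_eq_iff)
 finally show ?thesis .
 qed
 show "(%w. ext0 g (case w of (s, v) => X (min s t) v)) : bm (borel OM NF t)"
 proof (rule borel_measurable_LIMSEQ_real)
 show "(%w. ext0 g (case w of (s, v) => X (min (dyadic_above n s) t) v)) : bm (borel OM NF t)" for n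
 by (rule mcomp[OF D]) measurable
 fix w :: "ennreal \<times> 'w"
 obtain s v where w: "w = (s, v)" by (cases w)
 have "(%n. ext0 g (X (min (dyadic_above n s) t) v)) ->> ext0 g (X (min s t) v)"
 proof (cases "s < t")
 case False
 show ?thesis
 proof (cases "s = infy")
 case True thus ?thesis by (simp add: dyadic_above_def)
 next
 case s: False
 hence "min (dyadic_above n s) t = min s t" for n
 using dyadic_above_gt[of s n] False by (auto simp: min_def top.not_eq_extremum)
 thus ?thesis by simp
 qed
 next
 case True
 hence s: "s < infy" by (metis order_less_le_trans top_greatest oodef)
 have "filterlim (%n. min (dyadic_above n s) t) (at_right s) sequentially"
 unfolding filterlim_at
 proof
 show "\<forall>\<^sub>F n in sequentially. min (dyadic_above n s) t : {s<..} & min (dyadic_above n s) t ~= s"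
 using True dyadic_above_gt[OF s] by (intro always_eventually) (metis (no_types, lifting) greaterThan_iff min_less_iff_conj less_irrefl)
 have "(%n. min (dyadic_above n s) t) ->> min s t"
 by (intro tendsto_min dyadic_above_tendsto tendsto_const)
 thus "(%n. min (dyadic_above n s) t) ->> s" using True by (simp add: min_absorb1)
 qed
 from filterlim_compose[OF ext0_right_continuous[OF g s] this]
 show ?thesis using True by (simp add: min_absorb1)
 qed
 thus "(%n. ext0 g (case w of (s, v) => X (min (dyadic_above n s) t) v)) ->> ext0 g (case w of (s, v) => X (min s t) v)"
 by (simp add: w)
 qed
qed

lemma measurable_X_pair: "(%(s, v). X s v) : borel OM NF infy MM cemetery_borel"
 using measurable_X_min[of infy] by (simp add: min_def)

lemma measurable_X_time: "(%s. X s v) : borel MM cemetery_borel"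
 using mcomp[OF mPair[OF measurable_ident_sets[OF refl] measurable_const] measurable_X_pair, of v] by simp

lemma mXc:
 assumes s: "s : bm M" and w: "w : M MM NF infy"
 shows "(%z. X (s z) (w z)) : M MM cemetery_borel"
 using mcomp[OF mPair[OF s w] measurable_X_pair] by simp

lemma mXFF: "s <= t ==> X s : FF t MM cemetery_borel"
 by (intro measurable_NF_FF mXNF)

lemma measurable_id_FF: "(%x. x) : FF t MM NF t"
 by (intro measurable_NF_FF measurable_ident_sets) simp

lemma measurable_id_completion: "(%x. x) : completion (P x) MM NF infy"
 by (rule measurable_completion) (auto intro: measurable_ident_sets)

lemma stopping_min_measurable:
 assumes "stopping_time FF b"
 shows "(%v. min (b v) t) : bm (FF t)"
proof (rule borel_measurableI_le)
 fix a
 show "{x : space (FF t). min (b x) t <= a} : sets (FF t)"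
 proof (cases "t <= a")
 case False
 hence "{x : space (FF t). min (b x) t <= a} = {x : space (FF a). b x <= a}"
 by (auto simp: min_le_iff_disj)
 also have "... : sets (FF a)" using stopping_timeD[OF assms, of a] by (simp add: pred_def)
 finally show ?thesis using FF_mono[of a t] False by (meson linear subsetD)
 qed (simp add: min_le_iff_disj)
qed

text \<open>On the event \<open>b \<le> t\<close> the stopped position is a function of
  \<open>min (b w) t\<close> and of the path up to \<open>t\<close>, so progressive measurability
  applies.\<close>

lemma mXps:
 assumes b: "stopping_time FF b"
 shows "(%v. X (b v) v) : pre_sigma b MM cemetery_borel"
proof (rule measurableI)
 fix S :: "'e option set" assume S: "S : sets cemetery_borel"
 have "{v : {v. X (b v) v : S}. b v <= t} : sets (FF t)" for t
 proof -
 have "(%v. X (min (min (b v) t) t) v) : FF t MM cemetery_borel"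
 using mcomp[OF mPair[OF stopping_min_measurable[OF b] measurable_id_FF] measurable_X_min[of t]]
 by simp
 hence "(%v. X (min (b v) t) v) -` S Int space (FF t) : sets (FF t)"
 using S by (intro msets) simp_all
 moreover have "{v : space (FF t). b v <= t} : sets (FF t)"
 using stopping_timeD[OF b, of t] by (simp add: pred_def)
 ultimately have "((%v. X (min (b v) t) v) -` S Int space (FF t)) Int {v : space (FF t). b v <= t} : sets (FF t)"
 by (rule sets.Int)
 also have "((%v. X (min (b v) t) v) -` S Int space (FF t)) Int {v : space (FF t). b v <= t} = {v : {v. X (b v) v : S}. b v <= t}"
 by (auto simp: min_def)
 finally show ?thesis .
 qed
 thus "(%v. X (b v) v) -` S Int space (pre_sigma b) : sets (pre_sigma b)"
 by (intro sets_pre_sigmaI[OF b]) (simp add: space_pre_sigma vimage_def)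
qed simp

lemma stopping_time_shift:
 assumes b: "stopping_time FF b"
 shows "stopping_time FF (%v. b v + d)"
proof (rule stopping_timeI)
 fix t
 have eq: "(b v + d <= t) \<longleftrightarrow> (if t = infy then True else d <= t & b v <= t - d)" for v
 proof (cases "t = infy")
 case False
 hence "b v + d <= t \<longleftrightarrow> b v <= t - d" if "d <= t"
 using that by (cases d; cases t; cases "b v")
 (auto simp: ennreal_minus ennreal_plus[symmetric] top_unique simp del: ennreal_plus)
 moreover have "d <= t" if "b v + d <= t" using that by (metis add.commute add_increasing2 dual_order.trans order_refl zero_le)
 ultimately show ?thesis using False by meson
 qed simp
 have "Measurable.pred (FF (t - d)) (%v. b v <= t - d)" by (rule stopping_timeD[OF b])
 hence [measurable]: "Measurable.pred (FF t) (%v. b v <= t - d)"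
 by (rule mFFm) (simp add: diff_le_self_ennreal)
 show "Measurable.pred (FF t) (%v. b v + d <= t)" unfolding eq by measurable
qed

lemma pre_sigma_sub_FF:
 assumes b: "stopping_time FF b"
 shows "sets (pre_sigma b) <= sets (FF infy)"
proof
 fix A assume "A : sets (pre_sigma b)"
 from sets_pre_sigmaD[OF b this, of infy] show "A : sets (FF infy)" by simp
qed

end

section \<open>The strong Markov property for functionals of the path\<close>

context hunt_process
begin

lemma mpsc:
 assumes "stopping_time FF e" "f : pre_sigma e MM N"
 shows "f : CP (P x) MM N"
 by (rule mFFc[of _ infy], rule measurable_from_subalg[OF _ assms(2)])
 (simp add: subalgebra_def space_pre_sigma pre_sigma_sub_FF[OF assms(1)] del: oodef)

text \<open>The locale assumption is about conditional expectations of indicators. Here both sides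
  become measures on the state space weighted by \<open>LL\<close>, \<open>A\<close> being the law
  of the later position and \<open>B\<close> a mixture of kernels, so that equality on sets passes
  to all \<open>k\<close>.\<close>

lemma strong_markov_one:
 assumes e: "stopping_time FF e" and t: "t < infy" and k: "k : bm cb"
 and LL: "LL : sets (pre_sigma e)"
 shows "nn (CP (P x)) (%w. ind LL w * k (X (e w + t) w)) =
 (nn (CP (P x)) (%w. ind LL w * nn (P (X (e w) w)) (%w'. k (X t w'))))"
proof -
 let ?M = "CP (P x)"
 interpret prob_space "P x" by (rule prob_space_P)
 interpret M: prob_space ?M by (rule prob_space_completion)
 have sub: "subalgebra ?M (pre_sigma e)"
 using pre_sigma_sub_FF[OF e] FF_sub_P[of infy x] by (auto simp: subalgebra_def space_pre_sigma)
 interpret sf: sigma_finite_subalgebra ?M "pre_sigma e"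
 by (rule finite_measure_subalgebra_is_sigma_finite, unfold_locales) (fact sub)
 have LLM: "LL : sets ?M" using LL sub by (auto simp: subalgebra_def)
 have Xt: "(%w. X (e w + t) w) : ?M MM cb"
 by (rule mpsc[OF stopping_time_shift[OF e] mXps[OF stopping_time_shift[OF e]]])
 have X0: "(%w. X (e w) w) : ?M MM cb"
 by (rule mpsc[OF e mXps[OF e]])
 have Xt': "X t : NF infy MM cb" by (rule mXNF) simp
 define A where "A = distr (density ?M (ind LL)) cb (%w. X (e w + t) w)"
 have kern: "(%y. distr (P y) cb (X t)) : cb MM subprob_algebra cb"
 by (rule mcomp[OF kernel_sub measurable_distr[OF Xt']])
 hence kern': "(%w. distr (P (X (e w) w)) cb (X t)) : density ?M (ind LL) MM subprob_algebra cb"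
 using mcomp[OF X0 kern] by simp
 define B where "B = density ?M (ind LL) \<bind> (%w. distr (P (X (e w) w)) cb (X t))"
 have eq: "A = B"
 proof (rule measure_eqI)
 show "sets A = sets B" unfolding A_def B_def
 by (subst sets_bind[of _ _ cb]) auto
 fix S assume "S : sets A"
 hence S: "S : sets cb" by (simp add: A_def)
 let ?f = "ind {w'. X (e w' + t) w' : S} :: 'w => real"
 have Sm: "{w'. X (e w' + t) w' : S} : sets ?M"
 using msets[OF Xt S] by (simp add: vimage_def)
 have mm: "(%w. measure (P (X (e w) w)) {w'. X t w' : S}) : bm ?M"
 proof (rule mcomp[OF X0])
 have "{w'. X t w' : S} : sets (NF infy)" using msets[OF Xt' S] by (simp add: vimage_def)
 thus "(%y. measure (P y) {w'. X t w' : S}) : bm cb"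
 by (rule mcomp[OF kernel_sub measurable_measure_subprob_algebra])
 qed
 have "(\<integral>w\<in>LL. ?f w \<partial>?M) = (\<integral>w\<in>LL. real_cond_exp ?M (pre_sigma e) ?f w \<partial>?M)"
 by (rule sf.real_cond_exp_intA[OF _ LL], rule M.integrable_const_bound[where B=1]) (use Sm in auto)
 also have "... = (\<integral>w\<in>LL. measure (P (X (e w) w)) {w'. X t w' : S} \<partial>?M)"
 unfolding set_lebesgue_integral_def
 by (rule integral_cong_AE)
 (use strong_markov[OF return_in e t S, of x, unfolded bind_return_P] LLM mm in auto)
 finally have *: "(\<integral>w\<in>LL. ?f w \<partial>?M) = (\<integral>w\<in>LL. measure (P (X (e w) w)) {w'. X t w' : S} \<partial>?M)" .
 have bd: "measure (P y) Z <= 1" for y Z by (rule prob_space.prob_le_1[OF prob_space_P])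
 have "emu A S = nn ?M (%w. ind LL w * ind {w'. X (e w' + t) w' : S} w)"
 unfolding A_def using S Xt LLM Sm
 by (subst emeasure_distr) (auto simp: emeasure_density vimage_def)
 also have "... = nn ?M (%w. en (ind LL w * ?f w))"
 by (intro ncong) (auto split: spind)
 also have "... = en (\<integral>w\<in>LL. ?f w \<partial>?M)"
 unfolding set_lebesgue_integral_def real_scaleR_def
 by (rule neqint)
 (use LLM Sm in \<open>auto intro!: M.integrable_const_bound[where B=1] split: spind\<close>)
 also have "... = nn ?M (%w. en (ind LL w * measure (P (X (e w) w)) {w'. X t w' : S}))"
 unfolding * unfolding set_lebesgue_integral_def real_scaleR_def
 by (rule neqint[symmetric])
 (use LLM mm bd in \<open>auto intro!: M.integrable_const_bound[where B=1] split: spind\<close>)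
 also have "... = nn ?M (%w. ind LL w * emu (P (X (e w) w)) {w'. X t w' : S})"
 using prob_space.finite_measure[OF prob_space_P]
 by (intro ncong) (auto simp: finite_measure.emeasure_eq_measure split: spind)
 also have "... = nn ?M (%w. ind LL w * emu (distr (P (X (e w) w)) cb (X t)) S)"
 using Xt' S by (intro ncong, subst emeasure_distr) (auto simp: vimage_def mcongs[OF sets_P refl])
 also have "... = emu B S"
 unfolding B_def using LLM S kern' mcomp[OF mcomp[OF X0 kern] memeas[OF S]]
 by (subst emeasure_bind[where N=cb]) (auto simp: ndens)
 finally show "emu A S = emu B S" .
 qed
 have "nn ?M (%w. ind LL w * k (X (e w + t) w)) = nn A (%y. k y)"
 unfolding A_def using Xt k LLM mcomp[OF Xt k]
 by (simp add: nn_integral_distr ndens)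
 also have "... = nn (density ?M (ind LL)) (%w. nn (distr (P (X (e w) w)) cb (X t)) (%y. k y))"
 unfolding eq B_def by (rule nn_integral_bind[OF k kern'])
 also have "... = nn (density ?M (ind LL)) (%w. nn (P (X (e w) w)) (%w'. k (X t w')))"
 using Xt' k by (intro ncong nn_integral_distr) (simp_all add: mcongs[OF sets_P refl])
 also have "... = nn ?M (%w. ind LL w * nn (P (X (e w) w)) (%w'. k (X t w')))"
 proof (rule ndens)
 show "(%w. nn (P (X (e w) w)) (%w'. k (X t w'))) : bm ?M"
 by (rule mcomp[OF X0 measurable_E[OF mcomp[OF Xt' k]]])
 qed (use LLM in simp)
 finally show ?thesis .
qed

text \<open>The base time \<open>a\<close> lets the induction over time points move the origin to
  the smallest of them.\<close>

definition cyl :: "real set => (real => 'e option set) => real => 'w set" where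
 "cyl J S a = {w. ALL t:J. X (en (t - a)) w : S t}"

lemma cyl_sets: "finite J ==> (!!t. S t : sets cb) ==> cyl J S a : sets (NF infy)"
proof -
 assume "finite J" and S: "!!t. S t : sets cb"
 thus ?thesis
 proof (induction J)
 case empty thus ?case by (simp add: cyl_def)
 next
 case (insert b J)
 have "cyl (insert b J) S a = X (en (b - a)) -` S b Int space (NF infy) Int cyl J S a"
 by (auto simp: cyl_def)
 moreover have "X (en (b - a)) -` S b Int space (NF infy) : sets (NF infy)"
 by (rule msets[OF mXNF S]) simp
 ultimately show ?case using insert by auto
 qed
qed

text \<open>Induction from the smallest time. Its constraint is absorbed into the event at the later
  stopping time \<open>e + (b - a)\<close>, the remaining times are handled from there, and the
  one-time property brings the result back to \<open>e\<close>.\<close>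

lemma strong_markov_cyl:
 assumes "finite J" and S: "!!t. S t : sets cb"
 shows "ALL t:J. a <= t ==> stopping_time FF e ==> LL : sets (pre_sigma e) ==>
 (nn (CP (P x)) (%w. ind LL w * ind {w. ALL t:J. X (e w + en (t - a)) w : S t} w)) =
 (nn (CP (P x)) (%w. ind LL w * emu (P (X (e w) w)) (cyl J S a)))"
 using assms(1)
proof (induction J arbitrary: a e LL x rule: finite_linorder_min_induct)
 case empty
 have "emu (P y) UNIV = 1" for y using prob_space.emeasure_space_1[OF prob_space_P, of y] by simp
 thus ?case by (simp add: cyl_def)
next
 case (insert b A)
 note e = insert.prems(2) and LL = insert.prems(3)
 define d where "d = en (b - a)"
 have ab: "a <= b" using insert.prems(1) by simp
 have bA: "ALL t:A. b <= t" using insert.hyps(2) by auto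
 have add: "s + d + en (t - b) = s + en (t - a)" if "t : A" for t s
 using that bA ab unfolding d_def by (simp add: add.assoc flip: ennreal_plus)
 let ?e = "%w. e w + d"
 have e': "stopping_time FF ?e" by (rule stopping_time_shift[OF e])
 define k where "k y = ind (S b) y * emu (P y) (cyl A S b)" for y
 have cA: "cyl A S b : sets (NF infy)" by (rule cyl_sets[OF insert.hyps(1) S])
 have k: "k : bm cb"
 unfolding k_def using mcomp[OF kernel_sub memeas[OF cA]] S[of b]
 by (intro bmtimes bmind)
 let ?L = "LL Int {w. X (e w + d) w : S b}"
 have "{w. X (e w + d) w : S b} : sets (pre_sigma ?e)"
 using msets[OF mXps[OF e'] S[of b]] by (simp add: vimage_def space_pre_sigma)
 moreover have "LL : sets (pre_sigma ?e)"
 using mono_pre_sigma[OF e e'] LL by auto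
 ultimately have L: "?L : sets (pre_sigma ?e)" by auto
 have "nn (CP (P x)) (%w. ind LL w * ind {w. ALL t:insert b A. X (e w + en (t - a)) w : S t} w)
 = nn (CP (P x)) (%w. ind ?L w * ind {w. ALL t:A. X (?e w + en (t - b)) w : S t} w)"
 by (intro ncong) (auto split: spind simp: add simp flip: d_def)
 also have "... = nn (CP (P x)) (%w. ind ?L w * emu (P (X (?e w) w)) (cyl A S b))"
 by (rule insert.IH[OF bA e' L])
 also have "... = nn (CP (P x)) (%w. ind LL w * k (X (e w + d) w))"
 by (intro ncong) (auto split: spind simp: k_def)
 also have "... = nn (CP (P x)) (%w. ind LL w * nn (P (X (e w) w)) (%w'. k (X d w')))"
 by (rule strong_markov_one[OF e _ k LL]) (simp add: d_def)
 finally have main: "nn (CP (P x)) (%w. ind LL w * ind {w. ALL t:insert b A. X (e w + en (t - a)) w : S t} w)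
 = nn (CP (P x)) (%w. ind LL w * nn (P (X (e w) w)) (%w'. k (X d w')))" .
 \<comment> \<open>The induction hypothesis is used a second time, at the constant stopping time
   \<open>d\<close> under \<open>P y\<close>, to identify the inner expectation.\<close>
 have "nn (P y) (%w'. k (X d w')) = emu (P y) (cyl (insert b A) S a)" for y
 proof -
 have st: "stopping_time FF (%_. d)" by (rule stopping_time_const)
 have "{w. X d w : S b} : sets (pre_sigma (%_. d))"
 using msets[OF mXps[OF st] S[of b]] by (simp add: vimage_def space_pre_sigma)
 from insert.IH[OF bA st this, of y]
 have "nn (P y) (%w'. k (X d w')) = nn (P y) (%w. ind {w. X d w : S b} w * ind {w. ALL t:A. X (d + en (t - b)) w : S t} w)"
 by (simp add: k_def ncompl indicator_def)
 also have "... = nn (P y) (%w. ind (cyl (insert b A) S a) w)"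
 using add[of _ 0] by (intro ncong) (auto split: spind simp: cyl_def d_def)
 also have "... = emu (P y) (cyl (insert b A) S a)"
 using cyl_sets[of "insert b A" S a] insert.hyps(1) S by (intro nn_integral_indicator) auto
 finally show ?thesis .
 qed
 thus ?case using main by simp
qed

definition cylinders :: "'w set set" where
 "cylinders = {cyl J S 0 | J S. finite J & (ALL t:J. 0 <= t) & (ALL t. S t : sets cb)}"

lemma Int_stable_cylinders: "Int_stable cylinders"
proof (rule Int_stableI)
 fix a b assume "a : cylinders" "b : cylinders"
 then obtain J1 S1 J2 S2 where a: "a = cyl J1 S1 0" "finite J1" "ALL t:J1. 0 <= t" "ALL t. S1 t : sets cb"
 and b: "b = cyl J2 S2 0" "finite J2" "ALL t:J2. 0 <= t" "ALL t. S2 t : sets cb"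
 by (auto simp: cylinders_def)
 define S where "S t = (if t : J1 then S1 t else UNIV) Int (if t : J2 then S2 t else UNIV)" for t
 have "UNIV : sets (cb :: 'e option measure)" by (metis sets.top space_cemetery_borel)
 hence S: "ALL t. S t : sets cb" using a b by (auto simp: S_def)
 have "a Int b = cyl (J1 Un J2) S 0" unfolding a b cyl_def S_def by auto
 thus "a Int b : cylinders"
 using a b S unfolding cylinders_def by blast
qed

text \<open>Cylinders use finite times. Time \<open>\<infinity>\<close> adds no information, because
  the position there is always the cemetery.\<close>

lemma sets_NF_cylinders: "sets (NF infy) = sigma_sets UNIV cylinders"
proof
 show "sets (NF infy) <= sigma_sets UNIV cylinders"
 unfolding sets_NF
 proof (rule sigma_sets_mono, rule subsetI)
 fix A assume "A : {X s -` S |s S. s <= infy & S : sets cb}"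
 then obtain s S where A: "A = X s -` S" "S : sets cb" by auto
 show "A : sigma_sets UNIV cylinders"
 proof (cases s)
 case (real r)
 hence "A = cyl {r} (%_. S) 0" using A by (auto simp: cyl_def)
 hence "A : cylinders" unfolding cylinders_def using A real by blast
 thus ?thesis by auto
 next
 case top
 hence "A = {} | A = UNIV" using A X_infinity by auto
 thus ?thesis by (auto intro: sigma_sets.Empty sigma_sets_top)
 qed
 qed
 show "sigma_sets UNIV cylinders <= sets (NF infy)"
 proof -
 have "cylinders <= sets (NF infy)" unfolding cylinders_def using cyl_sets by blast
 from sets.sigma_sets_subset[OF this] show ?thesis by simp
 qed
qed

text \<open>The shift, redirected to \<open>\<theta>\<^sub>0\<close> at infinity, where \<open>\<theta>\<close> is unspecified.\<close>

definition sh :: "ennreal => 'w => 'w" where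
 "sh t = th (if t = infy then 0 else t)"

lemma X_sh: "X s (sh t w) = X (s + (if t = infy then 0 else t)) w"
 unfolding sh_def by (rule shift) (auto simp: top.not_eq_extremum)

lemma sh_finite: "t < infy ==> sh t = th t"
 by (auto simp: sh_def)

lemma measurable_sh:
 assumes s: "s : bm M" and w: "w : M MM NF infy"
 shows "(%z. sh (s z) (w z)) : M MM NF infy"
 unfolding natural_filtration_def
proof (rule measurable_measure_of)
 fix y assume "y : {X s -` S |s S. s <= infy & S : sets cb}"
 then obtain r S where y: "y = X r -` S" "S : sets cb" by auto
 have "(%z. X (r + (if s z = infy then 0 else s z)) (w z)) : M MM cb"
 by (rule mXc[OF _ w]) (use s in measurable)
 from msets[OF this y(2)]
 show "(%z. sh (s z) (w z)) -` y Int space M : sets M"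
 by (simp add: y X_sh vimage_def)
qed auto

text \<open>As functions of \<open>g\<close> both sides are finite measures, and they agree on the
  cylinders, a generator stable under intersection.\<close>

lemma strong_markov_set:
 assumes e: "stopping_time FF e" and LL: "LL : sets (pre_sigma e)" and fin: "!!w. w : LL ==> e w < infy"
 and g: "g : sets (NF infy)"
 shows "nn (CP (P x)) (%w. ind LL w * ind g (sh (e w) w)) =
 (nn (CP (P x)) (%w. ind LL w * emu (P (X (e w) w)) g))"
proof -
 let ?M = "CP (P x)"
 interpret prob_space "P x" by (rule prob_space_P)
 interpret M: prob_space ?M by (rule prob_space_completion)
 have LLM: "LL : sets ?M" using LL pre_sigma_sub_FF[OF e] FF_sub_P[of infy x] by auto
 have X0: "(%w. X (e w) w) : ?M MM cb"
 by (rule mpsc[OF e mXps[OF e]])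
 have eM: "e : bm ?M"
 by (rule mpsc[OF e measurable_stopping_time_pre_sigma[OF e]])
 have shM: "(%w. sh (e w) w) : ?M MM NF infy"
 by (rule measurable_sh[OF eM measurable_id_completion])
 have "distr (density ?M (ind LL)) (NF infy) (%w. sh (e w) w) = density ?M (ind LL) \<bind> (%w. P (X (e w) w))"
 (is "?A = ?B")
 proof (rule measure_eqI_generator_eq[where A="%_. UNIV"])
 show "Int_stable cylinders" by (rule Int_stable_cylinders)
 show "cylinders <= Pow UNIV" by simp
 have kern: "(%w. P (X (e w) w)) : density ?M (ind LL) MM subprob_algebra (NF infy)"
 using mcomp[OF X0 kernel_sub] by simp
 have eB: "emu ?B g = nn ?M (%w. ind LL w * emu (P (X (e w) w)) g)" if "g : sets (NF infy)" for g
 using that LLM mcomp[OF mcomp[OF X0 kernel_sub] memeas[OF that]]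
 by (subst emeasure_bind[OF _ kern]) (auto simp: ndens)
 have eA: "emu ?A g = nn ?M (%w. ind LL w * ind g (sh (e w) w))" if "g : sets (NF infy)" for g
 using that LLM shM msets[OF shM that]
 by (subst emeasure_distr) (auto simp: emeasure_density intro!: ncong split: spind)
 fix Y assume Y: "Y : cylinders"
 then obtain J S where Y': "Y = cyl J S 0" "finite J" "ALL t:J. 0 <= t" "ALL t. S t : sets cb"
 by (auto simp: cylinders_def)
 have YN: "Y : sets (NF infy)" using Y sets_NF_cylinders by auto
 show "emu ?A Y = emu ?B Y"
 unfolding eA[OF YN] eB[OF YN]
 using strong_markov_cyl[of J S 0 e LL x] Y' e LL
 proof -
 have "nn ?M (%w. ind LL w * ind Y (sh (e w) w)) =
 (nn ?M (%w. ind LL w * ind {w. ALL t:J. X (e w + en (t - 0)) w : S t} w))"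
 using fin by (intro ncong)
 (auto split: spind simp: Y' cyl_def X_sh add.commute dest!: fin)
 also have "... = nn ?M (%w. ind LL w * emu (P (X (e w) w)) Y)"
 unfolding Y' by (rule strong_markov_cyl) (use Y' e LL in auto)
 finally show "nn ?M (%w. ind LL w * ind Y (sh (e w) w)) = nn ?M (%w. ind LL w * emu (P (X (e w) w)) Y)" .
 qed
 next
 show "sets ?A = sigma_sets UNIV cylinders" by (simp add: sets_NF_cylinders del: oodef)
 show "sets ?B = sigma_sets UNIV cylinders"
 by (subst sets_bind[of _ _ "NF infy"]) (auto simp: sets_NF_cylinders simp del: oodef)
 have "cyl {} (%_. {}) 0 = UNIV" by (simp add: cyl_def)
 moreover have "cyl {} (%_. {}) 0 : cylinders" unfolding cylinders_def by blast
 ultimately have "UNIV : cylinders" by simp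
 thus "range (%_. UNIV) <= cylinders" by auto
 have "emu ?A UNIV = nn ?M (%w. ind LL w * 1)"
 using LLM shM by (subst emeasure_distr) (auto simp: emeasure_density)
 also have "... <= nn ?M (%w. 1)" by (intro nmono) (auto split: spind)
 also have "... = 1" using M.emeasure_space_1 by simp
 finally show "emu ?A UNIV ~= infy" by (auto simp: top_unique)
 qed simp
 moreover have "emu ?B g = nn ?M (%w. ind LL w * emu (P (X (e w) w)) g)"
 using g LLM mcomp[OF mcomp[OF X0 kernel_sub] memeas[OF g]]
 mcomp[OF X0 kernel_sub]
 by (subst emeasure_bind[where N="NF infy"]) (auto simp: ndens)
 moreover have "emu ?A g = nn ?M (%w. ind LL w * ind g (sh (e w) w))"
 using g LLM shM msets[OF shM g]
 by (subst emeasure_distr) (auto simp: emeasure_density intro!: ncong split: spind)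
 ultimately show ?thesis by simp
qed

text \<open>There are two passages from sets to functions: in the past, by comparing two weighted
  measures on \<open>pre_sigma e\<close>, and then in the future, by comparing two laws of the
  shifted path. \<open>H\<close> vanishes where \<open>e\<close> is infinite, since there is no
  shift by infinity.\<close>

lemma strong_markov_functional:
 assumes e: "stopping_time FF e" and H: "H : bm (pre_sigma e)"
 and fin: "!!w. e w = infy ==> H w = 0"
 and F: "F : bm (NF infy)"
 shows "nn (P x) (%w. H w * F (sh (e w) w)) = nn (P x) (%w. H w * nn (P (X (e w) w)) (%w'. F w'))"
proof -
 let ?M = "CP (P x)"
 have X0: "(%w. X (e w) w) : ?M MM cb"
 by (rule mpsc[OF e mXps[OF e]])
 have eM: "e : bm ?M"
 by (rule mpsc[OF e measurable_stopping_time_pre_sigma[OF e]])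
 have shM: "(%w. sh (e w) w) : ?M MM NF infy"
 by (rule measurable_sh[OF eM measurable_id_completion])
 have HM: "H : bm ?M" by (rule mpsc[OF e H])
 let ?I = "{w. e w < infy}"
 have Ipre: "?I : sets (pre_sigma e)"
 using msets[OF measurable_stopping_time_pre_sigma[OF e], of "{..<infy}"]
 by (simp add: space_pre_sigma vimage_def)
 have idp: "(%w. w) : ?M MM pre_sigma e"
 by (rule mpsc[OF e]) simp
 have set_level: "nn ?M (%w. H w * ind g (sh (e w) w)) = nn ?M (%w. H w * emu (P (X (e w) w)) g)"
 if g: "g : sets (NF infy)" for g
 proof -
 let ?a = "%w. ind ?I w * ind g (sh (e w) w) :: ennreal"
 let ?b = "%w. ind ?I w * emu (P (X (e w) w)) g"
 have IM: "?I : sets ?M" using Ipre pre_sigma_sub_FF[OF e] FF_sub_P[of infy x] by auto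
 have a: "?a : bm ?M"
 using IM mcomp[OF shM bmind[OF g]] by measurable
 have b: "?b : bm ?M"
 using IM mcomp[OF mcomp[OF X0 kernel_sub] memeas[OF g]] by measurable
 have "distr (density ?M ?a) (pre_sigma e) (%w. w) = distr (density ?M ?b) (pre_sigma e) (%w. w)"
 proof (rule measure_eqI)
 fix LL assume "LL : sets (distr (density ?M ?a) (pre_sigma e) (%w. w))"
 hence LL: "LL : sets (pre_sigma e)" by simp
 hence LLM: "LL : sets ?M" using pre_sigma_sub_FF[OF e] FF_sub_P[of infy x] by auto
 have "nn ?M (%w. ind (LL Int ?I) w * ind g (sh (e w) w)) =
 (nn ?M (%w. ind (LL Int ?I) w * emu (P (X (e w) w)) g))"
 by (rule strong_markov_set[OF e _ _ g]) (use LL Ipre in auto)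
 hence "nn ?M (%w. ?a w * ind LL w) = nn ?M (%w. ?b w * ind LL w)"
 by (simp add: indicator_inter_arith mult_ac)
 thus "emu (distr (density ?M ?a) (pre_sigma e) (%w. w)) LL = emu (distr (density ?M ?b) (pre_sigma e) (%w. w)) LL"
 using LL LLM a b idp by (simp add: emeasure_distr emeasure_density)
 qed simp
 from arg_cong[OF this, of "%N. integral\<^sup>N N H"]
 have "nn ?M (%w. ?a w * H w) = nn ?M (%w. ?b w * H w)"
 using a b H HM idp by (simp add: nn_integral_distr ndens)
 moreover have "?a w * H w = H w * ind g (sh (e w) w)" for w
 using fin[of w] by (cases "e w = infy") (auto simp: mult_ac top.not_eq_extremum)
 moreover have "?b w * H w = H w * emu (P (X (e w) w)) g" for w
 using fin[of w] by (cases "e w = infy") (auto simp: mult_ac top.not_eq_extremum)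
 ultimately show ?thesis by simp
 qed
 have kern: "(%w. P (X (e w) w)) : density ?M H MM subprob_algebra (NF infy)"
 using mcomp[OF X0 kernel_sub] by simp
 have "distr (density ?M H) (NF infy) (%w. sh (e w) w) = density ?M H \<bind> (%w. P (X (e w) w))"
 (is "?A = ?B")
 proof (rule measure_eqI)
 show "sets ?A = sets ?B" by (subst sets_bind[of _ _ "NF infy"]) auto
 fix g assume "g : sets ?A"
 hence g: "g : sets (NF infy)" by simp
 have "emu ?B g = nn ?M (%w. H w * emu (P (X (e w) w)) g)"
 using g HM mcomp[OF mcomp[OF X0 kernel_sub] memeas[OF g]]
 by (subst emeasure_bind[OF _ kern]) (auto simp: ndens)
 moreover have "emu ?A g = nn ?M (%w. H w * ind g (sh (e w) w))"
 using g HM shM msets[OF shM g]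
 by (subst emeasure_distr) (auto simp: emeasure_density intro!: ncong split: spind)
 ultimately show "emu ?A g = emu ?B g" using set_level[OF g] by simp
 qed
 from arg_cong[OF this, of "%N. integral\<^sup>N N F"]
 have "nn (density ?M H) (%w. F (sh (e w) w)) = nn (density ?M H) (%w. nn (P (X (e w) w)) (%w'. F w'))"
 using F shM by (simp add: nn_integral_distr nn_integral_bind[OF F kern])
 thus ?thesis
 using HM mcomp[OF shM F] mcomp[OF X0 measurable_E[OF F]]
 by (simp add: ndens ncompl)
qed

lemma FF_sub_pre_sigma: "sets (FF s) <= sets (pre_sigma (%_. s))"
proof
 fix A assume A: "A : sets (FF s)"
 have "{w : A. s <= t} : sets (FF t)" for t
 using FF_mono[of s t] A by (cases "s <= t") auto
 thus "A : sets (pre_sigma (%_. s))"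
 by (intro sets_pre_sigmaI stopping_time_const)
qed

lemma markov_functional:
 assumes s: "s < infy" and H: "H : bm (FF s)" and F: "F : bm (NF infy)"
 shows "nn (P x) (%w. H w * F (th s w)) = nn (P x) (%w. H w * nn (P (X s w)) (%w'. F w'))"
proof -
 have "H : bm (pre_sigma (%_. s))"
 by (rule measurable_from_subalg[OF _ H]) (simp add: subalgebra_def space_pre_sigma FF_sub_pre_sigma)
 from strong_markov_functional[OF stopping_time_const this _ F, of x]
 show ?thesis using s by (simp add: sh_finite)
qed

section \<open>Zero-one law and raw versions\<close>

text \<open>The events that are almost sure or almost impossible under \<open>P x\<close> form a
  sigma-field. It contains the events of time 0, by normality, and the completed null sets.\<close>

lemma blumenthal:
 assumes "g : sets (FF 0)"
 shows "(AE w in P x. w : g) | (AE w in P x. w ~: g)"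
proof -
 define C where "C = {g. (AE w in P x. w : g) | (AE w in P x. w ~: g)}"
 have "sigma_algebra UNIV C"
 unfolding sigma_algebra_iff2
 proof (intro conjI ballI allI impI)
 fix A :: "nat => 'w set" assume A: "range A <= C"
 show "(\<Union>i. A i) : C"
 proof (cases "EX i. AE w in P x. w : A i")
 case True
 then obtain i where "AE w in P x. w : A i" by auto
 hence "AE w in P x. w : (\<Union>i. A i)" by (rule evmono) auto
 thus ?thesis by (simp add: C_def)
 next
 case False
 hence "ALL i. AE w in P x. w ~: A i" using A by (auto simp: C_def)
 hence "AE w in P x. ALL i. w ~: A i" by (simp add: AEall)
 thus ?thesis by (simp add: C_def)
 qed
 qed (auto simp: C_def)
 then interpret C: sigma_algebra UNIV C .
 have "{X s -` S |s S. s <= 0 & S : sets cb} <= C"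
 proof safe
 fix s :: ennreal and S :: "'e option set" assume "s <= 0"
 hence s: "s = 0" by simp
 show "X s -` S : C"
 proof (cases "x : S")
 case True
 have "AE w in P x. X 0 w : S" using normal by eventually_elim (use True in auto)
 thus ?thesis by (simp add: C_def s)
 next
 case False
 have "AE w in P x. X 0 w ~: S" using normal by eventually_elim (use False in auto)
 thus ?thesis by (simp add: C_def s)
 qed
 qed
 hence 1: "sets (NF 0) <= C" unfolding sets_NF by (rule C.sigma_sets_subset)
 have 2: "null_sets (CP (P x)) <= C"
 proof
 fix A assume "A : null_sets (CP (P x))"
 hence "AE w in P x. w ~: A" using AE_not_in[of A "CP (P x)"] by (simp add: AE_completion_iff)
 thus "A : C" by (simp add: C_def)
 qed
 have "g : sigma_sets UNIV (sets (NF 0) Un null_sets (completion (return cb x \<bind> P)))"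
 using assms return_in unfolding sets_FF by blast
 hence "g : C" using C.sigma_sets_subset[of "sets (NF 0) Un null_sets (CP (P x))"] 1 2
 by (auto simp: bind_return_P)
 thus ?thesis by (simp add: C_def)
qed

lemma FF_0_I: "(!!t. 0 < t ==> g : sets (FF t)) ==> g : sets (FF 0)"
 using filtration_right_continuous[of 0] by auto

text \<open>The expectation of a functional that is measurable for the completed field need not be
  Borel in the starting point. A strictly positive integrable density turns \<open>j\<close> into an
  initial law with the same null sets, and completeness under that law supplies a raw functional off
  a single raw null set.\<close>

lemma raw_version:
 fixes F :: "'w => ennreal" and j :: "'e measure"
 assumes j: "sigma_finite_measure j" and sk: "sets j = sets borel" and F: "F : bm (FF infy)"
 obtains F0 Z where "F0 : bm (NF infy)" "Z : sets (NF infy)" "{w. F w ~= F0 w} <= Z"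
 "AE y in j. emu (PS y) Z = 0"
proof -
 interpret j: sigma_finite_measure j by fact
 note [measurable_cong] = sk
 have sp: "space j = UNIV" using sets_eq_imp_space_eq[OF sk] by simp
 obtain h :: "'e => real" where h[measurable]: "h : bm j" and hp: "!!x. h x > 0" and hi: "integrable j h"
 using j.obtain_positive_integrable_function by metis
 define c where "c = (\<integral>x. h x \<partial>j)"
 show ?thesis
 proof (cases "emu j UNIV = 0")
 case True
 \<comment> \<open>The zero measure cannot be normalised; the whole path space then serves as the
   exceptional set.\<close>
 hence "AE y in j. emu (PS y) UNIV = 0"
 by (intro AE_I[of _ _ UNIV]) (auto simp: sk)
 thus ?thesis by (intro that[of "%_. 0" UNIV]) auto
 next
 case False
 have c: "c > 0"
 proof -
 have "c ~= 0"
 proof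
 assume "c = 0"
 hence "AE x in j. h x = 0"
 using integral_nonneg_eq_0_iff_AE[OF hi] hp by (simp add: c_def less_imp_le)
 hence "AE x in j. False" using hp by (auto elim!: evmono simp: less_le)
 thus False using False sp AE_iff_measurable[of "space j" j "%_. False"] by auto
 qed
 moreover have "c >= 0" unfolding c_def using hp by (intro integral_nonneg_AE) (auto simp: less_imp_le)
 ultimately show ?thesis by simp
 qed
 define u where "u = distr (density j (%x. en (h x / c))) cb Some"
 have meas: "Some : density j (%x. en (h x / c)) MM cb"
 using measurable_Some by (simp add: mcongs[OF sk refl])
 have "nn j (%x. en (h x / c)) = en (\<integral>x. h x / c \<partial>j)"
 using hi hp c by (intro neqint) (auto simp: less_imp_le)
 also have "... = 1" using c hi by (simp add: c_def)
 finally have "prob_space (density j (%x. en (h x / c)))"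
 by (intro prob_spaceI) (simp add: emeasure_density sp cong: ncong)
 hence "prob_space u" unfolding u_def by (rule prob_space.prob_space_distr[OF _ meas])
 hence u: "u : space (prob_algebra cb)" by (simp add: space_prob_algebra u_def)
 have "F : bm (completion (u \<bind> P))"
 by (rule measurable_from_subalg[OF _ F]) (simp add: subalgebra_def FF_sub_completion[OF u] space_bind_P[OF u])
 from completion_ex_borel_measurable[OF this]
 obtain F0 where F0: "F0 : bm (u \<bind> P)" "AE x in u \<bind> P. F x = F0 x" by auto
 from AE_E[OF F0(2)] obtain Z where Z: "{w : space (u \<bind> P). F w ~= F0 w} <= Z" "emu (u \<bind> P) Z = 0" "Z : sets (u \<bind> P)" .
 have ZN: "Z : sets (NF infy)" using Z sets_bind_P[OF u] by simp
 have ku: "P : u MM subprob_algebra (NF infy)"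
 using kernel_sub by (simp add: u_def)
 have me: "(%y. emu (P y) Z) : bm cb"
 by (rule mcomp[OF kernel_sub memeas[OF ZN]])
 have "nn u (%y. emu (P y) Z) = 0"
 using Z(2) by (subst (asm) emeasure_bind[OF _ ku ZN]) (simp_all add: u_def)
 hence "AE y in u. emu (P y) Z = 0"
 using me by (subst (asm) n0AE) (simp_all add: u_def)
 moreover have "{y : space cb. emu (P y) Z = 0} : sets cb"
 using me by measurable
 ultimately have "AE y in density j (%x. en (h x / c)). emu (PS y) Z = 0"
 unfolding u_def by (subst (asm) AE_distr_iff[OF meas]) auto
 hence "AE y in j. emu (PS y) Z = 0"
 using hp c by (subst (asm) AE_density) auto
 moreover have "F0 : bm (NF infy)"
 using F0(1) by (simp add: mcongs[OF sets_bind_P[OF u] refl])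
 ultimately show ?thesis using Z ZN by (intro that[of F0 Z]) (auto simp: space_bind_P[OF u])
 qed
qed

end

section \<open>Time changes\<close>

text \<open>The right-continuous inverse is taken over rational times so that the inverse of an adapted
 process consists of stopping times without any regularity of its paths.\<close>

definition ivt :: "(ennreal => ennreal) => real => ennreal" where
 "ivt a u = Inf (ennreal ` {q : \<rat>. 0 <= q & en u < a (en q)})"

text \<open>The Stieltjes integral of \<open>g\<close> against \<open>a\<close>, read as a Lebesgue
  integral over the levels of the clock. Levels that are never passed have inverse
  \<open>\<infinity>\<close>, so integrands should vanish there; most of them do through a factor
  \<open>ext0 f (X s w)\<close>.\<close>

definition cint :: "(ennreal => ennreal) => (ennreal => ennreal) => ennreal" where
 "cint a g = sl {0..} (%u. g (ivt a u))"

lemma ivt_less_iff: "ivt a u < t \<longleftrightarrow> (EX q:{q\<in>\<rat>. 0 <= q & en q < t}. en u < a (en q))"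
 unfolding ivt_def by (auto simp: Inf_less_iff)

lemma measurable_ivt[measurable]: "ivt a : Bor"
proof (rule borel_measurableI_less)
 fix y
 have "{x : space borel. ivt a x < y} = (\<Union>q\<in>{q\<in>\<rat>. 0 <= q & en q < y}. {x. en x < a (en q)})"
 by (auto simp: ivt_less_iff)
 also have "... : sets borel"
 proof (rule sets.countable_UN')
 show "countable {q\<in>\<rat>. 0 <= q & en q < y}" using countable_rat by (rule countable_subset[rotated]) auto
 have "{x. en x < c} : sets borel" for c by measurable
 thus "(%q. {x. en x < a (en q)}) ` {q : \<rat>. 0 <= q & en q < y} <= sets borel" by auto
 qed
 finally show "{x : space borel. ivt a x < y} : sets borel" .
qed

definition good_path :: "ennreal => (ennreal => ennreal) => bool" where
 "good_path z a \<longleftrightarrow> a 0 = 0 & (ALL s t. s <= t --> t < infy --> a s <= a t) & continuous_on {..<infy} a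
 & (ALL t<z. a t < infy) & (ALL t. z <= t --> t < infy --> a t = a z)"

lemma good_path_mono: "good_path z a ==> s <= t ==> t < infy ==> a s <= a t"
 by (auto simp: good_path_def)

lemma good_path_tendsto:
 assumes "good_path z a" "t < infy"
 shows "(a \<longlongrightarrow> a t) (at t)"
proof -
 have "continuous_on {..<infy} a" using assms by (simp add: good_path_def)
 hence "isCont a t" using assms(2) by (subst (asm) continuous_on_eq_continuous_at) auto
 thus ?thesis by (simp add: isCont_def)
qed

lemma rat_between:
 assumes "s < (t::ennreal)" obtains q where "q : \<rat>" "0 <= q" "s < en q" "en q < t"
proof -
 obtain b where b: "s < b" "b < t" using dense[OF assms] by auto
 obtain c where c: "s < c" "c < b" using dense[OF b(1)] by auto
 have "c < infy" "b < infy" using b c by (auto simp: less_top[symmetric] intro: less_trans)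
 then obtain cr br where r: "c = en cr" "0 <= cr" "b = en br" "0 <= br"
 by (metis ennreal_cases less_irrefl oodef)
 hence "cr < br" using c by (simp add: ennreal_less_iff)
 then obtain q where q: "q : \<rat>" "cr < q" "q < br" using Rats_dense_in_real by blast
 hence "c < en q" "en q < b" using r by (auto simp: ennreal_less_iff)
 thus ?thesis using q r b c by (intro that[of q]) auto
qed

lemma dn_less:
 assumes "0 < (t :: ennreal)"
 obtains n where "en (rs n) < t"
proof -
 obtain r where r: "0 < en r" "en r < t" by (rule rat_between[OF assms]) auto
 then obtain n where "rs n < r" using reals_Archimedean[of r] by (auto simp: inverse_eq_divide)
 thus thesis by (intro that[of n] le_less_trans[OF ennreal_leI r(2)]) simp
qed

lemma ivt_less_good:
 assumes a: "good_path z a" and t: "t < infy" and u: "0 <= u"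
 shows "ivt a u < t \<longleftrightarrow> en u < a t"
proof
 assume "ivt a u < t"
 then obtain q where q: "en q < t" "en u < a (en q)" by (auto simp: ivt_less_iff)
 show "en u < a t" by (rule less_le_trans[OF q(2) good_path_mono[OF a less_imp_le[OF q(1)] t]])
next
 assume l: "en u < a t"
 have "t ~= 0" using l a by (auto simp: good_path_def)
 hence t0: "0 < t" by (simp add: zero_less_iff_neq_zero)
 have "\<forall>\<^sub>F s in at t. en u < a s" using order_tendstoD(1)[OF good_path_tendsto[OF a t] l] .
 hence "\<forall>\<^sub>F s in at_left t. en u < a s" by (rule filter_leD[OF at_le, rotated]) simp
 then obtain b where b: "b < t" "!!s. b < s ==> s < t ==> ennreal u < a s"
 using eventually_at_left[OF t0] by auto
 obtain q where "q : \<rat>" "0 <= q" "b < en q" "en q < t" using rat_between[OF b(1)] .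
 thus "ivt a u < t" using b(2) by (auto simp: ivt_less_iff)
qed

lemma ivt_le_good:
 assumes a: "good_path z a" and t: "t < infy" and u: "0 <= u"
 shows "ivt a u <= t ==> ennreal u <= a t"
proof (rule ccontr)
 assume le: "ivt a u <= t" and "~ en u <= a t"
 hence l: "a t < en u" by simp
 have "\<forall>\<^sub>F s in at t. a s < en u" using order_tendstoD(2)[OF good_path_tendsto[OF a t] l] .
 hence "\<forall>\<^sub>F s in at_right t. a s < en u" by (rule filter_leD[OF at_le, rotated]) simp
 then obtain b where b: "b > t" "!!s. t < s ==> s < b ==> a s < en u"
 using eventually_at_right[OF t] by auto
 obtain q where q: "t < en q" "en q < b" using rat_between[OF b(1)] .
 hence "en u < a (en q)"
 using ivt_less_good[OF a _ u, of "en q"] le by auto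
 thus False using b(2)[OF q] by auto
qed

lemma at_ivt:
 assumes a: "good_path z a" and u: "0 <= u" and f: "ivt a u < infy"
 shows "a (ivt a u) = en u"
 using ivt_le_good[OF a f u] ivt_less_good[OF a f u] by (metis antisym_conv2 less_irrefl order_refl)

lemma ivt_pos:
 assumes a: "good_path z a" and u: "0 < u" shows "0 < ivt a u"
proof (rule ccontr)
 assume "~ 0 < ivt a u"
 hence 0: "ivt a u = 0" by (simp add: zero_less_iff_neq_zero)
 hence "en u <= a 0" by (intro ivt_le_good[OF a]) (use u in auto)
 thus False using a u by (simp add: good_path_def)
qed

lemma ivt_shift:
 assumes a: "good_path z a" and a': "good_path z' a'" and s: "s < infy"
 and sh: "!!t. t < infy ==> a (s + t) = en c + a' t" and c: "a s = en c" "0 <= c" and v: "0 <= v"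
 shows "ivt a (c + v) = s + ivt a' v"
proof -
 have ge: "s <= ivt a (c + v)"
 using ivt_less_good[OF a s, of "c + v"] c v by (simp add: not_less[symmetric] ennreal_less_iff)
 have iff: "ivt a (c + v) < s + t \<longleftrightarrow> ivt a' v < t" if t: "t < infy" for t
 proof -
 have "ivt a (c + v) < s + t \<longleftrightarrow> en (c + v) < a (s + t)"
 using ivt_less_good[OF a, of "s + t" "c + v"] s t c v by (simp add: top.not_eq_extremum)
 also have "... \<longleftrightarrow> en v < a' t" using sh[OF t] c v by (simp add: ennreal_add_left_cancel_less)
 also have "... \<longleftrightarrow> ivt a' v < t" using ivt_less_good[OF a' t v] by simp
 finally show ?thesis .
 qed
 show ?thesis
 proof (rule antisym)
 show "ivt a (c + v) <= s + ivt a' v"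
 proof (rule ccontr)
 assume "~ ?thesis"
 hence l: "s + ivt a' v < ivt a (c + v)" by simp
 then obtain w where w: "s + ivt a' v < w" "w < ivt a (c + v)" using dense by blast
 define t where "t = w - s"
 have wf: "w < infy" "s <= w" using w by (auto simp: less_top[symmetric] intro: less_trans)
 (metis le_add1 zero_le add_increasing2 dual_order.trans less_imp_le order_refl)
 hence "w = s + t" "t < infy" using s by (auto simp: t_def less_top[symmetric] ennreal_minus_eq_top add_diff_inverse_ennreal)
 hence "ivt a' v < t" using w(1) s by (simp add: ennreal_add_left_cancel_less)
 hence "ivt a (c + v) < s + t" using iff[OF \<open>t < infy\<close>] by simp
 thus False using w \<open>w = s + t\<close> by simp
 qed
 show "s + ivt a' v <= ivt a (c + v)"
 proof (rule ccontr)
 assume "~ ?thesis"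
 hence l: "ivt a (c + v) < s + ivt a' v" by simp
 then obtain w where w: "ivt a (c + v) < w" "w < s + ivt a' v" using dense by blast
 define t where "t = w - s"
 have wf: "w < infy" "s <= w" using w ge by (auto simp: less_top[symmetric])
 hence wt: "w = s + t" "t < infy" using s by (auto simp: t_def less_top[symmetric] ennreal_minus_eq_top add_diff_inverse_ennreal)
 hence "ivt a' v < t" using w iff[OF wt(2)] by simp
 thus False using w(2) wt s by (auto simp: ennreal_add_left_cancel_less dest: less_asym)
 qed
 qed
qed

lemma cint_split:
 assumes a: "good_path z a" and a': "good_path z' a'" and s: "s < infy"
 and sh: "!!t. t < infy ==> a (s + t) = a s + a' t" and fin: "a s < infy"
 and g[measurable]: "g : Bor"
 shows "cint a g = cint a (%t. g t * ind {..<s} t) + cint a' (%t. g (s + t))"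
proof -
 obtain c where c: "a s = en c" "0 <= c" using fin by (cases "a s") auto
 have "cint a g = nl (%u. g (ivt a u) * ind {0..<c} u + g (ivt a u) * ind {c..} u)"
 unfolding cint_def using c by (intro ncong) (auto split: spind)
 also have "... = nl (%u. g (ivt a u) * ind {0..<c} u) + nl (%u. g (ivt a u) * ind {c..} u)"
 by (intro nadd) measurable
 also have "nl (%u. g (ivt a u) * ind {0..<c} u) = cint a (%t. g t * ind {..<s} t)"
 unfolding cint_def
 proof (intro ncong)
 fix u :: real
 show "g (ivt a u) * ind {0..<c} u = g (ivt a u) * ind {..<s} (ivt a u) * ind {0..} u"
 using ivt_less_good[OF a s, of u] c by (auto split: spind simp: ennreal_less_iff)
 qed
 also have "nl (%u. g (ivt a u) * ind {c..} u) = nl (%v. g (ivt a (c + 1 * v)) * ind {c..} (c + 1 * v))"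
 by (subst naffine[of _ 1 c]) auto
 also have "... = cint a' (%t. g (s + t))"
 unfolding cint_def
 proof (intro ncong)
 fix v :: real
 show "g (ivt a (c + 1 * v)) * ind {c..} (c + 1 * v) = g (s + ivt a' v) * ind {0..} v"
 using ivt_shift[OF a a' s _ c, of v] sh c by (auto split: spind)
 qed
 finally show ?thesis .
qed

text \<open>The set lies between the levels below \<open>a t\<close> and the levels up to
  \<open>a t\<close>, which differ by at most one point.\<close>

lemma emeasure_ivt_le:
 assumes a: "good_path z a" and t: "t < infy"
 shows "emu lborel {u. 0 <= u & ivt a u <= t} = a t"
proof (rule antisym)
 have up: "{u. 0 <= u & ivt a u <= t} <= {u. 0 <= u & en u <= a t}"
 using ivt_le_good[OF a t] by auto
 have low: "{u. 0 <= u & en u < a t} <= {u. 0 <= u & ivt a u <= t}"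
 using ivt_less_good[OF a t] less_imp_le by auto
 have E: "emu lborel {u. 0 <= u & en u <= a t} <= a t" "a t <= emu lborel {u. 0 <= u & en u < a t}"
 proof -
 have "emu lborel {u. 0 <= u & en u <= a t} <= a t & a t <= emu lborel {u. 0 <= u & en u < a t}"
 proof (cases "a t")
 case (real r)
 hence "{u. 0 <= u & en u <= a t} = {0..r}" "{u. 0 <= u & en u < a t} = {0..<r}"
 by (auto simp: ennreal_less_iff)
 thus ?thesis using real by simp
 next
 case top
 have "of_nat n <= emu lborel {0::real..}" for n
 proof -
 have "of_nat n = emu lborel {0..real n}" by (simp add: ennat)
 also have "... <= emu lborel {0::real..}" by (intro emeasure_mono) auto
 finally show ?thesis .
 qed
 hence "emu lborel {0::real..} = top"
 using SUP_least[of UNIV of_nat "emu lborel {0::real..}"] by (simp add: ennreal_SUP_of_nat_eq_top top_unique)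
 moreover have "{u::real. 0 <= u} = {0..}" by auto
 ultimately show ?thesis using top by (simp add: less_top[symmetric])
 qed
 thus "emu lborel {u. 0 <= u & en u <= a t} <= a t" "a t <= emu lborel {u. 0 <= u & en u < a t}" by auto
 qed
 show "emu lborel {u. 0 <= u & ivt a u <= t} <= a t"
 by (rule order_trans[OF emeasure_mono[OF up] E(1)]) measurable
 show "a t <= emu lborel {u. 0 <= u & ivt a u <= t}"
 by (rule order_trans[OF E(2) emeasure_mono[OF low]]) measurable
qed

lemma cint_indicator_le:
 assumes a: "good_path z a" and t: "t < infy"
 shows "cint a (ind {..t}) = a t"
proof -
 have "cint a (ind {..t}) = nl (%u. ind {u. 0 <= u & ivt a u <= t} u)"
 unfolding cint_def by (intro ncong) (auto split: spind)
 also have "... = emu lborel {u. 0 <= u & ivt a u <= t}"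
 by (rule nn_integral_indicator) measurable
 finally show ?thesis using emeasure_ivt_le[OF a t] by simp
qed

section \<open>The Stieltjes measure of a path as an image of Lebesgue measure\<close>

abbreviation stieltjes :: "(ennreal => ennreal) => real => real measure" where
 "stieltjes a r \<equiv> interval_measure (%s. enn2real (a (en (min s r))))"

context
 fixes z :: ennreal and a :: "ennreal => ennreal" and r :: real
 assumes a: "good_path z a" and r: "0 <= r" "en r < z"
begin

lemma stieltjes_fin: "a (en (min s r)) = en (enn2real (a (en (min s r))))"
proof -
 have "a (en (min s r)) <= a (en r)"
 by (rule good_path_mono[OF a]) (auto intro: ennreal_leI)
 also have "... < infy" using a r by (auto simp: good_path_def)
 finally show ?thesis by simp
qed

lemma stieltjes_mono: "s <= t ==> enn2real (a (en (min s r))) <= enn2real (a (en (min t r)))"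
proof -
 assume "s <= t"
 hence "a (en (min s r)) <= a (en (min t r))"
 by (intro good_path_mono[OF a]) (auto intro!: ennreal_leI)
 hence "en (enn2real (a (en (min s r)))) <= en (enn2real (a (en (min t r))))"
 using stieltjes_fin by metis
 thus ?thesis by (simp add: ennreal_le_iff)
qed

lemma stieltjes_cont: "continuous (at s) (%s. enn2real (a (en (min s r))))"
proof -
 have "((%s. a (en (min s r))) \<longlongrightarrow> a (en (min s r))) (at s)"
 proof (rule isCont_tendsto_compose[of "en (min s r)" a])
 show "((%s. en (min s r)) \<longlongrightarrow> en (min s r)) (at s)"
 by (intro tendsto_ennrealI tendsto_min tendsto_ident_at tendsto_const)
 show "isCont a (en (min s r))"
 using good_path_tendsto[OF a, of "en (min s r)"] by (simp add: isCont_def)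
 qed
 moreover have "a (en (min s r)) ~= \<top>" using stieltjes_fin by (metis ennreal_neq_top)
 ultimately have "((%s. enn2real (a (en (min s r)))) \<longlongrightarrow> enn2real (a (en (min s r)))) (at s)"
 by (metis stieltjes_fin tendsto_enn2real enn2real_nonneg)
 thus ?thesis by (simp add: continuous_at)
qed

lemma stieltjes_Ioc:
 "s <= t ==> emu (stieltjes a r) {s<..t} = en (enn2real (a (en (min t r))) - enn2real (a (en (min s r))))"
 by (rule emeasure_interval_measure_Ioc) (auto intro: stieltjes_mono stieltjes_cont continuous_at_imp_continuous_within)

lemma stieltjes_Ioc':
 assumes "0 <= s" "s <= t" "t <= r"
 shows "en (measure (stieltjes a r) {s<..t}) = a (en t) - a (en s)"
 "en (measure (stieltjes a r) {s<..t}) + a (en s) = a (en t)"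
proof -
 have "measure (stieltjes a r) {s<..t} = enn2real (a (en (min t r))) - enn2real (a (en (min s r)))"
 using stieltjes_Ioc[OF assms(2)] stieltjes_mono[OF assms(2)] by (simp add: measure_def)
 hence *: "measure (stieltjes a r) {s<..t} = enn2real (a (en t)) - enn2real (a (en s))"
 using assms by (simp add: min_def)
 have fin: "a (en t) = en (enn2real (a (en t)))" "a (en s) = en (enn2real (a (en s)))"
 using stieltjes_fin[of t] stieltjes_fin[of s] assms by (auto simp: min_def split: if_splits)
 have le: "enn2real (a (en s)) <= enn2real (a (en t))"
 using stieltjes_mono[OF assms(2)] assms by (simp add: min_def split: if_splits)
 show "en (measure (stieltjes a r) {s<..t}) = a (en t) - a (en s)"
 unfolding * using fin by (metis ennreal_minus enn2real_nonneg)
 show "en (measure (stieltjes a r) {s<..t}) + a (en s) = a (en t)"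
 unfolding * using fin le by (metis ennreal_plus diff_add_cancel diff_ge_0_iff_ge enn2real_nonneg)
qed

lemma stieltjes_finite: "finite_measure (stieltjes a r)"
proof (rule finite_measureI)
 have U: "(\<Union>n::nat. {- real n<..real n}) = UNIV"
 proof (safe, simp_all)
 fix x :: real
 obtain n :: nat where "\<bar>x\<bar> < real n" using reals_Archimedean2 by blast
 thus "EX n. - real n < x & x <= real n" by (intro exI[of _ n]) auto
 qed
 have "emu (stieltjes a r) UNIV = (SUP n. emu (stieltjes a r) {- real n<..real n})"
 unfolding U[symmetric] by (rule SUP_emeasure_incseq[symmetric]) (auto simp: incseq_def)
 also have "... <= en (enn2real (a (en r)))"
 proof (rule SUP_least)
 fix n :: nat
 have "enn2real (a (en (min (real n) r))) <= enn2real (a (en (min r r)))"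
 using stieltjes_mono[of "min (real n) r" r] by simp
 thus "emu (stieltjes a r) {- real n<..real n} <= en (enn2real (a (en r)))"
 by (subst stieltjes_Ioc) (auto intro!: ennreal_leI intro: order_trans[OF diff_le_self[THEN order_trans]] simp: diff_le_eq add_increasing2)
 qed
 finally have "emu (stieltjes a r) UNIV < \<top>" by (rule le_less_trans) simp
 thus "emu (stieltjes a r) (space (stieltjes a r)) ~= infy" by auto
qed

lemma stieltjes_atom: "measure (stieltjes a r) {s} = 0"
proof -
 have "emu (stieltjes a r) {s..s} = en (enn2real (a (en (min s r))) - enn2real (a (en (min s r))))"
 by (rule emeasure_interval_measure_Icc) (auto intro: stieltjes_mono stieltjes_cont continuous_at_imp_continuous_on)
 thus ?thesis by (simp add: measure_def)
qed

text \<open>Both measures give a half-open interval the increment of the clock over it. The clock is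
  capped at \<open>r\<close>, where it is finite, and negative end points count as time 0 because
  \<open>ennreal\<close> truncates.\<close>

lemma stieltjes_eq_distr:
 "distr (density lborel (ind {u. 0 <= u & ivt a u <= en r})) borel (%u. enn2real (ivt a u)) = stieltjes a r"
 (is "?D = _")
proof (rule measure_eqI_generator_eq[where E="range (%(s, t). {s<..t})" and A="%n. {- real n<..real n}" and \<Omega>=UNIV])
 have ZM[measurable]: "{u. 0 <= u & ivt a u <= en r} : sets lborel" by measurable
 have Ioc: "emu ?D {s<..t} = emu (stieltjes a r) {s<..t}" for s t
 proof (cases "s <= t")
 case True
 have key: "emu lborel {u. 0 <= u & ivt a u <= en (min v r)} = a (en (min v r))" for v
 by (rule emeasure_ivt_le[OF a]) simp
 let ?S = "%v. {u. 0 <= u & ivt a u <= en (min v r)}"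
 have eq: "{u. 0 <= u & ivt a u <= en r & s < enn2real (ivt a u) & enn2real (ivt a u) <= t} =
 (if 0 <= s then ?S t - ?S s else if 0 <= t then ?S t else {})"
 (is "?L = ?R")
 proof (rule set_eqI)
 fix u
 show "u : ?L \<longleftrightarrow> u : ?R"
 proof (cases "ivt a u")
 case (real w)
 thus ?thesis using r True by (auto simp: ennreal_le_iff2)
 next
 case top
 thus ?thesis by (auto simp: top_unique)
 qed
 qed
 have "emu ?D {s<..t} = emu (density lborel (ind {u. 0 <= u & ivt a u <= en r})) {u. s < enn2real (ivt a u) & enn2real (ivt a u) <= t}"
 by (subst emeasure_distr) (auto simp: vimage_def)
 also have "... = nl (%u. ind {u. 0 <= u & ivt a u <= en r} u * ind {u. s < enn2real (ivt a u) & enn2real (ivt a u) <= t} u)"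
 by (rule emeasure_density) measurable
 also have "... = nl (%u. ind {u. 0 <= u & ivt a u <= en r & s < enn2real (ivt a u) & enn2real (ivt a u) <= t} u)"
 by (intro ncong) (auto split: spind)
 also have "... = emu lborel {u. 0 <= u & ivt a u <= en r & s < enn2real (ivt a u) & enn2real (ivt a u) <= t}"
 by (rule nn_integral_indicator) measurable
 also have "... = emu lborel ?R" unfolding eq ..
 also have "... = en (enn2real (a (en (min t r))) - enn2real (a (en (min s r))))"
 proof (cases "0 <= s")
 case s: True
 have "emu lborel (?S t - ?S s) = emu lborel (?S t) - emu lborel (?S s)"
 proof (rule emeasure_Diff)
 show "emu lborel (?S s) ~= infy" unfolding key using stieltjes_fin by (metis ennreal_neq_top oodef)
 have "en (min s r) <= en (min t r)" using True by (intro ennreal_leI) auto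
 thus "?S s <= ?S t" by auto
 qed measurable
 also have "... = en (enn2real (a (en (min t r)))) - en (enn2real (a (en (min s r))))"
 unfolding key using stieltjes_fin by metis
 finally show ?thesis using s by (simp add: ennreal_minus)
 next
 case s: False
 hence m: "en (min s r) = 0" by (simp add: ennreal_eq_0_iff)
 have a0: "a 0 = 0" using a by (simp add: good_path_def)
 show ?thesis
 proof (cases "0 <= t")
 case t: True
 thus ?thesis using s key[of t] stieltjes_fin[of t] by (simp add: m a0)
 next
 case t: False
 hence "en (min t r) = 0" by (simp add: ennreal_eq_0_iff)
 thus ?thesis using s t by (simp add: m a0)
 qed
 qed
 also have "... = emu (stieltjes a r) {s<..t}" by (rule stieltjes_Ioc[OF True, symmetric])
 finally show ?thesis .
 qed simp
 fix Y :: "real set" assume "Y : range (%(s, t). {s<..t})"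
 thus "emu ?D Y = emu (stieltjes a r) Y" using Ioc by auto
next
 show "Int_stable (range (%(s, t). {s<..t::real}))"
 proof (rule Int_stableI)
 fix A B :: "real set" assume "A : range (%(s, t). {s<..t})" "B : range (%(s, t). {s<..t})"
 then obtain s t s' t' where "A = {s<..t}" "B = {s'<..t'}" by auto
 hence "A Int B = (%(s, t). {s<..t}) (max s s', min t t')" by auto
 thus "A Int B : range (%(s, t). {s<..t})" by blast
 qed
 show "sets ?D = sigma_sets UNIV (range (%(s, t). {s<..t}))"
 by (simp add: borel_sigma_sets_Ioc)
 show "sets (stieltjes a r) = sigma_sets UNIV (range (%(s, t). {s<..t}))"
 by (simp add: borel_sigma_sets_Ioc)
 show "(\<Union>n::nat. {- real n<..real n}) = UNIV"
 proof (safe, simp_all)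
 fix x :: real
 obtain n :: nat where "\<bar>x\<bar> < real n" using reals_Archimedean2 by blast
 thus "EX n. - real n < x & x <= real n" by (intro exI[of _ n]) auto
 qed
 fix i :: nat
 have "emu ?D {- real i<..real i} <= emu lborel {u. 0 <= u & ivt a u <= en r}"
 proof -
 have "emu ?D {- real i<..real i} <= emu ?D (space ?D)"
 by (rule emeasure_space)
 also have "emu ?D (space ?D) = emu (density lborel (ind {u. 0 <= u & ivt a u <= en r})) UNIV"
 by (subst emeasure_distr) auto
 also have "... = emu lborel {u. 0 <= u & ivt a u <= en r}"
 by (subst emeasure_density) auto
 finally show ?thesis .
 qed
 also have "... = a (en (min r r))" using emeasure_ivt_le[OF a] by simp
 also have "... < infy" using a r by (auto simp: good_path_def)
 finally show "emu ?D {- real i<..real i} ~= infy" by auto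
qed auto

lemma nn_integral_stieltjes:
 assumes g[measurable]: "g : Bor"
 shows "nn (stieltjes a r) (%s. g s) = cint a (%t. g (enn2real t) * ind {..ennreal r} t)"
proof -
 have [measurable]: "{u. 0 <= u & ivt a u <= en r} : sets lborel" by measurable
 have "nn (stieltjes a r) (%s. g s) = nn (density lborel (ind {u. 0 <= u & ivt a u <= en r})) (%u. g (enn2real (ivt a u)))"
 unfolding stieltjes_eq_distr[symmetric] by (rule nn_integral_distr) auto
 also have "... = cint a (%t. g (enn2real t) * ind {..ennreal r} t)"
 unfolding cint_def by (subst ndens) (auto intro!: ncong split: spind)
 finally show ?thesis .
qed

end

section \<open>Integration along the clock of an additive functional\<close>

lemma cint_cong: "(!!u. 0 <= u ==> g (ivt a u) = h (ivt a u)) ==> cint a g = cint a h"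
 unfolding cint_def by (intro ncong) (auto split: spind)

lemma cint_mono: "(!!u. 0 <= u ==> g (ivt a u) <= h (ivt a u)) ==> cint a g <= cint a h"
 unfolding cint_def by (intro nmono) (auto split: spind)

lemma cint_cmult: "g : Bor ==> cint a (%t. c * g t) = c * cint a g"
 unfolding cint_def by (subst ncmult[symmetric]) (auto simp: mult_ac)

text \<open>Only the level \<open>a s\<close> can have inverse \<open>s\<close>, so a continuous
  clock does not charge a single time.\<close>

lemma cint_closed_open:
 assumes a: "good_path z a" and s: "s < infy"
 shows "cint a (%t. g t * ind {..<s} t) = cint a (%t. g t * ind {..s} t)"
 unfolding cint_def
proof (rule ncongAE)
 have "AE u in lborel. u ~= enn2real (a s)" by (rule AE_lborel_singleton)
 thus "AE u in lborel. g (ivt a u) * ind {..<s} (ivt a u) * ind {0..} u =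
 g (ivt a u) * ind {..s} (ivt a u) * ind {0..} u"
 proof eventually_elim
 case (elim u)
 have "ivt a u < s" if "0 <= u" "ivt a u <= s"
 proof -
 have "en u <= a s" using ivt_le_good[OF a s] that by simp
 moreover have "en u ~= a s" using elim that by (metis enn2real_ennreal)
 ultimately show ?thesis using ivt_less_good[OF a s] that by simp
 qed
 thus ?case by (auto split: spind)
 qed
qed

text \<open>The square is an integral over the plane, and the two halves cut off by the diagonal
  contribute equally.\<close>

lemma square_nn_integral_le:
 fixes y :: "real => ennreal"
 assumes y[measurable]: "y : Bor"
 shows "nl (%u. y u)^2 <= 2 * nl (%u. y u * sl {u..} (%v. y v))"
proof -
 have [measurable]: "(%v. y u * ind {u..} v * y v) : Bor" for u by measurable
 have "nl (%u. y u)^2 = nl (%u. nl (%v. y u * y v))"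
 by (simp add: power2_eq_square ncmult nn_integral_multc)
 also have "... <= nl (%u. nl (%v. y u * (y v * ind {u..} v) + y v * (y u * ind {v..} u)))"
 by (intro nmono) (auto split: spind simp: mult_ac)
 also have "... = nl (%u. nl (%v. y u * (y v * ind {u..} v)) + nl (%v. y v * (y u * ind {v..} u)))"
 by (intro ncong nadd) (auto simp: indicator_def[abs_def])
 also have "... = nl (%u. nl (%v. y u * (y v * ind {u..} v))) + nl (%u. nl (%v. y v * (y u * ind {v..} u)))"
 by (intro nadd) (auto simp: indicator_def[abs_def])
 also have "nl (%u. nl (%v. y v * (y u * ind {v..} u))) = nl (%v. nl (%u. y v * (y u * ind {v..} u)))"
 by (rule lborel_pair.Fubini') (auto simp: indicator_def[abs_def])
 also have "nl (%u. nl (%v. y u * (y v * ind {u..} v))) = nl (%u. y u * sl {u..} (%v. y v))"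
 by (intro ncong ncmult) (auto simp: indicator_def[abs_def])
 finally show ?thesis by (simp add: mult_2)
qed

context hunt_process
begin

lemma ivt_less_FF:
 assumes B: "!!t. t < infy ==> B t : bm (FF t)"
 shows "{w. ivt (%t. B t w) u < t} : sets (FF t)"
proof -
 have "{w. ivt (%t. B t w) u < t} = (\<Union>q\<in>{q\<in>\<rat>. 0 <= q & en q < t}. {w\<in>space (FF t). en u < B (en q) w})"
 by (auto simp: ivt_less_iff)
 also have "... : sets (FF t)"
 proof (rule sets.countable_UN')
 show "countable {q\<in>\<rat>. 0 <= q & en q < t}" using countable_rat by (rule countable_subset[rotated]) auto
 show "(%q. {w\<in>space (FF t). en u < B (en q) w}) ` {q\<in>\<rat>. 0 <= q & en q < t} <= sets (FF t)"
 proof safe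
 fix q :: real assume "q : \<rat>" "0 <= q" "en q < t"
 hence [measurable]: "B (en q) : bm (FF t)"
 by (intro mFFm[OF B]) auto
 show "{w\<in>space (FF t). en u < B (en q) w} : sets (FF t)" by measurable
 qed
 qed
 finally show ?thesis .
qed

text \<open>The strict events \<open>ivt < t\<close> are countable unions over rational times; right
  continuity of the filtration turns them into the events \<open>ivt \<le> t\<close>.\<close>

lemma stopping_ivt:
 assumes B: "!!t. t < infy ==> B t : bm (FF t)"
 shows "stopping_time FF (%w. ivt (%t. B t w) u)"
proof (rule stopping_timeI)
 fix t
 let ?e = "%w. ivt (%t. B t w) u"
 have "{w. ?e w <= t} : sets (FF t)"
 proof (cases "t = infy")
 case True thus ?thesis by simp
 next
 case False
 hence t: "t < infy" by (simp add: top.not_eq_extremum)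
 have "{w. ?e w <= t} : sets (FF s)" if ts: "t < s" for s
 proof -
 let ?Q = "{q\<in>\<rat>. 0 <= q & t < en q & en q < s}"
 have ne: "?Q ~= {}" using rat_between[OF ts] by blast
 have "{w. ?e w <= t} = (\<Inter>q\<in>?Q. {w. ?e w < en q})"
 proof safe
 fix w assume *: "w : (\<Inter>q\<in>?Q. {w. ?e w < en q})"
 show "?e w <= t"
 proof (rule ccontr)
 assume "~ ?e w <= t"
 hence "t < min (?e w) s" using ts by simp
 from rat_between[OF this] obtain q where q: "q : \<rat>" "0 <= q" "t < en q" "en q < min (?e w) s" .
 hence "?e w < en q" using * by auto
 thus False using q by auto
 qed
 qed auto
 also have "... : sets (FF s)"
 proof (rule sets.countable_INT'[OF _ ne])
 show "countable ?Q" using countable_rat by (rule countable_subset[rotated]) auto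
 show "(%q. {w. ?e w < en q}) ` ?Q <= sets (FF s)"
 proof safe
 fix q assume "en q < s"
 thus "{w. ?e w < en q} : sets (FF s)"
 using ivt_less_FF[OF B, of u "en q"] FF_mono[of "en q" s] by (meson less_imp_le subsetD)
 qed
 qed
 finally show ?thesis .
 qed
 thus ?thesis using filtration_right_continuous[OF t] by auto
 qed
 thus "Measurable.pred (FF t) (%w. ?e w <= t)" by (simp add: pred_def)
qed

lemma measurable_ivt_pair_gen:
 assumes B: "!!t. t < infy ==> B t : bm M"
 shows "(%p. ivt (%t. B t (fst p)) (snd p)) : bm (M OM borel)"
proof (rule borel_measurableI_less)
 fix y
 have "{p : space (M OM borel). ivt (%t. B t (fst p)) (snd p) < y}
 = (\<Union>q\<in>{q\<in>\<rat>. 0 <= q & en q < y}. {p : space (M OM borel). en (snd p) < B (en q) (fst p)})"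
 by (auto simp: ivt_less_iff)
 also have "... : sets (M OM borel)"
 proof (rule sets.countable_UN', safe)
 show "countable {q\<in>\<rat>. 0 <= q & en q < y}" using countable_rat by (rule countable_subset[rotated]) auto
 fix q :: real
 have [measurable]: "B (en q) : bm M" by (rule B) simp
 show "{p : space (M OM borel). en (snd p) < B (en q) (fst p)} : sets (M OM borel)" by measurable
 qed
 finally show "{p : space (M OM borel). ivt (%t. B t (fst p)) (snd p) < y} : sets (M OM borel)" .
qed

lemma mcint:
 assumes B: "!!t. t < infy ==> B t : bm M"
 and g: "(%p. g (fst p) (snd p)) : bm (M OM borel)"
 shows "(%w. cint (%t. B t w) (g w)) : bm M"
proof -
 note [measurable] = measurable_ivt_pair_gen[OF B]
 have "(%p. (fst p, ivt (%t. B t (fst p)) (snd p))) : M OM borel MM M OM borel"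
 by measurable
 from mcomp[OF this g]
 have [measurable]: "(%p. g (fst p) (ivt (%t. B t (fst p)) (snd p))) : bm (M OM borel)"
 by simp
 show ?thesis unfolding cint_def
 by (rule lborel.borel_measurable_nn_integral) (unfold case_prod_beta, measurable)
qed

lemma mXFFp: "(%(w, s). X s w) : FF infy OM borel MM cb"
 using mXc[OF msnd mcomp[OF mfst measurable_id_FF]]
 by (simp add: case_prod_beta)

lemma measurable_cint_FF:
 assumes B: "!!t. t < infy ==> B t : bm (FF t)"
 and g: "(%(w, s). g w s) : bm (FF infy OM borel)"
 shows "(%w. cint (%t. B t w) (g w)) : bm (FF infy)"
 by (rule mcint[OF mFFm[OF B]]) (use g in \<open>simp_all add: case_prod_beta\<close>)

lemma sub_pair: "sets (FF infy OM (borel :: 'b::topological_space measure)) <= sets (CP (P x) OM (borel :: 'b measure))"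
proof -
 have "(%p. p) : CP (P x) OM (borel :: 'b measure) MM FF infy OM (borel :: 'b measure)"
 proof -
 have "(%w. w) : CP (P x) MM FF infy" by (rule mFFc[of _ infy]) simp
 hence "(%p. (fst p, snd p)) : CP (P x) OM (borel :: 'b measure) MM FF infy OM (borel :: 'b measure)"
 by (intro mPair mcomp[OF mfst]) auto
 thus ?thesis by simp
 qed
 from msets[OF this] show ?thesis by (auto simp: space_pair_measure)
qed

lemma measurable_pair_completion:
 "f : FF infy OM (borel :: 'b::topological_space measure) MM N ==> f : CP (P x) OM (borel :: 'b measure) MM N"
 by (rule measurable_from_subalg[rotated], assumption) (simp add: subalgebra_def sub_pair space_pair_measure del: oodef)

text \<open>Exchanging the integrals leaves an expectation at one fixed level, where the inverse
  clock is a stopping time and the strong Markov property can be applied.\<close>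

lemma cint_fubini:
 assumes B: "!!t. t < infy ==> B t : bm (FF t)"
 and g: "(%(w, s). g w s) : bm (FF infy OM borel)"
 shows "nn (P x) (%w. cint (%t. B t w) (g w)) = sl {0..} (%u. nn (P x) (%w. g w (ivt (%t. B t w) u)))"
proof -
 interpret prob_space "P x" by (rule prob_space_P)
 interpret M: prob_space "CP (P x)" by (rule prob_space_completion)
 interpret pair_sigma_finite "CP (P x)" lborel ..
 have [measurable]: "(%p. ivt (%t. B t (fst p)) (snd p)) : bm (FF infy OM borel)"
 by (rule measurable_ivt_pair_gen[OF mFFm[OF B]]) simp_all
 have "(%p. (fst p, ivt (%t. B t (fst p)) (snd p))) : FF infy OM borel MM FF infy OM borel"
 by measurable
 from mcomp[OF this g]
 have m1: "(%p. g (fst p) (ivt (%t. B t (fst p)) (snd p))) : bm (FF infy OM borel)"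
 by simp
 hence m2[measurable]: "(%p. g (fst p) (ivt (%t. B t (fst p)) (snd p))) : bm (CP (P x) OM borel)"
 by (rule measurable_pair_completion)
 have "nn (P x) (%w. cint (%t. B t w) (g w)) = nn (CP (P x)) (%w. nl (%u. g w (ivt (%t. B t w) u) * ind {0..} u))"
 by (simp add: cint_def ncompl)
 also have "... = nl (%u. nn (CP (P x)) (%w. g w (ivt (%t. B t w) u) * ind {0..} u))"
 by (rule Fubini'[symmetric]) (simp add: case_prod_beta)
 also have "... = sl {0..} (%u. nn (P x) (%w. g w (ivt (%t. B t w) u)))"
 proof (intro ncong)
 fix u :: real
 have "(%w. g w (ivt (%t. B t w) u)) : bm (CP (P x))"
 using mcomp[OF mPair[OF measurable_ident_sets[OF refl] measurable_const] m2, of u] by simp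
 from nn_integral_multc[OF this, of "ind {0..} u"]
 show "nn (CP (P x)) (%w. g w (ivt (%t. B t w) u) * ind {0..} u) =
 (nn (P x) (%w. g w (ivt (%t. B t w) u))) * ind {0..} u"
 by (simp only: ncompl)
 qed
 finally show ?thesis .
qed

text \<open>The strong Markov property is applied at each level and integrated over the levels. A
  level with infinite inverse contributes 0, because the path is then at the cemetery.\<close>

lemma strong_markov_cint:
 assumes B: "!!t. t < infy ==> B t : bm (FF t)"
 and W[measurable]: "W : Bor" and f[measurable]: "f : Bor"
 and F: "F : bm (NF infy)"
 shows "nn (P x) (%w. cint (%t. B t w) (%s. W s * ext0 f (X s w) * F (sh s w))) =
 (nn (P x) (%w. cint (%t. B t w) (%s. W s * ext0 f (X s w) * nn (P (X s w)) (%w'. F w'))))"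
proof -
 have Xm[measurable]: "(%p. X (snd p) (fst p)) : FF infy OM borel MM cb"
 using mXFFp by (simp add: case_prod_beta)
 have shm: "(%p. F (sh (snd p) (fst p))) : bm (FF infy OM borel)"
 by (rule mcomp[OF measurable_sh[OF msnd mcomp[OF mfst measurable_id_FF]] F])
 have Em: "(%p. nn (P (X (snd p) (fst p))) (%w'. F w')) : bm (FF infy OM borel)"
 by (rule mcomp[OF Xm measurable_E[OF F]])
 have Wm: "(%p. W (snd p) * ext0 f (X (snd p) (fst p))) : bm (FF infy OM borel)"
 using mcomp[OF Xm mext0[OF f]] by measurable
 have g1: "(%(w, s). W s * ext0 f (X s w) * F (sh s w)) : bm (FF infy OM borel)"
 using bmtimes[OF Wm shm] by (simp add: case_prod_beta)
 have g2: "(%(w, s). W s * ext0 f (X s w) * nn (P (X s w)) (%w'. F w')) : bm (FF infy OM borel)"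
 using bmtimes[OF Wm Em] by (simp add: case_prod_beta)
 have "nn (P x) (%w. W (ivt (%t. B t w) u) * ext0 f (X (ivt (%t. B t w) u) w) * F (sh (ivt (%t. B t w) u) w)) =
 (nn (P x) (%w. W (ivt (%t. B t w) u) * ext0 f (X (ivt (%t. B t w) u) w) * nn (P (X (ivt (%t. B t w) u) w)) (%w'. F w')))" for u
 proof -
 let ?e = "%w. ivt (%t. B t w) u"
 have e: "stopping_time FF ?e" by (rule stopping_ivt[OF B])
 have "(%w. W (?e w) * ext0 f (X (?e w) w)) : bm (pre_sigma ?e)"
 by (intro bmtimes mcomp[OF measurable_stopping_time_pre_sigma[OF e] W]
 mcomp[OF mXps[OF e] mext0[OF f]])
 thus ?thesis
 by (rule strong_markov_functional[OF e _ _ F]) (simp add: X_infinity[simplified])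
 qed
 thus ?thesis
 using cint_fubini[OF B g1, of x] cint_fubini[OF B g2, of x] by simp
qed

end

text \<open>The regularity of \<open>B\<close> off its exceptional set, gathered on one measurable
  set of paths. Invariance under the shift is asked before the lifetime, where \<open>B\<close> is
  finite and its vanishing at time 0 is inherited.\<close>

locale additive_functional = hunt_process X P \<theta>
 for X :: "ennreal => 'w => 'e::{metric_space, second_countable_topology} option"
 and P :: "'e option => 'w measure" and \<theta> :: "ennreal => 'w => 'w" +
 fixes B :: "ennreal => 'w => ennreal" and LL :: "'w set"
 assumes LL_sets: "LL : sets (process_filtration X P infy)"
 and adapted: "!!t. t < infy ==> B t : bm (process_filtration X P t)"
 and good: "!!w. w : LL ==> good_path (lifetime X w) (%t. B t w)"
 and shift_LL: "!!w s. w : LL ==> 0 < s ==> s < lifetime X w ==> s < infy ==> th s w : LL"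
 and additive: "!!w s t. w : LL ==> s < infy ==> t < infy ==> B (s + t) w = B s w + B t (th s w)"
begin

abbreviation II :: "('e => ennreal) => ennreal => 'w => ennreal" where
 "II f t w \<equiv> cint (%s. B s w) (%s. ind {..t} s * ext0 f (X s w))"

lemma mfX: "f : Bor ==> (%s. ext0 f (X s w)) : Bor"
 for f :: "'e => ennreal"
 by (rule mcomp[OF measurable_X_time mext0])

lemma measurable_II: "f : Bor ==> II f t : bm (FF infy)"
proof (rule measurable_cint_FF[OF adapted])
 assume f: "f : Bor"
 show "(%(w, s). ind {..t} s * ext0 f (X s w)) : bm (FF infy OM borel)"
 using mcomp[OF mXFFp mext0[OF f]] by (simp add: case_prod_beta)
qed

lemma ivt_finite_X: "X (ivt a u) w ~= None ==> ivt a u < infy & ivt a u < lifetime X w"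
 using X_infinity lt_iff by (metis top.not_eq_extremum oodef)

text \<open>The supremum over \<open>r\<close> in the definition is a monotone limit. For
  \<open>t\<close> beyond the lifetime it is taken along times \<open>r n\<close> increasing to the
  lifetime, which exhaust the times at which the path is alive.\<close>

lemma functional_integral_eq:
 assumes w: "w : LL" and f[measurable]: "f : Bor"
 shows "functional_integral X B f t w = II f t w"
proof -
 note [measurable] = mfX[OF f]
 define R where "R = {r. 0 <= r & en r <= t & en r < lifetime X w}"
 let ?I = "%r. cint (%s. B s w) (%s. ind {..ennreal r} s * ext0 f (X s w))"
 have eq: "sn (stieltjes (%s. B s w) r) {0..r} (%s. ext0 f (X (en s) w)) = ?I r" if r: "r : R" for r
 proof -
 have "sn (stieltjes (%s. B s w) r) {0..r} (%s. ext0 f (X (en s) w)) =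
 cint (%s. B s w) (%t. ext0 f (X (en (enn2real t)) w) * ind {0..r} (enn2real t) * ind {..ennreal r} t)"
 using r by (intro nn_integral_stieltjes[OF good[OF w]]) (auto simp: R_def)
 also have "... = ?I r"
 proof (rule cint_cong)
 fix u :: real
 let ?t = "ivt (%s. B s w) u"
 show "ext0 f (X (en (enn2real ?t)) w) * ind {0..r} (enn2real ?t) * ind {..ennreal r} ?t = ind {..ennreal r} ?t * ext0 f (X ?t w)"
 using r by (cases ?t) (auto split: spind simp: top_unique ennreal_le_iff2 R_def)
 qed
 finally show ?thesis .
 qed
 have "functional_integral X B f t w = (SUP r\<in>R. ?I r)"
 unfolding functional_integral_def R_def[symmetric] using eq by (intro SUP_cong) auto
 also have "... = II f t w"
 proof (rule antisym)
 show "(SUP r\<in>R. ?I r) <= II f t w"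
 by (intro SUP_least cint_mono) (auto simp: R_def split: spind)
 show "II f t w <= (SUP r\<in>R. ?I r)"
 proof (cases "t < lifetime X w")
 case True
 hence "t < infy" by (auto simp: less_top[symmetric])
 then obtain r where "t = en r" "0 <= r" by (cases t) auto
 hence "r : R" using True by (auto simp: R_def)
 thus ?thesis using \<open>t = en r\<close> by (intro SUP_upper2) auto
 next
 case False
 show ?thesis
 proof (cases "lifetime X w = 0")
 case True
 hence "X s w = None" for s by (simp add: X_eq_None_iff)
 thus ?thesis by (simp add: cint_def)
 next
 case nz: False
 let ?z = "lifetime X w"
 define r where "r n = (if ?z = infy then real n else max 0 (enn2real ?z - rs n))" for n :: nat
 have r0: "0 <= r n" for n by (simp add: r_def)
 have rz: "en (r n) < ?z" for n
 proof (cases ?z)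
 case (real z)
 hence "0 < z" using nz by (cases "z = 0") auto
 thus ?thesis using real by (auto simp: r_def ennreal_less_iff max_def)
 qed (simp add: r_def)
 have rm: "incseq r"
 proof (rule incseq_SucI)
 fix n
 have "1 / real (Suc (Suc n)) <= rs n" by (rule frac_le) auto
 thus "r n <= r (Suc n)" by (auto simp: r_def)
 qed
 have ex: "EX n. s <= en (r n)" if s: "s < ?z" for s
 proof -
 from s have "s < infy" by (auto simp: less_top[symmetric])
 then obtain v where v: "s = en v" "0 <= v" by (cases s) auto
 show ?thesis
 proof (cases ?z)
 case (real z)
 hence "v < z" using s v by (simp add: ennreal_less_iff)
 then obtain n where "rs n < z - v" using nat_approx_posE[of "z - v"] by auto
 thus ?thesis using real v by (intro exI[of _ n]) (auto simp: r_def intro!: ennreal_leI)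
 next
 case top
 obtain n :: nat where "v <= real n" using real_arch_simple by blast
 thus ?thesis using top v by (intro exI[of _ n]) (auto simp: r_def intro!: ennreal_leI)
 qed
 qed
 let ?h = "%n u. ind {..ennreal (r n)} (ivt (%s. B s w) u) * ext0 f (X (ivt (%s. B s w) u) w) * ind {0..} u"
 have "II f t w <= nl (%u. (SUP n. ?h n u))"
 unfolding cint_def
 proof (rule nmono)
 fix u :: real
 let ?t = "ivt (%s. B s w) u"
 show "ind {..t} ?t * ext0 f (X ?t w) * ind {0..} u <= (SUP n. ?h n u)"
 proof (cases "X ?t w = None")
 case False
 then obtain n where "?t <= en (r n)" using ex[of ?t] lt_iff by auto
 thus ?thesis by (intro SUP_upper2[of n]) (auto split: spind)
 qed simp
 qed
 also have "... = (SUP n. nl (%u. ?h n u))"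
 proof (rule nmcSUP)
 show "incseq ?h"
 proof (rule incseq_SucI, rule le_funI)
 fix n u
 have "en (r n) <= en (r (Suc n))" using rm by (intro ennreal_leI) (simp add: incseq_SucD)
 thus "?h n u <= ?h (Suc n) u" by (auto split: spind)
 qed
 qed measurable
 also have "... <= (SUP r\<in>R. ?I r)"
 proof (rule SUP_least)
 fix n
 have "r n : R" using r0 rz[of n] False by (auto simp: R_def)
 hence "?I (r n) <= (SUP r\<in>R. ?I r)" by (rule SUP_upper)
 thus "nl (%u. ?h n u) <= (SUP r\<in>R. ?I r)" by (simp add: cint_def)
 qed
 finally show ?thesis .
 qed
 qed
 qed
 finally show ?thesis .
qed

lemma X_shift: "t < infy ==> X (s + t) w = X s (th t w)"
 using shift by simp

text \<open>If the path has died by time \<open>s\<close>, the integrand after \<open>s\<close> and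
  the shifted integral both vanish. Otherwise the clock is finite at \<open>s\<close> and can be
  split there.\<close>

lemma cint_markov:
 assumes w: "w : LL" and s: "0 < s" "s < infy" and W[measurable]: "W : Bor"
 and f[measurable]: "f : Bor"
 shows "cint (%t. B t w) (%r. W r * ext0 f (X r w)) =
 cint (%t. B t w) (%r. W r * ind {..s} r * ext0 f (X r w)) +
 cint (%t. B t (th s w)) (%r. W (s + r) * ext0 f (X r (th s w)))"
proof (cases "X s w = None")
 case True
 have 1: "W r * ext0 f (X r w) = W r * ind {..s} r * ext0 f (X r w)" for r
 using X_None_mono[OF True, of r] by (cases "r <= s") auto
 have "X r (th s w) = None" for r
 using X_None_mono[OF True, of "s + r"] X_shift[OF s(2), of r w] by (simp add: add.commute)
 hence 2: "cint (%t. B t (th s w)) (%r. W (s + r) * ext0 f (X r (th s w))) = 0"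
 by (simp add: cint_def)
 show ?thesis unfolding 2 using 1 by (simp cong: cint_cong)
next
 case False
 hence sz: "s < lifetime X w" by (simp add: lt_iff)
 note [measurable] = mfX[OF f]
 let ?a = "%t. B t w" and ?a' = "%t. B t (th s w)" and ?g = "%r. W r * ext0 f (X r w)"
 have a: "good_path (lifetime X w) ?a" by (rule good[OF w])
 have a': "good_path (lifetime X (th s w)) ?a'" by (rule good[OF shift_LL[OF w s(1) sz s(2)]])
 have fin: "B s w < infy" using a sz by (auto simp: good_path_def)
 have "cint ?a ?g = cint ?a (%t. ?g t * ind {..<s} t) + cint ?a' (%t. ?g (s + t))"
 by (rule cint_split[OF a a' s(2)]) (use additive[OF w s(2)] fin in auto)
 also have "cint ?a (%t. ?g t * ind {..<s} t) = cint ?a (%t. ?g t * ind {..s} t)"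
 by (rule cint_closed_open[OF a s(2)])
 finally show ?thesis using X_shift[OF s(2)] by (simp add: mult_ac add.commute)
qed

lemma II_add:
 assumes w: "w : LL" and s: "0 < s" "s < infy" and f: "f : Bor"
 shows "II f (s + t) w = II f s w + II f t (th s w)"
proof -
 have le: "s + r <= s + t \<longleftrightarrow> r <= t" for r using s(2) by (auto simp: ennreal_add_left_cancel_le)
 have 1: "ind {..s + t} r * ind {..s} r = (ind {..s} r :: ennreal)" for r
 using order_trans[of r s "s + t"] by (auto split: spind)
 have 2: "ind {..s + t} (s + r) = (ind {..t} r :: ennreal)" for r
 by (auto simp: le indicator_def)
 show ?thesis
 using cint_markov[OF w s _ f, of "ind {..s + t}"] by (simp add: 1 2)
qed

lemma cint_tail:
 assumes w: "w : LL" and u: "0 < u" and X: "X (ivt (%t. B t w) u) w ~= None"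
 and g[measurable]: "g : Bor"
 defines "s \<equiv> ivt (%t. B t w) u"
 shows "sl {u..} (%v. g (ivt (%t. B t w) v)) = cint (%t. B t (th s w)) (%r. g (s + r))"
 and "0 < s" "s < infy" "s < lifetime X w" "B s w = en u" "th s w : LL"
proof -
 have a: "good_path (lifetime X w) (%t. B t w)" by (rule good[OF w])
 show s: "s < infy" "s < lifetime X w" using ivt_finite_X[OF X] by (auto simp: s_def)
 show s0: "0 < s" unfolding s_def by (rule ivt_pos[OF a u])
 show Bs: "B s w = en u" using at_ivt[OF a, of u] u s by (simp add: s_def)
 show th: "th s w : LL" by (rule shift_LL[OF w s0 s(2) s(1)])
 have a': "good_path (lifetime X (th s w)) (%t. B t (th s w))" by (rule good[OF th])
 have "sl {u..} (%v. g (ivt (%t. B t w) v)) = nl (%v. g (ivt (%t. B t w) (u + 1 * v)) * ind {u..} (u + 1 * v))"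
 by (subst naffine[of _ 1 u]) auto
 also have "... = cint (%t. B t (th s w)) (%r. g (s + r))"
 unfolding cint_def
 proof (intro ncong)
 fix v :: real
 show "g (ivt (%t. B t w) (u + 1 * v)) * ind {u..} (u + 1 * v) = g (s + ivt (%t. B t (th s w)) v) * ind {0..} v"
 using ivt_shift[OF a a' s(1) _ Bs, of v] additive[OF w s(1)] u Bs by (auto split: spind)
 qed
 finally show "sl {u..} (%v. g (ivt (%t. B t w) v)) = cint (%t. B t (th s w)) (%r. g (s + r))" .
qed

text \<open>The symmetrised square leaves, at each charged time \<open>s\<close>, the mass still to
  come before \<open>d\<close>. Seen from the shifted path this is at most its mass over the full
  length \<open>d\<close>.\<close>

lemma II_square_le:
 assumes w: "w : LL" and f[measurable]: "f : Bor"
 shows "(II f d w)^2 <= 2 * cint (%t. B t w) (%s. ind {..d} s * ext0 f (X s w) * II f d (sh s w))"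
proof -
 note [measurable] = mfX[OF f]
 let ?e = "ivt (%t. B t w)"
 let ?g = "%t. ind {..d} t * ext0 f (X t w)"
 let ?y = "%u. ?g (?e u) * ind {0..} u"
 have "(II f d w)^2 <= 2 * nl (%u. ?y u * sl {u..} (%v. ?y v))"
 unfolding cint_def by (rule square_nn_integral_le) measurable
 also have "nl (%u. ?y u * sl {u..} (%v. ?y v)) <= cint (%t. B t w) (%s. ?g s * II f d (sh s w))"
 unfolding cint_def[of "%t. B t w"]
 proof (rule nmonoAE)
 have "AE u in lborel. u ~= (0::real)" by (rule AE_lborel_singleton)
 thus "AE u in lborel. ?y u * sl {u..} (%v. ?y v) <= ?g (?e u) * II f d (sh (?e u) w) * ind {0..} u"
 proof eventually_elim
 case (elim u)
 show ?case
 proof (cases "0 < u & X (?e u) w ~= None")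
 case True
 hence u: "0 < u" and Xn: "X (?e u) w ~= None" by auto
 note T = cint_tail[OF w u Xn]
 have "sl {u..} (%v. ?y v) = sl {u..} (%v. ?g (?e v))"
 using u by (intro ncong) (auto split: spind)
 also have "... = cint (%t. B t (th (?e u) w)) (%r. ?g (?e u + r))"
 by (rule T(1)) measurable
 also have "... <= II f d (th (?e u) w)"
 proof (rule cint_mono)
 fix v :: real
 let ?r = "ivt (%t. B t (th (?e u) w)) v"
 have "X (?e u + ?r) w = X ?r (th (?e u) w)"
 using X_shift[OF T(3)[OF borel_measurable_const], of ?r w] by (simp add: add.commute)
 moreover have "?r <= d" if "?e u + ?r <= d"
 using that by (rule order_trans[rotated]) simp
 ultimately show "?g (?e u + ?r) <= ind {..d} ?r * ext0 f (X ?r (th (?e u) w))"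
 by (auto split: spind)
 qed
 finally have "sl {u..} (%v. ?y v) <= II f d (sh (?e u) w)"
 using T(3)[OF borel_measurable_const] by (simp add: sh_finite)
 thus ?thesis using u by (auto intro!: mult_mono split: spind)
 qed (use elim in \<open>auto split: spind\<close>)
 qed
 qed
 finally show ?thesis by (simp add: mlmono)
qed

lemma II_mono_time: "s <= t ==> II f s w <= II f t w"
 by (intro cint_mono) (auto split: spind)

lemma II_indicator_UNIV:
 assumes w: "w : LL" and t: "t < lifetime X w"
 shows "II (%_. 1) t w = B t w"
proof -
 have "II (%_. 1) t w = cint (%s. B s w) (ind {..t})"
 proof (rule cint_cong)
 fix u :: real
 let ?r = "ivt (%s. B s w) u"
 have "X ?r w ~= None" if "?r <= t" using that t lt_iff by (meson le_less_trans)
 thus "ind {..t} ?r * ext0 (%_. 1) (X ?r w) = (ind {..t} ?r :: ennreal)"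
 by (auto split: spind)
 qed
 also have "... = B t w"
 by (rule cint_indicator_le[OF good[OF w]]) (use t in \<open>auto simp: less_top[symmetric]\<close>)
 finally show ?thesis .
qed

end

context hunt_process
begin

text \<open>The set from the definition is cut down to the paths on which \<open>B\<close> starts at
  0. The cut survives a shift by \<open>s\<close> before the lifetime: additivity reads
  \<open>B s = B s + B 0 \<circ> \<theta>\<^sub>s\<close>, and \<open>B s\<close> is finite and
  cancels.\<close>

lemma PCAF_additive_functional:
 assumes "PCAF m \<E> D X P \<theta> N B"
 obtains LL where "additive_functional X P \<theta> B LL" "!!x. x ~: N ==> AE w in PS x. w : LL" "polar m \<E> D N"
proof -
 from assms obtain L where L1: "L : sets (FF infy)" and
 a: "ALL x:- N. AE w in PS x. w : L" "ALL x:- N. AE w in PS x. B 0 w = 0"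
 "ALL t. 0 < t & t < infy --> th t ` L <= L" and
 b: "ALL w:L. ALL s<infy. ALL t<infy. B (t + s) w = B t w + B s (th t w)"
 "ALL w:L. ALL t<lifetime X w. B t w < infy"
 "ALL w:L. ALL t<infy. lifetime X w <= t --> B t w = B (lifetime X w) w"
 "ALL w:L. continuous_on {..<infy} (%t. B t w)"
 unfolding PCAF_def by (elim conjE bexE) (rule that)
 have L2: "AE w in PS x. w : L" if "x ~: N" for x using a(1) that by auto
 have L3: "AE w in PS x. B 0 w = 0" if "x ~: N" for x using a(2) that by auto
 have L5: "B (t + s) w = B t w + B s (th t w)" if "w : L" "s < infy" "t < infy" for w s t
 using b(1) that by blast
 have ad: "!!t. t < infy ==> B t : bm (FF t)" using assms by (simp add: PCAF_def)
 define LL where "LL = {w : L. B 0 w = 0}"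
 have mono: "B s w <= B t w" if "w : L" "s <= t" "t < infy" for w s t
 proof -
 have "t = s + (t - s)" "t - s < infy" "s < infy"
 using that le_less_trans[OF that(2,3)] by (auto simp: add_diff_inverse_ennreal less_top[symmetric] ennreal_minus_eq_top)
 hence "B t w = B s w + B (t - s) (th s w)" using L5[OF that(1), of "t - s" s] by simp
 thus ?thesis by simp
 qed
 have "additive_functional X P \<theta> B LL"
 proof
 have [measurable]: "B 0 : bm (FF infy)" by (rule mFFm[OF ad]) auto
 have "{w : space (FF infy). B 0 w = 0} : sets (FF infy)" by measurable
 hence "L Int {w : space (FF infy). B 0 w = 0} : sets (FF infy)" using L1 by (intro sets.Int)
 thus "LL : sets (FF infy)" by (simp add: LL_def Int_def)
 show "B t : bm (FF t)" if "t < infy" for t using ad that .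
 show "good_path (lifetime X w) (%t. B t w)" if "w : LL" for w
 proof -
 have w: "w : L" "B 0 w = 0" using that by (simp_all add: LL_def)
 show ?thesis
 unfolding good_path_def
 by (intro conjI allI impI) (fact w(2), erule (1) mono[OF w(1)], fact b(4)[rule_format, OF w(1)],
 erule b(2)[rule_format, OF w(1)], erule (1) b(3)[rule_format, OF w(1), rotated])
 qed
 show "th s w : LL" if "w : LL" "0 < s" "s < lifetime X w" "s < infy" for w s
 proof -
 have \<open>w : L\<close> using that by (simp add: LL_def)
 hence thL: "th s w : L" by (rule subsetD[OF a(3)[rule_format, OF conjI[OF that(2,4)]] imageI])
 have "B (s + 0) w = B s w + B 0 (th s w)" by (rule L5[OF \<open>w : L\<close> _ that(4)]) simp
 hence "B s w + 0 = B s w + B 0 (th s w)" by (simp only: add_0_right)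
 moreover have "B s w < infy" using b(2) \<open>w : L\<close> that(3) by blast
 hence "B s w ~= \<top>" by auto
 ultimately have "B 0 (th s w) = 0" by (simp only: ennreal_add_left_cancel) auto
 with thL show ?thesis by (simp add: LL_def)
 qed
 show "B (s + t) w = B s w + B t (th s w)" if "w : LL" "s < infy" "t < infy" for w s t
 using L5[of w t s] that by (simp add: LL_def)
 qed
 moreover have "AE w in PS x. w : LL" if "x ~: N" for x
 using L2[OF that] L3[OF that] by eventually_elim (simp add: LL_def)
 moreover have "polar m \<E> D N" using assms by (simp add: PCAF_def)
 ultimately show ?thesis using that by blast
qed

end

section \<open>Symmetry of the transition function\<close>

lemma L2_measurable: "u : L2 m ==> u : bm m"
 by (simp add: L2_def)

lemma L2_square_integrable: "u : L2 m ==> integrable m (%x. u x * u x)"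
 by (simp add: L2_def power2_eq_square)

lemma L2_integrable_mult:
 assumes "u : L2 m" "v : L2 m" shows "integrable m (%x. u x * v x)"
proof (rule Bochner_Integration.integrable_bound)
 show "integrable m (%x. u x * u x + v x * v x)"
 using assms by (intro Bochner_Integration.integrable_add L2_square_integrable)
 show "(%x. u x * v x) : bm m"
 using assms by (intro borel_measurable_times L2_measurable)
 have "\<bar>a * b\<bar> <= \<bar>a * a + b * b\<bar>" for a b :: real
 proof -
 have "2 * (a * b) <= a * a + b * b" "- (2 * (a * b)) <= a * a + b * b"
 using zero_le_power2[of "a - b"] zero_le_power2[of "a + b"] by (simp_all add: power2_eq_square algebra_simps)
 thus ?thesis by linarith
 qed
 thus "AE x in m. norm (u x * v x) <= norm (u x * u x + v x * v x)" by simp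
qed

lemma L2_comb:
 assumes "u : L2 m" "v : L2 m" shows "(%x. a * u x + b * v x) : L2 m"
proof -
 have "integrable m (%x. a^2 * (u x * u x) + (2 * a * b) * (u x * v x) + b^2 * (v x * v x))"
 using assms by (intro Bochner_Integration.integrable_add integrable_mult_right L2_integrable_mult)
 also have "(%x. a^2 * (u x * u x) + (2 * a * b) * (u x * v x) + b^2 * (v x * v x)) = (%x. (a * u x + b * v x)\<^sup>2)"
 by (auto simp: power2_eq_square algebra_simps)
 finally have "integrable m (%x. (a * u x + b * v x)\<^sup>2)" .
 moreover have "(%x. a * u x + b * v x) : bm m"
 using assms by (intro borel_measurable_add borel_measurable_times borel_measurable_const L2_measurable)
 ultimately show ?thesis by (simp add: L2_def)
qed

lemma L2_diff: "u : L2 m ==> v : L2 m ==> (%x. u x - v x) : L2 m"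
 using L2_comb[of u m v 1 "-1"] by simp

lemma ip_comb:
 assumes "u : L2 m" "v : L2 m" "w : L2 m"
 shows "ip m (%x. a * u x + b * v x) w = a * ip m u w + b * ip m v w"
proof -
 have "ip m (%x. a * u x + b * v x) w = (\<integral>x. a * (u x * w x) + b * (v x * w x) \<partial>m)"
 unfolding L2_inner_def by (intro Bochner_Integration.integral_cong) (auto simp: algebra_simps)
 thus ?thesis using assms by (simp add: L2_inner_def L2_integrable_mult)
qed

lemma ip_commute: "ip m u v = ip m v u"
 by (simp add: L2_inner_def mult.commute)

lemma ip_diff:
 assumes "u : L2 m" "v : L2 m" "w : L2 m"
 shows "ip m (%x. u x - v x) w = ip m u w - ip m v w"
 using ip_comb[OF assms, of 1 "-1"] by simp

lemma ip_cong_AE: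
 assumes "AE x in m. u x = u' x" "u : L2 m" "u' : L2 m" "v : L2 m"
 shows "ip m u v = ip m u' v"
 unfolding L2_inner_def using assms by (intro integral_cong_AE borel_measurable_times L2_measurable) auto

lemma ip_self_nonneg: "0 <= ip m u u"
 unfolding L2_inner_def by (intro integral_nonneg_AE) simp

lemma L2_norm_nonneg: "0 <= L2_norm m u"
 by (simp add: L2_norm_def ip_self_nonneg)

lemma L2_norm_square: "L2_norm m u * L2_norm m u = ip m u u"
 by (simp add: L2_norm_def ip_self_nonneg)

lemma L2_norm_cong_AE:
 assumes "AE x in m. u x = u' x" "u : L2 m" "u' : L2 m"
 shows "L2_norm m u = L2_norm m u'"
proof -
 have "ip m u u = ip m u' u'"
 unfolding L2_inner_def using assms by (intro integral_cong_AE borel_measurable_times L2_measurable) auto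
 thus ?thesis by (simp add: L2_norm_def)
qed

lemma L2_Cauchy_Schwarz:
 assumes u: "u : L2 m" and v: "v : L2 m"
 shows "\<bar>ip m u v\<bar> <= L2_norm m u * L2_norm m v"
proof -
 define a b c where "a = ip m u u" and "b = ip m u v" and "c = ip m v v"
 have quad: "0 <= s * s * a + 2 * s * t * b + t * t * c" for s t
 proof -
 let ?w = "%x. s * u x + t * v x"
 have w: "?w : L2 m" by (rule L2_comb[OF u v])
 have "ip m ?w ?w = s * ip m u ?w + t * ip m v ?w"
 by (rule ip_comb[OF u v w])
 also have "... = s * s * a + 2 * s * t * b + t * t * c"
 using ip_comb[OF u v u, of s t] ip_comb[OF u v v, of s t]
 by (simp add: ip_commute[of m u ?w] ip_commute[of m v ?w] a_def b_def c_def
 ip_commute[of m v u] algebra_simps)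
 finally show ?thesis using ip_self_nonneg[of m ?w] by simp
 qed
 have a: "0 <= a" and c: "0 <= c" by (auto simp: a_def c_def ip_self_nonneg)
 have "b * b <= a * c"
 proof (cases "c = 0")
 case True
 have "b = 0"
 proof (rule ccontr)
 assume b: "b ~= 0"
 have "0 <= a + 2 * (- (a + 1) / (2 * b)) * b" using quad[of 1 "- (a + 1) / (2 * b)"] True by simp
 thus False using b by (simp add: field_simps)
 qed
 thus ?thesis using a c by simp
 next
 case False
 hence c: "0 < c" using c by simp
 have "0 <= a * c * c - b * b * c" using quad[of c "- b"] by (simp add: algebra_simps)
 hence "0 <= c * (a * c - b * b)" by (simp add: algebra_simps)
 thus ?thesis using c by (simp add: zero_le_mult_iff)
 qed
 hence "sqrt (b * b) <= sqrt (a * c)" by (rule real_sqrt_le_mono)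
 thus ?thesis by (simp add: a_def b_def c_def L2_norm_def real_sqrt_mult)
qed

context symmetric_hunt_process
begin

lemma space_m[simp]: "space m = UNIV"
 using sets_eq_imp_space_eq[OF sets_m] by simp

lemma meas_m: "bm m = Bor"
 by (rule mcongs[OF sets_m refl])

lemma DL_L2: "u : DL ==> u : L2 m" and L_L2: "u : DL ==> L u : L2 m"
proof -
 have "linear_operator m DL L" using L_self_adjoint unfolding self_adjoint_def by (elim conjE)
 hence "DL <= L2 m & L ` DL <= L2 m" unfolding linear_operator_def L2_subspace_def by (elim conjE) (rule conjI)
 thus "u : DL ==> u : L2 m" "u : DL ==> L u : L2 m" by auto
qed

lemma T_linear: "0 <= t ==> linear_operator m (L2 m) (T t)"
 using T_markov by (simp add: markov_semigroup_def)

lemma T_L2: "0 <= t ==> u : L2 m ==> T t u : L2 m"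
 using T_linear[of t] by (simp add: linear_operator_def image_subset_iff)

lemma T_contraction: "0 <= t ==> u : L2 m ==> L2_norm m (T t u) <= L2_norm m u"
 using T_markov by (simp add: markov_semigroup_def)

lemma T_comb: "0 <= t ==> u : L2 m ==> v : L2 m ==> AE x in m. T t (%x. a * u x + b * v x) x = a * T t u x + b * T t v x"
 using T_linear[of t] by (simp add: linear_operator_def)

lemma T_0: "u : L2 m ==> AE x in m. T 0 u x = u x"
 using T_markov by (simp add: markov_semigroup_def)

lemma T_add: "0 <= s ==> 0 <= t ==> u : L2 m ==> AE x in m. T (s + t) u x = T s (T t u) x"
 using T_markov by (simp add: markov_semigroup_def)

lemma T_continuous: "u : L2 m ==> ((%t. L2_norm m (%x. T t u x - u x)) \<longlongrightarrow> 0) (at_right 0)"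
 using T_markov by (simp add: markov_semigroup_def)

definition gen_err :: "('e => real) => real => 'e => real" where
 "gen_err u t x = (T t u x - u x) / t - L u x"

lemma gen_err_L2: "u : DL ==> 0 <= t ==> gen_err u t : L2 m"
proof -
 assume u: "u : DL" "0 <= t"
 have "(%x. (1 / t) * (T t u x - u x) + (-1) * L u x) : L2 m"
 by (intro L2_comb L2_diff T_L2 DL_L2 L_L2 u)
 thus ?thesis by (simp add: gen_err_def[abs_def])
qed

lemma gen_err_tendsto: "u : DL ==> ((%t. L2_norm m (gen_err u t)) \<longlongrightarrow> 0) (at_right 0)"
 using L_generates DL_L2 L_L2 unfolding generates_def gen_err_def[abs_def] by auto

lemma T_increment:
 assumes u: "u : DL" and s: "0 <= s" and d: "0 < d"
 shows "AE x in m. T (s + d) u x - T s u x = d * T s (L u) x + d * T s (gen_err u d) x"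
proof -
 have U: "u : L2 m" by (rule DL_L2[OF u])
 have g: "gen_err u d : L2 m" using gen_err_L2[OF u] d by simp
 have e: "T d u = (%x. 1 * u x + 1 * (d * L u x + d * gen_err u d x))"
 using d by (auto simp: gen_err_def field_simps)
 have c: "(%x. d * L u x + d * gen_err u d x) : L2 m" by (intro L2_comb L_L2 u g)
 have "AE x in m. T s (T d u) x = 1 * T s u x + 1 * T s (%x. d * L u x + d * gen_err u d x) x"
 by (subst e) (rule T_comb[OF s U c])
 moreover have "AE x in m. T s (%x. d * L u x + d * gen_err u d x) x = d * T s (L u) x + d * T s (gen_err u d) x"
 by (rule T_comb[OF s L_L2[OF u] g])
 moreover have "AE x in m. T (s + d) u x = T s (T d u) x"
 using T_add[OF s _ U, of d] d by simp
 ultimately show ?thesis by eventually_elim simp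
qed

lemma T_generator:
 assumes u: "u : DL" and s: "0 <= s"
 shows "T s u : DL" "AE x in m. L (T s u) x = T s (L u) x"
proof -
 have U: "u : L2 m" by (rule DL_L2[OF u])
 have L2: "T s u : L2 m" "T s (L u) : L2 m" by (intro T_L2 s U L_L2 u)+
 have "((%t. L2_norm m (%x. (T t (T s u) x - T s u x) / t - T s (L u) x)) \<longlongrightarrow> 0) (at_right 0)"
 proof (rule tendsto_sandwich[OF _ _ tendsto_const gen_err_tendsto[OF u]])
 show "\<forall>\<^sub>F t in at_right 0. 0 <= L2_norm m (%x. (T t (T s u) x - T s u x) / t - T s (L u) x)"
 by (simp add: L2_norm_nonneg)
 show "\<forall>\<^sub>F t in at_right 0. L2_norm m (%x. (T t (T s u) x - T s u x) / t - T s (L u) x) <= L2_norm m (gen_err u t)"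
 using eventually_at_right_less
 proof eventually_elim
 case (elim t)
 have g: "gen_err u t : L2 m" using gen_err_L2[OF u] elim by simp
 have "AE x in m. T (t + s) u x = T t (T s u) x" using T_add[of t s u] elim s U by simp
 hence "AE x in m. (T t (T s u) x - T s u x) / t - T s (L u) x = T s (gen_err u t) x"
 using T_increment[OF u s elim]
 by eventually_elim (use elim in \<open>simp add: add.commute field_simps\<close>)
 moreover have "(%x. (1 / t) * (T t (T s u) x - T s u x) + (-1) * T s (L u) x) : L2 m"
 using elim by (intro L2_comb L2_diff T_L2 L2) auto
 ultimately have "L2_norm m (%x. (T t (T s u) x - T s u x) / t - T s (L u) x) = L2_norm m (T s (gen_err u t))"
 by (intro L2_norm_cong_AE T_L2 s g) simp_all
 also have "... <= L2_norm m (gen_err u t)" by (rule T_contraction[OF s g])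
 finally show ?case .
 qed
 qed
 hence "T s u : DL & (AE x in m. L (T s u) x = T s (L u) x)"
 using L_generates L2 unfolding generates_def by blast
 thus "T s u : DL" "AE x in m. L (T s u) x = T s (L u) x" by auto
qed

lemma L_symmetric: "u : DL ==> v : DL ==> ip m (L u) v = ip m u (L v)"
proof -
 assume u: "u : DL" and v: "v : DL"
 have "(ALL u:DL. ip m (L u) v = ip m u (L v)) \<longleftrightarrow> v : DL & (AE x in m. L v x = L v x)"
 using L_self_adjoint DL_L2[OF v] L_L2[OF v] by (simp add: self_adjoint_def)
 thus ?thesis using u v by simp
qed

text \<open>\<open>F\<close> would have derivative zero, by the symmetry of the generator. Instead
  of differentiating, \<open>[0, t]\<close> is cut into equal steps of length \<open>d\<close>, each
  changing \<open>F\<close> by at most \<open>d * K d\<close>, and the total \<open>t * K d\<close>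
  tends to 0.\<close>

lemma T_symmetric_DL:
 assumes u: "u : DL" and v: "v : DL" and t: "0 < t"
 shows "ip m (T t u) v = ip m u (T t v)"
proof -
 have U: "u : L2 m" and V: "v : L2 m" using u v by (auto intro: DL_L2)
 define F where "F s = ip m (T s u) (T (t - s) v)" for s
 define K where "K d = L2_norm m (gen_err u d) * L2_norm m v + L2_norm m u * L2_norm m (gen_err v d)" for d
 have step: "\<bar>F (s + d) - F s\<bar> <= d * K d" if s: "0 <= s" "0 < d" "s + d <= t" for s d
 proof -
 let ?r = "t - s - d"
 have r: "0 <= ?r" using s by simp
 let ?z = "T s u" and ?y = "T ?r v" and ?gu = "T s (gen_err u d)" and ?gv = "T ?r (gen_err v d)"
 have geu: "gen_err u d : L2 m" and gev: "gen_err v d : L2 m" using gen_err_L2 u v s by auto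
 note L2s = T_L2[OF s(1) U] T_L2[OF r V] T_L2[OF s(1) geu] T_L2[OF r gev] T_L2[OF s(1) L_L2[OF u]] T_L2[OF r L_L2[OF v]]
 T_L2[of "s + d" u] T_L2[of "t - s" v]
 have A: "ip m (%x. T (s + d) u x - T s u x) ?y = d * ip m (T s (L u)) ?y + d * ip m ?gu ?y"
 by (subst ip_cong_AE[OF T_increment[OF u s(1,2)]])
 (use L2s s U V in \<open>auto intro!: L2_diff L2_comb simp: ip_comb\<close>)
 have B: "ip m (%x. T (?r + d) v x - T ?r v x) ?z = d * ip m (T ?r (L v)) ?z + d * ip m ?gv ?z"
 by (subst ip_cong_AE[OF T_increment[OF v r s(2)]])
 (use L2s s U V in \<open>auto intro!: L2_diff L2_comb simp: ip_comb\<close>)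
 have "ip m (T s (L u)) ?y = ip m (L ?z) ?y"
 using T_generator[OF u s(1)] L2s by (intro ip_cong_AE L_L2) auto
 also have "... = ip m ?z (L ?y)"
 by (rule L_symmetric) (use T_generator[OF u s(1)] T_generator[OF v r] in auto)
 also have "... = ip m (L ?y) ?z" by (rule ip_commute)
 also have "... = ip m (T ?r (L v)) ?z"
 using T_generator[OF v r] L2s by (intro ip_cong_AE L_L2) auto
 finally have C: "ip m (T s (L u)) ?y = ip m (T ?r (L v)) ?z" .
 have "F (s + d) - F s = ip m (%x. T (s + d) u x - T s u x) ?y - ip m (%x. T (?r + d) v x - T ?r v x) ?z"
 using L2s s U V unfolding F_def
 by (simp add: ip_diff algebra_simps ip_commute[of m ?z])
 also have "... = d * (ip m ?gu ?y - ip m ?gv ?z)" unfolding A B C by (simp add: algebra_simps)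
 also have "\<bar>...\<bar> <= d * K d"
 proof -
 have "\<bar>ip m ?gu ?y\<bar> <= L2_norm m (gen_err u d) * L2_norm m v"
 by (rule order_trans[OF L2_Cauchy_Schwarz mult_mono]) (use L2s T_contraction r s geu V L2_norm_nonneg in auto)
 moreover have "\<bar>ip m ?gv ?z\<bar> <= L2_norm m (gen_err v d) * L2_norm m u"
 by (rule order_trans[OF L2_Cauchy_Schwarz mult_mono]) (use L2s T_contraction r s gev U L2_norm_nonneg in auto)
 ultimately have "\<bar>ip m ?gu ?y - ip m ?gv ?z\<bar> <= K d" unfolding K_def by (simp add: mult.commute)
 thus ?thesis using s by (simp add: abs_mult)
 qed
 finally show ?thesis .
 qed
 have bound: "\<bar>F t - F 0\<bar> <= t * K (t / real (Suc n))" for n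
 proof -
 let ?d = "t / real (Suc n)"
 have "\<bar>F (real k * ?d) - F 0\<bar> <= real k * (?d * K ?d)" if "k <= Suc n" for k
 using that
 proof (induction k)
 case (Suc k)
 have "real k * e + e = real (Suc k) * e" for e by (simp add: algebra_simps)
 hence "real k * ?d + ?d = real (Suc k) * ?d" .
 moreover have "real (Suc k) * ?d <= real (Suc n) * ?d" using Suc.prems t by (intro mrmono) auto
 ultimately have "\<bar>F (real (Suc k) * ?d) - F (real k * ?d)\<bar> <= ?d * K ?d"
 using step[of "real k * ?d" ?d] t by simp
 hence "\<bar>F (real (Suc k) * ?d) - F 0\<bar> <= real k * (?d * K ?d) + ?d * K ?d"
 using Suc by linarith
 also have "real k * a + a = real (Suc k) * a" for a by (simp add: algebra_simps)
 finally show ?case .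
 qed simp
 from this[of "Suc n"] show ?thesis by simp
 qed
 have "(%n. t / real (Suc n)) ->> 0"
 using LIMSEQ_Suc[OF lim_const_over_n[of t]] by simp
 hence fl: "filterlim (%n. t / real (Suc n)) (at_right 0) sequentially"
 using t by (auto simp: filterlim_at intro!: always_eventually)
 have "(%n. t * K (t / real (Suc n))) ->> t * (0 * L2_norm m v + L2_norm m u * 0)"
 unfolding K_def
 by (intro tendsto_intros filterlim_compose[OF gen_err_tendsto[OF u] fl] filterlim_compose[OF gen_err_tendsto[OF v] fl])
 hence "\<bar>F t - F 0\<bar> <= 0" using bound by (intro LIMSEQ_le_const) auto
 hence "ip m (T t u) (T 0 v) = ip m (T 0 u) (T t v)" by (simp add: F_def)
 moreover have "ip m (T t u) (T 0 v) = ip m (T t u) v"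
 unfolding ip_commute[of m "T t u"] using t by (intro ip_cong_AE T_0 T_L2 U V) auto
 moreover have "ip m (T 0 u) (T t v) = ip m u (T t v)"
 using t by (intro ip_cong_AE T_0 T_L2 U V) auto
 ultimately show ?thesis by simp
qed

lemma T_diff_norm:
 assumes t: "0 <= t" and u: "u : L2 m" and v: "v : L2 m"
 shows "L2_norm m (%x. T t u x - T t v x) <= L2_norm m (%x. u x - v x)"
proof -
 have "AE x in m. T t (%x. 1 * u x + (-1) * v x) x = 1 * T t u x + (-1) * T t v x" by (rule T_comb[OF t u v])
 hence "AE x in m. T t u x - T t v x = T t (%x. u x - v x) x" by (simp add: eq_commute)
 hence "L2_norm m (%x. T t u x - T t v x) = L2_norm m (T t (%x. u x - v x))"
 by (rule L2_norm_cong_AE) (intro L2_diff T_L2 t u v)+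
 also have "... <= L2_norm m (%x. u x - v x)" by (intro T_contraction t L2_diff u v)
 finally show ?thesis .
qed

text \<open>The generator domain is dense and \<open>T t\<close> is a contraction, so
  \<open>u\<close> and then \<open>v\<close> may be replaced by elements of the domain at a small
  cost.\<close>

lemma T_symmetric:
 assumes u: "u : L2 m" and v: "v : L2 m" and t: "0 < t"
 shows "ip m (T t u) v = ip m u (T t v)"
proof -
 have dense: "EX w:DL. L2_norm m (%x. u x - w x) < d" if "u : L2 m" "0 < d" for u d
 using L_self_adjoint that unfolding self_adjoint_def L2_dense_def by blast
 have one: "\<bar>ip m (T t u) v - ip m u (T t v)\<bar> <= 2 * L2_norm m (%x. u x - w x) * L2_norm m v + \<bar>ip m (T t w) v - ip m w (T t v)\<bar>"
 if u: "u : L2 m" and v: "v : L2 m" and w: "w : L2 m" for u v w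
 proof -
 have t': "0 <= t" using t by simp
 have "ip m (T t u) v - ip m (T t w) v = ip m (%x. T t u x - T t w x) v"
 by (simp add: ip_diff T_L2 t' u v w)
 also have "\<bar>...\<bar> <= L2_norm m (%x. u x - w x) * L2_norm m v"
 by (rule order_trans[OF L2_Cauchy_Schwarz mrmono])
 (auto intro!: L2_diff T_L2 t' u v w T_diff_norm L2_norm_nonneg)
 finally have 1: "\<bar>ip m (T t u) v - ip m (T t w) v\<bar> <= L2_norm m (%x. u x - w x) * L2_norm m v" .
 have "ip m u (T t v) - ip m w (T t v) = ip m (%x. u x - w x) (T t v)"
 by (simp add: ip_diff T_L2 t' u v w)
 also have "\<bar>...\<bar> <= L2_norm m (%x. u x - w x) * L2_norm m v"
 by (rule order_trans[OF L2_Cauchy_Schwarz mlmono])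
 (auto intro!: L2_diff T_L2 t' u v w T_contraction L2_norm_nonneg)
 finally have "\<bar>ip m u (T t v) - ip m w (T t v)\<bar> <= L2_norm m (%x. u x - w x) * L2_norm m v" .
 with 1 show ?thesis by linarith
 qed
 \<comment> \<open>\<open>N\<close> collects the norms that multiply the approximation error when
   \<open>u\<close> and then \<open>v\<close> is replaced; the final 1 keeps it positive.\<close>
 define N where "N = 2 * L2_norm m v + 2 * (L2_norm m u + 1) + 1"
 have N: "0 < N" using L2_norm_nonneg[of m v] L2_norm_nonneg[of m u] by (simp add: N_def)
 have "\<bar>ip m (T t u) v - ip m u (T t v)\<bar> <= 0 + d" if d: "0 < d" for d
 proof -
 define h where "h = min (d / N) 1"
 have h: "0 < h" "h <= 1" "h * N <= d" using d N by (auto simp: h_def min_def field_simps)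
 obtain u' where u': "u' : DL" "L2_norm m (%x. u x - u' x) < h" using dense[OF u h(1)] by auto
 obtain v' where v': "v' : DL" "L2_norm m (%x. v x - v' x) < h" using dense[OF v h(1)] by auto
 have U': "u' : L2 m" and V': "v' : L2 m" using u' v' DL_L2 by auto
 have nu: "L2_norm m u' <= L2_norm m u + 1"
 proof -
 have "L2_norm m u' * L2_norm m u' = ip m u u' - ip m (%x. u x - u' x) u'"
 by (simp add: L2_norm_square ip_diff u U')
 also have "... <= L2_norm m u * L2_norm m u' + L2_norm m (%x. u x - u' x) * L2_norm m u'"
 using L2_Cauchy_Schwarz[OF u U'] L2_Cauchy_Schwarz[OF L2_diff[OF u U'] U'] by linarith
 also have "... <= (L2_norm m u + 1) * L2_norm m u'"
 using u'(2) h(2) L2_norm_nonneg[of m u'] by (simp add: distrib_right mrmono mult_left_le_one_le L2_norm_nonneg)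
 finally show ?thesis using L2_norm_nonneg[of m u'] L2_norm_nonneg[of m u]
 by (cases "L2_norm m u' = 0") (auto simp: mult_le_cancel_right)
 qed
 have "\<bar>ip m (T t u) v - ip m u (T t v)\<bar> <= 2 * h * L2_norm m v + \<bar>ip m (T t u') v - ip m u' (T t v)\<bar>"
 using one[OF u v U'] mrmono[OF less_imp_le[OF u'(2)] L2_norm_nonneg[of m v]] by linarith
 moreover have "\<bar>ip m (T t u') v - ip m u' (T t v)\<bar> = \<bar>ip m (T t v) u' - ip m v (T t u')\<bar>"
 by (simp add: ip_commute[of m _ u'] ip_commute[of m v] abs_minus_commute)
 moreover have "... <= 2 * h * (L2_norm m u + 1) + \<bar>ip m (T t v') u' - ip m v' (T t u')\<bar>"
 proof -
 have "L2_norm m (%x. v x - v' x) * L2_norm m u' <= h * (L2_norm m u + 1)"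
 using v'(2) nu h(1) L2_norm_nonneg[of m u'] by (intro mult_mono) auto
 thus ?thesis using one[OF v U' V'] by linarith
 qed
 moreover have "ip m (T t v') u' - ip m v' (T t u') = 0" using T_symmetric_DL[OF v'(1) u'(1) t] by simp
 ultimately have "\<bar>ip m (T t u) v - ip m u (T t v)\<bar> <= h * (2 * L2_norm m v + 2 * (L2_norm m u + 1))"
 by (simp add: algebra_simps)
 also have "... <= h * N" using h by (intro mlmono) (auto simp: N_def)
 finally show ?thesis using h by simp
 qed
 hence "\<bar>ip m (T t u) v - ip m u (T t v)\<bar> <= 0" by (rule field_le_epsilon)
 thus ?thesis by simp
qed

end

section \<open>Transition function and resolvent\<close>

lemma nn_integral_exp_Icc:
 fixes c r :: real
 assumes "0 < c" "0 <= r"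
 shows "sl {0..r} (%s. ee (- c * s)) = en ((1 - exp (- c * r)) / c)"
proof -
 have "((%s. - exp (- c * s) / c) has_real_derivative exp (- c * s)) (at s)" for s
 using assms by (auto intro!: derivative_eq_intros)
 hence "nl (%s. ee (- c * s) * ind {0..r} s) = en (- exp (- c * r) / c - (- exp (- c * 0) / c))"
 by (intro nn_integral_FTC_Icc) (use assms in auto)
 thus ?thesis by (simp add: diff_divide_distrib)
qed

lemma nn_integral_exp_Ici:
 fixes c :: real
 assumes "0 < c"
 shows "sl {0..} (%s. ee (- c * s)) = en (1 / c)"
proof -
 have "((%s. - exp (- c * s) / c) has_real_derivative exp (- c * s)) (at s)" for s
 using assms by (auto intro!: derivative_eq_intros)
 moreover have "((%s. - exp (- c * s) / c) \<longlongrightarrow> 0) at_top"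
 using assms by real_asymp
 ultimately have "nl (%s. ee (- c * s) * ind {0..} s) = en (0 - (- exp (- c * 0) / c))"
 by (intro nn_integral_FTC_atLeast) (use assms in auto)
 thus ?thesis by simp
qed

text \<open>For \<open>p t = P_t f\<close> the left side is an iterated resolvent. Substituting
  \<open>r = s + t\<close> and integrating out \<open>s\<close> over \<open>[0, r]\<close> leaves
  the explicit weight.\<close>

lemma laplace_double:
 fixes p :: "real => ennreal"
 assumes p[measurable]: "p : Bor" and c: "d < j"
 shows "sl {0..} (%s. ee (- j * s) * sl {0..} (%t. ee (- d * t) * p (s + t)))
 = sl {0..} (%r. en (exp (- d * r) * ((1 - exp (- (j - d) * r)) / (j - d))) * p r)"
proof -
 have inner: "sl {0..} (%t. ee (- d * t) * p (s + t)) = nl (%r. ee (- d * (r - s)) * p r * ind {s..} r)" for s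
 proof -
 have "nl (%r. ee (- d * (r - s)) * p r * ind {s..} r) =
 (nl (%t. ee (- d * ((s + 1 * t) - s)) * p (s + 1 * t) * ind {s..} (s + 1 * t)))"
 by (subst naffine[of _ 1 s]) auto
 also have "... = sl {0..} (%t. ee (- d * t) * p (s + t))"
 by (intro ncong) (auto split: spind)
 finally show ?thesis ..
 qed
 have "sl {0..} (%s. ee (- j * s) * sl {0..} (%t. ee (- d * t) * p (s + t)))
 = nl (%s. nl (%r. ee (- j * s) * ind {0..} s * (ee (- d * (r - s)) * p r * ind {s..} r)))"
 unfolding inner by (intro ncong) (subst ncmult, auto simp: mult_ac indicator_def[abs_def])
 also have "... = nl (%r. nl (%s. ee (- j * s) * ind {0..} s * (ee (- d * (r - s)) * p r * ind {s..} r)))"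
 by (rule lborel_pair.Fubini') (auto simp: indicator_def[abs_def])
 also have "... = sl {0..} (%r. en (exp (- d * r) * ((1 - exp (- (j - d) * r)) / (j - d))) * p r)"
 proof (intro ncong)
 fix r :: real
 show "nl (%s. ee (- j * s) * ind {0..} s * (ee (- d * (r - s)) * p r * ind {s..} r))
 = en (exp (- d * r) * ((1 - exp (- (j - d) * r)) / (j - d))) * p r * ind {0..} r"
 proof (cases "0 <= r")
 case True
 have "nl (%s. ee (- j * s) * ind {0..} s * (ee (- d * (r - s)) * p r * ind {s..} r))
 = nl (%s. (ee (- d * r) * p r) * (ee (- (j - d) * s) * ind {0..r} s))"
 proof (intro ncong)
 fix s :: real
 have "exp (- j * s) * exp (- d * (r - s)) = exp (- d * r) * exp (- (j - d) * s)"
 by (simp add: exp_add[symmetric] algebra_simps)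
 hence "ee (- j * s) * ee (- d * (r - s)) = ee (- d * r) * ee (- (j - d) * s)"
 by (simp only: ennreal_mult[symmetric] exp_ge_zero)
 hence "ee (- j * s) * (ee (- d * (r - s)) * p r) = ee (- d * r) * p r * ee (- (j - d) * s)"
 by (simp only: mult.assoc[symmetric]) (simp only: mult.assoc mult.commute[of "p r"])
 thus "ee (- j * s) * ind {0..} s * (ee (- d * (r - s)) * p r * ind {s..} r)
 = ee (- d * r) * p r * (ee (- (j - d) * s) * ind {0..r} s)"
 by (cases "0 <= s"; cases "s <= r") simp_all
 qed
 also have "... = ee (- d * r) * p r * en ((1 - exp (- (j - d) * r)) / (j - d))"
 using c True nn_integral_exp_Icc[of "j - d" r] by (subst ncmult) auto
 also have "... = en (exp (- d * r) * ((1 - exp (- (j - d) * r)) / (j - d))) * p r"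
 proof -
 have "- (j - d) * r <= 0" using c True by (intro mult_nonpos_nonneg) auto
 hence "0 <= (1 - exp (- (j - d) * r)) / (j - d)" using c by (intro divide_nonneg_nonneg) (simp_all only: exp_le_one_iff diff_ge_0_iff_ge less_imp_le)
 from ennreal_mult''[OF this, of "exp (- d * r)"] show ?thesis by (simp only: mult_ac)
 qed
 finally show ?thesis using True by simp
 next
 case False
 hence "nl (%s. ee (- j * s) * ind {0..} s * (ee (- d * (r - s)) * p r * ind {s..} r)) = nn ((lborel :: real measure)) (%s. 0)"
 by (intro ncong) (auto split: spind)
 thus ?thesis using False by simp
 qed
 qed
 finally show ?thesis .
qed

text \<open>The resolvent equation written without subtraction, so that infinite values are allowed:
  \<open>j - d\<close> times the weight of the double integral is
  \<open>exp (- d * r) - exp (- j * r)\<close>.\<close>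

lemma laplace_convolution:
 fixes p :: "real => ennreal"
 assumes p[measurable]: "p : Bor" and c: "d < j"
 shows "en (j - d) * sl {0..} (%s. ee (- j * s) * sl {0..} (%t. ee (- d * t) * p (s + t)))
 + sl {0..} (%r. ee (- j * r) * p r)
 = sl {0..} (%r. ee (- d * r) * p r)"
proof -
 have A: "sl {0..} (%s. ee (- j * s) * sl {0..} (%t. ee (- d * t) * p (s + t)))
 = sl {0..} (%r. en (exp (- d * r) * ((1 - exp (- (j - d) * r)) / (j - d))) * p r)"
 by (rule laplace_double[OF p c])
 have "en (j - d) * sl {0..} (%r. en (exp (- d * r) * ((1 - exp (- (j - d) * r)) / (j - d))) * p r)
 + sl {0..} (%r. ee (- j * r) * p r)
 = nl (%r. en (j - d) * (en (exp (- d * r) * ((1 - exp (- (j - d) * r)) / (j - d))) * p r * ind {0..} r)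
 + ee (- j * r) * p r * ind {0..} r)"
 by (subst nadd) (auto simp: ncmult)
 also have "... = sl {0..} (%r. ee (- d * r) * p r)"
 proof (intro ncong)
 fix r :: real
 show "en (j - d) * (en (exp (- d * r) * ((1 - exp (- (j - d) * r)) / (j - d))) * p r * ind {0..} r)
 + ee (- j * r) * p r * ind {0..} r = ee (- d * r) * p r * ind {0..} r"
 proof (cases "0 <= r")
 case True
 have nn: "0 <= exp (- d * r) * ((1 - exp (- (j - d) * r)) / (j - d))"
 proof -
 have "- (j - d) * r <= 0" using c True by (intro mult_nonpos_nonneg) auto
 thus ?thesis using c by (intro mult_nonneg_nonneg divide_nonneg_nonneg) (simp_all only: exp_le_one_iff diff_ge_0_iff_ge less_imp_le exp_ge_zero)
 qed
 have "(j - d) * (exp (- d * r) * ((1 - exp (- (j - d) * r)) / (j - d))) = exp (- d * r) - exp (- d * r) * exp (- (j - d) * r)"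
 proof -
 have "(j - d) * (E * ((1 - F) / (j - d))) = E - E * F" for E F using c by (simp add: field_simps)
 thus ?thesis .
 qed
 also have "exp (- d * r) * exp (- (j - d) * r) = exp (- j * r)" by (simp add: exp_add[symmetric] algebra_simps)
 finally have eq: "(j - d) * (exp (- d * r) * ((1 - exp (- (j - d) * r)) / (j - d))) + exp (- j * r) = exp (- d * r)" by simp
 have "en (j - d) * (en (exp (- d * r) * ((1 - exp (- (j - d) * r)) / (j - d))) * p r) + ee (- j * r) * p r
 = en ((j - d) * (exp (- d * r) * ((1 - exp (- (j - d) * r)) / (j - d))) + exp (- j * r)) * p r"
 proof -
 have gen: "en k * (en E * q) + en F * q = en (k * E + F) * q" if "0 <= k" "0 <= E" "0 <= F" for k E F q
 using that by (simp add: ennreal_mult distrib_right mult.assoc)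
 show ?thesis by (rule gen) (use nn c in auto)
 qed
 thus ?thesis using True unfolding eq by simp
 qed simp
 qed
 finally show ?thesis unfolding A .
qed

context symmetric_hunt_process
begin

lemma sigma_compact: obtains K :: "nat => 'e set" where "!!n. compact (K n)" "(\<Union>n. K n) = UNIV"
proof -
 define \<F> where "\<F> = {U::'e set. open U & (EX K. compact K & U <= K)}"
 have "\<Union>\<F> = UNIV"
 proof -
 have "EX U:\<F>. x : U" for x
 proof -
 have "EX U. openin euclidean U & (EX K. compactin euclidean K & x : U & U <= K)"
 using locally_compact unfolding locally_compact_space_def by (metis UNIV_I topspace_euclidean)
 thus ?thesis by (auto simp: \<F>_def)
 qed
 thus ?thesis by auto
 qed
 moreover obtain \<F>' where F': "\<F>' <= \<F>" "countable \<F>'" "\<Union>\<F>' = \<Union>\<F>"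
 by (rule Lindelof[of \<F>]) (auto simp: \<F>_def)
 ultimately have U: "\<Union>\<F>' = UNIV" by simp
 hence ne: "\<F>' ~= {}" by auto
 have "ALL U:\<F>'. EX K. compact K & U <= K" using F' by (auto simp: \<F>_def)
 then obtain k where k: "!!U. U : \<F>' ==> compact (k U) & U <= k U" by metis
 show ?thesis
 proof (rule that[of "%n. k (from_nat_into \<F>' n)"])
 show "compact (k (from_nat_into \<F>' n))" for n using k from_nat_into[OF ne] by auto
 have "x : (\<Union>n. k (from_nat_into \<F>' n))" for x
 proof -
 obtain U where "U : \<F>'" "x : U" using U by blast
 then obtain n where "from_nat_into \<F>' n = U" using from_nat_into_surj[OF F'(2)] by blast
 thus ?thesis using k[OF \<open>U : \<F>'\<close>] \<open>x : U\<close> by (intro UN_I[of n]) auto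
 qed
 thus "(\<Union>n. k (from_nat_into \<F>' n)) = UNIV" by auto
 qed
qed

lemma sigma_finite_m: "sigma_finite_measure m"
proof -
 obtain K :: "nat => 'e set" where K: "!!n. compact (K n)" "(\<Union>n. K n) = UNIV" by (rule sigma_compact) blast
 show ?thesis
 proof
 show "EX A. countable A & A <= sets m & \<Union>A = space m & (ALL a:A. emu m a ~= infy)"
 using K m_radon by (intro exI[of _ "range K"]) (auto simp: sets_m borel_compact less_top[symmetric])
 qed
qed

sublocale m: sigma_finite_measure m by (rule sigma_finite_m)

abbreviation "PT \<equiv> transition X P"
abbreviation "RR \<equiv> resolvent X P"

lemma mext0X: "f : Bor ==> (%w. ext0 f (X t w)) : bm (NF infy)"
 for f :: "'e => ennreal"
 by (rule mcomp[OF mXNF mext0]) auto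

lemma measurable_PT[measurable]: "f : Bor ==> PT t f : Bor"
 unfolding transition_def by (rule measurable_E_Some[OF mext0X])

lemma measurable_kernel_pair:
 assumes F: "case_prod F : bm (N OM NF infy)" and g: "g : N MM cb"
 shows "(%z. nn (P (g z)) (%w. F z w)) : bm N"
 by (rule nn_integral_measurable_subprob_algebra2[OF F mcomp[OF g kernel_sub]])

lemma measurable_PT_pair:
 assumes f: "f : Bor"
 shows "(%(t, x). PT t f x) : bm (borel OM borel)"
proof -
 have "(%z. nn (P (Some (snd z))) (%w. ext0 f (X (fst z) w))) : bm (borel OM borel)"
 proof (rule measurable_kernel_pair)
 have "(%p. X (fst (fst p)) (snd p)) : (borel OM borel) OM NF infy MM cb"
 by (rule mXc) measurable
 from mcomp[OF this mext0[OF f]]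
 show "(%(z, w). ext0 f (X (fst z) w)) : bm ((borel OM borel) OM NF infy)"
 by (simp add: split_beta')
 show "(%z. Some (snd z)) : borel OM borel MM cb"
 by (rule mcomp[OF msnd measurable_Some])
 qed
 thus ?thesis by (simp add: transition_def case_prod_beta)
qed

lemma PT_mono: "(!!y. f y <= g y) ==> PT t f x <= PT t g x"
proof -
 assume "!!y. f y <= g y"
 hence "ext0 f z <= ext0 g z" for z by (cases z) auto
 thus ?thesis unfolding transition_def by (intro nmono) auto
qed

lemma PT_add:
 assumes "f : Bor" "g : Bor"
 shows "PT t (%y. f y + g y) x = PT t f x + PT t g x"
proof -
 have "ext0 (%y. f y + g y) z = ext0 f z + ext0 g z" for z by (cases z) auto
 thus ?thesis unfolding transition_def
 using mext0X assms by (simp add: nadd mcongs[OF sets_P refl])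
qed

lemma PT_cmult:
 assumes "f : Bor"
 shows "PT t (%y. c * f y) x = c * PT t f x"
proof -
 have "ext0 (%y. c * f y) z = c * ext0 f z" for z by (cases z) auto
 thus ?thesis unfolding transition_def
 using mext0X[OF assms] by (simp add: ncmult mcongs[OF sets_P refl])
qed

lemma PT_const_le: "(!!y. f y <= c) ==> PT t f x <= c"
proof -
 assume "!!y. f y <= c"
 hence "ext0 f z <= c" for z by (cases z) auto
 hence "PT t f x <= nn (PS x) (%w. c)" unfolding transition_def by (intro nmono) auto
 also have "... = c" using prob_space.emeasure_space_1[OF prob_space_P, of "Some x"] by simp
 finally show ?thesis .
qed

lemma PT_SUP:
 assumes "!!n. f n : Bor" "incseq f"
 shows "PT t (%y. SUP n. f n y) x = (SUP n. PT t (f n) x)"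
proof -
 have e: "ext0 (%y. SUP n. f n y) z = (SUP n. ext0 (f n) z)" for z by (cases z) auto
 have "incseq (%n w. ext0 (f n) (X t w))"
 proof (intro incseq_SucI le_funI)
 fix n w
 show "ext0 (f n) (X t w) <= ext0 (f (Suc n)) (X t w)"
 using incseq_SucD[OF assms(2), of n] by (cases "X t w") (auto simp: le_fun_def)
 qed
 thus ?thesis unfolding transition_def e
 using mext0X[OF assms(1)]
 by (intro nmcSUP) (simp_all add: mcongs[OF sets_P refl])
qed

lemma PT_0: "PT 0 f x = f x"
proof -
 have "PT 0 f x = nn (PS x) (%w. f x)"
 unfolding transition_def using normal[of "Some x"]
 by (intro ncongAE) (auto elim: evmono)
 thus ?thesis using prob_space.emeasure_space_1[OF prob_space_P, of "Some x"] by simp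
qed

lemma PT_semigroup:
 assumes f: "f : Bor" and s: "s < infy"
 shows "PT s (PT t f) x = PT (s + t) f x"
proof -
 have n: "nn (P None) (%w. ext0 f (X t w)) = 0"
 proof -
 have "AE w in P None. X t w = None"
 using normal[of None] by eventually_elim (rule X_None_mono, auto)
 hence "nn (P None) (%w. ext0 f (X t w)) = nn (P None) (%w. 0)"
 by (intro ncongAE) (auto elim: evmono)
 thus ?thesis by simp
 qed
 have e: "ext0 (PT t f) z = nn (P z) (%w'. ext0 f (X t w'))" for z
 by (cases z) (auto simp: n transition_def)
 have "nn (PS x) (%w. 1 * ext0 f (X t (th s w))) = nn (PS x) (%w. 1 * nn (P (X s w)) (%w'. ext0 f (X t w')))"
 by (rule markov_functional[OF s _ mext0X[OF f]]) simp
 thus ?thesis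
 unfolding transition_def[of X P s] transition_def[of X P "s + t"] e
 using shift[OF s, of t] by (simp add: add.commute)
qed

lemma associated_nn:
 assumes f: "f : L2 m" "!!x. 0 <= f x" and t: "0 <= t"
 shows "AE x in m. PT (en t) (%x. en (f x)) x = en (T t f x)" "AE x in m. 0 <= T t f x"
proof -
 have e: "ext0 (%x. en (f x)) z = en (ext0 f z)" for z by (cases z) auto
 have nn: "0 <= ext0 f z" for z using f(2) by (cases z) auto
 show "AE x in m. PT (en t) (%x. en (f x)) x = en (T t f x)"
 using associated[OF t f(1)]
 proof eventually_elim
 case (elim x)
 thus ?case unfolding transition_def e using nn by (simp add: neqint)
 qed
 show "AE x in m. 0 <= T t f x"
 using associated[OF t f(1)] by eventually_elim (use nn in \<open>auto intro!: integral_nonneg_AE\<close>)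
qed

lemma PT_symmetric_L2:
 assumes f: "f : L2 m" "!!x. 0 <= f x" and g: "g : L2 m" "!!x. 0 <= g x" and t: "0 < t"
 shows "nn m (%x. PT (en t) (%x. en (f x)) x * en (g x)) = nn m (%x. en (f x) * PT (en t) (%x. en (g x)) x)"
proof -
 have A: "nn m (%x. PT (en t) (%x. en (f x)) x * en (g x)) = en (ip m (T t f) g)"
 if f: "f : L2 m" "!!x. 0 <= f x" and g: "g : L2 m" "!!x. 0 <= g x" for f g
 proof -
 have "nn m (%x. PT (en t) (%x. en (f x)) x * en (g x)) = nn m (%x. en (T t f x * g x))"
 using associated_nn[OF f less_imp_le[OF t]] g(2)
 by (intro ncongAE) (auto elim: evmono simp: ennreal_mult'')
 also have "... = en (ip m (T t f) g)"
 unfolding L2_inner_def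
 proof (rule neqint)
 show "integrable m (%x. T t f x * g x)" by (rule L2_integrable_mult) (use f g t T_L2 in auto)
 show "AE x in m. 0 <= T t f x * g x" using associated_nn(2)[OF f less_imp_le[OF t]] g(2) by (auto elim: evmono)
 qed
 finally show ?thesis .
 qed
 have "nn m (%x. en (f x) * PT (en t) (%x. en (g x)) x) = en (ip m (T t g) f)"
 using A[OF g f] by (simp add: mult.commute)
 also have "ip m (T t g) f = ip m (T t f) g"
 using T_symmetric[OF f(1) g(1) t] by (simp add: ip_commute)
 finally show ?thesis using A[OF f g] by simp
qed

lemma L2_approx:
 fixes f :: "'e => ennreal"
 assumes f: "f : Bor"
 obtains g :: "nat => 'e => real" where "!!n. g n : L2 m" "!!n x. 0 <= g n x" "!!x. f x = (SUP n. en (g n x))"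
 "incseq (%n x. en (g n x))" "!!n. integrable m (g n)" "!!n x. g n x <= real n" "!!n. g n : Bor"
proof -
 obtain A :: "nat => 'e set" where A: "range A <= sets m" "(\<Union>i. A i) = space m" "!!i. emu m (A i) ~= infy" "incseq A"
 using m.sigma_finite_incseq by metis
 note [measurable] = f measurable_sets_borel
 have [measurable]: "A n : sets borel" for n using A(1) sets_m by auto
 define g where "g n x = enn2real (min (f x) (of_nat n)) * ind (A n) x" for n x
 have gm[measurable]: "g n : Bor" for n unfolding g_def by measurable
 have g0: "0 <= g n x" for n x by (auto simp: g_def)
 have gn: "g n x <= real n * ind (A n) x" for n x
 proof -
 have "enn2real (min (f x) (of_nat n)) <= real n"
 by (rule enn2real_leI) (auto simp: ennat)
 thus ?thesis by (auto simp: g_def split: spind)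
 qed
 have ge: "en (g n x) = min (f x) (of_nat n) * ind (A n) x" for n x
 proof -
 have "min (f x) (of_nat n) < \<top>" by (simp add: min_less_iff_disj of_nat_less_top)
 thus ?thesis by (auto simp: g_def split: spind)
 qed
 have int: "integrable m (g n)" for n
 proof (rule Bochner_Integration.integrable_bound)
 show "integrable m (%x. real n * ind (A n) x)"
 proof (rule integrable_mult_right)
 have "emu m (A n) < infy" using A(3)[of n] by (simp add: less_top)
 thus "integrable m (indicat_real (A n))" using A(1) by auto
 qed
 show "g n : bm m" using gm by (simp add: meas_m)
 show "AE x in m. norm (g n x) <= norm (real n * ind (A n) x :: real)" using gn g0 by (auto simp: abs_of_nonneg)
 qed
 have gle: "g n x <= real n" for n x using gn[of n x] by (auto split: split_indicator_asm intro: order_trans)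
 have L2: "g n : L2 m" for n
 proof -
 have "integrable m (%x. real n * g n x)" by (intro integrable_mult_right int)
 hence "integrable m (%x. (g n x)\<^sup>2)"
 by (rule Bochner_Integration.integrable_bound)
 (use gle g0 gm in \<open>auto simp: meas_m power2_eq_square abs_mult intro!: mrmono\<close>)
 thus ?thesis using gm by (simp add: L2_def meas_m)
 qed
 have inc: "incseq (%n x. en (g n x))"
 proof (intro incseq_SucI le_funI)
 fix n x
 have "ind (A n) x <= (ind (A (Suc n)) x :: ennreal)" using incseq_SucD[OF A(4), of n] by (auto split: spind)
 thus "en (g n x) <= en (g (Suc n) x)" unfolding ge
 by (intro mult_mono min.mono) auto
 qed
 have sup: "f x = (SUP n. en (g n x))" for x
 proof (rule antisym)
 show "(SUP n. en (g n x)) <= f x" unfolding ge by (intro SUP_least) (auto split: spind)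
 obtain n0 where n0: "x : A n0" using A(2) by auto
 have "f x = (SUP n. min (f x) (of_nat n))"
 by (simp add: inf_SUP[symmetric] ennreal_SUP_of_nat_eq_top inf_min[symmetric])
 also have "... <= (SUP n. en (g n x))"
 proof (rule SUP_least)
 fix n :: nat
 have "x : A (max n n0)" using n0 A(4) by (meson incseqD max.cobounded2 subsetD)
 hence "min (f x) (of_nat n) <= en (g (max n n0) x)" unfolding ge by (auto simp: min.coboundedI2)
 thus "min (f x) (of_nat n) <= (SUP n. en (g n x))" by (rule SUP_upper2[rotated]) simp
 qed
 finally show "f x <= (SUP n. en (g n x))" .
 qed
 show ?thesis by (rule that[OF L2 g0 sup inc int gle gm])
qed

lemma PT_symmetric:
 assumes f[measurable]: "f : Bor" and g[measurable]: "g : Bor" and t: "t < infy"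
 shows "nn m (%x. PT t f x * g x) = nn m (%x. f x * PT t g x)"
proof (cases "t = 0")
 case True thus ?thesis by (simp add: PT_0[abs_def])
next
 case False
 then obtain r where r: "t = en r" "0 < r" using t by (cases t) (auto simp: less_le)
 obtain F where F: "!!n. F n : L2 m" "!!n x. 0 <= F n x" "!!x. f x = (SUP n. en (F n x))"
 "incseq (%n x. en (F n x))" "!!n. F n : Bor" by (rule L2_approx[OF f]) blast
 obtain H where H: "!!n. H n : L2 m" "!!n x. 0 <= H n x" "!!x. g x = (SUP n. en (H n x))"
 "incseq (%n x. en (H n x))" "!!n. H n : Bor" by (rule L2_approx[OF g]) blast
 note [measurable] = F(5) H(5)
 let ?f = "%n x. en (F n x)" and ?g = "%n x. en (H n x)"
 have mm: "h : Bor ==> h : bm m" for h :: "'e => ennreal" by (simp add: meas_m)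
 have Pf: "PT t f = (%x. SUP n. PT t (?f n) x)"
 proof -
 have "f = (%y. SUP n. ?f n y)" using F(3) by (simp add: fun_eq_iff)
 hence "PT t f x = PT t (%y. SUP n. ?f n y) x" for x by (rule arg_cong)
 thus ?thesis using PT_SUP[OF _ F(4), of t] F(5) by auto
 qed
 have Pg: "PT t g = (%x. SUP n. PT t (?g n) x)"
 proof -
 have "g = (%y. SUP n. ?g n y)" using H(3) by (simp add: fun_eq_iff)
 hence "PT t g x = PT t (%y. SUP n. ?g n y) x" for x by (rule arg_cong)
 thus ?thesis using PT_SUP[OF _ H(4), of t] H(5) by auto
 qed
 have iP: "incseq (%n x. PT t (h n) x)" if "incseq h" for h :: "nat => 'e => ennreal"
 using that by (intro incseq_SucI le_funI PT_mono) (simp add: incseq_def le_fun_def)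
 have prod: "nn m (%x. (SUP n. a n x) * (SUP n. b n x)) = (SUP n. nn m (%x. a n x * b n x))"
 if "incseq a" "incseq b" "!!n. a n : Bor" "!!n. b n : Bor" for a b :: "nat => 'e => ennreal"
 proof -
 have "nn m (%x. (SUP n. a n x) * (SUP n. b n x)) = nn m (%x. (SUP n. a n x * b n x))"
 proof (intro ncong)
 fix x
 have "incseq (%n. a n x)" "incseq (%n. b n x)" using that(1,2) by (auto simp: incseq_def le_fun_def)
 note inc = this
 have "(SUP n. a n x) * (SUP n. b n x) = (SUP n. SUP k. a n x * b k x)"
 by (simp only: SUPmr) (simp only: SUPml)
 also have "... = (SUP n. a n x * b n x)"
 proof (intro antisym SUP_least)
 fix n k
 have "a n x * b k x <= a (max n k) x * b (max n k) x"
 using inc by (intro mult_mono) (auto simp: incseq_def)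
 thus "a n x * b k x <= (SUP n. a n x * b n x)" by (rule SUP_upper2[rotated]) simp
 show "a n x * b n x <= (SUP n. SUP k. a n x * b k x)"
 by (intro SUP_upper2[of n] SUP_upper2[of n]) auto
 qed
 finally show "(SUP n. a n x) * (SUP n. b n x) = (SUP n. a n x * b n x)" .
 qed
 also have "... = (SUP n. nn m (%x. a n x * b n x))"
 proof (rule nmcSUP)
 show "incseq (%n x. a n x * b n x)"
 using that(1,2) by (intro incseq_SucI le_funI mult_mono) (simp_all add: incseq_def le_fun_def)
 show "(%x. a n x * b n x) : bm m" for n
 by (intro bmtimes mm that)
 qed
 finally show ?thesis .
 qed
 have "nn m (%x. PT t f x * g x) = (SUP n. nn m (%x. PT t (?f n) x * ?g n x))"
 unfolding Pf H(3)[abs_def] by (rule prod[OF iP[OF F(4)] H(4)]) measurable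
 also have "... = (SUP n. nn m (%x. ?f n x * PT t (?g n) x))"
 using PT_symmetric_L2[OF F(1,2) H(1,2) r(2)] by (simp add: r(1))
 also have "... = nn m (%x. f x * PT t g x)"
 unfolding Pg F(3)[abs_def] by (rule prod[OF F(4) iP[OF H(4)], symmetric]) measurable
 finally show ?thesis .
qed

text \<open>Symmetry moves the semigroup onto the constant 1, which it decreases.\<close>

lemma PT_excessive_measure:
 assumes f[measurable]: "f : Bor" and t: "t < infy"
 shows "nn m (%x. PT t f x) <= nn m (%x. f x)"
proof -
 have "nn m (%x. PT t f x) = nn m (%x. PT t f x * 1)" by simp
 also have "... = nn m (%x. f x * PT t (%_. 1) x)" by (rule PT_symmetric[OF f _ t]) simp
 also have "... <= nn m (%x. f x * 1)"
 by (intro nmono mlmono PT_const_le) auto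
 finally show ?thesis by simp
qed

lemma AE_m_iff: "(AE y in m. Q y) \<longleftrightarrow> (EX Z:sets borel. emu m Z = 0 & {y. ~ Q y} <= Z)"
proof
 assume "AE y in m. Q y"
 then obtain Z where "{y : space m. ~ Q y} <= Z" "emu m Z = 0" "Z : sets m" by (rule AE_E)
 thus "EX Z:sets borel. emu m Z = 0 & {y. ~ Q y} <= Z" by (auto simp: sets_m)
next
 assume "EX Z:sets borel. emu m Z = 0 & {y. ~ Q y} <= Z"
 thus "AE y in m. Q y" by (auto intro: AE_I simp: sets_m)
qed

text \<open>Absolute continuity makes an \<open>m\<close>-null set invisible at a positive time from
  every start. This is what later turns statements for almost every start into statements for all of
  them.\<close>

lemma AE_X:
 assumes Q: "AE y in m. Q y" and t: "0 < t" "t < infy"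
 shows "AE w in PS x. ALL y. X t w = Some y --> Q y"
proof -
 obtain Z where Z: "Z : sets borel" "emu m Z = 0" "{y. ~ Q y} <= Z" using Q by (auto simp: AE_m_iff)
 have "PT t (ind Z) x = 0"
 by (rule absolute_continuity[of _ 1]) (use Z t in \<open>auto simp: sets_m split: spind\<close>)
 hence "AE w in PS x. ext0 (ind Z) (X t w) = (0::ennreal)"
 unfolding transition_def using mext0X[of "ind Z" t] Z(1)
 by (subst (asm) n0AE) (auto simp: mcongs[OF sets_P refl])
 thus ?thesis
 by eventually_elim (use Z(3) in \<open>auto split: split_indicator_asm\<close>)
qed

lemma PT_cong_AE:
 assumes "AE y in m. f y = g y" "0 < t" "t < infy"
 shows "PT t f x = PT t g x"
proof -
 have "AE w in PS x. ext0 f (X t w) = ext0 g (X t w)"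
 using AE_X[OF assms, of x]
 proof eventually_elim
 case (elim w) thus ?case by (cases "X t w") auto
 qed
 thus ?thesis unfolding transition_def by (rule ncongAE)
qed

lemma PT_mono_AE:
 assumes "AE y in m. f y <= g y" "0 < t" "t < infy"
 shows "PT t f x <= PT t g x"
proof -
 have "AE w in PS x. ext0 f (X t w) <= ext0 g (X t w)"
 using AE_X[OF assms, of x]
 proof eventually_elim
 case (elim w) thus ?case by (cases "X t w") auto
 qed
 thus ?thesis unfolding transition_def by (rule nmonoAE)
qed

end

context symmetric_hunt_process
begin

lemma mPTt: "f : Bor ==> (%t. PT (en t) f x) : Bor"
proof -
 assume f: "f : Bor"
 have "(%t::real. (en t, x)) : borel MM borel OM borel" by measurable
 from mcomp[OF this measurable_PT_pair[OF f]] show ?thesis by simp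
qed

lemma pair_P: "pair_sigma_finite (P x) (lborel :: real measure)"
proof -
 interpret prob_space "P x" by (rule prob_space_P)
 show ?thesis ..
qed

lemma PT_zero: "PT s (%y. 0) x = 0"
proof -
 have "ext0 (%y. 0) z = (0::ennreal)" for z :: "'e option" by (cases z) auto
 thus ?thesis by (simp add: transition_def)
qed

lemma PT_nn_integral:
 assumes h: "(%(t, y). h t y) : bm (borel OM borel)"
 shows "PT s (%y. nn ((lborel :: real measure)) (%t. h t y)) x = nl (%t. PT s (h t) x)"
proof -
 interpret pair_sigma_finite "PS x" "lborel :: real measure" by (rule pair_P)
 have e: "ext0 (%y. nn ((lborel :: real measure)) (%t. h t y)) z = nl (%t. ext0 (h t) z)" for z
 by (cases z) auto
 have m: "(%p. ext0 (h (fst p)) (snd p)) : bm ((borel :: real measure) OM cb)"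
 proof -
 have the: "(the :: 'e option => 'e) : cb MM borel"
 by (rule measurable_from_cemetery) auto
 have "(%p. (fst p, the (snd p))) : (borel :: real measure) OM (cb :: 'e option measure) MM borel OM borel"
 by (intro mPair mfst mcomp[OF msnd the])
 from mcomp[OF this h]
 have h': "(%p. h (fst p) (the (snd p))) : bm ((borel :: real measure) OM (cb :: 'e option measure))"
 by simp
 have "{None} : sets (cb :: 'e option measure)" by (simp add: sets_cemetery_borel vimage_def)
 from msets[OF msnd this, of "borel :: real measure"]
 have "{p : space ((borel :: real measure) OM (cb :: 'e option measure)). snd p = None} : sets (borel OM cb)"
 by (simp add: vimage_def Int_def conj_commute)
 hence "(%p. if snd p = None then 0 else h (fst p) (the (snd p))) : bm ((borel :: real measure) OM (cb :: 'e option measure))"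
 by (intro measurable_If h') auto
 moreover have "(if z = None then 0 else h t (the z)) = ext0 (h t) z" for t z by (cases z) auto
 ultimately show ?thesis by simp
 qed
 have m2: "(%p. ext0 (h (snd p)) (X s (fst p))) : bm (PS x OM lborel)"
 proof -
 have "(%p. X s (fst p)) : PS x OM (lborel :: real measure) MM cb"
 by (rule mcomp[OF mfst]) (simp add: mcongs[OF sets_P refl] mXNF)
 hence "(%p. (snd p, X s (fst p))) : PS x OM (lborel :: real measure) MM borel OM cb"
 by (intro mPair mcomp[OF msnd]) simp_all
 from mcomp[OF this m] show ?thesis by simp
 qed
 show ?thesis
 unfolding transition_def e using m2 by (intro Fubini'[symmetric]) (simp add: split_beta')
qed

lemma expectation_time_integral:
 assumes f[measurable]: "f : Bor" and h[measurable]: "h : Bor"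
 shows "nn (PS x) (%w. nl (%t. h t * ext0 f (X (en t) w))) = nl (%t. h t * PT (en t) f x)"
 and "(%w. nl (%t. h t * ext0 f (X (en t) w))) : bm (PS x)"
proof -
 interpret pair_sigma_finite "PS x" "lborel :: real measure" by (rule pair_P)
 have Xm: "(%p. ext0 f (X (en (snd p)) (fst p))) : bm (PS x OM lborel)"
 proof -
 have "(%p. X (en (snd p)) (fst p)) : PS x OM lborel MM cb"
 proof (rule mXc)
 have "(%w. w) : PS x MM NF infy" by (rule measurable_ident_sets) simp
 from mcomp[OF mfst this]
 show "(%p. fst p) : PS x OM (lborel :: real measure) MM NF infy" .
 qed measurable
 from mcomp[OF this mext0[OF f]] show ?thesis .
 qed
 have m2: "(%(w, t). h t * ext0 f (X (en t) w)) : bm (PS x OM lborel)"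
 unfolding split_beta' using Xm by measurable
 show "nn (PS x) (%w. nl (%t. h t * ext0 f (X (en t) w))) = nl (%t. h t * PT (en t) f x)"
 unfolding transition_def Fubini'[OF m2, symmetric] using mext0X[OF f]
 by (intro ncong) (simp add: ncmult mcongs[OF sets_P refl])
 show "(%w. nl (%t. h t * ext0 f (X (en t) w))) : bm (PS x)"
 using m2 by (rule lborel.borel_measurable_nn_integral)
qed

lemma RR_eq:
 assumes f: "f : Bor"
 shows "RR a f x = sl {0..} (%t. ee (- a * t) * PT (en t) f x)"
proof -
 have "RR a f x = nn (PS x) (%w. nl (%t. ee (- a * t) * ind {0..} t * ext0 f (X (en t) w)))"
 unfolding resolvent_def
 proof (intro ncong)
 fix w and t :: real
 show "ee (- a * t) * ext0 f (X (en t) w) * ind {t. 0 <= t & en t < lifetime X w} t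
 = ee (- a * t) * ind {0..} t * ext0 f (X (en t) w)"
 by (cases "X (en t) w") (auto simp: lt_iff split: spind)
 qed
 thus ?thesis by (subst (asm) expectation_time_integral(1)) (simp_all add: f mult_ac)
qed

lemma mPTp:
 assumes f: "f : Bor"
 shows "(%p. PT (en (fst p)) f (snd p)) : bm (borel OM borel)"
 using mcomp[OF mPair[OF mcomp[OF mfst menn] msnd] measurable_PT_pair[OF f]]
 by simp

lemma measurable_RR[measurable]:
 assumes f: "f : Bor"
 shows "RR a f : Bor"
proof -
 note [measurable] = mcomp[OF mPair[OF msnd mfst] mPTp[OF f], simplified]
 have "(%x. nl (%t. ee (- a * t) * PT (en t) f x * ind {0..} t)) : Bor"
 by (rule lborel.borel_measurable_nn_integral) (unfold split_beta', measurable)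
 moreover have "RR a f = (%x. nl (%t. ee (- a * t) * PT (en t) f x * ind {0..} t))"
 by (rule ext) (rule RR_eq[OF f])
 ultimately show ?thesis by (simp only:)
qed

lemma RR_mono: "(!!y. f y <= g y) ==> RR a f x <= RR a g x"
proof -
 assume fg: "!!y. f y <= g y"
 have "ext0 f z <= ext0 g z" for z using fg by (cases z) auto
 thus ?thesis unfolding resolvent_def by (intro nmono mrmono mlmono) auto
qed

lemma RR_antimono: "a <= b ==> RR b f x <= RR a f x"
 unfolding resolvent_def
 by (intro nmono) (auto split: spind intro!: mrmono ennreal_leI)

lemma RR_const_le:
 assumes f: "f : Bor" "!!y. f y <= c" and a: "0 < a"
 shows "RR a f x <= c * en (1 / a)"
proof -
 have "RR a f x <= nl (%t. c * (ee (- a * t) * ind {0..} t))"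
 unfolding RR_eq[OF f(1)] by (intro nmono) (auto split: spind simp: mult.commute[of c] intro!: mlmono PT_const_le f(2))
 also have "... = c * en (1 / a)"
 using nn_integral_exp_Ici[OF a] by (subst ncmult) auto
 finally show ?thesis .
qed

lemma RR_add:
 assumes [measurable]: "f : Bor" "g : Bor"
 shows "RR a (%y. f y + g y) x = RR a f x + RR a g x"
proof -
 note [measurable] = mPTt[of f x] mPTt[of g x]
 have "RR a (%y. f y + g y) x = nl (%t. ee (- a * t) * PT (en t) f x * ind {0..} t + ee (- a * t) * PT (en t) g x * ind {0..} t)"
 by (subst RR_eq) (auto simp: PT_add distrib_left distrib_right)
 also have "... = RR a f x + RR a g x"
 by (subst nadd) (auto simp: RR_eq)
 finally show ?thesis .
qed

lemma RR_cmult: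
 assumes [measurable]: "f : Bor"
 shows "RR a (%y. c * f y) x = c * RR a f x"
proof -
 note [measurable] = mPTt[of f x]
 have "RR a (%y. c * f y) x = nl (%t. c * (ee (- a * t) * PT (en t) f x * ind {0..} t))"
 by (subst RR_eq) (auto simp: PT_cmult mult_ac)
 also have "... = c * RR a f x"
 by (subst ncmult) (auto simp: RR_eq)
 finally show ?thesis .
qed

lemma RR_SUP:
 assumes f: "!!n. f n : Bor" "incseq f"
 shows "RR a (%y. SUP n. f n y) x = (SUP n. RR a (f n) x)"
proof -
 note [measurable] = f(1) mPTt[OF f(1)]
 have i: "PT t (f n) x <= PT t (f (Suc n)) x" for t n
 using incseq_SucD[OF f(2), of n] by (intro PT_mono) (simp add: le_fun_def)
 have "RR a (%y. SUP n. f n y) x = nl (%t. (SUP n. ee (- a * t) * PT (en t) (f n) x * ind {0..} t))"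
 by (subst RR_eq) (auto simp: PT_SUP[OF f] SUPml SUPmr)
 also have "... = (SUP n. nl (%t. ee (- a * t) * PT (en t) (f n) x * ind {0..} t))"
 by (intro nmcSUP incseq_SucI le_funI)
 (auto split: spind intro!: mlmono i)
 also have "... = (SUP n. RR a (f n) x)" by (simp add: RR_eq f)
 finally show ?thesis .
qed

lemma AE_pos_time: "AE t in lborel. 0 <= t --> 0 < (t::real)"
proof -
 have "AE t in lborel. t ~= (0::real)" by (rule AE_lborel_singleton)
 thus ?thesis by eventually_elim auto
qed

lemma PT_RR:
 assumes f: "f : Bor" and s: "0 <= s"
 shows "PT (en s) (RR a f) x = sl {0..} (%t. ee (- a * t) * PT (en (s + t)) f x)"
proof -
 note [measurable] = mPTp[OF f]
 have "RR a f = (%y. nl (%t. ee (- a * t) * ind {0..} t * PT (en t) f y))"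
 by (simp add: fun_eq_iff RR_eq[OF f] mult_ac)
 hence "PT (en s) (RR a f) x = nl (%t. PT (en s) (%y. ee (- a * t) * ind {0..} t * PT (en t) f y) x)"
 by (simp only:) (rule PT_nn_integral, unfold split_beta', measurable)
 also have "... = sl {0..} (%t. ee (- a * t) * PT (en (s + t)) f x)"
 using s by (intro ncong) (simp add: PT_cmult measurable_PT[OF f] PT_semigroup[OF f] mult_ac PT_zero ennreal_plus[symmetric] del: ennreal_plus split: spind)
 finally show ?thesis .
qed

lemma RR_RR:
 assumes f: "f : Bor"
 shows "RR b (RR a f) x = sl {0..} (%s. ee (- b * s) * sl {0..} (%t. ee (- a * t) * PT (en (s + t)) f x))"
 unfolding RR_eq[OF measurable_RR[OF f]]
 by (intro ncong) (auto simp: PT_RR[OF f] split: spind)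

lemma RR_split:
 assumes f: "f : Bor" and s: "0 <= s"
 shows "RR a f x = sl {0..<s} (%t. ee (- a * t) * PT (en t) f x) + ee (- a * s) * PT (en s) (RR a f) x"
proof -
 note [measurable] = mPTt[OF f, of x]
 have "RR a f x = nl (%t. ee (- a * t) * PT (en t) f x * ind {0..<s} t + ee (- a * t) * PT (en t) f x * ind {s..} t)"
 unfolding RR_eq[OF f] using s by (intro ncong) (auto split: spind)
 also have "... = sl {0..<s} (%t. ee (- a * t) * PT (en t) f x) + sl {s..} (%t. ee (- a * t) * PT (en t) f x)"
 by (rule nadd) measurable
 also have "sl {s..} (%t. ee (- a * t) * PT (en t) f x) =
 (nl (%t. ee (- a * (s + 1 * t)) * PT (en (s + 1 * t)) f x * ind {s..} (s + 1 * t)))"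
 by (subst naffine[of _ 1 s]) auto
 also have "... = nl (%t. ee (- a * s) * (ee (- a * t) * PT (en (s + t)) f x * ind {0..} t))"
 proof (intro ncong)
 fix t :: real
 have "exp (- a * (s + 1 * t)) = exp (- a * s) * exp (- a * t)" by (simp add: exp_add[symmetric] algebra_simps)
 hence "ee (- a * (s + 1 * t)) = ee (- a * s) * ee (- a * t)"
 by (simp only: ennreal_mult exp_ge_zero)
 thus "ee (- a * (s + 1 * t)) * PT (en (s + 1 * t)) f x * ind {s..} (s + 1 * t) =
 ee (- a * s) * (ee (- a * t) * PT (en (s + t)) f x * ind {0..} t)"
 by (cases "0 <= t") (simp_all add: mult.assoc)
 qed
 also have "... = ee (- a * s) * PT (en s) (RR a f) x"
 unfolding PT_RR[OF f s] by (rule ncmult) measurable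
 finally show ?thesis .
qed

lemma PT_RR_le:
 assumes f: "f : Bor" and s: "0 <= s"
 shows "ee (- a * s) * PT (en s) (RR a f) x <= RR a f x"
 using RR_split[OF assms, of a x] by simp

lemma RR_resolvent:
 assumes f: "f : Bor" and c: "a < b"
 shows "RR a f x = en (b - a) * RR b (RR a f) x + RR b f x"
proof -
 have "en (b - a) * RR b (RR a f) x + RR b f x = RR a f x"
 unfolding RR_RR[OF f] RR_eq[OF f] by (rule laplace_convolution[OF mPTt[OF f] c])
 thus ?thesis ..
qed

lemma RR_commute:
 assumes f: "f : Bor"
 shows "RR b (RR a f) x = RR a (RR b f) x"
proof -
 note [measurable] = mPTt[OF f, of x]
 let ?h = "%s t. ee (- b * s) * ind {0..} s * (ee (- a * t) * PT (en (s + t)) f x * ind {0..} t)"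
 have A: "RR b (RR a f) x = nl (%s. nl (%t. ?h s t))"
 unfolding RR_RR[OF f] by (intro ncong) (subst ncmult, auto simp: mult_ac)
 have "RR a (RR b f) x = nl (%t. nl (%s. ?h s t))"
 unfolding RR_RR[OF f]
 proof (intro ncong)
 fix t :: real
 have "nl (%s. ?h s t) = nl (%s. (ee (- a * t) * ind {0..} t) * (ee (- b * s) * PT (en (t + s)) f x * ind {0..} s))"
 by (intro ncong) (auto simp: mult_ac add.commute)
 also have "... = (ee (- a * t) * ind {0..} t) * sl {0..} (%s. ee (- b * s) * PT (en (t + s)) f x)"
 by (rule ncmult) measurable
 finally show "ee (- a * t) * sl {0..} (%s. ee (- b * s) * PT (en (t + s)) f x) * ind {0..} t = nl (%s. ?h s t)"
 by (simp add: mult_ac)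
 qed
 also have "... = nl (%s. nl (%t. ?h s t))"
 by (rule lborel_pair.Fubini') (unfold split_beta', measurable)
 finally show ?thesis using A by simp
qed

lemma RR_excessive_measure:
 assumes f[measurable]: "f : Bor" and a: "0 < a"
 shows "nn m (%x. RR a f x) <= en (1 / a) * nn m (%x. f x)"
proof -
 interpret pair_sigma_finite m "lborel :: real measure" ..
 note [measurable] = mcomp[OF mPair[OF msnd mfst] mPTp[OF f], simplified]
 have ms: "sets (m OM lborel) = sets (borel OM borel)" by (rule sets_pair_measure_cong) (auto simp: sets_m)
 have "nn m (%x. RR a f x) = nn m (%x. nl (%t. ee (- a * t) * ind {0..} t * PT (en t) f x))"
 by (simp add: RR_eq[OF f] mult_ac)
 also have "... = nl (%t. nn m (%x. ee (- a * t) * ind {0..} t * PT (en t) f x))"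
 proof (rule Fubini'[symmetric])
 show "(%(x, t). ee (- a * t) * ind {0..} t * PT (en t) f x) : bm (m OM lborel)"
 unfolding mcongs[OF ms refl] split_beta' by measurable
 qed
 also have "... <= nl (%t. nn m (%x. f x) * (ee (- a * t) * ind {0..} t))"
 proof (intro nmono)
 fix t :: real
 have "nn m (%x. ee (- a * t) * ind {0..} t * PT (en t) f x) = ee (- a * t) * ind {0..} t * nn m (%x. PT (en t) f x)"
 by (rule ncmult) (simp add: meas_m)
 also have "... <= ee (- a * t) * ind {0..} t * nn m (%x. f x)"
 by (intro mlmono PT_excessive_measure) auto
 finally show "nn m (%x. ee (- a * t) * ind {0..} t * PT (en t) f x) <= nn m (%x. f x) * (ee (- a * t) * ind {0..} t)"
 by (simp add: mult_ac)
 qed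
 also have "... = nn m (%x. f x) * en (1 / a)"
 using nn_integral_exp_Ici[OF a] by (subst ncmult) auto
 finally show ?thesis by (simp add: mult.commute)
qed

section \<open>Excessive functions\<close>

lemma excessive_measurable: "excessive X P q ==> q : Bor"
 by (simp add: excessive_def)

lemma excessive_RR_le:
 assumes q: "excessive X P q" and a: "0 < a"
 shows "en a * RR a q x <= q x"
proof -
 have "(SUP a\<in>{0<..}. en a * RR a q x) = q x" using q by (simp add: excessive_def)
 thus ?thesis using a SUP_upper[of a "{0<..}" "%a. en a * RR a q x"] by simp
qed

text \<open>The resolvent equation expresses \<open>RR a q\<close> through \<open>RR b\<close>;
  bounding the inner \<open>a * RR a q\<close> by \<open>q\<close> leaves the coefficient
  \<open>(b - a) + a = b\<close>.\<close>

lemma supermedian_RR_mono: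
 assumes [measurable]: "q : Bor" and q: "!!a x. 0 < a ==> ennreal a * RR a q x <= q x"
 and ab: "0 < a" "a <= b"
 shows "en a * RR a q x <= en b * RR b q x"
proof (cases "a = b")
 case False
 hence lt: "a < b" using ab by simp
 have "en a * RR a q x = en (b - a) * RR b (%y. en a * RR a q y) x + en a * RR b q x"
 by (subst RR_resolvent[OF _ lt]) (auto simp: RR_cmult distrib_left mult_ac)
 also have "... <= en (b - a) * RR b q x + en a * RR b q x"
 by (intro add_right_mono mlmono RR_mono q ab) auto
 also have "... = en b * RR b q x"
 using lt ab by (simp add: distrib_right[symmetric] ennreal_plus[symmetric] del: ennreal_plus)
 finally show ?thesis .
qed simp

lemma excessive_SUP_nat:
 assumes q: "excessive X P q"
 shows "(SUP n. en (real (Suc n)) * RR (real (Suc n)) q x) = q x"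
 and "incseq (%n x. en (real (Suc n)) * RR (real (Suc n)) q x)"
proof -
 note qm = excessive_measurable[OF q] and qle = excessive_RR_le[OF q]
 show "(SUP n. en (real (Suc n)) * RR (real (Suc n)) q x) = q x"
 proof (rule antisym)
 show "(SUP n. en (real (Suc n)) * RR (real (Suc n)) q x) <= q x"
 by (intro SUP_least qle) simp
 have "q x = (SUP a\<in>{0<..}. en a * RR a q x)" using q by (simp add: excessive_def)
 also have "... <= (SUP n. en (real (Suc n)) * RR (real (Suc n)) q x)"
 proof (rule SUP_least)
 fix a :: real assume "a : {0<..}"
 moreover obtain n :: nat where "a <= real n" using real_arch_simple by blast
 ultimately have "en a * RR a q x <= en (real (Suc n)) * RR (real (Suc n)) q x"
 by (intro supermedian_RR_mono qm qle) auto
 thus "en a * RR a q x <= (SUP n. en (real (Suc n)) * RR (real (Suc n)) q x)"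
 by (rule SUP_upper2[rotated]) simp
 qed
 finally show "q x <= (SUP n. en (real (Suc n)) * RR (real (Suc n)) q x)" .
 qed
 show "incseq (%n x. en (real (Suc n)) * RR (real (Suc n)) q x)"
 by (intro incseq_SucI le_funI supermedian_RR_mono qm qle) auto
qed

lemma excessive_potential:
 assumes f: "f : Bor"
 shows "excessive X P (RR 0 f)"
 unfolding excessive_def
proof (intro conjI allI measurable_RR[OF f])
 fix x
 note [measurable] = mPTt[OF f, of x]
 have eq: "en b * RR b (RR 0 f) x = sl {0..} (%r. en (1 - exp (- b * r)) * PT (en r) f x)" if b: "0 < b" for b
 proof -
 have "RR b (RR 0 f) x = sl {0..} (%r. en (exp (- 0 * r) * ((1 - exp (- (b - 0) * r)) / (b - 0))) * PT (en r) f x)"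
 unfolding RR_RR[OF f] by (rule laplace_double[OF mPTt[OF f] b])
 hence "en b * RR b (RR 0 f) x = nl (%r. en b * (en ((1 - exp (- b * r)) / b) * PT (en r) f x * ind {0..} r))"
 by (subst ncmult) auto
 also have "... = sl {0..} (%r. en (1 - exp (- b * r)) * PT (en r) f x)"
 using b by (intro ncong) (auto split: spind simp: mult.assoc[symmetric] ennreal_mult'[symmetric])
 finally show ?thesis .
 qed
 show "(SUP a\<in>{0<..}. en a * RR a (RR 0 f) x) = RR 0 f x"
 proof (rule antisym)
 show "(SUP a\<in>{0<..}. en a * RR a (RR 0 f) x) <= RR 0 f x"
 proof (rule SUP_least)
 fix a :: real assume "a : {0<..}"
 hence "RR 0 f x = en (a - 0) * RR a (RR 0 f) x + RR a f x" by (intro RR_resolvent[OF f]) auto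
 thus "en a * RR a (RR 0 f) x <= RR 0 f x" by simp
 qed
 let ?h = "%n r. en (1 - exp (- real (Suc n) * r)) * PT (en r) f x * ind {0..} r"
 have "RR 0 f x = nl (%r. (SUP n. ?h n r))"
 unfolding RR_eq[OF f]
 proof (rule ncongAE)
 show "AE r in lborel. ee (- 0 * r) * PT (en r) f x * ind {0..} r = (SUP n. ?h n r)"
 using AE_pos_time
 proof eventually_elim
 case (elim r)
 show ?case
 proof (cases "0 <= r")
 case True
 hence r: "0 < r" using elim by simp
 have "(%n. 1 - exp (- real (Suc n) * r)) ->> 1 - 0"
 proof (intro tendsto_intros)
 have "(%n. exp (- r) ^ Suc n) ->> 0"
 by (rule LIMSEQ_Suc[OF LIMSEQ_realpow_zero]) (use r in auto)
 moreover have "exp (- r) ^ Suc n = exp (- real (Suc n) * r)" for n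
 by (subst exp_of_nat_mult[symmetric]) (simp add: algebra_simps)
 ultimately show "(%n. exp (- real (Suc n) * r)) ->> 0" by (simp only:)
 qed
 hence "(%n. en (1 - exp (- real (Suc n) * r))) ->> en 1" by (intro tendsto_ennrealI) simp
 moreover have "incseq (%n. en (1 - exp (- real (Suc n) * r)))"
 using r by (intro incseq_SucI ennreal_leI) (auto simp: algebra_simps)
 ultimately have "(SUP n. en (1 - exp (- real (Suc n) * r))) = 1"
 by (metis LIMSEQ_SUP LIMSEQ_unique ennreal_1)
 thus ?thesis using True by (simp add: SUPmr[symmetric])
 qed simp
 qed
 qed
 also have "... = (SUP n. nl (%r. ?h n r))"
 by (intro nmcSUP incseq_SucI le_funI)
 (auto split: spind intro!: mlmono mrmono ennreal_leI simp: algebra_simps)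
 also have "... = (SUP n. en (real (Suc n)) * RR (real (Suc n)) (RR 0 f) x)"
 by (subst eq) auto
 also have "... <= (SUP a\<in>{0<..}. en a * RR a (RR 0 f) x)"
 by (intro SUP_mono) (auto intro!: bexI[of _ "real (Suc _)"])
 finally show "RR 0 f x <= (SUP a\<in>{0<..}. en a * RR a (RR 0 f) x)" .
 qed
qed

end

lemma L2_boundedI:
 assumes f: "f : bm m" "!!x. 0 <= f x" "!!x. f x <= c" "integrable m f"
 shows "f : L2 m"
proof -
 have c: "0 <= c" using f(2,3) order_trans by blast
 have "integrable m (%x. c * f x)" by (intro integrable_mult_right f)
 hence "integrable m (%x. (f x)\<^sup>2)"
 by (rule Bochner_Integration.integrable_bound)
 (use f c in \<open>auto simp: power2_eq_square abs_mult intro!: mrmono\<close>)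
 thus ?thesis using f by (simp add: L2_def)
qed

lemma L2_pos: "z : L2 m ==> (%x. max (z x) 0) : L2 m"
proof -
 assume z: "z : L2 m"
 have m: "(%x. max (z x) 0) : bm m" using L2_measurable[OF z] by measurable
 have "integrable m (%x. (max (z x) 0)\<^sup>2)"
 proof (rule Bochner_Integration.integrable_bound)
 show "integrable m (%x. (z x)\<^sup>2)" using z by (simp add: L2_def)
 show "(%x. (max (z x) 0)\<^sup>2) : bm m" using m by measurable
 qed (auto simp: max_def)
 thus ?thesis using m by (simp add: L2_def)
qed

context symmetric_hunt_process
begin

text \<open>By the resolvent equation \<open>RR g k\<close> is the \<open>d\<close>-potential of the
  nonnegative function \<open>v\<close>. Boundedness of \<open>k\<close> keeps \<open>RR d k\<close>
  finite, as the cancellation in \<open>ennreal\<close> requires. Through this identity excessive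
  functions are reached by potentials of nonnegative functions.\<close>

lemma supermedian_split:
 assumes k[measurable]: "k : Bor" and bd: "!!x. k x <= en c" and ab: "0 < d" "d < g"
 and le: "!!x. en (g - d) * RR g k x <= k x"
 defines "v \<equiv> %x. k x - en (g - d) * RR g k x"
 shows "v : Bor" "!!x. v x <= k x" "!!x. RR g k x = RR d v x"
proof -
 show vm[measurable]: "v : Bor" unfolding v_def by measurable
 show "v x <= k x" for x by (simp add: v_def diff_le_self_ennreal)
 fix x
 have kv: "k = (%x. v x + en (g - d) * RR g k x)"
 proof
 fix x
 show "k x = v x + en (g - d) * RR g k x"
 using le[of x] unfolding v_def by (simp add: diff_add_cancel_ennreal)
 qed
 let ?Y = "en (g - d) * RR d (RR g k) x"
 have "RR d k x = RR d v x + ?Y"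
 by (subst kv) (simp add: RR_add RR_cmult)
 moreover have "RR d k x = ?Y + RR g k x"
 using RR_resolvent[OF k ab(2), of x] by (simp add: RR_commute[OF k])
 moreover have "RR d k x < \<top>"
 using RR_const_le[OF k bd ab(1), of x] by (auto simp: ennreal_mult[symmetric] intro: le_less_trans simp: enmlt)
 ultimately have "?Y + RR d v x = ?Y + RR g k x" "?Y ~= \<top>" by (auto simp: add.commute)
 thus "RR g k x = RR d v x" by (simp add: ennreal_add_left_cancel)
qed

text \<open>Excessiveness is defined through the resolvent. For the truncation \<open>k\<close> of
  \<open>q\<close> at \<open>j\<close>, the function \<open>RR g k\<close> is a
  \<open>d\<close>-potential for every \<open>d < g\<close> and so decreases under
  \<open>exp (- d * s) * P_s\<close>. Letting \<open>d\<close> tend to 0, and then \<open>j\<close>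
  and \<open>g\<close> to infinity, gives the claim for the semigroup.\<close>

lemma excessive_PT_le:
 assumes q: "excessive X P q" and s: "0 <= s"
 shows "PT (en s) q x <= q x"
proof -
 note qm[measurable] = excessive_measurable[OF q] and qle = excessive_RR_le[OF q]
 have 1: "PT (en s) (%y. en g * RR g (%y. min (q y) (of_nat j)) y) x <= en g * RR g (%y. min (q y) (of_nat j)) x"
 (is "PT _ (%y. _ * RR g ?k y) x <= _") if g: "0 < g" for g and j :: nat
 proof -
 have km[measurable]: "?k : Bor" by measurable
 have bd: "?k y <= en (real j)" for y by (simp add: ennat)
 have kle: "en g * RR g ?k y <= ?k y" for y
 proof (rule min.boundedI)
 show "en g * RR g ?k y <= q y"
 by (rule order_trans[OF mlmono[OF RR_mono] qle[OF g]]) auto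
 have "en g * RR g ?k y <= en g * (of_nat j * en (1 / g))"
 by (intro mlmono RR_const_le) (use g in auto)
 also have "... = of_nat j" using g by (simp add: mult.left_commute[of "en g"] ennreal_mult''[symmetric])
 finally show "en g * RR g ?k y <= of_nat j" .
 qed
 have "ee (- d * s) * PT (en s) (RR g ?k) x <= RR g ?k x" if d: "0 < d" "d < g" for d
 proof -
 have "en (g - d) * RR g ?k y <= ?k y" for y
 proof -
 have "en (g - d) * RR g ?k y <= en g * RR g ?k y"
 using d by (intro mrmono ennreal_leI) simp_all
 thus ?thesis using kle by (rule order_trans)
 qed
 note S = supermedian_split[OF km bd d this]
 have "RR g ?k = RR d (%y. ?k y - en (g - d) * RR g ?k y)" by (rule ext) (rule S(3))
 thus ?thesis using PT_RR_le[OF S(1) s, of d x] by simp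
 qed
 note A = this
 \<comment> \<open>The denominator starts at 2, so that each rate is strictly below
   \<open>g\<close>.\<close>
 have "(%n. ee (- (g / real (Suc (Suc n))) * s) * PT (en s) (RR g ?k) x) ->> ee (- 0 * s) * PT (en s) (RR g ?k) x"
 proof (intro tendsto_mult_ennreal tendsto_ennrealI tendsto_exp tendsto_mult tendsto_minus tendsto_const)
 show "(%n. g / real (Suc (Suc n))) ->> 0"
 using LIMSEQ_Suc[OF LIMSEQ_Suc[OF lim_const_over_n[of g]]] by simp
 qed auto
 hence "ee (- 0 * s) * PT (en s) (RR g ?k) x <= RR g ?k x"
 proof (rule LIMSEQ_le_const2, intro exI[of _ 0] allI impI)
 fix n show "ee (- (g / real (Suc (Suc n))) * s) * PT (en s) (RR g ?k) x <= RR g ?k x"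
 using g mult_strict_left_mono[of 1 "real (Suc (Suc n))" g] by (intro A) (auto simp: divide_less_eq)
 qed
 thus ?thesis by (simp add: PT_cmult mlmono)
 qed
 have 2: "PT (en s) (%y. en g * RR g q y) x <= q x" if g: "0 < g" for g
 proof -
 have inc: "incseq (%(j::nat) y. min (q y) (of_nat j))"
 by (intro incseq_SucI le_funI min.mono) auto
 have sup: "q = (%y. SUP j::nat. min (q y) (of_nat j))"
 by (simp add: fun_eq_iff inf_SUP[symmetric] ennreal_SUP_of_nat_eq_top inf_min[symmetric])
 have R: "en g * RR g q y = (SUP j::nat. en g * RR g (%y. min (q y) (of_nat j)) y)" for y
 by (subst sup) (simp add: RR_SUP[OF _ inc] SUPml)
 have "PT (en s) (%y. en g * RR g q y) x = (SUP j::nat. PT (en s) (%y. en g * RR g (%y. min (q y) (of_nat j)) y) x)"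
 unfolding R
 proof (rule PT_SUP)
 show "incseq (%j y. en g * RR g (%y. min (q y) (of_nat j)) y)"
 by (intro incseq_SucI le_funI mlmono RR_mono min.mono) auto
 qed measurable
 also have "... <= q x"
 proof (rule SUP_least)
 fix j :: nat
 have "en g * RR g (%y. min (q y) (of_nat j)) x <= en g * RR g q x"
 by (intro mlmono RR_mono) auto
 thus "PT (en s) (%y. en g * RR g (%y. min (q y) (of_nat j)) y) x <= q x"
 using 1[OF g, of j] qle[OF g, of x] by (meson order_trans)
 qed
 finally show ?thesis .
 qed
 have "PT (en s) q x = PT (en s) (%y. SUP n. en (real (Suc n)) * RR (real (Suc n)) q y) x"
 by (simp only: excessive_SUP_nat(1)[OF q])
 also have "... = (SUP n. PT (en s) (%y. en (real (Suc n)) * RR (real (Suc n)) q y) x)"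
 by (rule PT_SUP[OF _ excessive_SUP_nat(2)[OF q]]) measurable
 also have "... <= q x" by (intro SUP_least 2) simp
 finally show ?thesis .
qed

section \<open>Transience\<close>

context
 fixes f :: "'e => real" and c d :: real
 assumes f[measurable]: "f : Bor" and f0: "!!x. 0 <= f x" and fc: "!!x. f x <= c"
 and fi: "integrable m f" and d: "0 < d"
begin

private definition "U x = RR d (%x. en (f x)) x"
private definition "u x = enn2real (U x)"

private lemma c0: "0 <= c" using f0 fc order_trans by blast

private lemma U_bound: "U x <= en (c / d)"
proof -
 have "U x <= en c * en (1 / d)"
 unfolding U_def by (rule RR_const_le) (use d fc in \<open>auto intro: ennreal_leI\<close>)
 thus ?thesis using d c0 by (simp add: ennreal_mult[symmetric])
qed

private lemma U_u: "en (u x) = U x"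
 using U_bound[of x] unfolding u_def by (simp add: le_less_trans)

private lemma u_meas[measurable]: "u : Bor"
 unfolding u_def U_def by measurable

private lemma u0: "0 <= u x" by (simp add: u_def)

private lemma uc: "u x <= c / d"
 using U_bound[of x] c0 d by (simp add: U_u[symmetric] ennreal_le_iff)

private lemma u_int: "integrable m u"
proof (rule integrableI_nonneg)
 show "u : bm m" by (simp add: meas_m)
 have "nn m (%x. en (u x)) <= en (1 / d) * nn m (%x. en (f x))"
 unfolding U_u U_def by (rule RR_excessive_measure[OF _ d]) measurable
 also have "... < infy" using fi f0 by (auto simp: enmlt neqint)
 finally show "nn m (%x. en (u x)) < infy" .
qed (simp add: u0)

private lemma u_L2: "u : L2 m"
 by (rule L2_boundedI[OF _ u0 uc u_int]) (simp add: meas_m)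

private lemma f_L2: "f : L2 m"
 by (rule L2_boundedI[OF _ f0 fc fi]) (simp add: meas_m)

text \<open>\<open>RR_split\<close> with finite values: the part of the potential collected before
  time \<open>i\<close> is the difference of \<open>u\<close> and its discounted evolution.\<close>

private lemma V_eq:
 assumes e: "0 <= i"
 shows "AE x in m. sl {0..<i} (%t. ee (- d * t) * PT (en t) (%x. en (f x)) x) = en (u x - exp (- d * i) * T i u x)"
 and "AE x in m. exp (- d * i) * T i u x <= u x"
proof -
 have *: "AE x in m. sl {0..<i} (%t. ee (- d * t) * PT (en t) (%x. en (f x)) x) = en (u x - exp (- d * i) * T i u x) & exp (- d * i) * T i u x <= u x"
 using associated_nn[OF u_L2 u0 e]
 proof eventually_elim
 case (elim x)
 let ?V = "sl {0..<i} (%t. ee (- d * t) * PT (en t) (%x. en (f x)) x)"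
 have "U x = ?V + ee (- d * i) * PT (en i) U x"
 unfolding U_def by (subst RR_split[OF _ e]) auto
 moreover have "PT (en i) U x = en (T i u x)" using elim(1) by (simp add: U_u[abs_def] cong: if_cong)
 ultimately have eq: "en (u x) = ?V + en (exp (- d * i) * T i u x)"
 using elim(2) by (simp add: U_u ennreal_mult)
 have "?V <= en (u x)" unfolding eq by simp
 hence fin: "?V < \<top>" by (rule le_less_trans) simp
 then obtain w where w: "?V = en w" "0 <= w" by (cases ?V) auto
 hence "u x = w + exp (- d * i) * T i u x"
 using eq elim(2) u0[of x] by (simp add: ennreal_plus[symmetric] del: ennreal_plus)
 thus ?case using w by simp
 qed
 thus "AE x in m. sl {0..<i} (%t. ee (- d * t) * PT (en t) (%x. en (f x)) x) = en (u x - exp (- d * i) * T i u x)"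
 "AE x in m. exp (- d * i) * T i u x <= u x"
 by - (rule evmono[OF *], erule conjunct1, rule evmono[OF *], erule conjunct2)
qed

private lemma V_inner:
 assumes e: "0 < i" and z: "z : L2 m" "!!x. 0 <= z x" "z : Bor"
 shows "en (ip m z (%x. u x - exp (- d * i) * T i u x)) = sl {0..<i} (%t. ee (- d * t) * en (ip m z (T t f)))"
proof -
 interpret pair_sigma_finite m "lborel :: real measure" ..
 note [measurable] = z(3) mcomp[OF mPair[OF msnd mfst] mPTp[of "%x. en (f x)"], simplified]
 have ms: "sets (m OM lborel) = sets (borel OM borel)" by (rule sets_pair_measure_cong) (auto simp: sets_m)
 let ?v = "%x. u x - exp (- d * i) * T i u x"
 let ?p = "%t x. PT (en t) (%x. en (f x)) x"
 have vL: "?v : L2 m" using L2_comb[OF u_L2 T_L2[OF _ u_L2], of i 1 "- exp (- d * i)"] e by simp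
 have "en (ip m z ?v) = nn m (%x. en (z x * ?v x))"
 unfolding L2_inner_def
 using V_eq(2)[of i] z(2) e by (intro neqint[symmetric] L2_integrable_mult z vL) (auto elim!: evmono)
 also have "... = nn m (%x. nl (%t. en (z x) * (ee (- d * t) * ind {0..<i} t * ?p t x)))"
 proof (rule ncongAE)
 show "AE x in m. en (z x * ?v x) = nl (%t. en (z x) * (ee (- d * t) * ind {0..<i} t * ?p t x))"
 using V_eq[OF less_imp_le[OF e]]
 proof eventually_elim
 case (elim x)
 note [measurable] = mPTt[of "%x. en (f x)" x]
 have "nl (%t. en (z x) * (ee (- d * t) * ind {0..<i} t * ?p t x)) = en (z x) * nl (%t. ee (- d * t) * ind {0..<i} t * ?p t x)"
 by (rule ncmult) measurable
 also have "nl (%t. ee (- d * t) * ind {0..<i} t * ?p t x) = en (?v x)"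
 using elim(1) by (simp add: mult_ac)
 finally show ?case using elim(2) z(2)[of x] by (simp add: ennreal_mult)
 qed
 qed
 also have "... = nl (%t. nn m (%x. en (z x) * (ee (- d * t) * ind {0..<i} t * ?p t x)))"
 proof (rule Fubini'[symmetric])
 show "(%(x, t). en (z x) * (ee (- d * t) * ind {0..<i} t * ?p t x)) : bm (m OM lborel)"
 unfolding mcongs[OF ms refl] split_beta' by measurable
 qed
 also have "... = sl {0..<i} (%t. ee (- d * t) * en (ip m z (T t f)))"
 proof (intro ncong)
 fix t :: real
 show "nn m (%x. en (z x) * (ee (- d * t) * ind {0..<i} t * ?p t x)) = ee (- d * t) * en (ip m z (T t f)) * ind {0..<i} t"
 proof (cases "t : {0..<i}")
 case True
 have "nn m (%x. en (z x) * (ee (- d * t) * ind {0..<i} t * ?p t x)) = nn m (%x. ee (- d * t) * en (z x * T t f x))"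
 using associated_nn[OF f_L2 f0, of t] True z(2)
 by (intro ncongAE) (auto elim!: eventually_elim2 simp: ennreal_mult mult_ac)
 also have "... = ee (- d * t) * nn m (%x. en (z x * T t f x))"
 using True z(1) T_L2[of t f] f_L2 L2_measurable by (intro ncmult) (auto intro!: mcomp[OF _ menn] borel_measurable_times)
 also have "nn m (%x. en (z x * T t f x)) = en (ip m z (T t f))"
 unfolding L2_inner_def
 using associated_nn(2)[OF f_L2 f0, of t] True z(2)
 by (intro neqint L2_integrable_mult z T_L2 f_L2) (auto elim!: evmono)
 finally show ?thesis using True by simp
 qed simp
 qed
 finally show ?thesis .
qed

private lemma T_inner_tendsto:
 assumes z: "z : L2 m"
 shows "((%t. ip m z (T t f)) \<longlongrightarrow> ip m z f) (at_right 0)"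
proof (rule tendsto_dist_iff[THEN iffD2], rule tendsto_sandwich[OF _ _ tendsto_const])
 have "((%t. L2_norm m z * L2_norm m (%x. T t f x - f x)) \<longlongrightarrow> L2_norm m z * 0) (at_right 0)"
 by (intro tendsto_intros T_continuous f_L2)
 thus "((%t. L2_norm m z * L2_norm m (%x. T t f x - f x)) \<longlongrightarrow> 0) (at_right 0)" by simp
 show "\<forall>\<^sub>F t in at_right 0. dist (ip m z (T t f)) (ip m z f) <= L2_norm m z * L2_norm m (%x. T t f x - f x)"
 using eventually_at_right_less
 proof eventually_elim
 case (elim t)
 have "ip m z (T t f) - ip m z f = ip m z (%x. T t f x - f x)"
 using elim by (simp add: ip_commute[of m z] ip_diff T_L2 f_L2 z)
 thus ?case unfolding dist_real_def
 using L2_Cauchy_Schwarz[OF z L2_diff[OF T_L2[OF _ f_L2] f_L2], of t] elim by simp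
 qed
qed simp

text \<open>Only a pairing with a fixed \<open>z\<close> is differentiated. By
  \<open>V_inner\<close> the quotient is a discounted time average of \<open>ip m z (T t f)\<close>
  over \<open>[0, i]\<close>, which tends to the value at 0.\<close>

private lemma V_tendsto_nonneg:
 assumes z: "z : L2 m" "!!x. 0 <= z x" "z : Bor"
 shows "((%i. ip m z (%x. u x - exp (- d * i) * T i u x) / i) \<longlongrightarrow> ip m z f) (at_right 0)"
proof -
 let ?W = "%i. ip m z (%x. u x - exp (- d * i) * T i u x)"
 let ?a = "ip m z f"
 have W0: "0 <= ?W i" if "0 <= i" for i
 unfolding L2_inner_def using V_eq(2)[OF that] z(2) by (intro integral_nonneg_AE) (auto elim: evmono)
 have a0: "0 <= ?a" unfolding L2_inner_def using z f0 by (intro integral_nonneg_AE) auto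
 have up: "\<forall>\<^sub>F i in at_right 0. ?W i / i < ?a + l" and low: "\<forall>\<^sub>F i in at_right 0. exp (- d * i) * (?a - l) <= ?W i / i" if l: "0 < l" for l
 proof -
 have "\<forall>\<^sub>F t in at_right 0. dist (ip m z (T t f)) ?a < l / 2"
 using tendstoD[OF T_inner_tendsto[OF z(1)], of "l / 2"] l by simp
 then obtain b where b: "0 < b" "!!t. 0 < t ==> t < b ==> dist (ip m z (T t f)) ?a < l / 2"
 by (auto simp: eventually_at_right_field)
 have main: "?W i / i < ?a + l & exp (- d * i) * (?a - l) <= ?W i / i" if e: "0 < i" "i < b" for i
 proof
 have "en (?W i) <= nl (%t. en (?a + l / 2) * ind {0..<i} t)"
 unfolding V_inner[OF e(1) z]
 proof (rule nmonoAE)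
 show "AE t in lborel. ee (- d * t) * en (ip m z (T t f)) * ind {0..<i} t <= en (?a + l / 2) * ind {0..<i} t"
 using AE_pos_time
 proof eventually_elim
 case (elim t)
 show ?case
 proof (cases "t : {0..<i}")
 case True
 hence t: "0 < t" "t < b" using elim e by auto
 have "ee (- d * t) * en (ip m z (T t f)) <= 1 * en (?a + l / 2)"
 using abs_less_iff[THEN iffD1, OF b(2)[OF t, unfolded dist_real_def]] d t
 by (intro mult_mono ennreal_leI) (auto simp: abs_less_iff)
 thus ?thesis using True by simp
 qed simp
 qed
 qed
 also have "... = en ((?a + l / 2) * i)"
 using a0 l e by (simp add: ncmult ennreal_mult)
 finally have "?W i <= (?a + l / 2) * i" using a0 l e by (simp add: ennreal_le_iff)
 also have "... < (?a + l) * i" using l e by (intro mult_strict_right_mono) auto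
 finally show "?W i / i < ?a + l" using e by (simp add: divide_less_eq)
 show "exp (- d * i) * (?a - l) <= ?W i / i"
 proof (cases "?a - l <= 0")
 case True
 hence "exp (- d * i) * (?a - l) <= 0" by (intro mult_nonneg_nonpos) auto
 also have "0 <= ?W i / i" using W0[of i] e by simp
 finally show ?thesis .
 next
 case False
 have "en (exp (- d * i) * (?a - l) * i) = nl (%t. en (exp (- d * i) * (?a - l)) * ind {0..<i} t)"
 using False e by (simp add: ncmult ennreal_mult)
 also have "... <= en (?W i)"
 unfolding V_inner[OF e(1) z]
 proof (rule nmonoAE)
 show "AE t in lborel. en (exp (- d * i) * (?a - l)) * ind {0..<i} t <= ee (- d * t) * en (ip m z (T t f)) * ind {0..<i} t"
 using AE_pos_time
 proof eventually_elim
 case (elim t)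
 show ?case
 proof (cases "t : {0..<i}")
 case True
 hence t: "0 < t" "t < b" using elim e by auto
 have "?a - l <= ip m z (T t f)" using abs_less_iff[THEN iffD1, OF b(2)[OF t, unfolded dist_real_def]] l by auto
 hence "exp (- d * i) * (?a - l) <= exp (- d * t) * ip m z (T t f)"
 using False True d by (intro mult_mono) auto
 thus ?thesis using True False by (simp add: ennreal_mult'[symmetric] ennreal_leI)
 qed simp
 qed
 qed
 finally have "exp (- d * i) * (?a - l) * i <= ?W i" using W0[of i] e by (simp add: ennreal_le_iff)
 thus ?thesis using e by (simp add: le_divide_eq)
 qed
 qed
 thus "\<forall>\<^sub>F i in at_right 0. ?W i / i < ?a + l" "\<forall>\<^sub>F i in at_right 0. exp (- d * i) * (?a - l) <= ?W i / i"
 using b(1) by (auto simp: eventually_at_right_field)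
 qed
 show ?thesis
 proof (rule order_tendstoI)
 fix r assume r: "?a < r"
 show "\<forall>\<^sub>F i in at_right 0. ?W i / i < r" using up[of "r - ?a"] r by simp
 next
 fix r assume r: "r < ?a"
 define l where "l = (?a - r) / 2"
 have l: "0 < l" using r by (simp add: l_def)
 have "((%i. exp (- d * i) * (?a - l)) \<longlongrightarrow> exp (- d * 0) * (?a - l)) (at_right 0)"
 by (intro tendsto_intros)
 hence "\<forall>\<^sub>F i in at_right 0. r < exp (- d * i) * (?a - l)"
 by (rule order_tendstoD(1)) (use r in \<open>simp add: l_def field_simps\<close>)
 thus "\<forall>\<^sub>F i in at_right 0. r < ?W i / i"
 using low[OF l] by eventually_elim simp
 qed
qed

text \<open>Self-adjointness upgrades a weak identity: it suffices that
  \<open>ip m (L z) u = ip m z (d u - f)\<close> for all \<open>z\<close> in the domain, and this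
  comes from moving the difference quotient of \<open>T\<close> from \<open>z\<close> to
  \<open>u\<close> by symmetry. Positive and negative parts of \<open>z\<close> are treated apart,
  because the limit is computed with nonnegative integrals.\<close>

lemma resolvent_generator:
 shows "u : DL" "AE x in m. L u x = d * u x - f x"
proof -
 have vL: "(%x. u x - exp (- d * i) * T i u x) : L2 m" if "0 <= i" for i
 using L2_comb[OF u_L2 T_L2[OF that u_L2], of 1 "- exp (- d * i)"] by simp
 have w: "(%x. d * u x - f x) : L2 m" using L2_comb[OF u_L2 f_L2, of d "-1"] by simp
 have "ip m (L z) u = ip m z (%x. d * u x - f x)" if zD: "z : DL" for z
 proof -
 have z: "z : L2 m" by (rule DL_L2[OF zD])
 have zm: "z : Bor" using L2_measurable[OF z] by (simp add: meas_m)
 let ?p = "%x. max (z x) 0" and ?n = "%x. max (- z x) 0"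
 have nz: "(%x. - z x) : L2 m" using L2_comb[OF z z, of "-1" 0] by simp
 have pn: "?p : L2 m" "?n : L2 m" using L2_pos[OF z] L2_pos[OF nz] by auto
 have zpn: "ip m z h = ip m ?p h - ip m ?n h" if "h : L2 m" for h
 proof -
 have "z = (%x. ?p x - ?n x)" by (auto simp: max_def)
 hence "ip m z h = ip m (%x. ?p x - ?n x) h" by (rule arg_cong)
 also have "... = ip m ?p h - ip m ?n h" by (rule ip_diff[OF pn that])
 finally show ?thesis .
 qed
 let ?W = "%z i. ip m z (%x. u x - exp (- d * i) * T i u x)"
 have "((%i. ?W ?p i / i - ?W ?n i / i) \<longlongrightarrow> ip m ?p f - ip m ?n f) (at_right 0)"
 using pn zm by (intro tendsto_diff V_tendsto_nonneg) auto
 hence W: "((%i. ?W z i / i) \<longlongrightarrow> ip m z f) (at_right 0)"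
 unfolding zpn[OF f_L2, symmetric]
 proof (rule Lim_transform_eventually)
 show "\<forall>\<^sub>F i in at_right 0. ?W ?p i / i - ?W ?n i / i = ?W z i / i"
 using eventually_at_right_less by eventually_elim (subst zpn[OF vL], auto simp: diff_divide_distrib)
 qed
 \<comment> \<open>\<open>?Q i\<close> is the pairing of \<open>z\<close> with
   \<open>(T i u - u) / i\<close>, written so that its limit can be read off from that of
   \<open>?W z i / i\<close>.\<close>
 let ?Q = "%i. ((exp (d * i) - 1) / i) * ip m z u - exp (d * i) * (?W z i / i)"
 have "((%i. (exp (d * i) - 1) / i) \<longlongrightarrow> d) (at_right 0)" by real_asymp
 hence "(?Q \<longlongrightarrow> d * ip m z u - exp (d * 0) * ip m z f) (at_right 0)"
 by (intro tendsto_intros W)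
 hence Q1: "(?Q \<longlongrightarrow> ip m z (%x. d * u x - f x)) (at_right 0)"
 using ip_comb[OF u_L2 f_L2 z, of d "-1"] by (simp add: ip_commute[of m _ z])
 have "((%i. ip m (L z) u + ip m (gen_err z i) u) \<longlongrightarrow> ip m (L z) u + 0) (at_right 0)"
 proof (intro tendsto_intros)
 show "((%i. ip m (gen_err z i) u) \<longlongrightarrow> 0) (at_right 0)"
 proof (rule tendsto_rabs_zero_cancel, rule tendsto_sandwich[OF _ _ tendsto_const])
 have "((%i. L2_norm m (gen_err z i) * L2_norm m u) \<longlongrightarrow> 0 * L2_norm m u) (at_right 0)"
 by (intro tendsto_intros gen_err_tendsto zD)
 thus "((%i. L2_norm m (gen_err z i) * L2_norm m u) \<longlongrightarrow> 0) (at_right 0)" by simp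
 show "\<forall>\<^sub>F i in at_right 0. \<bar>ip m (gen_err z i) u\<bar> <= L2_norm m (gen_err z i) * L2_norm m u"
 using eventually_at_right_less by eventually_elim (intro L2_Cauchy_Schwarz gen_err_L2 zD u_L2, simp)
 qed simp
 qed
 moreover have "\<forall>\<^sub>F i in at_right 0. ip m (L z) u + ip m (gen_err z i) u = ?Q i"
 using eventually_at_right_less
 proof eventually_elim
 case (elim i)
 note Tz = T_L2[OF less_imp_le[OF elim] z] and Tu = T_L2[OF less_imp_le[OF elim] u_L2]
 have ge: "gen_err z i : L2 m" using gen_err_L2[OF zD] elim by simp
 have "(%x. L z x + gen_err z i x) = (%x. (1/i) * T i z x + (-1/i) * z x)"
 using elim by (auto simp: gen_err_def field_simps)
 hence "ip m (L z) u + ip m (gen_err z i) u = (1/i) * ip m (T i z) u + (-1/i) * ip m z u"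
 using ip_comb[OF L_L2[OF zD] ge u_L2, of 1 1] ip_comb[OF Tz z u_L2, of "1/i" "-1/i"] by simp
 also have "ip m (T i z) u = ip m z (T i u)" by (rule T_symmetric[OF z u_L2 elim])
 finally have LT: "ip m (L z) u + ip m (gen_err z i) u = (1/i) * ip m z (T i u) + (-1/i) * ip m z u" .
 have "?W z i = ip m z u - exp (- d * i) * ip m z (T i u)"
 using ip_comb[OF u_L2 Tu z, of 1 "- exp (- d * i)"] by (simp add: ip_commute[of m _ z])
 hence "exp (d * i) * ?W z i = exp (d * i) * ip m z u - (exp (d * i) * exp (- d * i)) * ip m z (T i u)"
 by (simp add: right_diff_distrib mult.assoc)
 hence "exp (d * i) * ?W z i = exp (d * i) * ip m z u - ip m z (T i u)"
 by (simp add: exp_add[symmetric])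
 hence Q: "?Q i = ((exp (d * i) - 1) * ip m z u - (exp (d * i) * ip m z u - ip m z (T i u))) / i"
 by (simp only: times_divide_eq_left times_divide_eq_right diff_divide_distrib[of "_ * _"])
 note Q
 also have "((exp (d * i) - 1) * ip m z u - (exp (d * i) * ip m z u - ip m z (T i u))) / i = ((1/i) * ip m z (T i u) + (-1/i) * ip m z u)"
 by (simp add: left_diff_distrib diff_divide_distrib)
 finally show ?case using LT by (simp only:)
 qed
 ultimately have "(?Q \<longlongrightarrow> ip m (L z) u) (at_right 0)" by (simp add: tendsto_cong)
 thus ?thesis using Q1 by (rule tendsto_unique[rotated]) simp
 qed
 hence "ALL z:DL. ip m (L z) u = ip m z (%x. d * u x - f x)" by (rule ballI)
 hence "u : DL & (AE x in m. L u x = d * u x - f x)"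
 by (rule iffD1[OF bspec[OF bspec[OF conjunct2[OF conjunct2[OF L_self_adjoint[unfolded self_adjoint_def]]] u_L2] w]])
 thus "u : DL" "AE x in m. L u x = d * u x - f x" by auto
qed

text \<open>Places the potential in the form domain, so that the transience inequality can be
  applied to it and its energy can be computed.\<close>

lemma resolvent_form:
 obtains u where "u : Bor" "!!x. en (u x) = RR d (%x. en (f x)) x" "!!x. 0 <= u x"
 "!!x. u x <= c / d" "integrable m u" "u : L2 m" "u : D"
 "!!v. v : D ==> \<E> u v = ip m f v - d * ip m u v"
proof
 show "u : Bor" by (rule u_meas)
 show "en (u x) = RR d (%x. en (f x)) x" "0 <= u x" "u x <= c / d" for x
 using U_u[of x] u0 uc by (simp_all add: U_def)
 show "integrable m u" by (rule u_int)
 show "u : L2 m" by (rule u_L2)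
 show "u : D" using resolvent_generator(1) form_domain by auto
 fix v assume v: "v : D"
 have vL: "v : L2 m" using form v unfolding dirichlet_form_def L2_subspace_def by auto
 have "\<E> u v = ip m (%x. - L u x) v" by (rule form_generator[OF resolvent_generator(1) v])
 also have "... = ip m (%x. 1 * f x + (- d) * u x) v"
 using resolvent_generator(2) L_L2[OF resolvent_generator(1)] L2_comb[OF f_L2 u_L2, of 1 "- d"] L2_measurable[OF vL]
 unfolding L2_inner_def
 proof (intro integral_cong_AE)
 show "AE x in m. - L u x * v x = (1 * f x + - d * u x) * v x"
 using resolvent_generator(2) by eventually_elim (simp only: mult_1, simp)
 qed (auto simp: L2_def meas_m)
 also have "... = ip m f v - d * ip m u v"
 by (subst ip_comb[OF f_L2 u_L2 vL]) simp
 finally show "\<E> u v = ip m f v - d * ip m u v" .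
qed

end

end

section \<open>A strictly positive function with bounded potential\<close>

context symmetric_hunt_process
begin

context
begin

private lemmas form' = form[unfolded dirichlet_form_def]
private lemmas subspace' = conjunct1[OF form', unfolded L2_subspace_def]

lemma D_L2: "u : D ==> u : L2 m"
 by (rule subsetD[OF conjunct1[OF subspace']])

lemma \<E>_nonneg: "u : D ==> 0 <= \<E> u u"
 by (rule form'[THEN conjunct2, THEN conjunct2, THEN conjunct2, THEN conjunct2, THEN conjunct2, THEN conjunct1, rule_format])

end

lemma SUP_RR_0:
 assumes f: "f : Bor"
 shows "(SUP n. RR (rs n) f x) = RR 0 f x" and "incseq (%n. RR (rs n) f x)"
proof -
 note [measurable] = mPTt[OF f, of x]
 let ?h = "%n t. ee (- (rs n) * t) * PT (en t) f x * ind {0..} t"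
 have dec: "1 / real (Suc (Suc n)) <= rs n" for n by (simp add: divide_simps)
 show "incseq (%n. RR (rs n) f x)" by (intro incseq_SucI RR_antimono dec)
 have inc: "incseq (%n. ee (- (rs n) * t))" if "0 <= t" for t
 using that by (intro incseq_SucI ennreal_leI) (use mrmono[OF dec] in auto)
 have "(SUP n. ee (- (rs n) * t)) = 1" if "0 <= t" for t
 proof (rule LIMSEQ_unique[OF LIMSEQ_SUP[OF inc[OF that]]])
 have "(%n. exp (- (rs n) * t)) ->> exp (- 0 * t)"
 using LIMSEQ_Suc[OF lim_const_over_n[of 1]] by (intro tendsto_intros) simp
 thus "(%n. ee (- (rs n) * t)) ->> 1"
 using tendsto_ennrealI by fastforce
 qed
 hence "RR 0 f x = nl (%t. (SUP n. ?h n t))"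
 unfolding RR_eq[OF f] by (intro ncong) (simp split: spind add: SUPmr[symmetric])
 also have "... = (SUP n. nl (%t. ?h n t))"
 proof (intro nmcSUP incseq_SucI le_funI)
 fix n t
 show "?h n t <= ?h (Suc n) t"
 using incseq_SucD[OF inc, of t n] by (cases "0 <= t") (simp_all only: indicator_simps mem_Collect_eq atLeast_iff mult_1_right mrmono zero_le, simp_all)
 qed measurable
 finally show "(SUP n. RR (rs n) f x) = RR 0 f x" by (simp add: RR_eq[OF f])
qed

text \<open>If the potential vanished at \<open>x\<close>, then \<open>P_t f x = 0\<close> for
  almost every \<open>t\<close>. Since \<open>f\<close> is positive off an \<open>m\<close>-null
  set, which is missed at positive times, the path from \<open>x\<close> would be dead at
  arbitrarily small times, against normality.\<close>

lemma RR_pos: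
 assumes f[measurable]: "f : Bor" and pos: "AE y in m. 0 < f y"
 shows "0 < RR a f x"
proof (rule ccontr)
 note [measurable] = mPTt[OF f, of x]
 assume "~ 0 < RR a f x"
 hence "sl {0..} (%t. ee (- a * t) * PT (en t) f x) = 0" by (simp add: RR_eq[OF f])
 hence AE: "AE t in lborel. ee (- a * t) * PT (en t) f x * ind {0..} t = 0"
 by (subst (asm) n0AE) auto
 have dead: "AE w in PS x. X (en (rs n)) w = None" for n
 proof -
 have "EX t. 0 < t & t < rs n & PT (en t) f x = 0"
 proof (rule ccontr)
 assume *: "~ ?thesis"
 have "AE t in lborel. t ~: {0<..<rs n}"
 using AE by eventually_elim (use * in \<open>auto split: split_indicator_asm\<close>)
 thus False by (subst (asm) AE_iff_null_sets[symmetric]) auto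
 qed
 then obtain t where t: "0 < t" "t < rs n" "PT (en t) f x = 0" by blast
 have "AE w in PS x. ext0 f (X (en t) w) = 0"
 using t(3) mext0X[OF f, of "en t"] unfolding transition_def
 by (subst (asm) n0AE) (auto simp: mcongs[OF sets_P refl])
 moreover have "AE w in PS x. ALL y. X (en t) w = Some y --> 0 < f y" by (rule AE_X[OF pos]) (use t in auto)
 ultimately show ?thesis
 proof eventually_elim
 case (elim w)
 hence "X (en t) w = None" by (cases "X (en t) w") auto
 thus ?case by (rule X_None_mono) (use t in \<open>auto intro: ennreal_leI\<close>)
 qed
 qed
 have "AE w in PS x. ALL n. X (en (rs n)) w = None" by (intro AEall[THEN iffD2] allI dead)
 hence "AE w in PS x. False"
 using normal[of "Some x"]
 proof eventually_elim
 case (elim w)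
 hence "0 < lifetime X w" by (simp add: lt_iff)
 then obtain n where "en (rs n) < lifetime X w" by (rule dn_less)
 thus False using elim(1) by (simp add: lt_iff)
 qed
 thus False using prob_space.AE_False[OF prob_space_P] by simp
qed

text \<open>Transience is stated with a Bochner integral, which is 0 by default when the integrand
  is not integrable. The bounded integrable \<open>g0\<close> is square integrable, so the integral
  is genuine for \<open>u\<close> in the domain and the inequality passes to
  \<open>nn_integral\<close>.\<close>

lemma transience_function:
 obtains f :: "'e => real" where "f : Bor" "!!x. 0 <= f x" "!!x. f x <= 1" "integrable m f"
 "AE x in m. 0 < f x" "!!u. u : D ==> (nn m (%x. en (\<bar>u x\<bar> * f x))) <= en (sqrt (\<E> u u))"
proof -
 obtain g0 C where g0: "integrable m g0" "!!x. \<bar>g0 x\<bar> <= C" "AE x in m. 0 < g0 x"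
 and tr: "!!u. u : D ==> (\<integral>x. \<bar>u x\<bar> * g0 x \<partial>m) <= sqrt (\<E> u u)"
 using transient unfolding transient_form_def by auto
 define f where "f x = min (max (g0 x) 0) 1" for x
 have g0m[measurable]: "g0 : Bor" using g0(1) by (simp add: meas_m[symmetric] borel_measurable_integrable)
 have f[measurable]: "f : Bor" unfolding f_def by measurable
 have f01: "0 <= f x" "f x <= 1" for x by (auto simp: f_def)
 have fi: "integrable m f"
 by (rule Bochner_Integration.integrable_bound[OF g0(1)]) (auto simp: meas_m f_def min_def max_def)
 have g0L: "g0 : L2 m"
 proof -
 have "integrable m (%x. C * g0 x)" using g0(1) by simp
 hence "integrable m (%x. (g0 x)\<^sup>2)"
 proof (rule Bochner_Integration.integrable_bound)
 show "AE x in m. norm ((g0 x)\<^sup>2) <= norm (C * g0 x)"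
 using order_trans[OF g0(2) abs_ge_self] by (intro AE_I2) (simp add: power2_eq_square abs_mult mrmono del: abs_mult_self_eq)
 qed (simp add: meas_m)
 thus ?thesis by (simp add: L2_def meas_m)
 qed
 show thesis
 proof (rule that[OF f f01 fi])
 show "AE x in m. 0 < f x" using g0(3) by eventually_elim (simp add: f_def)
 fix u assume u: "u : D"
 have am: "u : bm m" by (rule L2_measurable[OF D_L2[OF u]])
 hence aL: "(%x. \<bar>u x\<bar>) : L2 m" using D_L2[OF u] by (simp add: L2_def)
 have "nn m (%x. en (\<bar>u x\<bar> * f x)) <= nn m (%x. en (\<bar>u x\<bar> * g0 x))"
 proof (rule nmonoAE)
 show "AE x in m. en (\<bar>u x\<bar> * f x) <= en (\<bar>u x\<bar> * g0 x)"
 using g0(3) by eventually_elim (intro ennreal_leI mlmono, simp_all add: f_def)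
 qed
 also have "... = en (\<integral>x. \<bar>u x\<bar> * g0 x \<partial>m)"
 proof (rule neqint[OF L2_integrable_mult[OF aL g0L]])
 show "AE x in m. 0 <= \<bar>u x\<bar> * g0 x" using g0(3) by eventually_elim simp
 qed
 also have "... <= en (sqrt (\<E> u u))" by (intro ennreal_leI tr u)
 finally show "nn m (%x. en (\<bar>u x\<bar> * f x)) <= en (sqrt (\<E> u u))" .
 qed
qed

text \<open>If \<open>h = RR 0 f\<close> is the potential of a strictly positive \<open>f\<close> and \<open>k = min h 1\<close>, then \<open>v = k - RR 1 k\<close> is
 strictly positive where \<open>h\<close> is finite, and the resolvent equation gives \<open>RR \<alpha> v \<le> RR 1 k \<le> 1\<close> for small \<open>\<alpha>\<close>.\<close>

lemma reference_function:
 obtains g :: "'e => real" where "g : Bor" "!!x. 0 <= g x" "!!x. g x <= 1"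
 "integrable m g" "!!x. RR 0 (%x. en (g x)) x <= 1" "AE x in m. 0 < g x"
proof -
 obtain f :: "'e => real" where f[measurable]: "f : Bor" and f01: "!!x. 0 <= f x" "!!x. f x <= 1" and fi: "integrable m f"
 and fpos: "AE x in m. 0 < f x" and tr: "!!u. u : D ==> (nn m (%x. en (\<bar>u x\<bar> * f x))) <= en (sqrt (\<E> u u))"
 using transience_function by metis
 have fL: "f : L2 m" by (rule L2_boundedI[OF _ f01 fi]) (simp add: meas_m)
 let ?F = "%x. en (f x)"
 \<comment> \<open>With \<open>a = ip m f u\<close>, transience and the form identity give
   \<open>a \<le> sqrt (\<E> u u) \<le> sqrt a\<close>, hence \<open>a \<le> 1\<close> uniformly in
   \<open>d\<close>.\<close>
 have le1: "nn m (%x. ?F x * RR d ?F x) <= 1" if d: "0 < d" for d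
 proof -
 obtain u where um[measurable]: "u : Bor" and uR: "!!x. en (u x) = RR d ?F x" and u0: "!!x. 0 <= u x"
 and uL: "u : L2 m" and uD: "u : D" and uE: "!!v. v : D ==> \<E> u v = ip m f v - d * ip m u v"
 using resolvent_form[OF f f01 fi d] by metis
 let ?a = "ip m f u"
 have a0: "0 <= ?a" unfolding L2_inner_def using f01 u0 by (intro Bochner_Integration.integral_nonneg mult_nonneg_nonneg)
 have fu: "nn m (%x. en (f x * u x)) = en ?a"
 unfolding L2_inner_def using f01 u0 by (intro neqint L2_integrable_mult fL uL) simp
 have "en ?a <= en (sqrt (\<E> u u))"
 using tr[OF uD] u0 by (simp add: fu[symmetric] mult.commute)
 hence "?a <= sqrt (\<E> u u)" using \<E>_nonneg[OF uD] by (simp add: ennreal_le_iff)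
 also have "... <= sqrt ?a"
 using uE[OF uD] d u0 by (intro real_sqrt_le_mono) (simp add: L2_inner_def)
 finally have "?a * ?a <= ?a * 1" using a0 real_sqrt_mult_self[of ?a] mult_mono[of ?a "sqrt ?a" ?a "sqrt ?a"] by simp
 hence "?a <= 1" using a0 by (cases "?a = 0") auto
 moreover have "nn m (%x. ?F x * RR d ?F x) = en ?a"
 unfolding fu[symmetric] uR[symmetric] using f01 u0 by (simp add: ennreal_mult)
 ultimately show ?thesis by simp
 qed
 have "nn m (%x. ?F x * RR 0 ?F x) = nn m (%x. (SUP n. ?F x * RR (rs n) ?F x))"
 by (simp only: SUP_RR_0(1)[symmetric, of ?F] SUPml mcomp[OF f menn])
 also have "... = (SUP n. nn m (%x. ?F x * RR (rs n) ?F x))"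
 proof (intro nmcSUP incseq_SucI le_funI mlmono)
 show "RR (rs n) ?F x <= RR (1 / real (Suc (Suc n))) ?F x" for n x
 using incseq_SucD[OF SUP_RR_0(2)[of ?F]] by simp
 qed (simp_all add: meas_m)
 also have "... <= 1" by (intro SUP_least le1) simp
 finally have "nn m (%x. ?F x * RR 0 ?F x) ~= infy" by (auto simp: top_unique)
 hence fin: "AE x in m. ?F x * RR 0 ?F x ~= infy" by (intro nn_integral_PInf_AE) (auto simp: meas_m)
 let ?h = "RR 0 ?F"
 define k where "k x = min (?h x) 1" for x
 have Fm[measurable]: "?F : Bor" by measurable
 have km[measurable]: "k : Bor" unfolding k_def by measurable
 have k1: "k x <= 1" and kh: "k x <= ?h x" for x by (simp_all add: k_def)
 have R1: "RR 1 k x <= 1" for x using RR_const_le[OF km k1, of 1 x] by simp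
 have Rh: "RR 1 k x <= RR 1 ?h x" for x by (rule RR_mono) (rule kh)
 have hh: "?h x = RR 1 ?h x + RR 1 ?F x" for x using RR_resolvent[OF Fm, of 0 1 x] by simp
 have Rhh: "RR 1 k x <= ?h x" for x using Rh[of x] hh[of x] by (simp add: add_increasing2)
 have Rk: "RR 1 k x <= k x" for x using R1 Rhh by (simp add: k_def)
 have pos: "RR 1 k x < k x" if fin: "?h x < infy" for x
 proof (cases "?h x <= 1")
 case True
 have "0 < RR 1 ?F x" by (rule RR_pos[OF Fm]) (use fpos in \<open>auto elim: evmono\<close>)
 moreover have "RR 1 ?h x < infy" using fin hh[of x] by (auto simp: less_top)
 ultimately have "RR 1 ?h x < ?h x" unfolding hh[of x] by (cases "RR 1 ?h x"; cases "RR 1 ?F x") (auto simp: ennreal_less_iff simp flip: ennreal_plus)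
 thus ?thesis using True Rh[of x] by (simp add: k_def min_absorb1)
 next
 \<comment> \<open>Where \<open>h > 1\<close>, \<open>k\<close> equals 1. As \<open>h\<close> is
   finite, its tail \<open>P_n h\<close> falls below 1 for some \<open>n\<close>. Then
   \<open>RR 1 k\<close> is bounded by \<open>1 - exp (- n)\<close> from the time before
   \<open>n\<close> plus \<open>exp (- n)\<close> times a number below 1.\<close>
 case False
 let ?I = "%n. sl {0..<real n} (%t. PT (en t) ?F x)"
 note [measurable] = mPTt[OF Fm, of x] mPTt[OF km, of x]
 have "?h x = nl (%t. (SUP n. PT (en t) ?F x * ind {0..<real n} t))"
 unfolding RR_eq[OF Fm]
 proof (intro ncong)
 fix t :: real
 obtain n where "t < real n" using reals_Archimedean2 by blast
 hence "(SUP n. ind {0..<real n} t) = (ind {0..} t :: ennreal)"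
 by (intro antisym SUP_least SUP_upper2[of n]) (auto split: spind)
 thus "ee (- 0 * t) * PT (en t) ?F x * ind {0..} t = (SUP n. PT (en t) ?F x * ind {0..<real n} t)"
 by (simp add: SUPml[symmetric])
 qed
 also have "... = (SUP n. ?I n)"
 by (intro nmcSUP incseq_SucI le_funI mlmono) (auto split: spind)
 finally have hI: "?h x = (SUP n. ?I n)" .
 obtain c where c: "?h x = en c" "0 <= c" using fin by (cases "?h x") auto
 have "1 < c" using False c by (simp add: not_le)
 hence "en (c - 1) < (SUP n. ?I n)" unfolding hI[symmetric] c(1) using c(2) by (simp add: ennreal_less_iff)
 then obtain n where n: "en (c - 1) < ?I n" unfolding less_SUP_iff by blast
 have sp: "?h x = ?I n + PT (en (real n)) ?h x" using RR_split[OF Fm, of "real n" 0 x] by simp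
 have P1: "PT (en (real n)) ?h x < 1"
 proof (rule ccontr)
 assume "~ ?thesis"
 hence "?I n + 1 <= en c" unfolding c(1)[symmetric] sp by (simp add: add_left_mono)
 moreover obtain b where "?I n = en b" "0 <= b" using fin unfolding sp by (cases "?I n") auto
 ultimately show False using n c(2) \<open>1 < c\<close> by (simp add: ennreal_less_iff ennreal_le_iff flip: ennreal_1 ennreal_plus)
 qed
 hence n0: "0 < n" using PT_0[of ?h x] False by (cases n) auto
 have "PT (en (real n)) (RR 1 k) x <= PT (en (real n)) ?h x" by (rule PT_mono) (rule Rhh)
 hence P2: "PT (en (real n)) (RR 1 k) x < 1" using P1 by (rule le_less_trans)
 let ?e = "exp (- 1 * real n)"
 have "RR 1 k x = sl {0..<real n} (%t. ee (- 1 * t) * PT (en t) k x) + en ?e * PT (en (real n)) (RR 1 k) x"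
 by (rule RR_split[OF km]) simp
 also have "... <= sl {0..real n} (%t. ee (- 1 * t)) + en ?e * PT (en (real n)) (RR 1 k) x"
 using PT_const_le[OF k1, THEN mlmono] by (intro add_right_mono nmono) (simp split: spind)
 also have "sl {0..real n} (%t. ee (- 1 * t)) = en (1 - ?e)" by (subst nn_integral_exp_Icc) auto
 also have "en (1 - ?e) + en ?e * PT (en (real n)) (RR 1 k) x < 1"
 proof -
 obtain b where b: "PT (en (real n)) (RR 1 k) x = en b" "0 <= b" "b < 1"
 using P2 by (cases "PT (en (real n)) (RR 1 k) x") (auto simp: ennreal_less_one_iff)
 have "en (1 - ?e) + en ?e * en b = en (1 - ?e + ?e * b)" using b by (simp add: ennreal_mult)
 also have "... < en 1" by (rule ennreal_lessI) (use mult_strict_left_mono[OF b(3), of ?e] in simp_all)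
 finally show ?thesis unfolding b(1) ennreal_1 .
 qed
 also have "1 = k x" using False by (simp add: k_def min_absorb2 not_le less_imp_le)
 finally show ?thesis .
 qed
 define v where "v x = k x - RR 1 k x" for x
 have [measurable]: "v : Bor" unfolding v_def by measurable
 have "RR 0 v x <= 1" for x
 unfolding SUP_RR_0(1)[of v x, symmetric, OF \<open>v : Bor\<close>]
 proof (rule SUP_least)
 fix n
 \<comment> \<open>A rate strictly below 1, so that \<open>supermedian_split\<close> applies to the
   pair of rates \<open>?a\<close> and 1.\<close>
 let ?a = "1 / real (Suc (Suc n))"
 have "en (1 - ?a) * RR 1 k y <= 1 * RR 1 k y" for y by (intro mrmono) auto
 hence le: "en (1 - ?a) * RR 1 k y <= RR 1 k y" for y by simp
 note s = supermedian_split[OF km, of 1 ?a 1, OF _ _ _ order_trans[OF le Rk]]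
 have "RR (rs n) v x <= RR ?a v x" by (rule RR_antimono) (simp add: field_simps)
 also have "... <= RR ?a (%y. k y - en (1 - ?a) * RR 1 k y) x"
 unfolding v_def by (intro RR_mono ennreal_minus_mono le order_refl)
 also have "... = RR 1 k x" by (rule s(3)[symmetric]) (simp_all add: k1)
 also have "... <= 1" by (rule R1)
 finally show "RR (rs n) v x <= 1" .
 qed
 note Rv = this
 have v1: "v x <= 1" for x unfolding v_def using diff_le_self_ennreal k1 by (rule order_trans)
 \<comment> \<open>The bound by \<open>v\<close> controls the potential, the bound by
   \<open>f\<close> gives integrability.\<close>
 define g where "g x = min (enn2real (v x)) (f x)" for x
 have gm: "g : Bor" unfolding g_def by measurable
 have g01: "0 <= g x" "g x <= 1" "g x <= f x" for x using f01[of x] by (auto simp: g_def min.coboundedI2)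
 have gi: "integrable m g" by (rule Bochner_Integration.integrable_bound[OF fi]) (use g01 f01 gm in \<open>auto simp: meas_m\<close>)
 have gv: "en (g x) <= v x" for x
 proof -
 have "v x < \<top>" using v1[of x] by (rule le_less_trans) simp
 hence "en (enn2real (v x)) = v x" by simp
 thus ?thesis using ennreal_leI[of "g x" "enn2real (v x)"] by (simp add: g_def)
 qed
 have "AE x in m. 0 < g x"
 using fin fpos
 proof eventually_elim
 case (elim x)
 hence "?h x < infy" by (auto simp: ennreal_mult_eq_top_iff less_top[symmetric])
 hence "0 < v x" unfolding v_def by (rule pos[THEN diff_gr0_ennreal])
 moreover have "v x < \<top>" using v1[of x] by (rule le_less_trans) simp
 ultimately show ?case using elim(2) by (simp add: g_def enn2real_positive_iff)
 qed
 moreover have "RR 0 (%x. en (g x)) x <= 1" for x by (rule order_trans[OF RR_mono Rv]) (rule gv)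
 ultimately show thesis using that gm g01(1,2) gi by blast
qed

end

section \<open>Polar sets and smooth measures\<close>

lemma complete_measure_AE_measurable:
 fixes f g :: "'a => ennreal"
 assumes g: "g : bm (completion M)" and eq: "AE x in completion M. f x = g x"
 shows "f : bm (completion M)"
proof (rule measurableI)
 interpret completion: complete_measure "completion M" ..
 obtain Z where Z: "{x\<in>space (completion M). f x ~= g x} <= Z" "Z : null_sets (completion M)"
 using eq unfolding eventually_ae_filter by auto
 fix S :: "ennreal set" assume S: "S : sets borel"
 have "(g -` S Int space (completion M) - Z) Un (f -` S Int space (completion M) Int Z) : sets (completion M)"
 by (rule sets.Un[OF sets.Diff[OF msets[OF g S] null_setsD2[OF Z(2)]] completion.complete[OF _ Z(2)]]) auto
 moreover have "f -` S Int space (completion M) = (g -` S Int space (completion M) - Z) Un (f -` S Int space (completion M) Int Z)"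
 using Z(1) by auto
 ultimately show "f -` S Int space (completion M) : sets (completion M)" by simp
qed simp

context symmetric_hunt_process
begin

lemma capacity_mono: "S <= S' ==> capacity m \<E> D S <= capacity m \<E> D S'"
 unfolding capacity_def by (rule INF_superset_mono) auto

text \<open>Every compact set loses only a set of zero capacity outside the union of the
  \<open>F n\<close>, and the space is a countable union of compact sets.\<close>

lemma smooth_exhaustion:
 assumes "smooth_measure m \<E> D nu"
 obtains F :: "nat => 'e set" where "incseq F" "!!n. F n : sets borel" "!!n. emu nu (F n) < infy" "emu nu (- (\<Union>n. F n)) = 0"
proof -
 note a = assms[unfolded smooth_measure_def]
 note sets = conjunct1[OF a] and null = conjunct1[OF conjunct2[OF a], rule_format]
 obtain F :: "nat => 'e set" where F': "incseq F & (ALL n. closed (F n)) & (ALL n. emu nu (F n) < infy) &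
 (ALL K. compact K --> (%n. capacity m \<E> D (K - F n)) ->> 0)"
 using conjunct2[OF conjunct2[OF a]] by (rule exE)
 hence F: "incseq F" "!!n. closed (F n)" "!!n. emu nu (F n) < infy" by simp_all
 note F4 = F'[THEN conjunct2, THEN conjunct2, THEN conjunct2, rule_format]
 obtain K :: "nat => 'e set" where K: "!!n. compact (K n)" "(\<Union>n. K n) = UNIV" by (rule sigma_compact) blast
 have Fb: "F n : sets borel" for n using F(2) by (rule borel_closed)
 have Kb: "K n : sets borel" for n using K(1) by (intro borel_closed compact_imp_closed)
 have "capacity m \<E> D (K j - (\<Union>n. F n)) = 0" for j
 proof -
 have "capacity m \<E> D (K j - (\<Union>n. F n)) <= capacity m \<E> D (K j - F n)" for n by (rule capacity_mono) auto
 hence "capacity m \<E> D (K j - (\<Union>n. F n)) <= 0" by (intro LIMSEQ_le_const[OF F4[OF K(1)]]) auto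
 thus ?thesis by simp
 qed
 hence "emu nu (K j - (\<Union>n. F n)) = 0" for j using Fb Kb by (intro null) auto
 hence "(\<Union>j. K j - (\<Union>n. F n)) : null_sets nu" using Fb Kb sets by (intro null_sets_UN) (auto simp: null_sets_def)
 moreover have "(\<Union>j. K j - (\<Union>n. F n)) = - (\<Union>n. F n)" using K(2) by auto
 ultimately show thesis using that F(1,3) Fb by auto
qed

lemma smooth_sigma_finite:
 assumes nu: "smooth_measure m \<E> D nu"
 shows "sigma_finite_measure nu"
proof -
 have sets: "sets nu = sets borel" using nu unfolding smooth_measure_def by simp
 hence sp: "space nu = UNIV" using sets_eq_imp_space_eq[of nu borel] by simp
 obtain F :: "nat => 'e set" where F: "incseq F" "!!n. F n : sets borel" "!!n. emu nu (F n) < infy" "emu nu (- (\<Union>n. F n)) = 0"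
 by (rule smooth_exhaustion[OF nu]) blast
 show ?thesis
 proof
 show "EX A. countable A & A <= sets nu & \<Union>A = space nu & (ALL a:A. emu nu a ~= infy)"
 
 proof (intro exI[of _ "insert (- (\<Union>n. F n)) (range F)"] conjI ballI)
 fix a assume "a : insert (- (\<Union>n. F n)) (range F)"
 thus "emu nu a ~= infy" using F(3)[THEN less_imp_neq] F(4) by (elim insertE imageE) simp_all
 qed (use F(2) sp sets in auto)
 qed
qed

text \<open>The capacity is built from the form alone, so a small capacity does not bound an
  \<open>L2\<close> norm. Transience fills the gap: the integral of a strictly positive function
  over the intersection of the \<open>U n\<close> is at most \<open>sqrt (\<E> u u)\<close> for
  competitors \<open>u\<close> of vanishing energy.\<close>

lemma polar_null:
 assumes "polar m \<E> D N"
 obtains S where "S : sets borel" "N <= S" "emu m S = 0" "!!nu. smooth_measure m \<E> D nu ==> emu nu S = 0"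
proof -
 have "EX U. open U & N <= U & cap_open m \<E> D U < en (rs n)" for n
 proof -
 have "capacity m \<E> D N < en (rs n)" using assms unfolding polar_def by (simp only: ennreal_less_zero_iff) simp
 thus ?thesis unfolding capacity_def INF_less_iff by blast
 qed
 then obtain U where U: "!!n. open (U n)" "!!n. N <= U n" "!!n. cap_open m \<E> D (U n) < en (rs n)" by metis
 let ?S = "\<Inter>n. U n"
 have S[measurable]: "?S : sets borel" using U(1) by (intro sets.countable_INT) auto
 obtain f :: "'e => real" where f[measurable]: "f : Bor" and f01: "!!x. 0 <= f x"
 and fpos: "AE x in m. 0 < f x" and tr: "!!u. u : D ==> (nn m (%x. en (\<bar>u x\<bar> * f x))) <= en (sqrt (\<E> u u))"
 using transience_function by metis
 have lim: "(%n. en (rs n)) ->> 0" "(%n. en (sqrt (rs n))) ->> 0"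
 using tendsto_ennrealI[OF LIMSEQ_Suc[OF lim_const_over_n[of 1]]]
 tendsto_ennrealI[OF tendsto_real_sqrt[OF LIMSEQ_Suc[OF lim_const_over_n[of 1]]]] by simp_all
 have "nn m (%x. en (f x) * ind ?S x) <= en (sqrt (rs n))" for n
 proof -
 obtain u where u: "u : D" "AE x in m. ind (U n) x <= u x" "en (\<E> u u) < en (rs n)"
 using U(3)[of n] unfolding cap_open_def INF_less_iff by blast
 have "nn m (%x. en (f x) * ind ?S x) <= nn m (%x. en (\<bar>u x\<bar> * f x))"
 proof (rule nmonoAE)
 show "AE x in m. en (f x) * ind ?S x <= en (\<bar>u x\<bar> * f x)"
 using u(2)
 proof eventually_elim
 case (elim x)
 show ?case
 proof (cases "x : ?S")
 case True
 hence "1 <= \<bar>u x\<bar>" using elim by (auto simp: indicator_def)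
 hence "f x <= \<bar>u x\<bar> * f x" using f01[of x] mrmono[of 1 "\<bar>u x\<bar>" "f x"] by simp
 thus ?thesis using True by (simp add: ennreal_leI)
 qed simp
 qed
 qed
 also have "... <= en (sqrt (\<E> u u))" by (rule tr[OF u(1)])
 also have "... <= en (sqrt (rs n))"
 using u(3) \<E>_nonneg[OF u(1)] by (intro ennreal_leI real_sqrt_le_mono) (simp add: ennreal_less_iff[of "\<E> u u"] del: of_nat_Suc)
 finally show ?thesis .
 qed
 hence "nn m (%x. en (f x) * ind ?S x) <= 0" by (intro LIMSEQ_le_const[OF lim(2)]) auto
 hence "AE x in m. en (f x) * ind ?S x = 0" by (subst (asm) le_zero_eq, subst (asm) n0AE) (auto simp: meas_m)
 hence "AE x in m. x ~: ?S" using fpos by eventually_elim (auto simp: indicator_def split: if_splits)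
 hence mS: "emu m ?S = 0" using S by (subst (asm) AE_iff_null_sets[symmetric]) (auto simp: sets_m)
 have "capacity m \<E> D ?S <= en (rs n)" for n
 proof -
 have "capacity m \<E> D ?S <= cap_open m \<E> D (U n)"
 unfolding capacity_def by (rule INF_lower) (use U(1) in auto)
 thus ?thesis using U(3)[of n] by (meson less_imp_le order_trans)
 qed
 hence "capacity m \<E> D ?S <= 0" by (intro LIMSEQ_le_const[OF lim(1)]) auto
 hence "emu nu ?S = 0" if "smooth_measure m \<E> D nu" for nu
 using that S unfolding smooth_measure_def by simp
 moreover have "N <= ?S" using U(2) by auto
 ultimately show thesis using that[OF S _ mS] by blast
qed

lemma nn_integral_0_FF:
 assumes F: "F : bm (FF t)"
 shows "nn (P x) (%w. F w) = 0 \<longleftrightarrow> (AE w in P x. F w = 0)"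
 using n0AE[OF mFFc[OF F], of x]
 unfolding ncompl AE_completion_iff .

lemma expectation_version:
 fixes F :: "'w => ennreal" and c :: "'e measure"
 assumes c: "sigma_finite_measure c" and sk: "sets c = sets borel" and F: "F : bm (FF infy)"
 obtains k where "k : Bor" "AE y in c. nn (PS y) (%w. F w) = k y"
proof -
 obtain F0 Z where F0: "F0 : bm (NF infy)" and Z: "Z : sets (NF infy)" "{w. F w ~= F0 w} <= Z"
 and null: "AE y in c. emu (PS y) Z = 0" by (rule raw_version[OF c sk F])
 have "AE y in c. nn (PS y) (%w. F w) = nn (PS y) (%w. F0 w)"
 using null
 proof eventually_elim
 case (elim y)
 hence "AE w in PS y. F w = F0 w" using Z by (intro AE_I[of _ _ Z]) (auto simp: sets_P)
 thus ?case by (rule ncongAE)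
 qed
 with measurable_E_Some[OF F0] show thesis by (rule that)
qed

lemma raw_null_set:
 fixes c :: "'e measure"
 assumes c: "sigma_finite_measure c" "sets c = sets borel"
 and b: "b : sets (FF infy)" and AE: "AE y in c. AE w in PS y. w : b"
 obtains Z where "Z : sets (NF infy)" "- b <= Z" "AE y in c. emu (PS y) Z = 0"
proof -
 let ?F = "ind b :: 'w => ennreal"
 obtain F0 Z where F0: "F0 : bm (NF infy)" and Z: "Z : sets (NF infy)" "{w. ?F w ~= F0 w} <= Z"
 and null: "AE y in c. emu (PS y) Z = 0"
 by (rule raw_version[OF c bmind[OF b]])
 have ZF: "?F w = F0 w" if "w ~: Z" for w using Z(2) that by blast
 have ZF1: "F0 w = 1 \<longleftrightarrow> w : b" if "w ~: Z" for w unfolding ZF[OF that, symmetric] by (simp add: indicator_def)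
 have F0s: "{w. F0 w ~= 1} : sets (NF infy)"
 using borel_measurable_neq[OF F0 borel_measurable_const, of 1] by simp
 have "AE y in c. emu (PS y) (Z Un {w. F0 w ~= 1}) = 0"
 using null AE
 proof eventually_elim
 case (elim y)
 have "AE w in PS y. w ~: Z" using elim(1) Z by (intro AE_I[of _ _ Z]) (auto simp: sets_P)
 with elim(2) have "AE w in PS y. w ~: Z Un {w. F0 w ~= 1}"
 by eventually_elim (use ZF1 in auto)
 thus ?case using Z(1) F0s by (subst (asm) AE_iff_null_sets[symmetric]) (auto simp: sets_P)
 qed
 thus thesis by (rule that[OF sets.Un[OF Z(1) F0s], rotated]) (use ZF1 in auto)
qed

context
 fixes s :: ennreal
 assumes s: "0 < s" "s < infy"
begin

private lemma alive: "(%w. if X s w = None then 0 else 1 :: ennreal) : bm (FF s)"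
proof -
 have "(%z. if z = None then 0 else 1 :: ennreal) : bm (cb :: 'e option measure)"
 by (rule measurable_from_cemetery) auto
 from mcomp[OF mXFF[OF order_refl] this] show ?thesis .
qed

text \<open>The Markov property integrates the probability of \<open>Z\<close> over the position at
  time \<open>s\<close>, which avoids the \<open>m\<close>-null set of bad starting points.\<close>

lemma markov_null:
 assumes Z: "Z : sets (NF infy)" and null: "AE y in m. emu (PS y) Z = 0"
 shows "AE w in PS x. X s w ~= None --> th s w ~: Z"
proof -
 have th: "th s : NF infy MM NF infy"
 using measurable_sh[OF measurable_const[of s] measurable_ident] by (simp add: sh_finite[OF s(2)])
 let ?a = "%w. if X s w = None then 0 else 1 :: ennreal"
 have "nn (PS x) (%w. ?a w * ind Z (th s w)) = nn (PS x) (%w. ?a w * nn (P (X s w)) (%w'. ind Z w'))"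
 by (rule markov_functional[OF s(2) alive]) (use Z in simp)
 also have "... = nn (PS x) (%w. 0)"
 by (rule ncongAE) (use AE_X[OF null s, of x] Z in \<open>auto elim!: evmono simp: sets_P\<close>)
 finally have 0: "nn (PS x) (%w. ?a w * ind Z (th s w)) = 0" by simp
 have "(%w. ?a w * ind Z (th s w)) : bm (FF infy)"
 by (intro bmtimes mFFm[OF alive] measurable_NF_FF mcomp[OF th] bmind Z) simp
 from nn_integral_0_FF[OF this, THEN iffD1, OF 0]
 show ?thesis by (rule evmono) (auto split: if_splits)
qed

text \<open>\<open>F\<close> agrees with a raw functional off a raw set that is null from
  \<open>m\<close>-almost every start, hence negligible after time \<open>s\<close> from every
  \<open>x\<close>. A dead path contributes 0, because the exceptional set is not controlled under
  \<open>P None\<close>.\<close>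

lemma markov_completed:
 assumes H: "H : bm (FF s)" and F: "F : bm (FF infy)"
 shows "nn (PS x) (%w. H w * (if X s w = None then 0 else F (th s w))) =
 (nn (PS x) (%w. H w * ext0 (%y. nn (PS y) (%w'. F w')) (X s w)))"
proof -
 obtain F0 Z where F0: "F0 : bm (NF infy)" and Z: "Z : sets (NF infy)" "{w. F w ~= F0 w} <= Z"
 and null: "AE y in m. emu (PS y) Z = 0" by (rule raw_version[OF sigma_finite_m sets_m F])
 have ZF: "F w = F0 w" if "w ~: Z" for w using Z(2) that by blast
 let ?a = "%w. if X s w = None then 0 else 1 :: ennreal"
 have "nn (PS x) (%w. H w * (if X s w = None then 0 else F (th s w))) = nn (PS x) (%w. (H w * ?a w) * F0 (th s w))"
 by (rule ncongAE, rule evmono[OF markov_null[OF Z(1) null, of x]]) (use ZF in auto)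
 also have "... = nn (PS x) (%w. (H w * ?a w) * nn (P (X s w)) (%w'. F0 w'))"
 by (rule markov_functional[OF s(2) bmtimes[OF H alive] F0])
 also have "... = nn (PS x) (%w. H w * ext0 (%y. nn (PS y) (%w'. F w')) (X s w))"
 proof (rule ncongAE, rule evmono[OF AE_X[OF null s, of x]])
 fix w assume *: "ALL y. X s w = Some y --> emu (PS y) Z = 0"
 show "(H w * ?a w) * nn (P (X s w)) (%w'. F0 w') = H w * ext0 (%y. nn (PS y) (%w'. F w')) (X s w)"
 proof (cases "X s w")
 case (Some y)
 hence "AE w in PS y. F0 w = F w" using Z * by (intro AE_I[of _ _ Z]) (auto simp: sets_P)
 hence "nn (PS y) (%w. F0 w) = nn (PS y) (%w. F w)" by (rule ncongAE)
 thus ?thesis using Some by simp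
 qed simp
 qed
 finally show ?thesis .
qed

lemma markov_PT:
 assumes F: "F : bm (FF infy)"
 shows "nn (PS x) (%w. (if X s w = None then 0 else F (th s w))) = PT s (%y. nn (PS y) (%w'. F w')) x"
 using markov_completed[of "%_. 1", OF _ F] by (simp add: transition_def)

lemma measurable_shifted:
 assumes F: "F : bm (FF infy)"
 shows "(%w. if X s w = None then 0 else F (th s w) :: ennreal) : bm (CP (PS x))"
proof -
 obtain F0 Z where F0: "F0 : bm (NF infy)" and Z: "Z : sets (NF infy)" "{w. F w ~= F0 w} <= Z"
 and null: "AE y in m. emu (PS y) Z = 0" by (rule raw_version[OF sigma_finite_m sets_m F])
 have ZF: "F w = F0 w" if "w ~: Z" for w using Z(2) that by blast
 have th: "th s : NF infy MM NF infy"
 using measurable_sh[OF measurable_const[of s] measurable_ident] by (simp add: sh_finite[OF s(2)])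
 let ?F0 = "%w. (if X s w = None then 0 else 1) * F0 (th s w)"
 have "?F0 : bm (FF infy)"
 by (intro bmtimes mFFm[OF alive] measurable_NF_FF mcomp[OF th] F0) simp
 hence "?F0 : bm (CP (PS x))" by (rule mFFc)
 moreover have "AE w in CP (PS x). (if X s w = None then 0 else F (th s w)) = ?F0 w"
 unfolding AE_completion_iff by (rule evmono[OF markov_null[OF Z(1) null, of x]]) (use ZF in auto)
 ultimately show ?thesis by (rule complete_measure_AE_measurable)
qed

lemma markov_AE:
 assumes b: "b : sets (FF infy)" and AE: "AE y in m. AE w in PS y. w : b"
 shows "AE w in PS x. X s w ~= None --> th s w : b"
proof -
 obtain Z where "Z : sets (NF infy)" "- b <= Z" "AE y in m. emu (PS y) Z = 0"
 by (rule raw_null_set[OF sigma_finite_m sets_m b AE])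
 with markov_null[of Z x] show ?thesis by (auto elim!: evmono)
qed

end

end

section \<open>Additive functionals with a Revuz measure\<close>

lemma cint_cong_AE:
 "(AE u in lborel. 0 <= u --> g (ivt a u) = h (ivt a u)) ==> cint a g = cint a h"
 unfolding cint_def by (rule ncongAE) (auto elim!: evmono split: spind)

lemma cint_eq_0_iff:
 assumes g[measurable]: "g : Bor"
 shows "cint a g = 0 \<longleftrightarrow> (AE u in lborel. 0 <= u --> g (ivt a u) = 0)"
proof -
 have "cint a g = 0 \<longleftrightarrow> (AE u in lborel. g (ivt a u) * ind {0..} u = 0)"
 unfolding cint_def by (rule n0AE) measurable
 also have "... \<longleftrightarrow> (AE u in lborel. 0 <= u --> g (ivt a u) = 0)"
 by (intro arg_cong2[of _ _ _ _ eventually] ext refl) (auto split: spind)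
 finally show ?thesis .
qed

text \<open>Subadditivity gives \<open>d t \<le> n * d (t / n)\<close>, and the right side tends to
  \<open>t * l\<close>.\<close>

lemma subadditive_le_limit:
 fixes d :: "real => ennreal"
 assumes add: "!!s t. 0 < s ==> 0 < t ==> d (s + t) <= d s + d t"
 and lim: "((%t. d t / en t) \<longlongrightarrow> l) (at_right 0)" and t: "0 < t"
 shows "d t <= en t * l"
proof -
 have mult: "d (real (Suc n) * s) <= of_nat (Suc n) * d s" if s: "0 < s" for n s
 proof (induction n)
 case (Suc n)
 have "d (real (Suc (Suc n)) * s) = d (s + real (Suc n) * s)" by (simp add: algebra_simps)
 also have "... <= d s + d (real (Suc n) * s)" using s by (intro add) auto
 also have "... <= d s + of_nat (Suc n) * d s" by (intro add_left_mono Suc)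
 also have "... = of_nat (Suc (Suc n)) * d s" by (simp add: distrib_right)
 finally show ?case .
 qed simp
 have "filterlim (%n. t / real (Suc n)) (at_right 0) sequentially"
 using t LIMSEQ_Suc[OF lim_const_over_n[of t]] by (auto simp: filterlim_at)
 from filterlim_compose[OF lim this]
 have "(%n. en t * (d (t / real (Suc n)) / en (t / real (Suc n)))) ->> en t * l"
 by (intro tendsto_mult_ennreal tendsto_const) (use t in auto)
 thus ?thesis
 proof (rule LIMSEQ_le_const, intro exI[of _ 0] allI impI)
 fix n
 have "d t <= of_nat (Suc n) * d (t / real (Suc n))"
 using mult[of "t / real (Suc n)" n] t by simp
 also have "of_nat (Suc n) = en t * inverse (en (t / real (Suc n)))"
 using t by (simp add: inverse_ennreal ennreal_mult[symmetric] ennat del: of_nat_Suc)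
 finally show "d t <= en t * (d (t / real (Suc n)) / en (t / real (Suc n)))"
 by (simp only: divide_ennreal_def mult_ac)
 qed
qed

locale revuz_functional =
 symmetric_hunt_process X P \<theta> m DL L T \<E> D G + additive_functional X P \<theta> B LL
 for X :: "ennreal => 'w => 'e::{metric_space, second_countable_topology} option"
 and P \<theta> m DL L T \<E> D G B LL +
 fixes nu :: "'e measure" and N :: "'e set"
 assumes smooth: "smooth_measure m \<E> D nu" and revuz: "revuz m X P B nu" and N_polar: "polar m \<E> D N"
 and start_LL: "!!x. x ~: N ==> AE w in PS x. w : LL"
begin

abbreviation tau :: "'w => real => ennreal" where "tau w u \<equiv> ivt (%t. B t w) u"

lemma sets_nu: "sets nu = sets borel"
 using smooth unfolding smooth_measure_def by simp

lemma measurable_nu: "bm nu = Bor"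
 by (rule mcongs[OF sets_nu refl])

sublocale nu: sigma_finite_measure nu by (rule smooth_sigma_finite[OF smooth])

lemma AE_start: "AE x in m. AE w in PS x. w : LL" "AE x in nu. x ~: N" "AE x in m. x ~: N"
proof -
 obtain S where S: "S : sets borel" "N <= S" "emu m S = 0" "!!nu. smooth_measure m \<E> D nu ==> emu nu S = 0"
 by (rule polar_null[OF N_polar]) blast
 show "AE x in nu. x ~: N" by (rule AE_I[of _ _ S]) (use S(1,2) S(4)[OF smooth] in \<open>auto simp: sets_nu\<close>)
 show *: "AE x in m. x ~: N" by (rule AE_I[of _ _ S]) (use S(1-3) in \<open>auto simp: sets_m\<close>)
 show "AE x in m. AE w in PS x. w : LL" by (rule evmono[OF * start_LL])
qed

abbreviation Em :: "('w => ennreal) => ennreal" where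
 "Em F \<equiv> nn m (%x. nn (PS x) (%w. F w))"

lemma II_None: "X s w = None ==> II f t (th s w) = 0" if s: "s < infy"
proof -
 assume "X s w = None"
 hence "X r (th s w) = None" for r using X_shift[OF s, of r w] X_None_mono[of s w "r + s"] by simp
 thus ?thesis by (simp add: cint_def)
qed

lemma measurable_E_II:
 assumes f: "f : Bor"
 obtains k where "k : Bor" "AE y in m. nn (PS y) (%w. II f t w) = k y"
 using expectation_version[OF sigma_finite_m sets_m measurable_II[OF f]] by blast

text \<open>Additivity and the Markov property at \<open>s\<close>. It is kept as an equality
  because later the expectations of two functionals are subtracted.\<close>

lemma Em_II_split:
 assumes f: "f : Bor" and s: "0 < s" "s < infy"
 and k: "k : Bor" "AE y in m. nn (PS y) (%w. II f t w) = k y"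
 shows "Em (II f (s + t)) = Em (II f s) + nn m (%x. PT s k x)"
proof -
 obtain l where l: "l : Bor" "AE y in m. nn (PS y) (%w. II f s w) = l y" by (rule measurable_E_II[OF f])
 have "AE x in m. nn (PS x) (%w. II f (s + t) w) = l x + PT s k x"
 using AE_start(1) l(2)
 proof eventually_elim
 case (elim x)
 have eq: "AE w in PS x. II f (s + t) w = II f s w + (if X s w = None then 0 else II f t (th s w))"
 using elim(1) by (rule evmono) (simp add: II_add[OF _ s f] II_None[OF s(2)])
 have m1: "II f s : bm (CP (PS x))" "II f (s + t) : bm (CP (PS x))"
 by (intro mFFc[OF measurable_II[OF f]])+
 have "nn (PS x) (%w. II f (s + t) w) = nn (PS x) (%w. II f s w + (if X s w = None then 0 else II f t (th s w)))"
 by (rule ncongAE[OF eq])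
 also have "... = nn (PS x) (%w. II f s w) + nn (PS x) (%w. (if X s w = None then 0 else II f t (th s w)))"
 using nadd[OF m1(1) measurable_shifted[OF s measurable_II[OF f]]] by (simp only: ncompl)
 also have "nn (PS x) (%w. (if X s w = None then 0 else II f t (th s w))) = PT s k x"
 using markov_PT[OF s measurable_II[OF f]] PT_cong_AE[OF k(2) s] by simp
 finally show ?case using elim(2) by simp
 qed
 hence "Em (II f (s + t)) = nn m (%x. l x + PT s k x)" by (rule ncongAE)
 also have "... = nn m (%x. l x) + nn m (%x. PT s k x)" using l k by (intro nadd) (auto simp: meas_m)
 also have "nn m (%x. l x) = Em (II f s)" by (rule ncongAE[OF l(2), symmetric])
 finally show ?thesis .
qed

text \<open>The semigroup does not increase integrals against \<open>m\<close>. Subadditivity makes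
  the Revuz limit at 0 a bound at every time.\<close>

lemma Em_II_add:
 assumes f: "f : Bor" and s: "0 < s" "s < infy"
 shows "Em (II f (s + t)) <= Em (II f s) + Em (II f t)"
proof -
 obtain k where k: "k : Bor" "AE y in m. nn (PS y) (%w. II f t w) = k y" by (rule measurable_E_II[OF f])
 have "nn m (%x. PT s k x) <= Em (II f t)"
 unfolding ncongAE[OF k(2)] by (rule PT_excessive_measure[OF k(1) s(2)])
 thus ?thesis unfolding Em_II_split[OF f s k] by (rule add_left_mono)
qed

lemma Em_II_tendsto:
 assumes f: "f : Bor"
 shows "((%t. Em (II f (en t)) / en t) \<longlongrightarrow> (nn nu (%x. f x))) (at_right 0)"
proof -
 have eq: "nn m (%x. nn (CP (PS x)) (%w. functional_integral X B f t w)) = Em (II f t)" for t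
 using AE_start(1)
 by (intro ncongAE, elim evmono, unfold ncompl)
 (intro ncongAE, elim evmono, rule functional_integral_eq[OF _ f])
 show ?thesis using bspec[OF revuz[unfolded revuz_def] f] unfolding eq .
qed

lemma Em_II_le:
 assumes f: "f : Bor" and t: "0 < t"
 shows "Em (II f (en t)) <= en t * nn nu (%x. f x)"
 by (rule subadditive_le_limit[OF _ Em_II_tendsto[OF f] t]) (use Em_II_add[OF f] in simp)

text \<open>The mass that \<open>dB\<close> gives to \<open>S\<close> up to time \<open>t\<close>
  has expectation at most \<open>t\<close> times the measure of \<open>S\<close> under
  \<open>nu\<close>, which is 0.\<close>

lemma null_set_not_charged:
 assumes S: "S : sets borel" "emu nu S = 0"
 shows "AE x in m. AE w in PS x. AE u in lborel. 0 <= u --> (ALL y. X (tau w u) w = Some y --> y ~: S)"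
proof -
 let ?f = "ind S :: 'e => ennreal"
 have f[measurable]: "?f : Bor" using S by simp
 have "AE x in m. AE w in PS x. II ?f (of_nat n) w = 0" for n
 proof -
 obtain k where k: "k : Bor" "AE y in m. nn (PS y) (%w. II ?f (of_nat n) w) = k y"
 by (rule measurable_E_II[OF f])
 have "Em (II ?f (of_nat n)) <= Em (II ?f (en (real (Suc n))))"
 by (intro nmono II_mono_time) (simp add: ennat[symmetric] le_add_same_cancel2)
 also have "... <= en (real (Suc n)) * nn nu (%x. ?f x)" by (rule Em_II_le[OF f]) simp
 also have "... = 0" using S by (simp add: sets_nu)
 finally have "nn m (%y. k y) = 0" using ncongAE[OF k(2)] by simp
 hence "AE y in m. k y = 0" using k(1) by (subst (asm) n0AE) (auto simp: meas_m)
 thus ?thesis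
 using k(2) by eventually_elim (simp add: nn_integral_0_FF[OF measurable_II[OF f], symmetric])
 qed
 hence "AE x in m. ALL n. AE w in PS x. II ?f (of_nat n) w = 0" by (intro AEall[THEN iffD2] allI)
 thus ?thesis
 proof (rule evmono)
 fix x assume "ALL n. AE w in PS x. II ?f (of_nat n) w = 0"
 hence "AE w in PS x. ALL n. II ?f (of_nat n) w = 0" by (rule AEall[THEN iffD2])
 thus "AE w in PS x. AE u in lborel. 0 <= u --> (ALL y. X (tau w u) w = Some y --> y ~: S)"
 proof (rule evmono)
 fix w assume 0: "ALL n. II ?f (of_nat n) w = 0"
 note [measurable] = mfX[OF f]
 have "AE u in lborel. 0 <= u --> ind {..of_nat n} (tau w u) * ext0 ?f (X (tau w u) w) = (0::ennreal)" for n
 by (rule cint_eq_0_iff[THEN iffD1]) (measurable, use 0 in blast)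
 hence "AE u in lborel. ALL n. 0 <= u --> ind {..of_nat n} (tau w u) * ext0 ?f (X (tau w u) w) = (0::ennreal)"
 by (intro AEall[THEN iffD2] allI)
 thus "AE u in lborel. 0 <= u --> (ALL y. X (tau w u) w = Some y --> y ~: S)"
 proof (rule evmono, intro impI allI)
 fix u y assume *: "ALL n. 0 <= u --> ind {..of_nat n} (tau w u) * ext0 ?f (X (tau w u) w) = (0::ennreal)"
 and u: "0 <= u" and y: "X (tau w u) w = Some y"
 hence "tau w u < infy" using ivt_finite_X[of "%t. B t w" u w] by simp
 then obtain n where "tau w u <= of_nat n" using ennreal_Ex_less_of_nat[of "tau w u"] by (auto intro: less_imp_le)
 hence "ext0 ?f (X (tau w u) w) = (0::ennreal)" using *[rule_format, OF u, of n] by simp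
 thus "y ~: S" using y by (simp add: indicator_def split: if_splits)
 qed
 qed
 qed
qed

text \<open>The starting points from which \<open>Z\<close> has positive probability form a
  \<open>nu\<close>-null set, which the clock does not charge. At the remaining positions the strong
  Markov property excludes that the shifted path lies in \<open>Z\<close>.\<close>

lemma strong_markov_null:
 assumes Z: "Z : sets (NF infy)" and null: "AE y in nu. emu (PS y) Z = 0"
 shows "AE x in m. AE w in PS x. AE u in lborel. 0 <= u -->
 (ALL y. X (tau w u) w = Some y --> emu (PS y) Z = 0 & sh (tau w u) w ~: Z)"
proof -
 let ?S = "{y. emu (PS y) Z ~= 0}"
 have [measurable]: "(%y. emu (PS y) Z) : Bor"
 using measurable_E_Some[of "ind Z"] Z by (simp add: sets_P)
 have "?S : sets nu" unfolding sets_nu by measurable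
 from AE_iff_null_sets[OF this] null have "emu nu ?S = 0" by auto
 hence "AE x in m. AE w in PS x. AE u in lborel. 0 <= u --> (ALL y. X (tau w u) w = Some y --> y ~: ?S)"
 by (rule null_set_not_charged[rotated]) measurable
 thus ?thesis
 proof (rule evmono)
 fix x assume 1: "AE w in PS x. AE u in lborel. 0 <= u --> (ALL y. X (tau w u) w = Some y --> y ~: ?S)"
 let ?i = "%w. cint (%t. B t w) (%s. 1 * ext0 (%_. 1) (X s w) * ind Z (sh s w)) :: ennreal"
 have iZ: "ind Z : bm (NF infy)" using Z by simp
 have "(%s. sh s w) : borel MM NF infy" for w by (rule measurable_sh) auto
 note mZ = mcomp[OF this iZ]
 have mi: "(%s. 1 * ext0 (%_. 1) (X s w) * ind Z (sh s w) :: ennreal) : Bor" for w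
 by (intro bmtimes mfX mZ) auto
 have "?i : bm (FF infy)"
 proof (rule measurable_cint_FF[OF adapted])
 have "(%p. fst p) : FF infy OM (borel :: ennreal measure) MM NF infy"
 by (rule mcomp[OF mfst measurable_id_FF])
 from mcomp[OF measurable_sh[OF msnd this] iZ] mcomp[OF mXFFp mext0[of "%_. 1"]]
 show "(%(w, s). 1 * ext0 (%_. 1) (X s w) * ind Z (sh s w) :: ennreal) : bm (FF infy OM borel)"
 unfolding case_prod_beta by (intro bmtimes) simp_all
 qed
 moreover have "nn (PS x) (%w. ?i w) = 0"
 proof -
 have "nn (PS x) (%w. ?i w) =
 (nn (PS x) (%w. cint (%t. B t w) (%s. 1 * ext0 (%_. 1) (X s w) * nn (P (X s w)) (%w'. ind Z w'))))"
 by (rule strong_markov_cint[OF adapted _ _ iZ]) auto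
 also have "... = nn (PS x) (%w. 0)"
 proof (rule ncongAE, rule evmono[OF 1])
 fix w assume *: "AE u in lborel. 0 <= u --> (ALL y. X (tau w u) w = Some y --> y ~: ?S)"
 have "cint (%t. B t w) (%s. 1 * ext0 (%_. 1) (X s w) * nn (P (X s w)) (%w'. ind Z w')) = cint (%t. B t w) (%s. 0 :: ennreal)"
 proof (rule cint_cong_AE, rule evmono[OF *], rule impI)
 fix u :: real assume u: "0 <= u --> (ALL y. X (tau w u) w = Some y --> y ~: ?S)" "0 <= u"
 thus "1 * ext0 (%_. 1) (X (tau w u) w) * nn (P (X (tau w u) w)) (%w'. ind Z w') = (0 :: ennreal)"
 using Z by (cases "X (tau w u) w") (simp_all add: sets_P)
 qed
 thus "cint (%t. B t w) (%s. 1 * ext0 (%_. 1) (X s w) * nn (P (X s w)) (%w'. ind Z w')) = 0"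
 by (simp add: cint_def)
 qed
 finally show ?thesis by simp
 qed
 ultimately have 2: "AE w in PS x. ?i w = 0" by (rule nn_integral_0_FF[THEN iffD1])
 show "AE w in PS x. AE u in lborel. 0 <= u -->
 (ALL y. X (tau w u) w = Some y --> emu (PS y) Z = 0 & sh (tau w u) w ~: Z)"
 using 1 2
 proof eventually_elim
 case (elim w)
 from elim(1) elim(2)[unfolded cint_eq_0_iff[OF mi]] show ?case
 by eventually_elim (auto simp: indicator_def split: if_splits)
 qed
 qed
qed

text \<open>The counterpart of \<open>markov_completed\<close> on the clock, with a raw exceptional
  set that is null from \<open>nu\<close>-almost every start. One set of good \<open>x\<close>
  serves all \<open>W\<close> and \<open>f\<close>, since the exceptional set depends on
  \<open>F\<close> alone.\<close>

lemma strong_markov_cint_FF: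
 assumes F: "F : bm (FF infy)"
 shows "AE x in m. ALL (W :: ennreal => ennreal) (f :: 'e => ennreal). W : Bor --> f : Bor -->
 (nn (PS x) (%w. cint (%t. B t w) (%s. W s * ext0 f (X s w) * F (sh s w)))) =
 (nn (PS x) (%w. cint (%t. B t w) (%s. W s * ext0 (%y. f y * nn (PS y) (%w'. F w')) (X s w))))"
proof -
 obtain F0 Z where F0: "F0 : bm (NF infy)" and Z: "Z : sets (NF infy)" "{w. F w ~= F0 w} <= Z"
 and null: "AE y in nu. emu (PS y) Z = 0"
 by (rule raw_version[OF nu.sigma_finite_measure_axioms sets_nu F])
 have ZF: "F w = F0 w" if "w ~: Z" for w using Z(2) that by blast
 show ?thesis
 proof (rule evmono[OF strong_markov_null[OF Z(1) null]], intro allI impI)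
 fix x and W :: "ennreal => ennreal" and f :: "'e => ennreal" assume W: "W : Bor" and f: "f : Bor"
 and *: "AE w in PS x. AE u in lborel. 0 <= u -->
 (ALL y. X (tau w u) w = Some y --> emu (PS y) Z = 0 & sh (tau w u) w ~: Z)"
 have "nn (PS x) (%w. cint (%t. B t w) (%s. W s * ext0 f (X s w) * F (sh s w))) =
 (nn (PS x) (%w. cint (%t. B t w) (%s. W s * ext0 f (X s w) * F0 (sh s w))))"
 proof (rule ncongAE, rule evmono[OF *], rule cint_cong_AE, elim evmono, rule impI)
 fix w u assume "0 <= u --> (ALL y. X (tau w u) w = Some y --> emu (PS y) Z = 0 & sh (tau w u) w ~: Z)" "0 <= u"
 thus "W (tau w u) * ext0 f (X (tau w u) w) * F (sh (tau w u) w) = W (tau w u) * ext0 f (X (tau w u) w) * F0 (sh (tau w u) w)"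
 by (cases "X (tau w u) w") (simp_all add: ZF)
 qed
 also have "... = nn (PS x) (%w. cint (%t. B t w) (%s. W s * ext0 f (X s w) * nn (P (X s w)) (%w'. F0 w')))"
 by (rule strong_markov_cint[OF adapted W f F0])
 also have "... = nn (PS x) (%w. cint (%t. B t w) (%s. W s * ext0 (%y. f y * nn (PS y) (%w'. F w')) (X s w)))"
 proof (rule ncongAE, rule evmono[OF *], rule cint_cong_AE, elim evmono, rule impI)
 fix w u assume **: "0 <= u --> (ALL y. X (tau w u) w = Some y --> emu (PS y) Z = 0 & sh (tau w u) w ~: Z)" "0 <= u"
 show "W (tau w u) * ext0 f (X (tau w u) w) * nn (P (X (tau w u) w)) (%w'. F0 w') =
 W (tau w u) * ext0 (%y. f y * nn (PS y) (%w'. F w')) (X (tau w u) w)"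
 proof (cases "X (tau w u) w")
 case (Some y)
 hence "AE w in PS y. F0 w = F w" using Z ** by (intro AE_I[of _ _ Z]) (auto simp: sets_P)
 hence "nn (PS y) (%w. F0 w) = nn (PS y) (%w. F w)" by (rule ncongAE)
 thus ?thesis using Some by (simp add: mult.assoc)
 qed simp
 qed
 finally show "nn (PS x) (%w. cint (%t. B t w) (%s. W s * ext0 f (X s w) * F (sh s w))) =
 (nn (PS x) (%w. cint (%t. B t w) (%s. W s * ext0 (%y. f y * nn (PS y) (%w'. F w')) (X s w))))" .
 qed
qed

end

section \<open>Comparison of additive functionals\<close>

lemma (in hunt_process) growth_comparison:
 assumes "additive_functional X P \<theta> A LLA" "additive_functional X P \<theta> B LLB"
 and w: "w : LLA" "w : LLB" and q: "0 <= q" and F[measurable]: "F : sets borel" and Z: "Z : sets (NF infy)"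
 and charged: "AE u in lborel. 0 <= u --> (ALL y. X (ivt (%t. B t w) u) w = Some y --> y : F -->
 sh (ivt (%t. B t w) u) w ~: Z)"
 and growth: "!!w' y g. w' ~: Z ==> X 0 w' = Some y ==> y : F ==> 0 < g ==>
 EX d>0. d < g & en q * B (en d) w' <= A (en d) w'"
 shows "en q * cint (%t. B t w) (%s. ind {..t} s * ext0 (ind F) (X s w)) <=
 cint (%t. A t w) (%s. ind {..t} s * ext0 (ind F) (X s w))"
proof -
 interpret A: additive_functional X P \<theta> A LLA by fact
 interpret B: additive_functional X P \<theta> B LLB by fact
 let ?f = "ind F :: 'e => ennreal"
 have f: "?f : Bor" by measurable
 let ?a = "%t. A t w" and ?b = "%t. B t w"
 define V where "V r = {s. 0 <= s & s <= r & ext0 ?f (X (en s) w) = 1}" for r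
 have Xm: "(%s::real. ext0 ?f (X (en s) w)) : Bor"
 by (rule mcomp[OF menn A.mfX[OF f]])
 have shm: "(%s::real. sh (en s) w) : borel MM NF infy" by (rule measurable_sh) auto
 have Zm: "{s::real. sh (en s) w : Z} : sets borel" using msets[OF shm Z] by (simp add: vimage_def)
 have Vm[measurable]: "V r : sets borel" for r unfolding V_def using Xm by measurable
 have VI: "ext0 ?f (X (en s) w) * ind {0..r} s = ind (V r) s" for r s
 by (cases "X (en s) w") (auto simp: V_def split: spind)
 have int: "sn (stieltjes a r) {0..r} (%s. ext0 ?f (X (en s) w)) = emu (stieltjes a r) (V r)" for a r
 unfolding VI by (rule nn_integral_indicator) simp
 have "en q * functional_integral X B ?f t w <= functional_integral X A ?f t w"
 unfolding functional_integral_def[of X B] SUPml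
 proof (rule SUP_least)
 fix r assume R: "r : {r. 0 <= r & en r <= t & en r < lifetime X w}"
 hence r: "0 <= r" "en r < lifetime X w" by auto
 note ga = A.good[OF w(1)] and gb = B.good[OF w(2)]
 interpret b: finite_measure "stieltjes ?b r" by (rule stieltjes_finite[OF gb r])
 let ?Z = "{s::real. sh (en s) w : Z}"
 \<comment> \<open>The end point \<open>r\<close> is dropped, because both clocks are frozen after
   \<open>r\<close> and no growth step starts there; it is not an atom.\<close>
 define W where "W = (V r - {r}) - ?Z"
 have W[measurable]: "W : sets borel" unfolding W_def using Zm by measurable
 have V'm[measurable]: "V r Int ?Z : sets borel" using Zm by measurable
 have V': "emu (stieltjes ?b r) (V r Int ?Z) = 0"
 proof -
 have "emu (stieltjes ?b r) (V r Int ?Z) = cint ?b (%t. ind (V r Int ?Z) (enn2real t) * ind {..ennreal r} t)"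
 by (subst nn_integral_stieltjes[OF gb r, symmetric]) simp_all
 also have "... = cint ?b (%t. 0)"
 proof (rule cint_cong_AE, rule evmono[OF charged], rule impI)
 fix u :: real
 let ?t = "ivt ?b u"
 assume u: "0 <= u --> (ALL y. X ?t w = Some y --> y : F --> sh ?t w ~: Z)" "0 <= u"
 have "~ (enn2real ?t : V r & enn2real ?t : ?Z & ?t <= en r)"
 proof (intro notI, elim conjE)
 assume *: "enn2real ?t : V r" "enn2real ?t : ?Z" "?t <= en r"
 hence e: "en (enn2real ?t) = ?t" by (cases ?t) (simp_all add: top_unique)
 show False
 using * u unfolding V_def mem_Collect_eq e by (cases "X ?t w") (auto split: split_indicator_asm)
 qed
 thus "ind (V r Int ?Z) (enn2real ?t) * ind {..ennreal r} ?t = (0::ennreal)"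
 by (simp add: indicator_def)
 qed
 finally show ?thesis by (simp add: cint_def)
 qed
 have "emu (stieltjes ?b r) (V r) <= emu (stieltjes ?b r) (W Un ((V r Int ?Z) Un {r}))"
 proof (rule emeasure_mono)
 show "V r <= W Un (V r Int ?Z Un {r})" by (auto simp: W_def)
 qed (use W V'm in simp)
 also have "... <= emu (stieltjes ?b r) W + (emu (stieltjes ?b r) (V r Int ?Z) + emu (stieltjes ?b r) {r})"
 by (intro order_trans[OF emeasure_subadditive add_left_mono] emeasure_subadditive) auto
 also have "... = emu (stieltjes ?b r) W"
 unfolding V' by (simp add: b.emeasure_eq_measure stieltjes_atom[OF gb r])
 finally have "en q * emu (stieltjes ?b r) (V r) <= en q * emu (stieltjes ?b r) W" by (rule mlmono) simp
 also have "... <= emu (stieltjes ?a r) W"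
 proof (rule emeasure_le_of_growth)
 show "finite_measure (stieltjes ?a r)" "finite_measure (stieltjes ?b r)"
 by (rule stieltjes_finite[OF ga r] stieltjes_finite[OF gb r])+
 show "measure (stieltjes ?b r) {s} = 0" for s by (rule stieltjes_atom[OF gb r])
 fix s g :: real assume s: "s : W" and g: "0 < g"
 hence s': "0 <= s" "s < r" "sh (en s) w ~: Z" and Xs: "ext0 ?f (X (en s) w) = 1"
 by (auto simp: W_def V_def)
 have sh: "sh (en s) = th (en s)" by (rule sh_finite) simp
 obtain y where y: "X (en s) w = Some y" "y : F"
 using Xs by (cases "X (en s) w") (auto split: split_indicator_asm)
 have "X 0 (sh (en s) w) = Some y" unfolding sh using A.X_shift[of "en s" 0 w] y by simp
 from growth[OF s'(3) this y(2), of "min g (r - s)"] g s' obtain d where d: "0 < d" "d < g" "d < r - s"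
 and le: "en q * B (en d) (sh (en s) w) <= A (en d) (sh (en s) w)" by auto
 have se: "en (s + d) = en s + en d" using s' d by simp
 have "en s <= en r" using s' by (intro ennreal_leI) simp
 hence lt: "en s < lifetime X w" using r(2) by (rule le_less_trans)
 have inc: "en (measure (stieltjes (%t. C t w) r) {s<..s+d}) = C (en d) (sh (en s) w)"
 if C: "additive_functional X P \<theta> C LL" and w: "w : LL" for C LL
 proof -
 interpret C: additive_functional X P \<theta> C LL by fact
 have "C (en s) w + en (measure (stieltjes (%t. C t w) r) {s<..s+d}) = C (en (s + d)) w"
 using stieltjes_Ioc'(2)[OF C.good[OF w] r, of s "s + d"] s' d by (simp add: add.commute)
 also have "... = C (en s) w + C (en d) (sh (en s) w)"
 unfolding se sh by (rule C.additive[OF w]) auto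
 finally have eq: "C (en s) w + en (measure (stieltjes (%t. C t w) r) {s<..s+d}) = ..." .
 have "C (en s) w < infy" using C.good[OF w] lt unfolding good_path_def by blast
 thus ?thesis using eq by (subst (asm) ennreal_add_left_cancel) auto
 qed
 have "en (q * measure (stieltjes ?b r) {s<..s+d}) <= en (measure (stieltjes ?a r) {s<..s+d})"
 using le q by (simp add: ennreal_mult inc[OF assms(1) w(1)] inc[OF assms(2) w(2)])
 thus "EX d>0. d < g & q * measure (stieltjes ?b r) {s<..s+d} <= measure (stieltjes ?a r) {s<..s+d}"
 using d by (auto simp: ennreal_le_iff)
 qed (use q in auto)
 also have "... <= emu (stieltjes ?a r) (V r)" by (intro emeasure_mono) (auto simp: W_def)
 also have "... <= functional_integral X A ?f t w"
 unfolding functional_integral_def by (rule SUP_upper2[OF R]) (rule eq_refl[OF int[symmetric]])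
 finally show "en q * sn (stieltjes ?b r) {0..r} (%s. ext0 ?f (X (en s) w)) <= functional_integral X A ?f t w"
 by (simp only: int[of ?b r])
 qed
 thus ?thesis unfolding A.functional_integral_eq[OF w(1) f] B.functional_integral_eq[OF w(2) f] .
qed

locale revuz_pair = symmetric_hunt_process X P \<theta> m DL L T \<E> D G
 + A: revuz_functional X P \<theta> m DL L T \<E> D G A LLA nuA NA
 + B: revuz_functional X P \<theta> m DL L T \<E> D G B LLB nuB NB
 for X :: "ennreal => 'w => 'e::{metric_space, second_countable_topology} option"
 and P \<theta> m DL L T \<E> D G A LLA nuA NA B LLB nuB NB +
 assumes le: "!!S. S : sets borel ==> emu nuA S <= emu nuB S"
begin

lemma AE_nuA: "AE y in nuA. Q y" if Q: "AE y in nuB. Q y"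
proof -
 obtain S where "{y : space nuB. ~ Q y} <= S" "emu nuB S = 0" "S : sets nuB" using Q by (rule AE_E)
 thus ?thesis
 using le[of S] by (intro AE_I[of _ _ S]) (auto simp: A.sets_nu B.sets_nu sets_eq_imp_space_eq[OF A.sets_nu] sets_eq_imp_space_eq[OF B.sets_nu])
qed

context
 fixes q :: real
 assumes q: "1 < q"
begin

text \<open>Rational times make this an event of \<open>FF 0\<close>, so the zero-one law sorts the
  starting points into two classes.\<close>

private definition "H = {w. ALL n. EX r:\<rat>. 0 < r & r < rs n & en q * B (en r) w <= A (en r) w}"

private lemma H_FF_0: "H : sets (FF 0)"
proof (rule FF_0_I)
 fix t :: ennreal assume "0 < t"
 then obtain c where c: "0 < en c" "en c < t" by (rule rat_between) auto
 then obtain n0 where n0: "rs n0 < c" using reals_Archimedean[of c] by (auto simp: inverse_eq_divide)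
 \<comment> \<open>The index is shifted by \<open>n0\<close> so that all times involved stay below
   \<open>c\<close>; the intersection is unchanged because the conditions are nested in
   \<open>n\<close>.\<close>
 have "(\<Inter>n. \<Union>r\<in>{r : \<rat>. 0 < r & r < 1 / real (Suc (n + n0))}. {w. en q * B (en r) w <= A (en r) w}) : sets (FF t)"
 proof (intro sets.countable_INT sets.countable_UN' image_subsetI)
 fix n r assume r: "r : {r : \<rat>. 0 < r & r < 1 / real (Suc (n + n0))}"
 have "r < c" using r n0 divide_left_mono[of "real (Suc n0)" "real (Suc (n + n0))" 1] by auto
 hence "en r <= en c" by (intro ennreal_leI) simp
 hence rt: "en r <= t" using c(2) by simp
 have [measurable]: "A (en r) : bm (FF t)" "B (en r) : bm (FF t)"
 by (rule mFFm[OF A.adapted rt] mFFm[OF B.adapted rt], simp)+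
 have "{w : space (FF t). en q * B (en r) w <= A (en r) w} : sets (FF t)" by measurable
 thus "{w. en q * B (en r) w <= A (en r) w} : sets (FF t)" by simp
 qed (auto intro: countable_subset[OF _ countable_rat])
 moreover have "H = (\<Inter>n. \<Union>r\<in>{r : \<rat>. 0 < r & r < 1 / real (Suc (n + n0))}. {w. en q * B (en r) w <= A (en r) w})"
 (is "_ = ?R")
 proof (intro set_eqI iffI)
 fix w assume *: "w : ?R"
 show "w : H" unfolding H_def
 proof (intro CollectI allI)
 fix n
 from * obtain r where r: "r : \<rat>" "0 < r" "r < 1 / real (Suc (n + n0))" "en q * B (en r) w <= A (en r) w" by blast
 hence "r < rs n" using divide_left_mono[of "real (Suc n)" "real (Suc (n + n0))" 1] by auto
 thus "EX r:\<rat>. 0 < r & r < rs n & en q * B (en r) w <= A (en r) w" using r by blast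
 qed
 next
 fix w assume "w : H"
 thus "w : ?R" unfolding H_def by blast
 qed
 ultimately show "H : sets (FF t)" by simp
qed

private lemma H_FF: "H : sets (FF infy)"
 using FF_mono[of 0 infy] H_FF_0 by auto

private lemma zero_one: "(AE w in P x. w : H) | (AE w in P x. w ~: H)"
 by (rule blumenthal[OF H_FF_0])

private lemma H_growth:
 assumes "w : H" "0 < g"
 shows "EX d>0. d < g & en q * B (en d) w <= A (en d) w"
proof -
 obtain n where n: "rs n < g" using reals_Archimedean[OF assms(2)] by (auto simp: inverse_eq_divide)
 obtain r where r: "0 < r" "r < rs n" "en q * B (en r) w <= A (en r) w" using assms(1) unfolding H_def by blast
 thus ?thesis using n by (intro exI[of _ r]) simp
qed

private lemma not_H_growth:
 assumes "w ~: H" "0 < g"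
 shows "EX d>0. d < g & en (1 / q) * A (en d) w <= B (en d) w"
proof -
 obtain n where n: "!!r. r : \<rat> ==> 0 < r ==> r < rs n ==> ~ en q * B (en r) w <= A (en r) w"
 using assms(1) unfolding H_def by blast
 obtain r where r: "r : \<rat>" "0 < r" "r < min g (rs n)" using Rats_dense_in_real[of 0 "min g (rs n)"] assms(2) by auto
 hence "A (en r) w <= en q * B (en r) w" using n[of r] by auto
 hence "en (1 / q) * A (en r) w <= en (1 / q) * (en q * B (en r) w)" by (rule mlmono) simp
 also have "... = B (en r) w" using q by (simp add: mult.assoc[symmetric] ennreal_mult'[symmetric])
 finally show ?thesis using r by (intro exI[of _ r]) simp
qed

text \<open>On \<open>S\<close> the path comparison gives
  \<open>q * nuB S \<le> nuA S \<le> nuB S\<close> with a finite right side, and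
  \<open>q > 1\<close> leaves only the value 0.\<close>

private lemma growth_set_null:
 assumes S[measurable]: "S : sets borel" and Z: "Z : sets (NF infy)" and Z0: "AE y in nuB. emu (PS y) Z = 0"
 and ZS: "!!w y. w ~: Z ==> X 0 w = Some y ==> y : S ==> w : H" and fin: "emu nuB S < infy"
 shows "emu nuB S = 0"
proof -
 let ?f = "ind S :: 'e => ennreal"
 have f: "?f : Bor" by measurable
 have le: "en q * B.Em (B.II ?f t) <= A.Em (A.II ?f t)" for t
 proof -
 obtain k where k[measurable]: "k : Bor" and kB: "AE y in m. nn (PS y) (%w. B.II ?f t w) = k y"
 by (rule B.measurable_E_II[OF f])
 have "en q * B.Em (B.II ?f t) = nn m (%y. en q * k y)"
 by (subst ncongAE[OF kB]) (simp add: ncmult meas_m)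
 also have "... <= A.Em (A.II ?f t)"
 proof (rule nmonoAE)
 show "AE x in m. en q * k x <= nn (PS x) (%w. A.II ?f t w)"
 using A.AE_start(1) B.AE_start(1) B.strong_markov_null[OF Z Z0] kB
 proof eventually_elim
 case (elim x)
 have "AE w in PS x. en q * B.II ?f t w <= A.II ?f t w"
 using elim(1-3)
 proof eventually_elim
 case (elim w)
 show ?case
 proof (rule growth_comparison[OF A.additive_functional_axioms B.additive_functional_axioms elim(1,2) _ S Z])
 show "AE u in lborel. 0 <= u --> (ALL y. X (B.tau w u) w = Some y --> y : S --> sh (B.tau w u) w ~: Z)"
 using elim(3) by (rule evmono) auto
 qed (use q ZS H_growth in auto)
 qed
 hence "nn (PS x) (%w. en q * B.II ?f t w) <= nn (PS x) (%w. A.II ?f t w)" by (rule nmonoAE)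
 also have "nn (PS x) (%w. en q * B.II ?f t w) = en q * k x"
 using ncmult[OF mFFc[OF B.measurable_II[OF f]], of "Some x" "en q" t] elim(4)
 by (simp only: ncompl)
 finally show ?case .
 qed
 qed
 finally show ?thesis .
 qed
 have "en q * nn nuB (%x. ?f x) <= nn nuA (%x. ?f x)"
 proof (rule tendsto_le[OF _ A.Em_II_tendsto[OF f]])
 show "((%t. en q * (B.Em (B.II ?f (en t)) / en t)) \<longlongrightarrow> en q * nn nuB (%x. ?f x)) (at_right 0)"
 by (intro tendsto_mult_ennreal tendsto_const B.Em_II_tendsto f) (use q in auto)
 show "\<forall>\<^sub>F t in at_right 0. en q * (B.Em (B.II ?f (en t)) / en t) <= A.Em (A.II ?f (en t)) / en t"
 using le by (intro always_eventually allI) (simp add: divide_ennreal_def mult.assoc[symmetric] mrmono)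
 qed simp
 also have "nn nuA (%x. ?f x) <= emu nuB S" using revuz_pair.le[OF revuz_pair_axioms S] by (simp add: A.sets_nu)
 finally have "en q * emu nuB S <= emu nuB S" by (simp add: B.sets_nu)
 moreover obtain c where c: "emu nuB S = en c" "0 <= c" using fin by (cases "emu nuB S") auto
 ultimately have "q * c <= 1 * c" using q by (simp add: ennreal_mult[symmetric] ennreal_le_iff)
 hence "c = 0" using q c(2) mult_strict_right_mono[of 1 q c] by (cases "c = 0") auto
 thus ?thesis using c by simp
qed

text \<open>By the zero-one law, \<open>S\<close> consists up to a null set of the points from which
  \<open>H\<close> is almost sure. It is cut into pieces of finite mass, to which
  \<open>growth_set_null\<close> applies.\<close>

private lemma H_null: "AE y in nuB. AE w in PS y. w ~: H"
proof -
 obtain k where k[measurable]: "k : Bor" and kP: "AE y in nuB. nn (PS y) (%w. ind H w) = k y"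
 by (rule expectation_version[OF B.nu.sigma_finite_measure_axioms B.sets_nu bmind[OF H_FF]])
 define S where "S = {y. k y ~= 0}"
 have S[measurable]: "S : sets borel" unfolding S_def by measurable
 have "X 0 -` (- Some ` S) Int space (FF infy) : sets (FF infy)"
 proof (rule msets[OF mXFF[OF zero_le]])
 have "Some -` (- Some ` S) = - S" by auto
 thus "- Some ` S : sets cb" using S by (simp add: sets_cemetery_borel)
 qed
 \<comment> \<open>Paths starting off \<open>S\<close> are added, so that the enlarged event is
   almost sure from almost every start and one raw null set \<open>Z\<close> covers its
   complement.\<close>
 hence H': "H Un {w. X 0 w ~: Some ` S} : sets (FF infy)" using H_FF by (simp add: vimage_def)
 have "AE y in nuB. AE w in PS y. w : H Un {w. X 0 w ~: Some ` S}"
 using kP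
 proof (rule evmono)
 fix y assume ky: "nn (PS y) (%w. ind H w) = k y"
 show "AE w in PS y. w : H Un {w. X 0 w ~: Some ` S}"
 using zero_one[of "Some y"]
 proof
 assume "AE w in PS y. w ~: H"
 hence "AE w in PS y. ind H w = (0::ennreal)" by (rule evmono) simp
 hence "y ~: S" using ky by (simp add: S_def nn_integral_0_FF[OF bmind[OF H_FF], symmetric])
 thus ?thesis by (intro evmono[OF normal[of "Some y"]]) auto
 qed (auto elim: evmono)
 qed
 then obtain Z where Z: "Z : sets (NF infy)" "- (H Un {w. X 0 w ~: Some ` S}) <= Z" "AE y in nuB. emu (PS y) Z = 0"
 by (rule raw_null_set[OF B.nu.sigma_finite_measure_axioms B.sets_nu H'])
 obtain F :: "nat => 'e set" where F: "!!n. F n : sets borel" "!!n. emu nuB (F n) < infy" "emu nuB (- (\<Union>n. F n)) = 0"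
 by (rule smooth_exhaustion[OF B.smooth]) blast
 have "emu nuB (S Int F n) = 0" for n
 proof (rule growth_set_null[OF _ Z(1,3)])
 have "emu nuB (S Int F n) <= emu nuB (F n)" by (rule emeasure_mono) (use F in \<open>auto simp: B.sets_nu\<close>)
 thus "emu nuB (S Int F n) < infy" using F(2) by (rule le_less_trans)
 show "w ~: Z ==> X 0 w = Some y ==> y : S Int F n ==> w : H" for w y using Z(2) by blast
 qed (use F in auto)
 hence "(\<Union>n. S Int F n) : null_sets nuB" using F by (intro null_sets_UN) (auto simp: null_sets_def B.sets_nu)
 moreover have "- (\<Union>n. F n) : null_sets nuB" using F by (auto simp: null_sets_def B.sets_nu)
 ultimately have "(\<Union>n. S Int F n) Un - (\<Union>n. F n) : null_sets nuB" by (rule null_sets.Un)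
 from AE_not_in[OF this] kP show ?thesis
 proof eventually_elim
 case (elim y)
 hence "nn (PS y) (%w. ind H w) = 0" by (auto simp: S_def)
 hence "AE w in PS y. ind H w = (0::ennreal)" by (simp only: nn_integral_0_FF[OF bmind[OF H_FF]])
 thus ?case by (rule evmono) (simp add: indicator_def split: if_splits)
 qed
qed

text \<open>Off \<open>H\<close> one has \<open>A \<le> q B\<close> at all small rational times, so
  the comparison runs with exchanged roles and factor \<open>1 / q\<close>.\<close>

lemma dominated_factor:
 "AE x in m. AE w in PS x. ALL F t. F : sets borel --> A.II (ind F) t w <= en q * B.II (ind F) t w"
proof -
 have "- H : sets (FF infy)" using H_FF by (metis Compl_eq_Diff_UNIV sets.compl_sets space_FF)
 moreover have "AE y in nuA. AE w in PS y. w : - H" using AE_nuA[OF H_null] by simp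
 ultimately obtain Z where Z: "Z : sets (NF infy)" "- (- H) <= Z" "AE y in nuA. emu (PS y) Z = 0"
 by (rule raw_null_set[OF A.nu.sigma_finite_measure_axioms A.sets_nu])
 show ?thesis
 using A.AE_start(1) B.AE_start(1) A.strong_markov_null[OF Z(1,3)]
 proof eventually_elim
 case (elim x)
 thus ?case
 proof eventually_elim
 case (elim w)
 show ?case
 proof (intro allI impI)
 fix F :: "'e set" and t assume F: "F : sets borel"
 have "en (1 / q) * A.II (ind F) t w <= B.II (ind F) t w"
 proof (rule growth_comparison[OF B.additive_functional_axioms A.additive_functional_axioms elim(2,1) _ F Z(1)])
 show "AE u in lborel. 0 <= u --> (ALL y. X (A.tau w u) w = Some y --> y : F --> sh (A.tau w u) w ~: Z)"
 using elim(3) by (rule evmono) auto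
 show "EX d>0. d < g & en (1 / q) * A (en d) w' <= B (en d) w'" if "w' ~: Z" "0 < g" for w' g
 using that Z(2) by (intro not_H_growth) auto
 qed (use q in auto)
 hence "en q * (en (1 / q) * A.II (ind F) t w) <= en q * B.II (ind F) t w" by (rule mlmono) simp
 thus "A.II (ind F) t w <= en q * B.II (ind F) t w"
 using q by (simp add: mult.assoc[symmetric] ennreal_mult'[symmetric])
 qed
 qed
 qed
qed

end

lemma dominated:
 "AE x in m. AE w in PS x. ALL F t. F : sets borel --> A.II (ind F) t w <= B.II (ind F) t w"
proof -
 have "AE x in m. ALL n. AE w in PS x. ALL F t. F : sets borel --> A.II (ind F) t w <= en (1 + rs n) * B.II (ind F) t w"
 by (intro AEall[THEN iffD2] allI dominated_factor) simp
 thus ?thesis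
 proof (rule evmono)
 fix x assume "ALL n. AE w in PS x. ALL F t. F : sets borel --> A.II (ind F) t w <= en (1 + rs n) * B.II (ind F) t w"
 hence "AE w in PS x. ALL n. ALL F t. F : sets borel --> A.II (ind F) t w <= en (1 + rs n) * B.II (ind F) t w"
 by (rule AEall[THEN iffD2])
 thus "AE w in PS x. ALL F t. F : sets borel --> A.II (ind F) t w <= B.II (ind F) t w"
 proof (rule evmono, intro allI impI)
 fix w t and F :: "'e set" assume *: "ALL n. ALL F t. F : sets borel --> A.II (ind F) t w <= en (1 + rs n) * B.II (ind F) t w"
 and F: "F : sets borel"
 have "(%n. en (1 + rs n) * B.II (ind F) t w) ->> en (1 + 0) * B.II (ind F) t w"
 using LIMSEQ_Suc[OF lim_const_over_n[of 1]] by (intro tendsto_mult_ennreal tendsto_ennrealI tendsto_add tendsto_const) auto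
 hence "A.II (ind F) t w <= en (1 + 0) * B.II (ind F) t w"
 by (rule LIMSEQ_le_const) (use * F in blast)
 thus "A.II (ind F) t w <= B.II (ind F) t w" by simp
 qed
 qed
qed

end

context revuz_pair
begin

text \<open>The difference of the two expectations is subadditive: by \<open>Em_II_split\<close> its
  increment is the integral of \<open>PT s\<close> applied to the nonnegative function
  \<open>l - k\<close>, which \<open>m\<close> does not increase. Its slope at 0 is the difference
  of the masses of \<open>F\<close>, so \<open>subadditive_le_limit\<close> applies. Finite mass of
  \<open>F\<close> keeps all subtractions in \<open>ennreal\<close> meaningful.\<close>

lemma Em_difference:
 assumes F[measurable]: "F : sets borel" and fin: "emu nuB F < infy" and t: "0 < t"
 shows "B.Em (B.II (ind F) (en t)) <= A.Em (A.II (ind F) (en t)) + en t * (emu nuB F - emu nuA F)"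
proof -
 let ?f = "ind F :: 'e => ennreal"
 have f: "?f : Bor" by measurable
 have cancel: "y = x + (y - x)" if "x <= y" for x y :: ennreal
 using that by (subst add.commute) (simp add: diff_add_cancel_ennreal)
 let ?a = "%t. A.Em (A.II ?f (en t))" and ?b = "%t. B.Em (B.II ?f (en t))"
 have bfin: "?b t < infy" if "0 < t" for t
 using B.Em_II_le[OF f that] fin by (auto simp: B.sets_nu intro!: le_less_trans[OF B.Em_II_le[OF f that]] enmlt[THEN iffD2])
 have ab: "?a t <= ?b t" for t
 using dominated by (intro nmonoAE, elim evmono) (intro nmonoAE, elim evmono, use F in blast)
 have add: "?b (s + t) - ?a (s + t) <= (?b s - ?a s) + (?b t - ?a t)" if st: "0 < s" "0 < t" for s t
 proof -
 obtain k where k[measurable]: "k : Bor" and kE: "AE y in m. nn (PS y) (%w. A.II ?f (en t) w) = k y"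
 by (rule A.measurable_E_II[OF f])
 obtain l where l[measurable]: "l : Bor" and lE: "AE y in m. nn (PS y) (%w. B.II ?f (en t) w) = l y"
 by (rule B.measurable_E_II[OF f])
 let ?d = "%y. l y - k y"
 have kl: "AE y in m. l y = k y + ?d y"
 using kE lE dominated
 proof eventually_elim
 case (elim y)
 have "k y <= l y" unfolding elim(1,2)[symmetric]
 by (rule nmonoAE, rule evmono[OF elim(3)]) (use F in blast)
 thus ?case by (rule cancel)
 qed
 have e: "en (s + t) = en s + en t" using st by simp
 have bt: "?b t = ?a t + nn m (%y. ?d y)"
 unfolding ncongAE[OF kE] ncongAE[OF lE] ncongAE[OF kl]
 by (rule nadd) (simp_all add: meas_m)
 have "?b (s + t) = ?b s + nn m (%y. PT (en s) l y)"
 unfolding e by (rule B.Em_II_split[OF f _ _ l lE]) (use st in auto)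
 also have "nn m (%y. PT (en s) l y) = nn m (%y. PT (en s) k y + PT (en s) ?d y)"
 by (intro ncong) (subst PT_cong_AE[OF kl], auto simp: st PT_add)
 also have "... = nn m (%y. PT (en s) k y) + nn m (%y. PT (en s) ?d y)"
 by (rule nadd) (simp_all add: meas_m)
 also have "... <= nn m (%y. PT (en s) k y) + nn m (%y. ?d y)"
 by (intro add_left_mono PT_excessive_measure) auto
 finally have 1: "?b (s + t) <= ?b s + (nn m (%y. PT (en s) k y) + nn m (%y. ?d y))" by (simp add: add_left_mono)
 have 2: "?a (s + t) = ?a s + nn m (%y. PT (en s) k y)"
 unfolding e by (rule A.Em_II_split[OF f _ _ k kE]) (use st in auto)
 have "?a r < \<top>" if "0 < r" for r using le_less_trans[OF ab bfin[OF that]] by simp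
 note afin = this[OF st(2)] this[OF add_pos_pos[OF st]]
 have D: "?b t - ?a t = nn m (%y. ?d y)" unfolding bt using afin by (simp add: ennreal_add_diff_cancel_left)
 have bs: "?a s + (?b s - ?a s) = ?b s" by (rule cancel[OF ab, symmetric])
 have "?a (s + t) + ((?b s - ?a s) + (?b t - ?a t)) = (?a s + (?b s - ?a s)) + (nn m (%y. PT (en s) k y) + nn m (%y. ?d y))"
 unfolding 2 D by (simp only: ac_simps)
 note this[unfolded bs]
 thus ?thesis using 1 afin by (subst ennreal_minus_le_iff) (simp only: less_top[symmetric], simp)
 qed
 have lim: "((%t. (?b t - ?a t) / en t) \<longlongrightarrow> (nn nuB (%x. ?f x)) - (nn nuA (%x. ?f x))) (at_right 0)"
 proof (rule Lim_transform_eventually)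
 show "((%t. ?b t / en t - ?a t / en t) \<longlongrightarrow> (nn nuB (%x. ?f x)) - (nn nuA (%x. ?f x))) (at_right 0)"
 proof (intro tendsto_diff_ennreal A.Em_II_tendsto B.Em_II_tendsto f)
 show "nn nuB (%x. ?f x) ~= \<top>" using fin by (simp add: B.sets_nu less_top)
 show "nn nuA (%x. ?f x) ~= \<top>" using le_less_trans[OF revuz_pair.le[OF revuz_pair_axioms F] fin] by (simp add: A.sets_nu less_top)
 qed
 show "\<forall>\<^sub>F t in at_right 0. ?b t / en t - ?a t / en t = (?b t - ?a t) / en t"
 using eventually_at_right_less
 proof eventually_elim
 case (elim t)
 have "?b t = ?a t + (?b t - ?a t)" by (rule cancel[OF ab])
 hence "?b t / en t = ?a t / en t + (?b t - ?a t) / en t" by (metis add_divide_distrib_ennreal)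
 moreover have "?a t / en t ~= \<top>"
 using le_less_trans[OF ab bfin[OF elim]] elim by (simp add: divide_ennreal_def ennreal_mult_eq_top_iff inverse_ennreal)
 ultimately show ?case by (simp add: ennreal_add_diff_cancel_left)
 qed
 qed
 have "?b t = ?a t + (?b t - ?a t)" by (rule cancel[OF ab])
 also have "?b t - ?a t <= en t * (nn nuB (%x. ?f x) - (nn nuA (%x. ?f x)))"
 by (rule subadditive_le_limit[OF add lim t])
 finally show ?thesis by (simp add: A.sets_nu B.sets_nu add_left_mono)
qed

end

section \<open>Recovering the functional from its approximations, for almost every start\<close>

context symmetric_hunt_process
begin

lemma nn_integral_eq_imp_AE_eq:
 assumes fg: "f : bm M" "g : bm M" "AE x in M. f x <= g x"
 and le: "nn M (%x. g x) <= nn M (%x. f x)" and fin: "nn M (%x. f x) < infy"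
 shows "AE x in M. f x = g x"
proof (rule ccontr)
 assume *: "~ ?thesis"
 have "~ (AE x in M. g x <= f x)"
 proof
 assume "AE x in M. g x <= f x"
 with fg(3) have "AE x in M. f x = g x" by eventually_elim simp
 with * show False ..
 qed
 from nn_integral_less[OF fg(1,2) _ fg(3) this] fin le show False by (simp add: less_top)
qed

context
 fixes B :: "ennreal => 'w => ennreal" and LL nu N and As :: "nat => ennreal => 'w => ennreal" and LLs and nus :: "nat => 'e measure" and Ns
 assumes pair: "!!n. revuz_pair X P \<theta> m DL L T \<E> D G (As n) (LLs n) (nus n) (Ns n) B LL nu N"
 and sup: "!!S. S : sets borel ==> emu nu S = (SUP n. emu (nus n) S)" "!!S. S : sets borel ==> incseq (%n. emu (nus n) S)"
begin

interpretation B: revuz_functional X P \<theta> m DL L T \<E> D G B LL nu N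
 using pair[of 0] unfolding revuz_pair_def by simp

private lemma start: "AE x in m. ALL n. AE w in PS x. w : LLs n"
proof (intro AEall[THEN iffD2] allI)
 fix n
 interpret pn: revuz_pair X P \<theta> m DL L T \<E> D G "As n" "LLs n" "nus n" "Ns n" B LL nu N by (rule pair)
 show "AE x in m. AE w in PS x. w : LLs n" by (rule pn.A.AE_start)
qed

text \<open>Domination gives one inequality on paths, and \<open>Em_difference\<close>, with the
  masses of \<open>F\<close> increasing to a finite limit, makes the expectations equal. Equal
  finite integrals of ordered functions force equality almost everywhere, first in the start and
  then on the path.\<close>

private lemma approximation_fixed:
 assumes F[measurable]: "F : sets borel" and fin: "emu nu F < infy" and t: "0 < t"
 shows "AE x in m. AE w in PS x. en t < lifetime X w --> B.II (ind F) (en t) w <= (SUP n. As n (en t) w)"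
proof -
 let ?f = "ind F :: 'e => ennreal"
 have f: "?f : Bor" by measurable
 let ?Y = "B.II ?f (en t)"
 let ?Yn = "%n w. cint (%s. As n s w) (%s. ind {..ennreal t} s * ext0 ?f (X s w))"
 have Ynm: "?Yn n : bm (FF infy)" for n
 proof -
 interpret pn: revuz_pair X P \<theta> m DL L T \<E> D G "As n" "LLs n" "nus n" "Ns n" B LL nu N by (rule pair)
 show ?thesis by (rule pn.A.measurable_II[OF f])
 qed
 hence supm: "(%w. SUP n. ?Yn n w) : bm (FF infy)" by measurable
 have dom: "AE x in m. AE w in PS x. (SUP n. ?Yn n w) <= ?Y w"
 proof -
 have "AE x in m. AE w in PS x. ?Yn n w <= ?Y w" for n
 proof -
 interpret pn: revuz_pair X P \<theta> m DL L T \<E> D G "As n" "LLs n" "nus n" "Ns n" B LL nu N by (rule pair)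
 show ?thesis using pn.dominated by (elim evmono) (use F in blast)
 qed
 hence "AE x in m. ALL n. AE w in PS x. ?Yn n w <= ?Y w" by (intro AEall[THEN iffD2] allI)
 thus ?thesis
 proof (rule evmono)
 fix x assume "ALL n. AE w in PS x. ?Yn n w <= ?Y w"
 hence "AE w in PS x. ALL n. ?Yn n w <= ?Y w" by (rule AEall[THEN iffD2])
 thus "AE w in PS x. (SUP n. ?Yn n w) <= ?Y w" by (rule evmono) (auto intro: SUP_least)
 qed
 qed
 have Y: "B.Em ?Y <= B.Em (%w. SUP n. ?Yn n w)"
 proof -
 have "(%n. emu (nus n) F) ->> emu nu F" using sup[OF F] LIMSEQ_SUP by simp
 hence "(%n. B.Em (%w. SUP n. ?Yn n w) + en t * (emu nu F - emu (nus n) F)) ->>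
 B.Em (%w. SUP n. ?Yn n w) + en t * (emu nu F - emu nu F)"
 using fin by (intro tendsto_add tendsto_const tendsto_mult_ennreal tendsto_diff_ennreal) (auto simp: less_top)
 hence "B.Em ?Y <= B.Em (%w. SUP n. ?Yn n w) + en t * (emu nu F - emu nu F)"
 proof (rule LIMSEQ_le_const, intro exI[of _ 0] allI impI)
 fix n
 interpret pn: revuz_pair X P \<theta> m DL L T \<E> D G "As n" "LLs n" "nus n" "Ns n" B LL nu N by (rule pair)
 have "B.Em ?Y <= B.Em (?Yn n) + en t * (emu nu F - emu (nus n) F)" by (rule pn.Em_difference[OF F fin t])
 also have "B.Em (?Yn n) <= B.Em (%w. SUP n. ?Yn n w)" by (intro nmono SUP_upper) simp
 finally show "B.Em ?Y <= B.Em (%w. SUP n. ?Yn n w) + en t * (emu nu F - emu (nus n) F)" by (simp add: add_right_mono)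
 qed
 thus ?thesis using fin by simp
 qed
 have "B.Em ?Y <= en t * emu nu F" using B.Em_II_le[OF f t] by (simp add: B.sets_nu)
 also have "... < infy" using fin by (simp add: enmlt)
 finally have Yfin: "B.Em ?Y < infy" .
 obtain k where k[measurable]: "k : Bor" and kE: "AE y in m. nn (PS y) (%w. (SUP n. ?Yn n w)) = k y"
 by (rule expectation_version[OF sigma_finite_m sets_m supm])
 obtain l where l[measurable]: "l : Bor" and lE: "AE y in m. nn (PS y) (%w. ?Y w) = l y"
 by (rule B.measurable_E_II[OF f])
 have lfin: "nn m (%y. l y) < infy" using Yfin unfolding ncongAE[OF lE] .
 have kl: "AE y in m. k y <= l y"
 using dom kE lE
 proof eventually_elim
 case (elim y)
 show ?case using nmonoAE[OF elim(1)] unfolding elim(2,3) .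
 qed
 have "AE y in m. k y = l y"
 proof (rule nn_integral_eq_imp_AE_eq[OF _ _ kl])
 show "nn m (%y. l y) <= nn m (%y. k y)" using Y unfolding ncongAE[OF lE] ncongAE[OF kE] .
 show "nn m (%y. k y) < infy" using nmonoAE[OF kl] lfin by (rule le_less_trans)
 qed (simp_all add: meas_m)
 moreover have "AE y in m. l y ~= infy" using lfin by (intro nn_integral_PInf_AE) (auto simp: meas_m)
 ultimately show ?thesis
 using kE lE dom start
 proof eventually_elim
 case (elim x)
 have "AE w in CP (PS x). (SUP n. ?Yn n w) = ?Y w"
 proof (rule nn_integral_eq_imp_AE_eq)
 show "?Y : bm (CP (PS x))" by (rule mFFc[OF B.measurable_II[OF f]])
 show "(%w. SUP n. ?Yn n w) : bm (CP (PS x))" by (rule mFFc[OF supm])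
 show "AE w in CP (PS x). (SUP n. ?Yn n w) <= ?Y w" unfolding AE_completion_iff by (rule elim(5))
 qed (use elim in \<open>simp_all add: ncompl less_top\<close>)
 hence "AE w in PS x. (SUP n. ?Yn n w) = ?Y w" unfolding AE_completion_iff .
 moreover have "AE w in PS x. ALL n. w : LLs n" by (rule AEall[THEN iffD2, OF elim(6)])
 ultimately show ?case
 proof eventually_elim
 case (elim w)
 show ?case
 proof
 assume lt: "en t < lifetime X w"
 have "?Yn n w <= As n (en t) w" for n
 proof -
 interpret pn: revuz_pair X P \<theta> m DL L T \<E> D G "As n" "LLs n" "nus n" "Ns n" B LL nu N by (rule pair)
 have "w : LLs n" using elim(2) by blast
 have "?Yn n w <= pn.A.II (%_. 1) (en t) w"
 proof (intro cint_mono mlmono)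
 show "ext0 ?f z <= ext0 (%_. 1) z" for z :: "'e option" by (cases z) (auto split: spind)
 qed simp
 thus ?thesis unfolding pn.A.II_indicator_UNIV[OF \<open>w : LLs n\<close> lt] .
 qed
 thus "?Y w <= (SUP n. As n (en t) w)" unfolding elim(1)[symmetric] by (intro SUP_mono) auto
 qed
 qed
 qed
qed

text \<open>The first inequality is domination with \<open>F = UNIV\<close>. For the second, sets of
  finite mass exhaust the space up to a set that \<open>dB\<close> does not charge.\<close>

private lemma approximation_time:
 assumes t: "0 < t"
 shows "AE x in m. AE w in PS x. en t < lifetime X w -->
 (ALL n. As n (en t) w <= B (en t) w) & B (en t) w <= (SUP n. As n (en t) w)"
proof -
 have U: "ind UNIV = (%_. 1 :: ennreal)" by auto
 have "AE x in m. ALL n. AE w in PS x. en t < lifetime X w --> As n (en t) w <= B (en t) w"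
 proof (intro AEall[THEN iffD2] allI)
 fix n
 interpret pn: revuz_pair X P \<theta> m DL L T \<E> D G "As n" "LLs n" "nus n" "Ns n" B LL nu N by (rule pair)
 show "AE x in m. AE w in PS x. en t < lifetime X w --> As n (en t) w <= B (en t) w"
 using pn.dominated pn.A.AE_start(1) B.AE_start(1)
 proof eventually_elim
 case (elim x)
 thus ?case
 proof eventually_elim
 case (elim w)
 show ?case
 proof
 assume lt: "en t < lifetime X w"
 show "As n (en t) w <= B (en t) w"
 using elim(1)[rule_format, of UNIV "en t"] unfolding U pn.A.II_indicator_UNIV[OF elim(2) lt] B.II_indicator_UNIV[OF elim(3) lt] by simp
 qed
 qed
 qed
 qed
 moreover
 obtain F :: "nat => 'e set" where F: "incseq F" "!!n. F n : sets borel" "!!n. emu nu (F n) < infy" "emu nu (- (\<Union>n. F n)) = 0"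
 by (rule smooth_exhaustion[OF B.smooth]) blast
 have "AE x in m. ALL j. AE w in PS x. en t < lifetime X w --> B.II (ind (F j)) (en t) w <= (SUP n. As n (en t) w)"
 by (intro AEall[THEN iffD2] allI approximation_fixed F t)
 moreover have "AE x in m. AE w in PS x. AE u in lborel. 0 <= u --> (ALL y. X (B.tau w u) w = Some y --> y ~: - (\<Union>n. F n))"
 by (rule B.null_set_not_charged[OF _ F(4)]) (use F(2) in auto)
 ultimately show ?thesis
 using B.AE_start(1)
 proof eventually_elim
 case (elim x)
 show ?case
 using elim(1,2)[THEN AEall[THEN iffD2]] elim(3,4)
 proof eventually_elim
 case (elim w)
 show ?case
 proof (intro impI conjI allI)
 assume lt: "en t < lifetime X w"
 thus "As n (en t) w <= B (en t) w" for n using elim(1) by blast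
 let ?g = "%f s. ind {..ennreal t} s * ext0 f (X s w) :: ennreal"
 have "B (en t) w = cint (%t. B t w) (?g (%_. 1))" by (rule B.II_indicator_UNIV[OF elim(4) lt, symmetric])
 also have "... = cint (%t. B t w) (%s. SUP j. ?g (ind (F j)) s)"
 proof (rule cint_cong_AE, rule evmono[OF elim(3)], rule impI)
 fix u :: real assume u: "0 <= u --> (ALL y. X (B.tau w u) w = Some y --> y ~: - (\<Union>n. F n))" "0 <= u"
 show "?g (%_. 1) (B.tau w u) = (SUP j. ?g (ind (F j)) (B.tau w u))"
 proof (cases "X (B.tau w u) w")
 case (Some y)
 then obtain j where "y : F j" using u by auto
 hence "(SUP j. ind (F j) y :: ennreal) = 1"
 by (intro antisym SUP_least SUP_upper2[of j]) (auto split: spind)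
 thus ?thesis using Some by (simp add: SUPml[symmetric])
 qed simp
 qed
 also have "... = (SUP j. cint (%t. B t w) (?g (ind (F j))))"
 proof -
 have gm: "?g (ind (F j)) : Bor" for j
 using B.mfX[of "ind (F j)" w] F(2)[of j] by measurable
 have ginc: "?g (ind (F j)) s <= ?g (ind (F (Suc j))) s" for j s
 using incseq_SucD[OF F(1), of j] by (intro mlmono, cases "X s w") (auto split: spind)
 show ?thesis unfolding cint_def SUPmr
 proof (rule nmcSUP)
 show "incseq (%j u. ?g (ind (F j)) (B.tau w u) * ind {0..} u)"
 by (intro incseq_SucI le_funI mrmono ginc) simp
 qed (use gm in measurable)
 qed
 also have "... <= (SUP n. As n (en t) w)" using elim(2) lt by (intro SUP_least) blast
 finally show "B (en t) w <= (SUP n. As n (en t) w)" .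
 qed
 qed
 qed
qed

lemma approximation:
 "AE x in m. AE w in PS x. ALL t:\<rat> Int {0<..}. en t < lifetime X w -->
 (ALL n. As n (en t) w <= B (en t) w) & B (en t) w <= (SUP n. As n (en t) w)"
proof -
 have c: "countable (\<rat> Int {0<..} :: real set)" by (rule countable_subset[OF _ countable_rat]) auto
 have "AE x in m. ALL t:\<rat> Int {0<..}. AE w in PS x. en t < lifetime X w -->
 (ALL n. As n (en t) w <= B (en t) w) & B (en t) w <= (SUP n. As n (en t) w)"
 by (rule AE_ball_countable[OF c, THEN iffD2]) (intro ballI approximation_time, simp)
 thus ?thesis by (rule evmono) (rule AE_ball_countable[OF c, THEN iffD2])
qed

end

end

section \<open>Occupation times before a level of the clock\<close>

lemma (in symmetric_hunt_process) PT_time_integral: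
 assumes r[measurable]: "r : Bor" and f[measurable]: "f : Bor" and g[measurable]: "g : Bor"
 shows "nn m (%x. nl (%t. r t * PT (en t) f x) * g x) = nl (%t. r t * nn m (%x. PT (en t) f x * g x))"
proof -
 interpret pair_sigma_finite m "lborel :: real measure" ..
 note [measurable] = mcomp[OF mPair[OF msnd mfst] mPTp, simplified, OF f]
 have ms: "sets (m OM lborel) = sets (borel OM borel)" by (rule sets_pair_measure_cong) (auto simp: sets_m)
 have "nn m (%x. nl (%t. r t * PT (en t) f x) * g x) = nn m (%x. nl (%t. r t * (PT (en t) f x * g x)))"
 using mPTt[OF f]
 by (intro ncong) (subst nn_integral_multc[symmetric], auto simp: mult_ac)
 also have "... = nl (%t. nn m (%x. r t * (PT (en t) f x * g x)))"
 by (rule Fubini'[symmetric]) (unfold split_beta' mcongs[OF ms refl], measurable)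
 also have "... = nl (%t. r t * nn m (%x. PT (en t) f x * g x))"
 by (intro ncong ncmult) (simp add: meas_m)
 finally show ?thesis .
qed

lemma (in symmetric_hunt_process) RR_symmetric:
 assumes f[measurable]: "f : Bor" and g[measurable]: "g : Bor"
 shows "nn m (%x. RR a f x * g x) = nn m (%x. f x * RR a g x)"
proof -
 have "nn m (%x. PT (en t) f x * g x) = nn m (%x. PT (en t) g x * f x)" for t
 unfolding PT_symmetric[OF f g ennreal_less_top[unfolded oodef[symmetric]]] by (simp only: mult.commute)
 hence "nn m (%x. RR a f x * g x) = nn m (%x. RR a g x * f x)"
 using PT_time_integral[OF _ f g, of "%t. ee (- a * t) * ind {0..} t"]
 PT_time_integral[OF _ g f, of "%t. ee (- a * t) * ind {0..} t"]
 by (simp add: RR_eq[OF f] RR_eq[OF g] mult_ac)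
 thus ?thesis by (simp add: mult.commute)
qed

lemma mexpn[measurable]: "exp_neg : Bor"
 unfolding exp_neg_def[abs_def] by measurable

lemma exp_neg_add: "s < infy ==> exp_neg (s + t) = exp_neg s * exp_neg t"
 by (cases s; cases t) (auto simp: exp_neg_def ennreal_mult[symmetric] exp_add[symmetric] simp del: ennreal_plus simp flip: ennreal_plus)

lemma exp_neg_le_1: "exp_neg s <= 1"
 by (auto simp: exp_neg_def)

context revuz_functional
begin

text \<open>For \<open>s > t\<close> the clock may be frozen at \<open>s\<close>: the two inverses
  either agree or both exceed \<open>t\<close>. This gives measurability with respect to
  \<open>FF s\<close>, and right continuity of the filtration lets \<open>s\<close> decrease to
  \<open>t\<close>.\<close>

lemma II_adapted:
 assumes f: "f : Bor" and t: "t < infy"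
 shows "II f t : bm (FF t)"
proof -
 have *: "II f t : bm (FF s)" if ts: "t < s" "s < infy" for s
 proof -
 let ?B = "%r w. B (min r s) w"
 have eq: "II f t w = cint (%r. ?B r w) (%r. ind {..t} r * ext0 f (X (min r s) w))" for w
 unfolding cint_def
 proof (rule ncong)
 fix u :: real
 have less: "ivt (%r. ?B r w) u < r \<longleftrightarrow> tau w u < r" if "r <= s" for r
 unfolding ivt_less_iff
 proof (intro bex_cong refl)
 fix q assume "q : {q : \<rat>. 0 <= q & en q < r}"
 hence "min (en q) s = en q" using that by (intro min_absorb1) (auto intro: less_imp_le less_le_trans)
 thus "en u < ?B (en q) w \<longleftrightarrow> en u < B (en q) w" by (simp only:)
 qed
 have le: "ivt (%r. ?B r w) u <= r \<longleftrightarrow> tau w u <= r" if r: "r < s" for r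
 proof -
 have le_iff: "a <= r \<longleftrightarrow> (ALL q. r < q --> q < s --> a < q)" for a
 proof
 assume *: "ALL q. r < q --> q < s --> a < q"
 show "a <= r"
 proof (rule ccontr)
 assume "~ a <= r"
 hence "r < min a s" using r by simp
 then obtain q where "r < q" "q < min a s" using dense by blast
 thus False using * by auto
 qed
 qed (auto intro: le_less_trans)
 show ?thesis unfolding le_iff using less[OF less_imp_le] by blast
 qed
 have "ivt (%r. ?B r w) u = tau w u | (t < ivt (%r. ?B r w) u & t < tau w u)"
 proof (cases "tau w u <= t")
 case True
 hence 1: "tau w u < s" using ts(1) by (rule le_less_trans)
 have 2: "ivt (%r. ?B r w) u <= tau w u" using le[OF 1] by simp
 hence "tau w u <= ivt (%r. ?B r w) u" using le[OF le_less_trans[OF 2 1]] by simp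
 thus ?thesis using 2 by simp
 qed (use le[OF ts(1)] in auto)
 thus "ind {..t} (tau w u) * ext0 f (X (tau w u) w) * ind {0..} u =
 ind {..t} (ivt (%r. ?B r w) u) * ext0 f (X (min (ivt (%r. ?B r w) u) s) w) * ind {0..} u"
 using ts(1) by (auto simp: min_def split: spind)
 qed
 show ?thesis unfolding eq
 proof (rule mcint)
 fix r :: ennreal
 have "min r s < infy" using ts by (simp add: min_less_iff_disj)
 thus "?B r : bm (FF s)" by (rule mFFm[OF adapted]) simp
 next
 have "(%p. (snd p, fst p)) : FF s OM borel MM borel OM NF s"
 by (intro mPair msnd mcomp[OF mfst measurable_id_FF])
 from mcomp[OF mcomp[OF this measurable_X_min] mext0[OF f]]
 have "(%p. ext0 f (X (min (snd p) s) (fst p))) : bm (FF s OM borel)" by simp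
 thus "(%p. ind {..t} (snd p) * ext0 f (X (min (snd p) s) (fst p))) : bm (FF s OM borel)" by measurable
 qed
 qed
 show ?thesis
 proof (rule measurableI)
 fix S :: "ennreal set" assume S: "S : sets borel"
 have "II f t -` S : sets (FF s)" if "s : {t<..}" for s
 proof -
 have "t < s" using that by simp
 then obtain r where r: "t < r" "r < s" using dense by blast
 hence "r < infy" by (auto intro: less_le_trans)
 from msets[OF *[OF r(1) this] S] have "II f t -` S : sets (FF r)" by simp
 thus ?thesis by (rule subsetD[OF FF_mono[OF less_imp_le[OF r(2)]]])
 qed
 thus "II f t -` S Int space (FF t) : sets (FF t)" using filtration_right_continuous[OF t] by auto
 qed simp
qed

abbreviation "occ g l w \<equiv> sl {0..} (%t. ee (- t) * ind {..tau w l} (en t) * ext0 g (X (en t) w))"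

abbreviation "pot g w \<equiv> sl {0..} (%t. ee (- t) * ext0 g (X (en t) w))"

lemma mext0Xt: "g : Bor ==> (%p. ext0 g (X (en (snd p)) (fst p))) : bm (FF infy OM borel)"
 for g :: "'e => ennreal"
proof -
 assume g: "g : Bor"
 have "(%p. (fst p, en (snd p))) : FF infy OM borel MM FF infy OM borel" by measurable
 from mcomp[OF this mcomp[OF mXFFp mext0[OF g]]] show ?thesis by simp
qed

lemma measurable_occ:
 assumes g: "g : Bor"
 shows "occ g l : bm (FF infy)"
proof -
 note [measurable] = mext0Xt[OF g]
 have "(%w. tau w l) : bm (FF infy)"
 using mcomp[OF mPair[OF measurable_ident_sets[OF refl] measurable_const[of l]] measurable_ivt_pair_gen[of B "FF infy"]]
 mFFm[OF adapted] by simp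
 note [measurable] = this
 have "(%p. ee (- snd p) * (if en (snd p) <= tau (fst p) l then 1 else 0) * ext0 g (X (en (snd p)) (fst p)) * ind {0..} (snd p))
 : bm (FF infy OM borel)" by measurable
 hence "(%(w, t). ee (- t) * ind {..tau w l} (en t) * ext0 g (X (en t) w) * ind {0..} t)
 : bm (FF infy OM lborel)"
 by (simp add: split_beta' indicator_def of_bool_def mcongs[OF sets_pair_measure_cong[OF refl sets_lborel] refl] cong: if_cong)
 thus ?thesis by (rule lborel.borel_measurable_nn_integral)
qed

text \<open>The level sets of the clock: \<open>tau v \<le> r \<le> tau (v + l)\<close> forces \<open>v\<close> into an interval of length \<open>l\<close>.\<close>

lemma cint_occ_le:
 assumes w: "w : LL" and l: "0 <= l" and g[measurable]: "g : Bor"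
 shows "cint (%t. B t w) (%s. exp_neg s * ext0 (%_. 1) (X s w) * occ g l (sh s w)) <= en l * pot g w"
proof -
 note [measurable] = mcomp[OF menn mfX[OF g, of w]]
 let ?e = "%r. ee (- r) * ext0 g (X (en r) w) * ind {0..} r"
 let ?i = "%v r. ind {v. 0 <= v & tau w v <= en r & en r <= tau w (v + l)} v :: ennreal"
 have pred: "Measurable.pred (borel OM borel) (%p. 0 <= fst p & tau w (fst p) <= en (snd p) & en (snd p) <= tau w (fst p + l))"
 by measurable
 have "cint (%t. B t w) (%s. exp_neg s * ext0 (%_. 1) (X s w) * occ g l (sh s w)) <= nl (%v. nl (%r. ?e r * ?i v r))"
 unfolding cint_def
 proof (rule nmonoAE)
 show "AE v in lborel. exp_neg (tau w v) * ext0 (%_. 1) (X (tau w v) w) * occ g l (sh (tau w v) w) * ind {0..} v <= nl (%r. ?e r * ?i v r)"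
 using AE_pos_time
 proof eventually_elim
 case (elim v)
 let ?s = "tau w v"
 show ?case
 proof (cases "0 < v & X ?s w ~= None")
 case True
 hence v: "0 < v" and Xn: "X ?s w ~= None" by auto
 note ct = cint_tail(2-6)[OF w v Xn borel_measurable_const]
 define s' where "s' = enn2real ?s"
 have s': "?s = en s'" "0 <= s'" using ct(2) by (auto simp: s'_def)
 have gs: "good_path (lifetime X (th ?s w)) (%t. B t (th ?s w))" by (rule good[OF ct(5)])
 have shift: "tau w (v + l) = ?s + tau (th ?s w) l"
 by (rule ivt_shift[OF good[OF w] gs ct(2) _ ct(4) _ l]) (use additive[OF w ct(2)] ct(4) v in auto)
 have "exp_neg ?s * ext0 (%_. 1) (X ?s w) * occ g l (sh ?s w) = ee (- s') * occ g l (th ?s w)"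
 using Xn ct(2) by (auto simp: sh_finite exp_neg_def s'_def)
 also have "... = nl (%t. ee (- s') * (ee (- t) * ind {..tau (th ?s w) l} (en t) * ext0 g (X (en t) (th ?s w)) * ind {0..} t))"
 by (rule ncmult[symmetric]) (use mcomp[OF menn mfX[OF g, of "th ?s w"]] in measurable)
 also have "... <= nl (%t. ?e (s' + 1 * t) * ?i v (s' + 1 * t))"
 proof (rule nmono)
 fix t :: real
 show "ee (- s') * (ee (- t) * ind {..tau (th ?s w) l} (en t) * ext0 g (X (en t) (th ?s w)) * ind {0..} t)
 <= ?e (s' + 1 * t) * ?i v (s' + 1 * t)"
 proof (cases "0 <= t & en t <= tau (th ?s w) l")
 case True
 hence st: "en (s' + t) = en t + ?s" using s' by (simp add: add.commute)
 have "en (s' + t) <= tau w (v + l)" unfolding st shift using True by (simp add: add.commute add_left_mono)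
 moreover have "?s <= en (s' + t)" unfolding st by simp
 moreover have "X (en t) (th ?s w) = X (en (s' + t)) w" unfolding st by (rule X_shift[OF ct(2), symmetric])
 moreover have e: "ee (- (s' + t)) = ee (- s') * ee (- t)"
 by (simp only: minus_add_distrib exp_add ennreal_mult exp_ge_zero)
 ultimately show ?thesis
 unfolding mult_1 e using True s' v by (simp add: mult_ac)
 qed auto
 qed
 also have "... = nl (%r. ?e r * ?i v r)"
 by (subst naffine[of "%r. ?e r * ?i v r" 1 s']) auto
 finally show ?thesis using v by simp
 qed (use elim in auto)
 qed
 qed
 also have "... = nl (%r. nl (%v. ?e r * ?i v r))"
 by (rule lborel_pair.Fubini'[symmetric]) (unfold split_beta', use pred in measurable)
 also have "... <= nl (%r. en l * ?e r)"
 proof (rule nmono)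
 fix r :: real
 show "nl (%v. ?e r * ?i v r) <= en l * ?e r"
 proof (cases "X (en r) w = None")
 case False
 hence "en r < lifetime X w" by (simp add: lt_iff)
 moreover have "ALL t<lifetime X w. B t w < infy" using good[OF w] unfolding good_path_def by (elim conjE)
 ultimately have "B (en r) w < infy" by simp
 then obtain b where b: "B (en r) w = en b" "0 <= b" by (cases "B (en r) w") auto
 have "nl (%v. ?e r * ?i v r) <= nl (%v. ?e r * ind {b - l..b} v)"
 proof (intro nmono mlmono)
 fix v
 show "?i v r <= ind {b - l..b} v"
 proof (cases "0 <= v & tau w v <= en r & en r <= tau w (v + l)")
 case True
 hence "en v <= en b" using ivt_le_good[OF good[OF w], of "en r" v] b by simp
 moreover have "~ tau w (v + l) < en r" using True by (simp add: not_less)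
 hence "b <= v + l" using ivt_less_good[OF good[OF w], of "en r" "v + l"] True l b by (simp add: ennreal_less_iff not_less del: ennreal_plus)
 ultimately show ?thesis using True l b by (simp add: ennreal_le_iff indicator_def)
 qed auto
 qed simp
 also have "... = en l * ?e r" using l by (subst ncmind) (auto simp: mult.commute)
 finally show ?thesis .
 qed simp
 qed
 also have "... = en l * pot g w" by (rule ncmult) measurable
 finally show ?thesis .
qed

end

section \<open>The second moment bound and the estimate for potentials\<close>

text \<open>This is \<open>(c - e (p - q))\<^sup>2 / (2 e) \<ge> 0\<close> with the negative terms
  moved to the left. It trades \<open>c p\<close> for \<open>c q\<close>; in the application
  \<open>c\<close> is the mass collected up to time \<open>d\<close>, and \<open>p\<close> and
  \<open>q\<close> are the values of a potential at times \<open>d\<close> and 0.\<close>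

lemma amgm_ennreal:
 fixes c p q :: ennreal
 assumes e: "0 < e" and fin: "p < infy" "q < infy"
 shows "c * p + en e * (p * q) <= c * q + (en (1 / (2 * e)) * c\<^sup>2 + (en (e / 2) * p\<^sup>2 + en (e / 2) * q\<^sup>2))"
proof (cases c)
 case (real c')
 obtain p' q' where pq: "p = en p'" "q = en q'" "0 <= p'" "0 <= q'" using fin by (cases p; cases q) auto
 have "0 <= (c' - e * (p' - q'))\<^sup>2 / (2 * e)" using e by simp
 also have "(c' - e * (p' - q'))\<^sup>2 / (2 * e) = c' * q' + (1 / (2 * e) * c'\<^sup>2 + (e / 2 * p'\<^sup>2 + e / 2 * q'\<^sup>2)) - (c' * p' + e * (p' * q'))"
 using e by (simp add: field_simps power2_eq_square)
 finally have "c' * p' + e * (p' * q') <= c' * q' + (1 / (2 * e) * c'\<^sup>2 + (e / 2 * p'\<^sup>2 + e / 2 * q'\<^sup>2))" by simp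
 hence "en (c' * p' + e * (p' * q')) <= en (c' * q' + (1 / (2 * e) * c'\<^sup>2 + (e / 2 * p'\<^sup>2 + e / 2 * q'\<^sup>2)))" by (rule ennreal_leI)
 thus ?thesis using pq e real by (simp add: ennreal_power flip: ennreal_mult ennreal_plus)
qed (use e in \<open>simp add: ennreal_mult_top\<close>)

text \<open>The integrand need not be measurable, so the constant is pulled out of the simple
  functions below it.\<close>

lemma nn_integral_double_le: "nn M (%x. 2 * f x) <= 2 * nn M (%x. f x)"
proof -
 have "en (1 / 2) * nn M (%x. 2 * f x) <= nn M (%x. f x)"
 unfolding nn_integral_def[of M "%x. 2 * f x"] SUPml
 proof (rule SUP_least)
 fix g assume g: "g : {g. simple_function M g & g <= (%x. 2 * f x)}"
 hence "en (1 / 2) * integral\<^sup>S M g = nn M (%x. en (1 / 2) * g x)"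
 by (simp add: nn_integral_eq_simple_integral[symmetric] ncmult borel_measurable_simple_function)
 also have "... <= nn M (%x. en (1 / 2) * (2 * f x))" using g by (intro nmono mlmono) (auto simp: le_fun_def)
 also have "... = nn M (%x. f x)" using ennreal_mult'[of "1/2" 2] by (simp add: mult.assoc[symmetric])
 finally show "en (1 / 2) * integral\<^sup>S M g <= nn M (%x. f x)" .
 qed
 from mlmono[OF this, of 2] show ?thesis
 using ennreal_mult'[of 2 "1/2"] by (simp add: mult.assoc[symmetric])
qed

context revuz_functional
begin

lemma pot_RR: "g : Bor ==> (nn (PS x) (%w. pot g w)) = RR 1 g x"
 unfolding resolvent_def
proof (intro ncong)
 fix w and t :: real
 show "ee (- t) * ext0 g (X (en t) w) * ind {0..} t =
 ee (- 1 * t) * ext0 g (X (en t) w) * ind {t. 0 <= t & en t < lifetime X w} t"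
 by (cases "X (en t) w") (auto simp: lt_iff split: spind)
qed

lemma measurable_pot:
 assumes g: "g : Bor"
 shows "pot g : bm (FF infy)"
proof -
 note [measurable] = mext0Xt[OF g]
 have "(%p. ee (- snd p) * ext0 g (X (en (snd p)) (fst p)) * ind {0..} (snd p)) : bm (FF infy OM borel)"
 by measurable
 thus ?thesis
 by (intro lborel.borel_measurable_nn_integral) (simp add: split_beta' mcongs[OF sets_pair_measure_cong[OF refl sets_lborel] refl])
qed

lemma pot_shift:
 assumes d: "0 <= d" and g: "g : Bor"
 shows "pot g w = sl {0..<d} (%t. ee (- t) * ext0 g (X (en t) w)) + ee (- d) * pot g (th (en d) w)"
proof -
 note [measurable] = mcomp[OF menn mfX[OF g, of w]] mcomp[OF menn mfX[OF g, of "th (en d) w"]]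
 let ?e = "%t. ee (- t) * ext0 g (X (en t) w)"
 have "pot g w = nl (%t. ?e t * ind {0..<d} t + ?e t * ind {d..} t)"
 using d by (intro ncong) (auto split: spind)
 also have "... = sl {0..<d} (%t. ?e t) + sl {d..} (%t. ?e t)" by (rule nadd) measurable
 also have "sl {d..} (%t. ?e t) = nl (%t. ?e (d + 1 * t) * ind {d..} (d + 1 * t))"
 by (subst naffine[of "%t. ?e t * ind {d..} t" 1 d]) auto
 also have "... = nl (%t. ee (- d) * (ee (- t) * ext0 g (X (en t) (th (en d) w)) * ind {0..} t))"
 proof (rule ncong)
 fix t :: real
 have "ee (- (d + t)) = ee (- d) * ee (- t)" by (simp only: minus_add_distrib exp_add ennreal_mult exp_ge_zero)
 moreover have "0 <= t ==> X (en (d + t)) w = X (en t) (th (en d) w)"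
 using X_shift[of "en d" "en t" w] d by (simp add: add.commute)
 ultimately show "?e (d + 1 * t) * ind {d..} (d + 1 * t) = ee (- d) * (ee (- t) * ext0 g (X (en t) (th (en d) w)) * ind {0..} t)"
 by (cases "0 <= t") (simp_all only: mult_1, simp_all add: mult.assoc)
 qed
 also have "... = ee (- d) * pot g (th (en d) w)" by (rule ncmult) measurable
 finally show ?thesis .
qed

context
 fixes S and g :: "'e => ennreal" and l c :: real
 assumes S[measurable]: "S : sets borel" and SN: "S Int N = {}" and g[measurable]: "g : Bor"
 and gc: "!!x. g x <= en c" and c0: "0 <= c" and l0: "0 <= l"
 and occ: "!!y. y : S ==> 1 <= nn (PS y) (%w. occ g l w)" and Sfin: "emu nu S < infy"
begin

private abbreviation "s \<equiv> ind S :: 'e => ennreal"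
private abbreviation "UU w \<equiv> cint (%t. B t w) (%r. exp_neg r * ext0 s (X r w))"

private lemma sm[measurable]: "s : Bor" by measurable

private lemma Wm: "W : Bor ==> (%w. cint (%t. B t w) (%r. W r * ext0 s (X r w))) : bm (FF infy)"
proof (rule mcint)
 fix W :: "ennreal => ennreal" assume [measurable]: "W : Bor"
 have "(%p. ext0 s (X (snd p) (fst p))) : bm (FF infy OM borel)"
 using mcomp[OF mXFFp mext0[OF sm]] by (simp add: case_prod_beta)
 thus "(%p. W (snd p) * ext0 s (X (snd p) (fst p))) : bm (FF infy OM borel)" by measurable
qed (rule mFFm[OF adapted], simp_all)

text \<open>From every charged position in \<open>S\<close> the expected discounted occupation of
  \<open>g\<close>, before the clock rises by a further \<open>l\<close>, is at least 1. By
  \<open>cint_occ_le\<close> no moment is counted for more than clock mass \<open>l\<close>.\<close>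

private lemma U_le_AE: "AE x in m. nn (PS x) (%w. UU w) <= en l * RR 1 g x"
 using strong_markov_cint_FF[OF measurable_occ[OF g, of l]] AE_start(1)
proof eventually_elim
 case (elim x)
 have "nn (PS x) (%w. UU w) <= nn (PS x) (%w. cint (%t. B t w) (%r. exp_neg r * ext0 (%y. s y * nn (PS y) (%w'. occ g l w')) (X r w)))"
 proof (intro nmono cint_mono mlmono)
 fix z show "ext0 s z <= ext0 (%y. s y * nn (PS y) (%w'. occ g l w')) z"
 using occ by (cases z) (auto split: spind)
 qed simp
 also have "... = nn (PS x) (%w. cint (%t. B t w) (%r. exp_neg r * ext0 s (X r w) * occ g l (sh r w)))"
 by (rule elim(1)[rule_format, OF mexpn sm, symmetric])
 also have "... <= nn (PS x) (%w. en l * pot g w)"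
 proof (rule nmonoAE, rule evmono[OF elim(2)])
 fix w assume w: "w : LL"
 have "cint (%t. B t w) (%r. exp_neg r * ext0 s (X r w) * occ g l (sh r w)) <=
 cint (%t. B t w) (%r. exp_neg r * ext0 (%_. 1) (X r w) * occ g l (sh r w))"
 proof (intro cint_mono mlmono mrmono)
 show "ext0 s z <= ext0 (%_. 1) z" for z :: "'e option" by (cases z) (auto split: spind)
 qed auto
 also have "... <= en l * pot g w" by (rule cint_occ_le[OF w l0 g])
 finally show "cint (%t. B t w) (%r. exp_neg r * ext0 s (X r w) * occ g l (sh r w)) <= en l * pot g w" .
 qed
 also have "... = en l * RR 1 g x"
 unfolding pot_RR[OF g, symmetric] using ncmult[OF mFFc[OF measurable_pot[OF g]], of "Some x" "en l"]
 by (simp only: ncompl)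
 finally show ?case .
qed

private lemma U_shifted:
 assumes d: "d < infy"
 shows "cint (%t. B t (th d w)) (%r. exp_neg (d + r) * ext0 s (X r (th d w))) = exp_neg d * (if X d w = None then 0 else UU (th d w))"
proof -
 have "cint (%t. B t (th d w)) (%r. exp_neg (d + r) * ext0 s (X r (th d w))) = cint (%t. B t (th d w)) (%r. exp_neg d * (exp_neg r * ext0 s (X r (th d w))))"
 unfolding exp_neg_add[OF d] by (simp only: mult.assoc)
 also have "... = exp_neg d * UU (th d w)"
 by (intro cint_cmult bmtimes mexpn mfX sm)
 also have "UU (th d w) = (if X d w = None then 0 else UU (th d w))"
 proof (cases "X d w = None")
 case True
 hence "X r (th d w) = None" for r using X_shift[OF d, of r w] X_None_mono[of d w "r + d"] by simp
 thus ?thesis using True by (simp add: cint_def)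
 qed auto
 finally show ?thesis .
qed

private lemma E_U_shifted:
 assumes d: "0 < d" "d < infy"
 shows "nn (PS x) (%w. exp_neg d * (if X d w = None then 0 else UU (th d w))) = exp_neg d * PT d (%y. nn (PS y) (%w. UU w)) x"
 using ncmult[OF measurable_shifted[OF d Wm[OF mexpn]], of x "exp_neg d"]
 unfolding ncompl markov_PT[OF d Wm[OF mexpn]] .

text \<open>The bound passes from almost every \<open>x\<close> to every \<open>x\<close> off
  \<open>N\<close> by starting at a time \<open>d n > 0\<close>, where absolute continuity applies
  and the discounted potential has not increased. The mass before \<open>d n\<close> disappears in
  the limit, because the inverse clock is positive at positive levels.\<close>

private lemma U_le:
 assumes x: "x ~: N"
 shows "nn (PS x) (%w. UU w) <= en l * RR 1 g x"
proof -
 define d where "d n = en (rs n)" for n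
 have d: "0 < d n" "d n < infy" for n by (simp_all add: d_def)
 have ddec: "d (Suc n) <= d n" for n unfolding d_def by (intro ennreal_leI) (simp add: divide_simps)
 let ?W = "%n r. exp_neg r * ind {d n<..} r"
 let ?T = "%n w. cint (%t. B t w) (%r. ?W n r * ext0 s (X r w))"
 have Wmeas: "?W n : Bor" for n by measurable
 have T_le: "nn (PS x) (%w. ?T n w) <= en l * RR 1 g x" for n
 proof -
 have "nn (PS x) (%w. ?T n w) <= nn (PS x) (%w. exp_neg (d n) * (if X (d n) w = None then 0 else UU (th (d n) w)))"
 proof (rule nmonoAE, rule evmono[OF start_LL[OF x]])
 fix w assume w: "w : LL"
 have "?T n w = cint (%t. B t w) (%r. ?W n r * ind {..d n} r * ext0 s (X r w)) +
 cint (%t. B t (th (d n) w)) (%r. ?W n (d n + r) * ext0 s (X r (th (d n) w)))"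
 by (rule cint_markov[OF w d Wmeas sm])
 also have "cint (%t. B t w) (%r. ?W n r * ind {..d n} r * ext0 s (X r w)) = cint (%t. B t w) (%_. 0)"
 by (rule cint_cong) (auto split: spind)
 also have "... + cint (%t. B t (th (d n) w)) (%r. ?W n (d n + r) * ext0 s (X r (th (d n) w)))
 <= cint (%t. B t (th (d n) w)) (%r. exp_neg (d n + r) * ext0 s (X r (th (d n) w)))"
 by (simp add: cint_def[of _ "%_. 0"]) (intro cint_mono mrmono, auto split: spind)
 finally show "?T n w <= exp_neg (d n) * (if X (d n) w = None then 0 else UU (th (d n) w))" unfolding U_shifted[OF d(2)] .
 qed
 also have "... <= exp_neg (d n) * PT (d n) (%y. en l * RR 1 g y) x"
 unfolding E_U_shifted[OF d] by (intro mlmono PT_mono_AE[OF U_le_AE d]) simp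
 also have "... = en l * (ee (- 1 * (rs n)) * PT (en (rs n)) (RR 1 g) x)"
 by (simp add: PT_cmult d_def exp_neg_def mult_ac)
 also have "... <= en l * RR 1 g x" by (intro mlmono PT_RR_le) auto
 finally show ?thesis .
 qed
 have "nn (PS x) (%w. UU w) = nn (PS x) (%w. (SUP n. ?T n w))"
 proof (rule ncongAE, rule evmono[OF start_LL[OF x]])
 fix w assume w: "w : LL"
 have inc: "?W n r <= ?W (Suc n) r" for n r using ddec[of n] by (auto split: spind)
 have "UU w = cint (%t. B t w) (%r. SUP n. ?W n r * ext0 s (X r w))"
 proof (rule cint_cong_AE, rule evmono[OF AE_pos_time], rule impI)
 fix u :: real assume u: "0 <= u --> 0 < u" "0 <= u"
 hence "0 < tau w u" by (intro ivt_pos[OF good[OF w]]) simp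
 then obtain q where q: "0 < en q" "en q < tau w u" by (rule rat_between) auto
 then obtain n where "rs n < q" using reals_Archimedean[of q] by (auto simp: inverse_eq_divide)
 hence "d n <= en q" unfolding d_def by (intro ennreal_leI) simp
 hence "?W n (tau w u) = exp_neg (tau w u)" using q by simp
 hence "(SUP n. ?W n (tau w u)) = exp_neg (tau w u)"
 by (intro antisym SUP_least SUP_upper2[of n]) (auto split: spind)
 thus "exp_neg (tau w u) * ext0 s (X (tau w u) w) = (SUP n. ?W n (tau w u) * ext0 s (X (tau w u) w))"
 by (simp only: SUPmr[symmetric])
 qed
 also have "... = (SUP n. ?T n w)"
 unfolding cint_def SUPmr
 by (intro nmcSUP incseq_SucI le_funI mrmono inc) (use mfX[OF sm] in measurable)
 finally show "UU w = (SUP n. ?T n w)" .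
 qed
 also have "... = (SUP n. nn (CP (PS x)) (%w. ?T n w))"
 unfolding ncompl[symmetric, of "PS x" "%w. SUP n. ?T n w"]
 by (intro nmcSUP mFFc[OF Wm[OF Wmeas]] incseq_SucI le_funI cint_mono mrmono)
 (use ddec in \<open>auto split: spind intro: less_le_trans dest: le_less_trans\<close>)
 also have "... <= en l * RR 1 g x" unfolding ncompl by (intro SUP_least T_le)
 finally show ?thesis .
qed

private abbreviation "C d \<equiv> II s (en d)"

private lemma Cm: "C d : bm (FF infy)" by (rule measurable_II[OF sm])

private lemma C_le:
 assumes d: "0 <= d"
 shows "C d w <= en (exp d) * cint (%t. B t w) (%r. exp_neg r * ind {..ennreal d} r * ext0 s (X r w))"
proof -
 have "C d w <= cint (%t. B t w) (%r. en (exp d) * (exp_neg r * ind {..ennreal d} r * ext0 s (X r w)))"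
 proof (intro cint_mono)
 fix u :: real
 show "ind {..ennreal d} (tau w u) * ext0 s (X (tau w u) w) <=
 en (exp d) * (exp_neg (tau w u) * ind {..ennreal d} (tau w u) * ext0 s (X (tau w u) w))"
 proof (cases "tau w u <= en d")
 case True
 hence "exp_neg (tau w u) = ee (- enn2real (tau w u))" by (auto simp: exp_neg_def top_unique)
 moreover have "enn2real (tau w u) <= d" using True d enn2real_mono[of "tau w u" "en d"] by simp
 ultimately have "1 <= en (exp d) * exp_neg (tau w u)" by (simp add: ennreal_mult'[symmetric] exp_minus_inverse exp_add[symmetric])
 from mrmono[OF this, of "ext0 s (X (tau w u) w)"] show ?thesis using True by (simp add: mult.assoc)
 qed simp
 qed
 also have "... = en (exp d) * cint (%t. B t w) (%r. exp_neg r * ind {..ennreal d} r * ext0 s (X r w))"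
 by (intro cint_cmult bmtimes mexpn mfX sm) measurable
 finally show ?thesis .
qed

private lemma C_le_UU: "0 <= d ==> C d w <= en (exp d) * UU w"
 by (rule order_trans[OF C_le mlmono[OF cint_mono]]) (auto split: spind)

private lemma C_bound:
 assumes x: "x ~: N" and d: "0 <= d"
 shows "nn (PS x) (%w. C d w) <= en (exp d) * (en l * en c)"
proof -
 have "nn (PS x) (%w. C d w) <= nn (PS x) (%w. en (exp d) * UU w)" by (intro nmono C_le_UU d)
 also have "... = en (exp d) * nn (PS x) (%w. UU w)"
 using ncmult[OF mFFc[OF Wm[OF mexpn]], of "Some x" "en (exp d)"] by (simp only: ncompl)
 also have "... <= en (exp d) * (en l * (en c * en (1 / 1)))"
 by (intro mlmono order_trans[OF U_le[OF x]] RR_const_le g gc) auto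
 finally show ?thesis by simp
qed

private definition "dn n = rs n"

private lemma dn: "0 < dn n" "dn n <= 1" "dn ->> 0"
 using LIMSEQ_Suc[OF lim_const_over_n[of 1]] by (auto simp: dn_def[abs_def])

private lemma C_lim:
 assumes x: "x ~: N"
 shows "(%n. nn (PS x) (%w. C (dn n) w)) ->> 0"
proof -
 have "(%n. nn (CP (PS x)) (%w. C (dn n) w)) ->> (nn (CP (PS x)) (%w. 0))"
 proof (rule nn_integral_dominated_convergence)
 show "nn (CP (PS x)) (%w. C 1 w) < infy"
 unfolding ncompl by (rule le_less_trans[OF C_bound[OF x]]) (auto simp: enmlt)
 show "AE w in CP (PS x). C (dn n) w <= C 1 w" for n
 by (intro AE_I2 II_mono_time ennreal_leI dn)
 show "AE w in CP (PS x). (%n. C (dn n) w) ->> 0"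
 unfolding AE_completion_iff using start_LL[OF x] normal[of "Some x"]
 proof eventually_elim
 case (elim w)
 have "(%n. en (dn n)) ->> 0" using tendsto_ennrealI[OF dn(3)] by simp
 hence e0: "filterlim (%n. en (dn n)) (at 0) sequentially" using dn(1) by (auto simp: filterlim_at ennreal_eq_0_iff not_le)
 from filterlim_compose[OF good_path_tendsto[OF good[OF elim(1)]] this] good[OF elim(1)]
 have B0: "(%n. B (en (dn n)) w) ->> 0" by (simp add: good_path_def)
 have "0 < lifetime X w" using elim(2) by (simp add: lt_iff)
 with \<open>(%n. en (dn n)) ->> 0\<close> have "\<forall>\<^sub>F n in sequentially. en (dn n) < lifetime X w" by (rule order_tendstoD(2))
 hence "\<forall>\<^sub>F n in sequentially. C (dn n) w <= B (en (dn n)) w"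
 proof eventually_elim
 case (elim n)
 have "C (dn n) w <= II (%_. 1) (en (dn n)) w"
 proof (intro cint_mono mlmono)
 show "ext0 s z <= ext0 (%_. 1) z" for z by (cases z) (auto split: spind)
 qed simp
 thus ?case unfolding II_indicator_UNIV[OF \<open>w : LL\<close> elim] .
 qed
 thus ?case by (intro tendsto_sandwich[OF _ _ tendsto_const B0]) auto
 qed
 qed (use mFFc[OF measurable_II[OF sm]] in auto)
 thus ?thesis by (simp add: ncompl)
qed

private lemma C_small:
 obtains k :: "nat => 'e => ennreal" where "!!n. k n : Bor" "!!n. AE y in nu. nn (PS y) (%w. C (dn n) w) = k n y"
 "(%n. nn nu (%y. s y * k n y)) ->> 0"
proof -
 have "EX k. k : Bor & (AE y in nu. nn (PS y) (%w. C (dn n) w) = k y)" for n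
 by (rule expectation_version[OF nu.sigma_finite_measure_axioms sets_nu Cm[of "dn n"]]) blast
 then obtain k where "ALL n. k n : Bor & (AE y in nu. nn (PS y) (%w. C (dn n) w) = k n y)" by (rule choice[OF allI, THEN exE])
 hence k: "!!n. k n : Bor" "!!n. AE y in nu. nn (PS y) (%w. C (dn n) w) = k n y" by simp_all
 have all: "AE y in nu. ALL n. nn (PS y) (%w. C (dn n) w) = k n y" by (intro AEall[THEN iffD2] allI k)
 let ?b = "en (exp 1) * (en l * en c)"
 have "(%n. nn nu (%y. s y * k n y)) ->> (nn nu (%y. 0))"
 proof (rule nn_integral_dominated_convergence)
 show "nn nu (%y. ?b * s y) < infy" using Sfin by (simp add: ncmind sets_nu enmlt)
 show "AE y in nu. s y * k n y <= ?b * s y" for n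
 using all
 proof eventually_elim
 case (elim y)
 have "nn (PS y) (%w. C (dn n) w) <= ?b" if "y : S"
 proof -
 have "y ~: N" using that SN by auto
 hence "nn (PS y) (%w. C 1 w) <= ?b" by (rule C_bound) simp
 moreover have "nn (PS y) (%w. C (dn n) w) <= nn (PS y) (%w. C 1 w)" by (intro nmono II_mono_time ennreal_leI dn)
 ultimately show ?thesis by (rule order_trans[rotated])
 qed
 thus ?case using elim by (auto split: spind)
 qed
 show "AE y in nu. (%n. s y * k n y) ->> 0"
 using all
 proof eventually_elim
 case (elim y)
 show ?case
 proof (cases "y : S")
 case True
 hence "y ~: N" using SN by auto
 from C_lim[OF this] show ?thesis using True elim by simp
 qed simp
 qed
 qed (use k(1) in \<open>simp_all add: measurable_nu\<close>)
 thus thesis using that[OF k] by simp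
qed

text \<open>By \<open>II_square_le\<close> and the Revuz bound the second moment is at most
  \<open>2 d\<close> times the integral of \<open>E_y C_d\<close> over \<open>S\<close>. By
  \<open>C_small\<close> that integral tends to 0 along the times \<open>dn n\<close>, so the second
  moment is \<open>o(d)\<close> there.\<close>

private lemma C_square:
 assumes k[measurable]: "k : Bor" and kE: "AE y in nu. nn (PS y) (%w. C d w) = k y" and d: "0 < d"
 shows "Em (%w. (C d w)\<^sup>2) <= 2 * (en d * nn nu (%y. s y * k y))"
proof -
 obtain Z where Z: "{y : space nu. nn (PS y) (%w. C d w) ~= k y} <= Z" "emu nu Z = 0" "Z : sets nu" using kE by (rule AE_E)
 hence Z': "Z : sets borel" "!!y. y ~: Z ==> (nn (PS y) (%w. C d w)) = k y" using sets_eq_imp_space_eq[OF sets_nu] by (auto simp: sets_nu)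
 let ?i = "ind {..ennreal d} :: ennreal => ennreal"
 have im: "?i : Bor" by measurable
 have "AE x in m. nn (PS x) (%w. (C d w)\<^sup>2) <= 2 * nn (PS x) (%w. II (%y. s y * k y) (en d) w)"
 using AE_start(1) strong_markov_cint_FF[OF Cm[of d]] null_set_not_charged[OF Z'(1) Z(2)]
 proof eventually_elim
 case (elim x)
 have "nn (PS x) (%w. (C d w)\<^sup>2) <= nn (PS x) (%w. 2 * cint (%t. B t w) (%r. ?i r * ext0 s (X r w) * C d (sh r w)))"
 by (rule nmonoAE, rule evmono[OF elim(1)], rule II_square_le[OF _ sm])
 also have "... <= 2 * nn (PS x) (%w. cint (%t. B t w) (%r. ?i r * ext0 s (X r w) * C d (sh r w)))"
 by (rule nn_integral_double_le)
 also have "... = 2 * nn (PS x) (%w. cint (%t. B t w) (%r. ?i r * ext0 (%y. s y * nn (PS y) (%w'. C d w')) (X r w)))"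
 by (simp only: elim(2)[rule_format, OF im sm])
 also have "nn (PS x) (%w. cint (%t. B t w) (%r. ?i r * ext0 (%y. s y * nn (PS y) (%w'. C d w')) (X r w))) =
 (nn (PS x) (%w. II (%y. s y * k y) (en d) w))"
 proof (rule ncongAE, rule evmono[OF elim(3)], rule cint_cong_AE, elim evmono, rule impI)
 fix w u assume *: "0 <= u --> (ALL y. X (tau w u) w = Some y --> y ~: Z)" "0 <= u"
 thus "?i (tau w u) * ext0 (%y. s y * nn (PS y) (%w'. C d w')) (X (tau w u) w) = ?i (tau w u) * ext0 (%y. s y * k y) (X (tau w u) w)"
 using Z'(2) by (cases "X (tau w u) w") auto
 qed
 finally show ?case .
 qed
 hence "Em (%w. (C d w)\<^sup>2) <= nn m (%x. 2 * nn (PS x) (%w. II (%y. s y * k y) (en d) w))" by (rule nmonoAE)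
 also have "... = 2 * Em (II (%y. s y * k y) (en d))"
 proof -
 obtain q where q: "q : Bor" "AE y in m. nn (PS y) (%w. II (%y. s y * k y) (en d) w) = q y"
 by (rule measurable_E_II[of "%y. s y * k y"]) measurable
 have "AE y in m. 2 * nn (PS y) (%w. II (%y. s y * k y) (en d) w) = 2 * q y" using q(2) by (rule evmono) simp
 thus ?thesis unfolding ncongAE[OF q(2)] using q(1)
 by (subst ncongAE) (auto simp: ncmult meas_m)
 qed
 also have "... <= 2 * (en d * nn nu (%y. s y * k y))" by (intro mlmono Em_II_le d) auto
 finally show ?thesis .
qed

context
 fixes v :: "'e => ennreal" and M d :: real
 assumes v[measurable]: "v : Bor" and vM: "!!x. v x <= en M" and M0: "0 <= M"
 and vfin: "nn m (%x. v x) < infy" and d: "0 < d"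
begin

private abbreviation "h \<equiv> RR 1 v"
private abbreviation "h' \<equiv> %x. sl {0..<d} (%t. ee (- t) * PT (en t) v x)"

private lemma h_split: "h x = h' x + ee (- d) * PT (en d) h x"
 using RR_split[OF v less_imp_le[OF d], of 1 x] by simp

private lemma h'_le: "h' x <= en (d * M)"
proof -
 have "h' x <= nl (%t. en M * ind {0..<d} t)"
 proof (rule nmono)
 fix t
 have "0 <= t ==> ee (- t) * PT (en t) v x <= 1 * en M" by (intro mult_mono PT_const_le vM) auto
 thus "ee (- t) * PT (en t) v x * ind {0..<d} t <= en M * ind {0..<d} t" by (auto split: spind)
 qed
 also have "... = en (d * M)" using d M0 by (simp add: ncmind ennreal_mult' mult.commute)
 finally show ?thesis .
qed

private lemma measurable_h'[measurable]: "h' : Bor"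
proof -
 note [measurable] = mcomp[OF mPair[OF msnd mfst] mPTp[OF v], simplified]
 show ?thesis by (rule lborel.borel_measurable_nn_integral) (unfold split_beta', measurable)
qed

lemma h_fin: "nn m (%x. h x) < infy"
 using RR_excessive_measure[OF v, of 1] vfin by (auto intro: le_less_trans)

private lemma h_le: "h x <= en M"
 using RR_const_le[OF v vM, of 1 x] by simp

private lemma h'_g: "nn m (%x. h' x * RR 1 g x) <= en d * nn m (%x. h x * g x)"
proof -
 have "nn m (%x. h' x * RR 1 g x) = nl (%t. ee (- t) * ind {0..<d} t * nn m (%x. PT (en t) v x * RR 1 g x))"
 using PT_time_integral[of "%t. ee (- t) * ind {0..<d} t" v "RR 1 g"] by (simp add: mult_ac)
 also have "... <= nl (%t. nn m (%x. v x * RR 1 g x) * ind {0..<d} t)"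
 proof (rule nmono)
 fix t :: real
 have "ee (- t) * nn m (%x. PT (en t) v x * RR 1 g x) <= nn m (%x. v x * RR 1 g x)" if t: "0 <= t"
 proof -
 have "ee (- t) * nn m (%x. PT (en t) v x * RR 1 g x) = nn m (%x. v x * (ee (- 1 * t) * PT (en t) (RR 1 g) x))"
 by (subst PT_symmetric) (auto simp: ncmult[symmetric] meas_m mult_ac)
 also have "... <= nn m (%x. v x * RR 1 g x)" by (intro nmono mlmono PT_RR_le g t) simp
 finally show ?thesis .
 qed
 thus "ee (- t) * ind {0..<d} t * nn m (%x. PT (en t) v x * RR 1 g x) <= nn m (%x. v x * RR 1 g x) * ind {0..<d} t"
 by (auto split: spind)
 qed
 also have "... = en d * nn m (%x. h x * g x)"
 using d by (subst ncmind) (simp_all add: RR_symmetric[OF v g] mult.commute[of "en d"])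
 finally show ?thesis .
qed

text \<open>Additivity gives \<open>k + P_d q \<le> exp d * q\<close>, where \<open>q\<close> is the
  expectation of \<open>UU\<close>. Integrated against \<open>h\<close>, the semigroup moves onto
  \<open>h\<close> by symmetry and cancels with the corresponding part of
  \<open>h = h' + exp (- d) * P_d h\<close>. Only \<open>h'\<close>, the potential collected before
  \<open>d\<close>, then meets \<open>q\<close>, and \<open>q\<close> is at most
  \<open>l * RR 1 g\<close>.\<close>

lemma start_bound:
 assumes k[measurable]: "k : Bor" and kE: "AE x in m. nn (PS x) (%w. C d w) = k x"
 shows "nn m (%x. h x * k x) <= en (exp d) * (en l * (en d * nn m (%x. h x * g x)))"
proof -
 obtain q where q[measurable]: "q : Bor" and qE: "AE x in m. nn (PS x) (%w. UU w) = q x"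
 by (rule expectation_version[OF sigma_finite_m sets_m Wm[OF mexpn]])
 have ql: "AE x in m. q x <= en l * RR 1 g x" using qE U_le_AE by eventually_elim simp
 have dd: "0 < en d" "en d < infy" using d by auto
 have "AE x in m. k x + PT (en d) q x <= en (exp d) * q x"
 using AE_start(1) kE qE
 proof eventually_elim
 case (elim x)
 let ?Q = "%w. if X (en d) w = None then 0 else UU (th (en d) w)"
 have e1: "en (exp d) * exp_neg (en d) = 1" using d by (simp add: exp_neg_def ennreal_mult'[symmetric] exp_add[symmetric])
 have "k x + PT (en d) q x = nn (CP (PS x)) (%w. C d w) + nn (CP (PS x)) (%w. ?Q w)"
 unfolding ncompl markov_PT[OF dd Wm[OF mexpn]] PT_cong_AE[OF qE dd] elim(2) ..
 also have "... = nn (CP (PS x)) (%w. C d w + ?Q w)"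
 by (rule nadd[symmetric]) (intro mFFc[OF Cm] measurable_shifted[OF dd Wm[OF mexpn]])+
 also have "... <= nn (CP (PS x)) (%w. en (exp d) * UU w)"
 proof (rule nmonoAE, unfold AE_completion_iff, rule evmono[OF elim(1)])
 fix w assume w: "w : LL"
 have "C d w + ?Q w <= en (exp d) * cint (%t. B t w) (%r. exp_neg r * ind {..ennreal d} r * ext0 s (X r w)) + en (exp d) * (exp_neg (en d) * ?Q w)"
 unfolding mult.assoc[symmetric] e1 by (intro add_mono) (use C_le[of d w] d in \<open>simp_all add: mult.assoc\<close>)
 also have "... = en (exp d) * UU w"
 unfolding cint_markov[OF w dd mexpn sm] U_shifted[OF dd(2)] by (simp only: distrib_left)
 finally show "C d w + ?Q w <= en (exp d) * UU w" .
 qed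
 also have "... = en (exp d) * q x"
 using ncmult[OF mFFc[OF Wm[OF mexpn]], of "Some x" "en (exp d)"] elim(3) by (simp only: ncompl)
 finally show ?case .
 qed
 hence "nn m (%x. h x * (k x + PT (en d) q x)) <= nn m (%x. h x * (en (exp d) * q x))"
 by (intro nmonoAE, elim evmono) (rule mlmono, simp_all)
 also have "nn m (%x. h x * (k x + PT (en d) q x)) = nn m (%x. h x * k x) + nn m (%x. PT (en d) h x * q x)"
 using PT_symmetric[of h q "en d"] by (simp add: distrib_left nadd meas_m)
 also have "nn m (%x. h x * (en (exp d) * q x)) = nn m (%x. en (exp d) * (h' x * q x) + PT (en d) h x * q x)"
 proof (rule ncong)
 fix x
 have "en (exp d) * ee (- d) = 1" by (simp add: ennreal_mult'[symmetric] exp_add[symmetric])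
 hence "en (exp d) * h x = en (exp d) * h' x + PT (en d) h x"
 by (subst h_split) (simp add: distrib_left mult.assoc[symmetric])
 from arg_cong[OF this, of "%z. z * q x"]
 show "h x * (en (exp d) * q x) = en (exp d) * (h' x * q x) + PT (en d) h x * q x"
 by (simp add: distrib_left mult_ac)
 qed
 also have "... = en (exp d) * nn m (%x. h' x * q x) + nn m (%x. PT (en d) h x * q x)"
 by (simp add: nadd ncmult meas_m)
 finally have sum: "nn m (%x. h x * k x) + nn m (%x. PT (en d) h x * q x) <= en (exp d) * nn m (%x. h' x * q x) + nn m (%x. PT (en d) h x * q x)" .
 have "nn m (%x. PT (en d) h x * q x) <= nn m (%x. PT (en d) h x * (en l * en c))"
 proof (rule nmonoAE, rule evmono[OF ql], rule mlmono)
 fix x assume "q x <= en l * RR 1 g x"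
 also have "... <= en l * (en c * en (1 / 1))" by (intro mlmono RR_const_le g gc) auto
 finally show "q x <= en l * en c" by simp
 qed simp
 also have "... = nn m (%x. PT (en d) h x) * (en l * en c)" by (rule nn_integral_multc) (simp add: meas_m)
 also have "... < infy"
 using le_less_trans[OF PT_excessive_measure[of h "en d"] h_fin] by (simp add: enmlt)
 finally have "nn m (%x. h x * k x) <= en (exp d) * nn m (%x. h' x * q x)"
 using sum by (auto simp: ennreal_add_left_cancel_le add.commute[of _ "nn m (%x. PT (en d) h x * q x)"])
 also have "nn m (%x. h' x * q x) <= nn m (%x. en l * (h' x * RR 1 g x))"
 by (rule nmonoAE, rule evmono[OF ql], unfold mult.left_commute[of "en l"], rule mlmono) simp_all
 also have "... = en l * nn m (%x. h' x * RR 1 g x)" by (rule ncmult) (simp add: meas_m)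
 also have "... <= en l * (en d * nn m (%x. h x * g x))" by (intro mlmono h'_g) simp
 finally show ?thesis by (simp add: mlmono)
qed

text \<open>\<open>amgm_ennreal\<close> is applied to the mass \<open>C d\<close> and to the values
  of \<open>h\<close> at times \<open>d\<close> and 0. The quadratic terms in \<open>h\<close>
  combine to \<open>e\<close> times the integral of \<open>h * (h - P_d h)\<close>, which is of
  order \<open>d\<close> because \<open>h\<close> exceeds \<open>P_d h\<close> by at most
  \<open>d * M\<close>.\<close>

lemma end_bound:
 assumes k[measurable]: "k : Bor" and kE: "AE x in m. nn (PS x) (%w. C d w) = k x" and e: "0 < e"
 shows "Em (%w. C d w * ext0 h (X (en d) w)) <=
 (nn m (%x. h x * k x)) + en (1 / (2 * e)) * Em (%w. (C d w)\<^sup>2) + en e * (en (d * M) * nn m (%x. h x))"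
proof -
 let ?p = "%w. ext0 h (X (en d) w)"
 have hm: "h : Bor" "(%x. (h x)\<^sup>2) : Bor" by measurable
 have pF: "(%w. ext0 f (X (en d) w)) : bm (FF infy)" if "f : Bor" for f :: "'e => ennreal"
 by (rule mcomp[OF mXFF mext0[OF that]]) simp
 obtain k1 where k1[measurable]: "k1 : Bor" and k1E: "AE x in m. nn (PS x) (%w. C d w * ?p w) = k1 x"
 by (rule expectation_version[OF sigma_finite_m sets_m bmtimes[OF Cm pF[OF hm(1)]]])
 obtain k3 where k3[measurable]: "k3 : Bor" and k3E: "AE x in m. nn (PS x) (%w. (C d w)\<^sup>2) = k3 x"
 by (rule expectation_version[OF sigma_finite_m sets_m borel_measurable_power_ennreal[OF Cm]])
 let ?h2 = "%x. (h x)\<^sup>2"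
 have "AE x in m. k1 x + en e * (h x * PT (en d) h x) <=
 h x * k x + (en (1 / (2 * e)) * k3 x + (en (e / 2) * PT (en d) ?h2 x + en (e / 2) * ?h2 x))"
 using k1E k3E kE
 proof eventually_elim
 case (elim x)
 let ?M = "CP (PS x)"
 have P1: "emu (PS x) UNIV = 1" using prob_space.emeasure_space_1[OF prob_space_P[of "Some x"]] by simp
 note [measurable] = mFFc[OF Cm, of d "Some x"] mFFc[OF pF[OF hm(1)], of "Some x"]
 have sq: "(ext0 h z)\<^sup>2 = ext0 ?h2 z" for z by (cases z) auto
 have "nn ?M (%w. C d w * ?p w + en e * (?p w * h x)) <=
 (nn ?M (%w. C d w * h x + (en (1 / (2 * e)) * (C d w)\<^sup>2 + (en (e / 2) * (?p w)\<^sup>2 + en (e / 2) * (h x)\<^sup>2))))"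
 proof (intro nmono amgm_ennreal e)
 have "h y < infy" for y using h_le by (rule le_less_trans) simp
 thus "h x < infy" "ext0 h z < infy" for z by (cases z; simp)+
 qed
 hence "nn ?M (%w. C d w * ?p w) + en e * (nn ?M (%w. ?p w) * h x) <=
 (nn ?M (%w. C d w)) * h x + (en (1 / (2 * e)) * nn ?M (%w. (C d w)\<^sup>2) + (en (e / 2) * nn ?M (%w. (?p w)\<^sup>2) + en (e / 2) * (h x)\<^sup>2))"
 by (simp add: nadd ncmult nn_integral_multc P1 del: ncompl)
 thus ?case
 unfolding ncompl sq elim(1-3) transition_def[symmetric] by (simp only: mult.commute[of _ "h x"])
 qed
 hence "nn m (%x. k1 x + en e * (h x * PT (en d) h x)) <=
 (nn m (%x. h x * k x + (en (1 / (2 * e)) * k3 x + (en (e / 2) * PT (en d) ?h2 x + en (e / 2) * ?h2 x))))"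
 by (rule nmonoAE)
 also have "... = nn m (%x. h x * k x) + (en (1 / (2 * e)) * nn m (%x. k3 x) + (en (e / 2) * nn m (%x. PT (en d) ?h2 x) + en (e / 2) * nn m (%x. ?h2 x)))"
 using measurable_PT[OF hm(2)] by (simp add: nadd ncmult meas_m)
 also have "... <= nn m (%x. h x * k x) + (en (1 / (2 * e)) * nn m (%x. k3 x) + (en (e / 2) * nn m (%x. ?h2 x) + en (e / 2) * nn m (%x. ?h2 x)))"
 by (intro add_left_mono add_right_mono mlmono PT_excessive_measure hm) auto
 also have "en (e / 2) * nn m (%x. ?h2 x) + en (e / 2) * nn m (%x. ?h2 x) = en e * nn m (%x. ?h2 x)"
 using e by (simp add: distrib_right[symmetric] ennreal_plus[symmetric] del: ennreal_plus)
 also have "nn m (%x. ?h2 x) <= nn m (%x. en (d * M) * h x + h x * PT (en d) h x)"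
 proof (rule nmono)
 fix x
 have "h x <= en (d * M) + 1 * PT (en d) h x"
 by (subst h_split) (intro add_mono h'_le mrmono, use d in auto)
 from mrmono[OF this, of "h x"] show "?h2 x <= en (d * M) * h x + h x * PT (en d) h x"
 by (simp add: power2_eq_square distrib_left mult.commute)
 qed
 also have "... = en (d * M) * nn m (%x. h x) + nn m (%x. h x * PT (en d) h x)"
 by (simp add: nadd ncmult meas_m)
 finally have "nn m (%x. k1 x) + en e * nn m (%x. h x * PT (en d) h x) <=
 (nn m (%x. h x * k x) + en (1 / (2 * e)) * nn m (%x. k3 x) + en e * (en (d * M) * nn m (%x. h x))) + en e * nn m (%x. h x * PT (en d) h x)"
 by (simp add: nadd ncmult meas_m distrib_left mlmono add.assoc)
 moreover have "nn m (%x. h x * PT (en d) h x) <= nn m (%x. h x * en M)"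
 by (intro nmono mlmono PT_const_le h_le) simp
 hence "nn m (%x. h x * PT (en d) h x) < infy"
 by (rule le_less_trans) (use h_fin in \<open>simp add: nn_integral_multc meas_m enmlt\<close>)
 ultimately have "nn m (%x. k1 x) <= nn m (%x. h x * k x) + en (1 / (2 * e)) * nn m (%x. k3 x) + en e * (en (d * M) * nn m (%x. h x))"
 by (auto simp: add.commute[of _ "en e * nn m (%x. h x * PT (en d) h x)"] ennreal_add_left_cancel_le ennreal_mult_eq_top_iff)
 thus ?thesis unfolding ncongAE[OF k1E] ncongAE[OF k3E] .
qed

private lemma pot_v_le: "pot v w <= en (d * M) + (if X (en d) w = None then 0 else pot v (th (en d) w))"
proof -
 have "sl {0..<d} (%t. ee (- t) * ext0 v (X (en t) w)) <= nl (%t. en M * ind {0..<d} t)"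
 proof (rule nmono)
 fix t
 have "ext0 v z <= en M" for z using vM by (cases z) auto
 hence "0 <= t ==> ee (- t) * ext0 v (X (en t) w) <= 1 * en M" by (intro mult_mono) auto
 thus "ee (- t) * ext0 v (X (en t) w) * ind {0..<d} t <= en M * ind {0..<d} t" by (auto split: spind)
 qed
 also have "... = en (d * M)" using d M0 by (simp add: ncmind ennreal_mult' mult.commute)
 finally have 1: "sl {0..<d} (%t. ee (- t) * ext0 v (X (en t) w)) <= en (d * M)" .
 have "ee (- d) * pot v (th (en d) w) <= 1 * pot v (th (en d) w)" using d by (intro mrmono) auto
 also have "1 * pot v (th (en d) w) = (if X (en d) w = None then 0 else pot v (th (en d) w))"
 proof (cases "X (en d) w = None")
 case True
 hence "X r (th (en d) w) = None" for r using X_shift[of "en d" r w] X_None_mono[of "en d" w "r + en d"] by simp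
 thus ?thesis using True by simp
 qed auto
 finally show ?thesis unfolding pot_shift[OF less_imp_le[OF d] v, of w] by (rule add_mono[OF 1])
qed

text \<open>\<open>h (X r)\<close> is the conditional expectation of \<open>pot v\<close> for the
  path shifted by \<open>r\<close>. For \<open>r \<le> d\<close> this shifted value is at most
  \<open>exp d * pot v\<close>, and \<open>pot v\<close> differs from its value after time
  \<open>d\<close> by at most \<open>d * M\<close>. What remains is conditioned at time
  \<open>d\<close>, where \<open>C d\<close> is known by \<open>II_adapted\<close>.\<close>

lemma charged_bound:
 "Em (II (%y. s y * h y) (en d)) <= en (exp d) * (en (d * M) * Em (C d) + Em (%w. C d w * ext0 h (X (en d) w)))"
proof -
 have hm: "h : Bor" by measurable
 have pF: "(%w. C d w * ext0 h (X (en d) w)) : bm (FF infy)"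
 by (rule bmtimes[OF Cm mcomp[OF mXFF mext0[OF hm]]]) simp
 obtain k where k[measurable]: "k : Bor" and kE: "AE x in m. nn (PS x) (%w. C d w) = k x"
 by (rule expectation_version[OF sigma_finite_m sets_m Cm])
 obtain k1 where k1[measurable]: "k1 : Bor" and k1E: "AE x in m. nn (PS x) (%w. C d w * ext0 h (X (en d) w)) = k1 x"
 by (rule expectation_version[OF sigma_finite_m sets_m pF])
 let ?i = "ind {..ennreal d} :: ennreal => ennreal"
 have im: "?i : Bor" by measurable
 have dd: "0 < en d" "en d < infy" using d by auto
 have "AE x in m. nn (PS x) (%w. II (%y. s y * h y) (en d) w) <= en (exp d) * (en (d * M) * k x + k1 x)"
 using strong_markov_cint_FF[OF measurable_pot[OF v]] AE_start(1) kE k1E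
 proof eventually_elim
 case (elim x)
 let ?Q = "%w. if X (en d) w = None then 0 else pot v (th (en d) w)"
 let ?M = "CP (PS x)"
 have "nn (PS x) (%w. II (%y. s y * h y) (en d) w) = nn (PS x) (%w. cint (%t. B t w) (%r. ?i r * ext0 s (X r w) * pot v (sh r w)))"
 unfolding elim(1)[rule_format, OF im sm] pot_RR[OF v] ..
 also have "... <= nn (PS x) (%w. en (exp d) * (en (d * M) * C d w + C d w * ?Q w))"
 proof (rule nmonoAE, rule evmono[OF elim(2)])
 fix w assume w: "w : LL"
 have "cint (%t. B t w) (%r. ?i r * ext0 s (X r w) * pot v (sh r w)) <= cint (%t. B t w) (%r. en (exp d) * pot v w * (?i r * ext0 s (X r w)))"
 proof (rule cint_mono)
 fix u :: real
 let ?r = "tau w u"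
 show "?i ?r * ext0 s (X ?r w) * pot v (sh ?r w) <= en (exp d) * pot v w * (?i ?r * ext0 s (X ?r w))"
 proof (cases "?r <= en d")
 case True
 then obtain r' where r': "?r = en r'" "0 <= r'" by (cases ?r) (auto simp: top_unique)
 have rd: "r' <= d" using True r' d by (simp add: ennreal_le_iff)
 have "ee (- r') * pot v (th (en r') w) <= pot v w" unfolding pot_shift[OF r'(2) v, of w] by simp
 from mlmono[OF this, of "en (exp r')"]
 have "pot v (th (en r') w) <= en (exp r') * pot v w"
 by (simp add: mult.assoc[symmetric] ennreal_mult'[symmetric] exp_add[symmetric])
 also have "... <= en (exp d) * pot v w" using rd by (intro mrmono ennreal_leI) auto
 finally have "pot v (sh ?r w) <= en (exp d) * pot v w" using r' by (simp add: sh_finite)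
 thus ?thesis by (simp add: mult.commute[of _ "pot v (sh ?r w)"] mrmono)
 qed simp
 qed
 also have "... = en (exp d) * (pot v w * C d w)"
 by (subst cint_cmult) (auto simp: mult.assoc intro!: bmtimes mfX)
 also have "... <= en (exp d) * ((en (d * M) + ?Q w) * C d w)"
 by (intro mlmono mrmono pot_v_le) auto
 finally show "cint (%t. B t w) (%r. ?i r * ext0 s (X r w) * pot v (sh r w)) <= en (exp d) * (en (d * M) * C d w + C d w * ?Q w)"
 by (simp add: distrib_right mult.commute[of "?Q w"])
 qed
 also have "... = en (exp d) * (en (d * M) * nn ?M (%w. C d w) + nn ?M (%w. C d w * ?Q w))"
 unfolding ncompl[symmetric, of "PS x"]
 using mFFc[OF Cm, of d "Some x"] measurable_shifted[OF dd measurable_pot[OF v], of x]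
 by (simp add: ncmult nadd)
 also have "nn ?M (%w. C d w * ?Q w) = k1 x"
 unfolding ncompl markov_completed[OF dd II_adapted[OF sm dd(2)] measurable_pot[OF v]] pot_RR[OF v] by (rule elim(4))
 finally show ?case using elim(3) by (simp add: ncompl)
 qed
 hence "Em (II (%y. s y * h y) (en d)) <= nn m (%x. en (exp d) * (en (d * M) * k x + k1 x))" by (rule nmonoAE)
 also have "... = en (exp d) * (en (d * M) * nn m (%x. k x) + nn m (%x. k1 x))"
 by (simp add: nadd ncmult meas_m)
 finally show ?thesis unfolding ncongAE[OF kE] ncongAE[OF k1E] .
qed

end

text \<open>Divided by \<open>d\<close>, the term with \<open>Em (C d)\<close> and the second moment
  vanish as \<open>d\<close> tends to 0, which leaves the error \<open>e * M\<close> times the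
  integral of \<open>RR 1 v\<close>. Then \<open>e\<close> tends to 0.\<close>

lemma potential_bound:
 assumes v[measurable]: "v : Bor" and vM: "!!x. v x <= en M" and M0: "0 <= M" and vfin: "nn m (%x. v x) < infy"
 shows "nn nu (%y. s y * RR 1 v y) <= en l * nn m (%x. RR 1 v x * g x)"
proof -
 let ?H = "nn m (%x. RR 1 v x)" and ?J = "nn m (%x. RR 1 v x * g x)" and ?I = "nn nu (%y. s y * RR 1 v y)"
 have H: "?H < infy" by (rule h_fin[OF v vM M0 vfin zero_less_one])
 have "?J <= nn m (%x. RR 1 v x * en c)" by (intro nmono mlmono gc) simp
 also have "... < infy" using H by (simp add: nn_integral_multc meas_m enmlt)
 finally have J: "?J < infy" .
 obtain a where a: "!!n. a n : Bor" "!!n. AE y in nu. nn (PS y) (%w. C (dn n) w) = a n y"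
 "(%n. nn nu (%y. s y * a n y)) ->> 0" by (rule C_small) blast
 let ?a = "%n. nn nu (%y. s y * a n y)"
 have main: "?I <= en l * ?J + en e * (en M * ?H)" if e: "0 < e" for e
 proof -
 let ?b = "%n. ee (dn n) * ((en (dn n) * (en M * emu nu S) + ee (dn n) * (en l * ?J)) + (en (1 / e) * ?a n + en e * (en M * ?H)))"
 have le: "Em (II (%y. s y * RR 1 v y) (en (dn n))) / en (dn n) <= ?b n" for n
 proof -
 let ?d = "dn n"
 note d = dn(1)[of n]
 obtain k where k: "k : Bor" and kE: "AE x in m. nn (PS x) (%w. C ?d w) = k x"
 by (rule expectation_version[OF sigma_finite_m sets_m Cm])
 have dM: "en (?d * M) = en ?d * en M" using d by (simp add: ennreal_mult')
 have "Em (C ?d) <= en ?d * emu nu S" using Em_II_le[OF sm d] by (simp add: sets_nu)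
 hence 1: "en (?d * M) * Em (C ?d) <= en ?d * (en ?d * (en M * emu nu S))"
 unfolding dM mult.assoc mult.left_commute[of "en ?d" "en M"] by (intro mlmono) simp_all
 have "Em (%w. C ?d w * ext0 (RR 1 v) (X (en ?d) w)) <=
 (nn m (%x. RR 1 v x * k x)) + en (1 / (2 * e)) * Em (%w. (C ?d w)\<^sup>2) + en e * (en (?d * M) * ?H)"
 by (rule end_bound[OF v vM M0 vfin d k kE e])
 also have "... <= en (exp ?d) * (en l * (en ?d * ?J)) + en (1 / (2 * e)) * (2 * (en ?d * ?a n)) + en e * (en (?d * M) * ?H)"
 by (intro add_mono order_refl mlmono start_bound[OF v vM M0 vfin d k kE] C_square[OF a(1,2) d]) auto
 also have "en (1 / (2 * e)) * (2 * (en ?d * ?a n)) = en ?d * (en (1 / e) * ?a n)"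
 using e ennreal_mult'[of "1 / (2 * e)" 2] by (simp add: mult.assoc[symmetric]) (simp add: mult_ac)
 finally have 2: "Em (%w. C ?d w * ext0 (RR 1 v) (X (en ?d) w)) <=
 en (exp ?d) * (en l * (en ?d * ?J)) + en ?d * (en (1 / e) * ?a n) + en e * (en (?d * M) * ?H)" .
 have "Em (II (%y. s y * RR 1 v y) (en ?d)) <= en (exp ?d) * (en (?d * M) * Em (C ?d) + Em (%w. C ?d w * ext0 (RR 1 v) (X (en ?d) w)))"
 by (rule charged_bound[OF v vM M0 vfin d])
 also have "... <= en (exp ?d) * (en ?d * (en ?d * (en M * emu nu S)) +
 (en (exp ?d) * (en l * (en ?d * ?J)) + en ?d * (en (1 / e) * ?a n) + en e * (en (?d * M) * ?H)))"
 by (intro mlmono add_mono 1 2) simp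
 also have "... = en ?d * ?b n" unfolding dM by (simp add: distrib_left mult_ac add_ac)
 finally show ?thesis using d by (intro divide_le_posI_ennreal) simp_all
 qed
 have "filterlim dn (at_right 0) sequentially" using dn by (auto simp: filterlim_at dn(1)[THEN less_imp_neq, symmetric])
 moreover have "(%y. s y * RR 1 v y) : Bor" by measurable
 ultimately have "(%n. Em (II (%y. s y * RR 1 v y) (en (dn n))) / en (dn n)) ->> ?I"
 by (intro filterlim_compose[OF Em_II_tendsto])
 moreover have "?b ->> en (exp 0) * ((en 0 * (en M * emu nu S) + en (exp 0) * (en l * ?J)) + (en (1 / e) * 0 + en e * (en M * ?H)))"
 using J H Sfin by (intro tendsto_mult_ennreal tendsto_add tendsto_const tendsto_ennrealI tendsto_exp dn(3) a(3))
 (auto simp: ennreal_mult_eq_top_iff)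
 ultimately have "?I <= en (exp 0) * ((en 0 * (en M * emu nu S) + en (exp 0) * (en l * ?J)) + (en (1 / e) * 0 + en e * (en M * ?H)))"
 by (rule LIMSEQ_le) (use le in blast)
 thus ?thesis by simp
 qed
 have "(%n. en l * ?J + en (dn n) * (en M * ?H)) ->> en l * ?J + en 0 * (en M * ?H)"
 using H by (intro tendsto_add tendsto_const tendsto_mult_ennreal tendsto_ennrealI dn(3)) (auto simp: ennreal_mult_eq_top_iff)
 hence "?I <= en l * ?J + en 0 * (en M * ?H)"
 by (rule LIMSEQ_le_const) (use main dn(1) in blast)
 thus ?thesis by simp
qed

end

end

section \<open>Excessive functions as limits of bounded integrable potentials\<close>

context symmetric_hunt_process
begin

text \<open>Capping \<open>q\<close> by \<open>i\<close> times an everywhere positive, bounded and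
  integrable potential gives a bounded integrable function \<open>?k i\<close> that increases to
  \<open>q\<close>. By \<open>supermedian_split\<close> with rates 1 and \<open>b = n + 2\<close>,
  the function \<open>b * RR b (?k i)\<close> is the 1-potential of the nonnegative
  \<open>v n i\<close>.\<close>

lemma excessive_approx:
 assumes q: "excessive X P q"
 obtains v :: "nat => nat => 'e => ennreal" where "!!n i. v n i : Bor" "!!n i. EX M>=0. ALL y. v n i y <= en M"
 "!!n i. nn m (%x. v n i x) < infy" "!!n. incseq (%i. RR 1 (v n i))" "incseq (%n y. SUP i. RR 1 (v n i) y)"
 "!!y. q y = (SUP n. SUP i. RR 1 (v n i) y)"
proof -
 note qm[measurable] = excessive_measurable[OF q]
 obtain a :: "'e => real" where a: "a : Bor" "!!x. 0 <= a x" "!!x. a x <= 1" "integrable m a" "AE x in m. 0 < a x"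
 by (rule reference_function) blast
 note [measurable] = a(1)
 let ?a = "%x. en (a x)"
 let ?k = "%i y. min (q y) (of_nat i * RR 1 ?a y)"
 have kinc: "incseq ?k"
 by (intro incseq_SucI le_funI min.mono mrmono) auto
 have ksup: "(SUP i. ?k i y) = q y" for y
 proof (intro antisym SUP_least)
 have "0 < RR 1 ?a y" by (rule RR_pos) (use a(5) in \<open>auto elim: evmono\<close>)
 hence "(SUP i. of_nat i * RR 1 ?a y) = \<top>" unfolding SUPmr[symmetric]
 by (simp add: ennreal_SUP_of_nat_eq_top ennreal_top_mult)
 moreover have "(SUP i. ?k i y) = min (q y) (SUP i. of_nat i * RR 1 ?a y)"
 by (simp add: inf_min[symmetric] inf_SUP)
 ultimately have "(SUP i. ?k i y) = min (q y) \<top>" by (simp only:)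
 thus "q y <= (SUP i. ?k i y)" by (simp only: min_def top_greatest if_True order_refl)
 qed simp
 let ?b = "%n. real (Suc (Suc n))"
 have km[measurable]: "?k i : Bor" for i by measurable
 have kle: "?k i y <= en (real i)" for i y
 proof -
 have "RR 1 ?a y <= 1 * en (1 / 1)" by (rule RR_const_le) (use a in auto)
 thus ?thesis
 using mlmono[of "RR 1 ?a y" 1 "of_nat i"] by (intro min.coboundedI2) (simp add: ennat)
 qed
 have sm: "en (b - 1) * RR b (?k i) y <= ?k i y" if b: "1 < b" for b i y
 proof (rule min.boundedI)
 have "en (b - 1) * RR b (?k i) y <= en b * RR b q y" by (intro mult_mono RR_mono ennreal_leI) auto
 also have "... <= q y" by (rule excessive_RR_le[OF q]) (use b in simp)
 finally show "en (b - 1) * RR b (?k i) y <= q y" .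
 have "en (b - 1) * RR b (?k i) y <= en (b - 1) * RR b (%y. of_nat i * RR 1 ?a y) y" by (intro mlmono RR_mono) auto
 also have "... = of_nat i * (en (b - 1) * RR b (RR 1 ?a) y)" by (simp add: RR_cmult mult.left_commute)
 also have "... <= of_nat i * RR 1 ?a y" using RR_resolvent[of "?a" 1 b y] b by (intro mlmono) auto
 finally show "en (b - 1) * RR b (?k i) y <= of_nat i * RR 1 ?a y" .
 qed
 define v where "v n i y = en (?b n) * (?k i y - en (?b n - 1) * RR (?b n) (?k i) y)" for n i y
 have b1: "1 < ?b n" for n by simp
 note split = supermedian_split[OF km kle zero_less_one b1 sm[OF b1]]
 have vm: "v n i : Bor" for n i unfolding v_def by measurable
 have vk: "v n i y <= en (?b n) * ?k i y" for n i y unfolding v_def by (intro mlmono split(2)) simp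
 have v: "RR 1 (v n i) y = en (?b n) * RR (?b n) (?k i) y" for n i y
 unfolding v_def[abs_def] by (subst RR_cmult[OF split(1)]) (simp only: split(3)[symmetric])
 have vs: "(SUP i. RR 1 (v n i) y) = en (?b n) * RR (?b n) q y" for n y
 using RR_SUP[OF _ kinc, of "?b n" y] unfolding v by (simp add: ksup SUPml[symmetric])
 show thesis
 proof (rule that[OF vm])
 have "v n i y <= en (?b n * real i)" for n i y
 using order_trans[OF vk mlmono[OF kle]] by (simp add: ennreal_mult)
 thus "EX M>=0. ALL y. v n i y <= en M" for n i by (intro exI[of _ "?b n * real i"]) auto
 show "nn m (%x. v n i x) < infy" for n i
 proof -
 have "nn m (%x. v n i x) <= nn m (%x. en (?b n * real i) * RR 1 ?a x)"
 by (intro nmono order_trans[OF vk]) (auto simp: ennreal_mult mult.assoc ennat[symmetric] intro!: mlmono)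
 also have "... = en (?b n * real i) * nn m (%x. RR 1 ?a x)" by (rule ncmult) (simp add: meas_m)
 also have "... <= en (?b n * real i) * (en (1 / 1) * nn m (%x. ?a x))" by (intro mlmono RR_excessive_measure) auto
 also have "... < infy" using a(4) a(2) by (simp add: neqint enmlt)
 finally show ?thesis .
 qed
 show "incseq (%i. RR 1 (v n i))" for n
 unfolding v using le_funD[OF incseq_SucD[OF kinc]] by (intro incseq_SucI le_funI mlmono RR_mono zero_le) blast
 have inc: "en (real (Suc n)) * RR (real (Suc n)) q y <= en (?b n) * RR (?b n) q y" for n y
 using le_funD[OF incseq_SucD[OF excessive_SUP_nat(2)[OF q]]] .
 show "incseq (%n y. SUP i. RR 1 (v n i) y)" unfolding vs by (intro incseq_SucI le_funI inc)
 show "q y = (SUP n. SUP i. RR 1 (v n i) y)" for y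
 unfolding vs excessive_SUP_nat(1)[OF q, of y, symmetric]
 by (intro antisym SUP_mono) (use inc in blast)+
 qed
qed

end

context revuz_functional
begin

text \<open>\<open>potential_bound\<close> asks for a set of finite mass off \<open>N\<close>. A
  Borel null set containing \<open>N\<close> is removed from \<open>S\<close>, and the rest is
  exhausted by pieces of finite mass.\<close>

lemma excessive_bound:
 fixes q g :: "'e => ennreal"
 assumes S[measurable]: "S : sets borel" and g[measurable]: "g : Bor" and gc: "!!x. g x <= en c" and c0: "0 <= c" and l0: "0 <= l"
 and occ: "!!y. y : S ==> y ~: N ==> 1 <= nn (PS y) (%w. occ g l w)" and q: "excessive X P q"
 shows "sn nu S (%y. q y) <= en l * nn m (%x. q x * g x)"
proof -
 note qm[measurable] = excessive_measurable[OF q]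
 obtain N0 where N0: "N0 : sets borel" "N <= N0" "!!nu. smooth_measure m \<E> D nu ==> emu nu N0 = 0"
 by (rule polar_null[OF N_polar]) blast
 obtain F :: "nat => 'e set" where F: "incseq F" "!!n. F n : sets borel" "!!n. emu nu (F n) < infy" "emu nu (- (\<Union>n. F n)) = 0"
 by (rule smooth_exhaustion[OF smooth]) blast
 obtain v :: "nat => nat => 'e => ennreal" where vm[measurable]: "!!n i. v n i : Bor" and vM: "!!n i. EX M>=0. ALL y. v n i y <= en M"
 and vfin: "!!n i. nn m (%x. v n i x) < infy" and vinc: "!!n. incseq (%i. RR 1 (v n i))" "incseq (%n y. SUP i. RR 1 (v n i) y)"
 and vq: "!!y. q y = (SUP n. SUP i. RR 1 (v n i) y)" by (rule excessive_approx[OF q]) blast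
 let ?J = "en l * nn m (%x. q x * g x)"
 have fixed: "nn nu (%y. ind (S Int F j - N0) y * q y) <= ?J" for j
 proof -
 let ?S = "S Int F j - N0"
 have Sm[measurable]: "?S : sets borel" using S F(2) N0(1) by auto
 have "emu nu ?S <= emu nu (F j)" by (rule emeasure_mono) (use F(2) in \<open>auto simp: sets_nu\<close>)
 hence Sfin: "emu nu ?S < infy" using F(3) by (rule le_less_trans)
 have step: "nn nu (%y. ind ?S y * RR 1 (v n i) y) <= ?J" for n i
 proof -
 obtain M where M: "0 <= M" "!!y. v n i y <= en M" using vM[of n i] by auto
 have "nn nu (%y. ind ?S y * RR 1 (v n i) y) <= en l * nn m (%x. RR 1 (v n i) x * g x)"
 proof (rule potential_bound[OF Sm _ g gc c0 l0 _ Sfin vm M(2,1) vfin])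
 show "?S Int N = {}" using N0 by auto
 show "1 <= nn (PS y) (%w. occ g l w)" if "y : ?S" for y using that N0 by (intro occ) auto
 qed
 also have "... <= ?J" unfolding vq by (intro mlmono nmono mrmono SUP_upper2[of n] SUP_upper) auto
 finally show ?thesis .
 qed
 have "nn nu (%y. ind ?S y * q y) = (SUP n. nn nu (%y. ind ?S y * (SUP i. RR 1 (v n i) y)))"
 unfolding vq SUPml[of "ind ?S _" "%n. SUP i. RR 1 (v n i) _"] using vinc(2)
 by (intro nmcSUP incseq_SucI le_funI mlmono) (auto simp: incseq_Suc_iff le_fun_def measurable_nu)
 also have "... = (SUP n. SUP i. nn nu (%y. ind ?S y * RR 1 (v n i) y))"
 unfolding SUPml using vinc(1)
 by (intro SUP_cong refl nmcSUP incseq_SucI le_funI mlmono) (auto simp: incseq_Suc_iff le_fun_def measurable_nu)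
 also have "... <= ?J" by (intro SUP_least step)
 finally show ?thesis .
 qed
 have "AE y in nu. y ~: N0 Un - (\<Union>n. F n)"
 using N0(1) N0(3)[OF smooth] F by (intro AE_not_in null_sets.Un) (auto simp: null_sets_def sets_nu)
 hence "sn nu S (%y. q y) = nn nu (%y. (SUP j. ind (S Int F j - N0) y * q y))"
 proof (intro ncongAE, elim evmono)
 fix y assume "y ~: N0 Un - (\<Union>n. F n)"
 then obtain j where "y : F j" "y ~: N0" by auto
 hence "(SUP j. ind (S Int F j - N0) y) = (ind S y :: ennreal)"
 by (intro antisym SUP_least SUP_upper2[of j]) (auto split: spind)
 thus "q y * ind S y = (SUP j. ind (S Int F j - N0) y * q y)"
 by (simp only: SUPmr[symmetric] mult.commute[of "q y"])
 qed
 also have "... = (SUP j. nn nu (%y. ind (S Int F j - N0) y * q y))"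
 using incseq_SucD[OF F(1)] F(2) N0(1) by (intro nmcSUP incseq_SucI le_funI mrmono)
 (auto simp: measurable_nu split: spind)
 also have "... <= ?J" by (intro SUP_least fixed)
 finally show ?thesis .
qed

end

section \<open>From fine continuity to finite potentials\<close>

context symmetric_hunt_process
begin

lemma SUP_survival: "(SUP n. PT (en (rs n)) (%_. 1) x) = 1"
proof -
 have "(SUP n. PT (en (rs n)) (%_. 1) x) = nn (PS x) (%w. (SUP n. ext0 (%_. 1 :: ennreal) (X (en (rs n)) w)))"
 unfolding transition_def
 proof (rule nmcSUP[symmetric])
 show "(%w. ext0 (%_. 1 :: ennreal) (X (en (rs n)) w)) : bm (PS x)" for n
 using mext0X[of "%_. 1"] by (simp add: mcongs[OF sets_P refl])
 show "incseq (%n w. ext0 (%_. 1 :: ennreal) (X (en (rs n)) w))"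
 proof (intro incseq_SucI le_funI)
 fix n w
 have "en (1 / real (Suc (Suc n))) <= en (rs n)" by (intro ennreal_leI) (simp add: field_simps)
 from X_None_mono[OF _ this, of w]
 show "ext0 (%_. 1 :: ennreal) (X (en (rs n)) w) <= ext0 (%_. 1 :: ennreal) (X (en (1 / real (Suc (Suc n)))) w)"
 by (auto simp: ext0_def split: option.split)
 qed
 qed
 also have "... = nn (PS x) (%w. 1)"
 proof (rule ncongAE)
 show "AE w in PS x. (SUP n. ext0 (%_. 1 :: ennreal) (X (en (rs n)) w)) = (1 :: ennreal)"
 using normal[of "Some x"]
 proof eventually_elim
 case (elim w)
 hence "0 < lifetime X w" by (simp add: lt_iff)
 then obtain n where "en (rs n) < lifetime X w" by (rule dn_less)
 then obtain y where "X (en (rs n)) w = Some y" by (auto simp: lt_iff)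
 thus ?case by (intro antisym SUP_least SUP_upper2[of n]) (auto simp: ext0_def split: option.split)
 qed
 qed
 also have "... = 1" using prob_space.emeasure_space_1[OF prob_space_P] by simp
 finally show ?thesis .
qed

lemma fine_open_excessive: "excessive X P q ==> open U ==> openin (fine_topology X P) (q -` U)"
 unfolding fine_topology_def by (rule topology_generated_by_Basis) blast

end

context revuz_functional
begin

text \<open>\<open>exp_neg B\<close> before the lifetime is decreasing, so the first
  \<open>r\<close> units of time carry at least the fraction \<open>1 - exp (- r)\<close> of the
  discounted integral. During them either the clock has not passed \<open>l\<close>, and the time
  counts as occupation up to the deficit \<open>1 - g\<close>, or the integrand is at most
  \<open>exp (- l)\<close>.\<close>

lemma phi1_path_le:
 assumes w: "w : LL" and g[measurable]: "g : Bor" and g1: "!!y. g y <= 1" and r: "0 < r" and l: "0 <= l"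
 shows "en (1 - exp (- r)) * sl {t. 0 <= t & en t < lifetime X w} (%t. ee (- t) * exp_neg (B (en t) w))
 <= occ g l w + en (r * exp (- l)) + sl {0..<r} (%t. (1 - ext0 g (X (en t) w)))"
proof -
 note gp = good[OF w]
 note [measurable] = mcomp[OF menn mfX[OF g, of w]]
 have "continuous_on {..<infy} (%t. B t w)" using gp by (simp add: good_path_def)
 hence "continuous_on UNIV (%t. B (en t) w)"
 by (rule continuous_on_compose2) (auto intro!: continuous_on_ennreal continuous_on_id)
 from borel_measurable_continuous_onI[OF this] have Bm[measurable]: "(%t. B (en t) w) : Bor" .
 define h where "h t = (if 0 <= t & en t < lifetime X w then exp_neg (B (en t) w) else 0)" for t
 have [measurable]: "h : Bor" unfolding h_def[abs_def] by measurable
 have anti: "exp_neg t <= exp_neg s" if "s <= t" for s t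
 using that by (cases s; cases t) (auto simp: exp_neg_def ennreal_le_iff top_unique)
 have h_dec: "h (r + t) <= h t" if "0 <= t" for t
 proof -
 have "en t <= en (r + t)" using r by (intro ennreal_leI) simp
 hence "B (en t) w <= B (en (r + t)) w" and "en (r + t) < lifetime X w ==> ennreal t < lifetime X w"
 by (auto intro: good_path_mono[OF gp] le_less_trans simp del: ennreal_plus)
 thus ?thesis unfolding h_def using that r by (auto intro!: anti simp del: ennreal_plus)
 qed
 let ?I = "sl {t. 0 <= t & en t < lifetime X w} (%t. ee (- t) * exp_neg (B (en t) w))"
 have I: "?I = sl {0..} (%t. ee (- t) * h t)"
 by (intro ncong) (auto simp: h_def split: spind)
 have h1: "h t <= 1" for t by (simp add: h_def exp_neg_le_1)
 have "?I <= sl {0..} (%t. ee (- 1 * t))"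
 unfolding I using mlmono[OF h1] by (intro nmono) (auto split: spind)
 also have "... < infy" by (subst nn_integral_exp_Ici) auto
 finally obtain i where i: "?I = en i" "0 <= i" by (cases ?I) auto
 let ?J = "sl {0..<r} (%t. ee (- t) * h t)"
 have "?I = ?J + sl {r..} (%t. ee (- t) * h t)" unfolding I
 using r by (subst nadd[symmetric]) (auto intro!: ncong split: spind)
 also have "sl {r..} (%t. ee (- t) * h t) = nl (%t. ee (- (r + 1 * t)) * h (r + 1 * t) * ind {r..} (r + 1 * t))"
 by (subst naffine[of _ 1 r]) auto
 also have "... <= nl (%t. ee (- r) * (ee (- t) * h t * ind {0..} t))"
 proof (rule nmono)
 fix t
 have e: "ee (- (r + 1 * t)) = ee (- r) * ee (- t)"
 by (simp only: mult_1 minus_add_distrib exp_add ennreal_mult exp_ge_zero)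
 show "ee (- (r + 1 * t)) * h (r + 1 * t) * ind {r..} (r + 1 * t) <= ee (- r) * (ee (- t) * h t * ind {0..} t)"
 unfolding e using h_dec[of t] by (cases "0 <= t") (auto simp: mult.assoc intro!: mlmono)
 qed
 also have "... = ee (- r) * ?I" unfolding I by (rule ncmult) measurable
 finally have *: "?I <= ?J + ee (- r) * ?I" by (simp add: add_left_mono)
 have "en (1 - exp (- r)) * ?I <= ?J"
 proof (cases ?J)
 case (real j)
 have "en i <= en j + ee (- r) * en i" using * unfolding real(2) i(1) .
 also have "... = en (j + exp (- r) * i)" using real i by (simp add: ennreal_mult)
 finally have "(1 - exp (- r)) * i <= j" using real i by (subst (asm) ennreal_le_iff) (auto simp: algebra_simps)
 thus ?thesis using i r unfolding real(2) i(1) by (simp add: ennreal_mult[symmetric] ennreal_leI)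
 qed simp
 also have "?J <= nl (%t. ee (- t) * ind {..tau w l} (en t) * ext0 g (X (en t) w) * ind {0..} t
 + (ee (- l) * ind {0..<r} t + (1 - ext0 g (X (en t) w)) * ind {0..<r} t))"
 proof (rule nmono)
 fix t :: real
 show "ee (- t) * h t * ind {0..<r} t <= ee (- t) * ind {..tau w l} (en t) * ext0 g (X (en t) w) * ind {0..} t
 + (ee (- l) * ind {0..<r} t + (1 - ext0 g (X (en t) w)) * ind {0..<r} t)"
 proof (cases "0 <= t & t < r & en t < lifetime X w")
 case True
 then obtain y where y: "X (en t) w = Some y" by (auto simp: lt_iff)
 have "g y < infy" using g1[of y] by (rule le_less_trans) simp
 then obtain b where b: "g y = en b" "0 <= b" "b <= 1" using g1[of y] by (cases "g y") (auto simp: ennreal_le_1)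
 have e1: "exp (- t) <= 1" using True by simp
 show ?thesis
 proof (cases "en t <= tau w l")
 case tl: True
 have "(1 - b) * exp (- t) <= 1 - b" using b e1 by (intro mult_left_le) auto
 hence "ee (- t) <= en (exp (- t) * b + (1 - b))" by (intro ennreal_leI) (simp add: algebra_simps)
 also have "... = ee (- t) * g y + (1 - g y)" using b ennreal_minus[of b 1] by (simp add: ennreal_mult)
 finally have "ee (- t) * h t <= ee (- t) * g y + (1 - g y)"
 using mlmono[OF h1[of t], of "ee (- t)"] by (simp add: order_trans)
 thus ?thesis using True tl y by (auto intro: order_trans add_increasing2 simp: add.left_commute[of "ee (- t) * g y"])
 next
 case False
 hence "en l < B (en t) w" using ivt_less_good[OF gp, of "en t" l] l by (simp add: not_le)
 hence "exp_neg (B (en t) w) <= ee (- l)" using anti[of "en l" "B (en t) w"] l by (simp add: exp_neg_def)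
 hence "h t <= ee (- l)" by (simp add: h_def)
 hence "ee (- t) * h t <= 1 * ee (- l)" using e1 by (intro mult_mono) auto
 thus ?thesis using True by (simp add: add_increasing add_increasing2)
 qed
 qed (auto simp: h_def)
 qed
 also have "... = occ g l w + (ee (- l) * en r + sl {0..<r} (%t. (1 - ext0 g (X (en t) w))))"
 using r by (subst nadd, simp, simp, subst nadd) (auto simp: ncmind)
 also have "ee (- l) * en r = en (r * exp (- l))" using r by (simp add: ennreal_mult mult.commute)
 finally show ?thesis by (simp only: add.assoc)
qed

text \<open>The expected deficit is \<open>r\<close> minus the expected amount of \<open>g\<close>
  collected before \<open>r\<close>; the latter stands on the left to avoid a subtraction.\<close>

lemma phi1_le:
 assumes y: "y ~: N" and g[measurable]: "g : Bor" and g1: "!!y. g y <= 1" and r: "0 < r" and l: "0 <= l"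
 shows "en (1 - exp (- r)) * phi1 X P B y + sl {0..<r} (%t. PT (en t) g y)
 <= nn (PS y) (%w. occ g l w) + en (r * exp (- l)) + en r"
proof -
 let ?C = "CP (PS y)" and ?c = "1 - exp (- r)"
 let ?I = "%w. sl {t. 0 <= t & en t < lifetime X w} (%t. ee (- t) * exp_neg (B (en t) w))"
 let ?U = "%w. nl (%t. ind {0..<r} t * ext0 g (X (en t) w))"
 define V where "V w = sl {0..<r} (%t. (1 - ext0 g (X (en t) w)))" for w
 have c: "0 < ?c" using r by simp
 have e1: "ext0 g z <= 1" for z using g1 by (cases z) auto
 have UV: "V w + ?U w = en r" for w
 proof -
 note [measurable] = mcomp[OF menn mfX[OF g, of w]]
 have "V w + ?U w = nl (%t. (1 - ext0 g (X (en t) w)) * ind {0..<r} t + ind {0..<r} t * ext0 g (X (en t) w))"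
 unfolding V_def by (rule nadd[symmetric]) auto
 also have "... = nl (%t. ind {0..<r} t)"
 using diff_add_cancel_ennreal[OF e1] by (intro ncong) (simp split: spind)
 finally show ?thesis using r by simp
 qed
 have Um: "?U : bm (PS y)" by (rule expectation_time_integral(2)) auto
 have "V w = en r - ?U w" for w
 proof -
 have "?U w <= en r" using UV[of w] by (metis le_iff_add add.commute)
 hence "?U w < infy" by (rule le_less_trans) simp
 thus ?thesis unfolding UV[of w, symmetric] by (auto intro!: ennreal_add_diff_cancel_right[symmetric])
 qed
 hence Vm: "V : bm (PS y)" using Um by (auto simp: cong: measurable_cong)
 note [measurable] = measurable_completion[OF Um] measurable_completion[OF Vm] mFFc[OF measurable_occ[OF g], of l "Some y"]
 have "en ?c * phi1 X P B y <= nn ?C (%w. occ g l w + en (r * exp (- l)) + V w)" (is "_ <= ?R")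
 proof -
 have "phi1 X P B y <= nn ?C (%w. en (1 / ?c) * (occ g l w + en (r * exp (- l)) + V w))"
 unfolding phi1_def
 proof (rule nmonoAE)
 show "AE w in ?C. ?I w <= en (1 / ?c) * (occ g l w + en (r * exp (- l)) + V w)"
 using AE_completion[OF start_LL[OF y]]
 proof eventually_elim
 case (elim w)
 have "?I w = en (1 / ?c) * (en ?c * ?I w)" using c by (simp add: mult.assoc[symmetric] ennreal_mult[symmetric])
 also have "... <= en (1 / ?c) * (occ g l w + en (r * exp (- l)) + V w)"
 unfolding V_def by (intro mlmono phi1_path_le[OF elim g g1 r l]) simp
 finally show ?case .
 qed
 qed
 also have "... = en (1 / ?c) * ?R" by (rule ncmult) measurable
 finally have "en ?c * phi1 X P B y <= en ?c * (en (1 / ?c) * ?R)" by (rule mlmono) simp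
 also have "... = ?R" using c by (simp add: mult.assoc[symmetric] ennreal_mult[symmetric])
 finally show ?thesis .
 qed
 hence "en ?c * phi1 X P B y + nn ?C (%w. ?U w) <= ?R + nn ?C (%w. ?U w)" by (rule add_right_mono)
 also have "... = nn ?C (%w. occ g l w + en (r * exp (- l)) + V w + ?U w)"
 by (rule nadd[symmetric]) measurable
 also have "... = nn ?C (%w. occ g l w + (en (r * exp (- l)) + en r))" by (simp only: add.assoc UV)
 also have "... = nn ?C (%w. occ g l w) + nn ?C (%w. en (r * exp (- l)) + en r)" by (rule nadd) measurable
 also have "nn ?C (%w. en (r * exp (- l)) + en r) = en (r * exp (- l)) + en r"
 using prob_space.emeasure_space_1[OF prob_space_P[of "Some y"]] by simp
 also have "nn ?C (%w. ?U w) = sl {0..<r} (%t. PT (en t) g y)"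
 unfolding ncompl by (subst expectation_time_integral(1)) (auto simp: mult.commute)
 also have "nn ?C (%w. occ g l w) = nn (PS y) (%w. occ g l w)" by (rule ncompl)
 finally show ?thesis by (simp only: add.assoc)
qed

end

text \<open>\<open>nn_integral\<close> is a supremum over simple functions, and the support of a
  simple function below the integrand is a measurable subset of \<open>V\<close>. It serves a finely
  open \<open>V\<close> that is not known to be Borel.\<close>

lemma set_nn_integral_inner_le:
 fixes f :: "'a => ennreal"
 assumes le: "!!S. S : sets M ==> S <= V ==> (sn M S (%x. f x)) <= c"
 shows "sn M V (%x. f x) <= c"
 unfolding nn_integral_def
proof (rule SUP_least, clarify)
 fix u :: "'a => ennreal" assume u: "simple_function M u" "u <= (%x. f x * ind V x)"
 note [measurable] = borel_measurable_simple_function[OF u(1)]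
 let ?S = "{x : space M. u x ~= 0}"
 have ule: "u x <= f x * ind V x" for x using u(2) by (simp add: le_fun_def)
 have "u x = 0" if "x ~: V" for x using ule[of x] that by simp
 hence sub: "?S <= V" by auto
 have "integral\<^sup>S M u = nn M (%x. u x)" by (rule nn_integral_eq_simple_integral[OF u(1), symmetric])
 also have "... <= sn M ?S (%x. f x)"
 proof (rule nmono)
 fix x assume "x : space M"
 thus "u x <= f x * ind ?S x" using ule[of x] sub by (cases "u x = 0") auto
 qed
 also have "... <= c" by (rule le[OF _ sub]) measurable
 finally show "integral\<^sup>S M u <= c" .
qed

context revuz_functional
begin

text \<open>On a finely open \<open>V\<close> around \<open>x\<close> a lower bound for
  \<open>\<phi>\<close> and a lower bound for the amount of \<open>g\<close> collected before
  \<open>r\<close> hold together, which bounds the occupation before level \<open>l\<close> from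
  below. \<open>excessive_bound\<close> with the excessive function \<open>G x\<close> then compares
  with the finite potential of \<open>g\<close>.\<close>

lemma phi1_pos_finite_potential:
 assumes p: "continuous_map (fine_topology X P) euclidean (phi1 X P B)" and x: "0 < phi1 X P B x"
 shows "x : finite_potential_set X P G nu"
proof -
 have "0 < min 1 (phi1 X P B x)" using x by simp
 then obtain a where a': "0 < en a" "en a < min 1 (phi1 X P B x)" by (rule rat_between) blast
 hence a: "0 < a" "a < 1" "en a < phi1 X P B x" by (auto simp: ennreal_less_iff)
 \<comment> \<open>The choice \<open>exp (- l) = a / 8\<close> closes the budget:
   \<open>\<phi> > a\<close> contributes at least \<open>r * a / 2\<close>, as
   \<open>1 - exp (- r) \<ge> r / 2\<close> for \<open>r \<le> 1\<close>; the time missing from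
   \<open>b\<close> costs \<open>r * a / 4\<close> and the late clock \<open>r * a / 8\<close>. What
   remains is \<open>d = r * a / 8\<close>.\<close>
 define l where "l = ln (8 / a)"
 have l: "0 <= l" "exp (- l) = a / 8" using a unfolding l_def by (auto simp: exp_minus)
 have "en (1 - a / 4) < (SUP n. PT (en (rs n)) (%_. 1) x)"
 unfolding SUP_survival using a by (simp add: ennreal_less_one_iff)
 then obtain n where n: "en (1 - a / 4) < PT (en (rs n)) (%_. 1) x" unfolding less_SUP_iff by blast
 define r where "r = rs n"
 have r: "0 < r" "r <= 1" "en (1 - a / 4) < PT (en r) (%_. 1) x" using n by (auto simp: r_def)
 define b where "b = r * (1 - a / 4)"
 obtain h :: "'e => real" where h[measurable]: "h : Bor" and h0: "!!x. 0 <= h x"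
 and hR: "!!x. RR 0 (%x. en (h x)) x <= 1" and hpos: "AE x in m. 0 < h x"
 by (rule reference_function) blast
 \<comment> \<open>\<open>g j\<close> has potential at most \<open>j\<close>, and it increases to 1
   almost everywhere, so it eventually collects almost all of the time before
   \<open>r\<close>.\<close>
 define g where "g j y = en (min 1 (real j * h y))" for j y
 have g[measurable]: "g j : Bor" for j unfolding g_def[abs_def] by measurable
 have g1: "g j y <= 1" for j y by (simp add: g_def ennreal_le_1)
 have ginc: "incseq g"
 unfolding g_def[abs_def] using h0
 by (intro incseq_SucI le_funI ennreal_leI min.mono order_refl mrmono) auto
 have gsup: "AE y in m. (SUP j. g j y) = 1"
 using hpos
 proof eventually_elim
 case (elim y)
 obtain k where k: "1 < real k * h y" using ex_less_of_nat_mult[OF elim] by blast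
 hence "g k y = 1" by (simp add: g_def)
 thus ?case by (intro antisym SUP_least g1 SUP_upper2[of k]) auto
 qed
 note [measurable] = mPTt[OF g]
 have "en b = en (1 - a / 4) * en r" using r(1) a by (simp add: b_def ennreal_mult[symmetric] mult.commute)
 also have "... < PT (en r) (%_. 1) x * en r" using r by (simp add: ennreal_mult_strict_right_mono)
 also have "... = sl {0..<r} (%t. PT (en r) (%_. 1) x)" using r(1) by (simp add: ncmind)
 also have "... <= nl (%t. (SUP j. PT (en t) (g j) x * ind {0..<r} t))"
 using AE_pos_time
 proof (intro nmonoAE, eventually_elim)
 case (elim t)
 show ?case
 proof (cases "0 <= t & t < r")
 case True
 have "PT (en r) (%_. 1) x <= PT (en t) (%_. 1) x" unfolding transition_def
 proof (rule nmono)
 fix w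
 have "en t <= en r" using True by (intro ennreal_leI) simp
 from X_None_mono[OF _ this, of w]
 show "ext0 (%_. 1 :: ennreal) (X (en r) w) <= ext0 (%_. 1) (X (en t) w)" by (auto simp: ext0_def split: option.split)
 qed
 also have "... = PT (en t) (%y. SUP j. g j y) x"
 by (rule PT_cong_AE) (use gsup True elim in \<open>auto elim!: evmono\<close>)
 also have "... = (SUP j. PT (en t) (g j) x)" by (rule PT_SUP[OF g ginc])
 finally show ?thesis using True by simp
 qed auto
 qed
 also have "... = (SUP j. sl {0..<r} (%t. PT (en t) (g j) x))"
 using incseq_SucD[OF ginc]
 by (intro nmcSUP incseq_SucI le_funI mrmono PT_mono) (auto simp: le_fun_def)
 finally obtain j where j: "en b < sl {0..<r} (%t. PT (en t) (g j) x)" unfolding less_SUP_iff by blast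
 let ?g = "g j" and ?Gr = "%y. sl {0..<r} (%t. PT (en t) (g j) y)"
 let ?R = "RR 0 ?g" and ?Q = "RR 0 (PT (en r) ?g)"
 have Q: "?R y = ?Gr y + ?Q y" for y
 proof -
 have "PT (en r) ?R y = ?Q y" unfolding PT_RR[OF g less_imp_le[OF r(1)]] RR_eq[OF measurable_PT[OF g]]
 using r(1) by (intro ncong) (auto simp: PT_semigroup[OF g] add.commute split: spind)
 thus ?thesis using RR_split[OF g less_imp_le[OF r(1)], of 0 j y] by simp
 qed
 have Rfin: "?R y < infy" for y
 proof -
 have "?R y <= RR 0 (%y. en (real j) * en (h y)) y"
 by (rule RR_mono) (use h0 in \<open>auto simp: g_def ennreal_mult[symmetric] intro!: ennreal_leI\<close>)
 also have "... <= en (real j) * 1" by (subst RR_cmult, measurable) (intro mlmono hR zero_le)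
 also have "... < infy" by (simp add: enmlt)
 finally show ?thesis .
 qed
 have b0: "0 < b" using r(1) a by (simp add: b_def)
 obtain q where q: "0 <= q" "en (b + q) < ?R x" "?Q x < en q"
 proof -
 have "?Gr x < infy" "?Q x < infy" using Rfin[of x] unfolding Q by (auto simp: ennreal_add_eq_top less_top)
 then obtain k where k: "?Q x = en k" "0 <= k" by (cases "?Q x") auto
 obtain u where u: "?Gr x = en u" "0 <= u" using \<open>?Gr x < infy\<close> by (cases "?Gr x") auto
 have "b < u" using j u b0 by (simp add: ennreal_less_iff)
 hence q: "0 <= k + (u - b) / 2" "b + (k + (u - b) / 2) < u + k" "k < k + (u - b) / 2" using k(2) by (simp_all add: field_simps)
 have "?R x = en (u + k)" unfolding Q u(1) k(1) using u(2) k(2) by simp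
 hence "en (b + (k + (u - b) / 2)) < ?R x" using q b0 by (simp add: ennreal_less_iff del: ennreal_plus)
 moreover have "?Q x < en (k + (u - b) / 2)" unfolding k(1) using q(3) k(2) by (simp add: ennreal_less_iff del: ennreal_plus)
 ultimately show thesis using that[OF q(1)] by blast
 qed
 \<comment> \<open>The amount \<open>?Gr\<close> collected before \<open>r\<close> is a difference
   of two excessive functions. The conditions \<open>?R > b + q\<close> and \<open>?Q < q\<close>
   are finely open and together force \<open>?Gr \<ge> b\<close>.\<close>
 define V where "V = {y. en a < phi1 X P B y} Int (?R -` {en (b + q)<..} Int ?Q -` {..<en q})"
 have top: "topspace (fine_topology X P) = UNIV"
 using openin_subset[OF fine_open_excessive[OF excessive_potential[OF g], of UNIV]] by auto
 have Vo: "openin (fine_topology X P) V"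
 unfolding V_def
 proof (intro openin_Int fine_open_excessive excessive_potential open_greaterThan open_lessThan)
 show "openin (fine_topology X P) {y. en a < phi1 X P B y}"
 using openin_continuous_map_preimage[OF p, of "{en a<..}"] by (simp add: top open_greaterThan)
 qed measurable
 have xV: "x : V" unfolding V_def using a(3) q by simp
 define d where "d = r * a / 8"
 have d: "0 < d" using r(1) a by (simp add: d_def)
 have occ: "en d <= nn (PS y) (%w. occ ?g l w)" if y: "y : V" "y ~: N" for y
 proof (cases "nn (PS y) (%w. occ ?g l w)")
 case (real e)
 have "en b <= ?Gr y"
 proof (rule ccontr)
 assume c: "~ en b <= ?Gr y"
 then obtain u where u: "?Gr y = en u" "0 <= u" by (cases "?Gr y") auto
 have "?Q y < en q" using y(1) by (simp add: V_def)
 then obtain k where k: "?Q y = en k" "0 <= k" by (cases "?Q y") auto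
 have "en (b + q) < en (u + k)" using y(1) u k unfolding V_def by (simp add: Q)
 thus False using c u k \<open>?Q y < en q\<close> b0 q(1) by (simp add: ennreal_less_iff ennreal_le_iff del: ennreal_plus)
 qed
 moreover have "en (r * a / 2) <= en (1 - exp (- r)) * phi1 X P B y"
 proof -
 have "exp (- r) <= 1 / (1 + r)" using exp_ge_add_one_self[of r] r(1) by (simp add: exp_minus field_simps)
 also have "... <= 1 - r / 2" using r by (simp add: field_simps)
 finally have "en (r / 2) * en a <= en (1 - exp (- r)) * phi1 X P B y"
 using y(1) by (intro mult_mono ennreal_leI) (auto simp: V_def)
 thus ?thesis using r(1) a by (simp add: ennreal_mult[symmetric])
 qed
 ultimately have "en (r * a / 2) + en b <= en (1 - exp (- r)) * phi1 X P B y + ?Gr y" by (rule add_mono[rotated])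
 also have "... <= en e + en (r * (a / 8)) + en r"
 using phi1_le[OF y(2) g g1 r(1) l(1), of j] unfolding real(2) l(2) .
 finally have "en (r * a / 2 + b) <= en (e + r * (a / 8) + r)"
 using r(1) a b0 real(1) by (simp add: ennreal_plus)
 hence "r * a / 2 + b <= e + r * (a / 8) + r" using r(1) a real(1) by (subst (asm) ennreal_le_iff) auto
 thus ?thesis unfolding real(2) d_def b_def by (intro ennreal_leI) (simp add: algebra_simps)
 qed simp
 \<comment> \<open>Rescaling turns the lower bound \<open>d\<close> for the occupation into the 1
   that \<open>excessive_bound\<close> asks for.\<close>
 let ?g' = "%y. en (1 / d) * ?g y"
 have "sn nu V (%y. G x y) <= en l * nn m (%y. G x y * ?g' y)"
 proof (rule set_nn_integral_inner_le, rule excessive_bound)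
 fix S assume "S : sets nu" and SV: "S <= V"
 thus "S : sets borel" by (simp add: sets_nu)
 show "?g' y <= en (1 / d)" for y using mlmono[OF g1, of "en (1 / d)"] by simp
 show "1 <= nn (PS y) (%w. occ ?g' l w)" if y: "y : S" "y ~: N" for y
 proof -
 note [measurable] = mFFc[OF measurable_occ[OF g]]
 have o: "occ ?g' l w = en (1 / d) * occ ?g l w" for w
 proof -
 note [measurable] = mcomp[OF menn mfX[OF g, of j w]]
 have "ext0 ?g' z = en (1 / d) * ext0 ?g z" for z by (cases z) auto
 thus ?thesis by (subst ncmult[symmetric]) (auto intro!: ncong simp: mult_ac)
 qed
 have "1 = en (1 / d) * en d" using d by (simp add: ennreal_mult[symmetric])
 also have "... <= en (1 / d) * nn (PS y) (%w. occ ?g l w)" using y SV by (intro mlmono occ) auto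
 also have "... = nn (CP (PS y)) (%w. occ ?g' l w)" unfolding o ncompl[symmetric, of "PS y" "occ ?g l"]
 by (rule ncmult[symmetric]) measurable
 finally show ?thesis by (simp only: ncompl)
 qed
 qed (use d l green_excessive in auto)
 also have "... = en l * (en (1 / d) * ?R x)" by (subst green[symmetric]) (measurable, simp only: RR_cmult[OF g])
 also have "... < infy" using Rfin[of x] by (simp add: enmlt)
 finally show ?thesis unfolding finite_potential_set_def using Vo xV by blast
qed

end

section \<open>Fine neighborhoods\<close>

context symmetric_hunt_process
begin

abbreviation Y :: "nat => 'w => 'e option" where "Y n \<equiv> X (en (rs n))"

text \<open>A probabilistic form of fine neighborhood along the times \<open>1 / (n + 1)\<close>, in
  which dying does not count as leaving \<open>W\<close>. Convergence of probabilities suffices,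
  since it is used to bound the mean of a bounded function that vanishes at the cemetery.\<close>

definition near :: "'e => 'e set => bool" where
 "near x W \<longleftrightarrow> W : sets borel & (%n. measure (PS x) {w. Y n w : Some ` (- W)}) ->> 0"

lemma X_event: "W : sets borel ==> {w. X s w : Some ` (- W)} : sets (NF t)" if "s <= t"
proof -
 assume "W : sets borel"
 hence "Some ` (- W) : sets cb" by (simp add: sets_cemetery_borel inj_vimage_image_eq borel_comp)
 from msets[OF mXNF[OF that] this] show ?thesis by (simp add: vimage_def)
qed

lemma sets_P_NF: "A : sets (NF infy) ==> A : sets (P x)" by simp

lemma near_Int:
 assumes "near x V" "near x W"
 shows "near x (V Int W)"
proof -
 interpret prob_space "PS x" by (rule prob_space_P)
 have ev: "{w. Y n w : Some ` (- V)} : events" "{w. Y n w : Some ` (- W)} : events" for n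
 using assms by (auto simp: near_def intro!: sets_P_NF X_event)
 have le: "prob {w. Y n w : Some ` (- (V Int W))} <= prob {w. Y n w : Some ` (- V)} + prob {w. Y n w : Some ` (- W)}" for n
 using ev by (intro order_trans[OF finite_measure_mono measure_Un_le]) auto
 have "(%n. prob {w. Y n w : Some ` (- V)} + prob {w. Y n w : Some ` (- W)}) ->> 0 + 0"
 using assms by (intro tendsto_add) (auto simp: near_def)
 hence "(%n. prob {w. Y n w : Some ` (- (V Int W))}) ->> 0"
 unfolding add_0_right by (rule Lim_null_comparison[OF always_eventually[OF allI], rotated]) (subst real_norm_def, subst abs_of_nonneg[OF measure_nonneg], rule le)
 thus ?thesis using assms[unfolded near_def, THEN conjunct1] by (simp add: near_def sets.Int)
qed

text \<open>The maximal inequality for the supermartingale \<open>e\<^sup>-\<^sup>t f(X\<^sub>t)\<close> at finitely many times.\<close>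

lemma maximal_inequality:
 fixes t :: "nat => real"
 assumes f[measurable]: "f : Bor" and sm: "!!t y. 0 <= t ==> ee (- t) * PT (en t) f y <= f y"
 shows "(!!i j. i < j ==> j < p ==> t i < t j) ==> (!!i. i < p ==> 0 < t i & t i <= c) ==>
 b * emu (PS y) {w. EX i<p. b < ext0 f (X (en (t i)) w)} <= en (exp c) * f y"
proof (induction p arbitrary: t c y)
 case (Suc p)
 let ?s = "t 0" and ?t = "%i. t (Suc i) - t 0"
 let ?A = "%(q :: nat) t. {w. EX i<q. b < ext0 f (X (en (t i)) w)}"
 have ev: "{w. b < ext0 f (X s w)} : sets (NF r)" if "s <= r" for s r
 using msets[OF mcomp[OF mXNF[OF that] mext0[OF f]], of "{b<..}"] by (simp add: vimage_def)
 have A: "?A q t : sets (NF infy)" for q t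
 proof -
 have "?A q t = (\<Union>i\<in>{..<q}. {w. b < ext0 f (X (en (t i)) w)})" by auto
 also have "... : sets (NF infy)" by (intro sets.finite_UN finite_lessThan ev) (simp_all only: finite_lessThan oodef top_greatest)
 finally show ?thesis .
 qed
 have mono: "t 0 < t (Suc i)" if "i < p" for i by (rule Suc.prems(1)) (use that in simp_all)
 have IH: "b * emu (PS z) (?A p ?t) <= ee (c - ?s) * f z" for z
 by (rule Suc.IH) (use Suc.prems mono in \<open>auto simp: field_simps\<close>)
 have s: "0 <= ?s" "?s <= c" "0 < en ?s" "en ?s < infy" using Suc.prems(2)[of 0] by auto
 \<comment> \<open>Either the level is exceeded at the first time, or the remaining times are seen
   from the position there with the horizon \<open>c - ?s\<close>.\<close>
 let ?H = "%w. ind {w. ~ b < ext0 f (X (en ?s) w)} w :: ennreal"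
 have Hm: "?H : bm (FF (en ?s))"
 using msets[OF measurable_NF_FF[OF mcomp[OF mXNF[OF order_refl] mext0[OF f]]], of "{..b}" "en ?s"]
 by (intro bmind) (simp add: vimage_def not_less)
 have Fm: "ind (?A p ?t) : bm (FF infy)" by (rule bmind[OF subsetD[OF NF_sub_FF A]])
 let ?F = "%z. nn (PS z) (%w. ind (?A p ?t) w)"
 have Fe: "?F : Bor" by (rule measurable_E_Some) (use A in auto)
 have e: "{w. b < ext0 f (X (en ?s) w)} : sets (PS y)" by (rule sets_P_NF[OF ev]) simp
 let ?C = "CP (PS y)"
 have em: "(%w. ind {w. b < ext0 f (X (en ?s) w)} w :: ennreal) : bm ?C" by (rule measurable_completion[OF bmind[OF e]])
 have HC: "?H : bm ?C" by (rule mFFc[OF Hm])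
 have HF: "(%w. ?H w * ext0 ?F (X (en ?s) w)) : bm ?C"
 by (rule bmtimes[OF HC mFFc[OF measurable_NF_FF[OF mext0X[OF Fe]]]])
 have "emu (PS y) (?A (Suc p) t) <= nn ?C (%w. ind {w. b < ext0 f (X (en ?s) w)} w
 + ?H w * (if X (en ?s) w = None then 0 else ind (?A p ?t) (th (en ?s) w)))"
 unfolding ncompl
 proof (subst nn_integral_indicator[OF sets_P_NF[OF A], symmetric], rule nmono)
 fix w
 have sh: "X (en (?t i)) (th (en ?s) w) = X (en (t (Suc i))) w" if "i < p" for i
 using mono[OF that] s by (subst shift) (auto simp flip: ennreal_plus)
 have "X (en ?s) w ~= None" if "b < ext0 f (X (en (t (Suc i))) w)" "i < p" for i
 using that(1) X_None_mono[OF _ ennreal_leI[OF less_imp_le[OF mono[OF that(2)]]], of w] by fastforce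
 thus "ind (?A (Suc p) t) w <= ind {w. b < ext0 f (X (en ?s) w)} w
 + ?H w * (if X (en ?s) w = None then 0 else ind (?A p ?t) (th (en ?s) w))"
 by (cases "b < ext0 f (X (en ?s) w)") (auto simp: sh less_Suc_eq_0_disj split: spind)
 qed
 also have "... = nn ?C (%w. ind {w. b < ext0 f (X (en ?s) w)} w)
 + nn ?C (%w. ?H w * (if X (en ?s) w = None then 0 else ind (?A p ?t) (th (en ?s) w)))"
 by (rule nadd) (rule em, rule bmtimes[OF HC measurable_shifted[OF s(3,4) Fm]])
 also have "... = nn ?C (%w. ind {w. b < ext0 f (X (en ?s) w)} w) + nn ?C (%w. ?H w * ext0 ?F (X (en ?s) w))"
 by (simp only: ncompl markov_completed[OF s(3,4) Hm Fm])
 also have "... = nn ?C (%w. ind {w. b < ext0 f (X (en ?s) w)} w + ?H w * ext0 ?F (X (en ?s) w))"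
 by (rule nadd[symmetric]) (rule em, rule HF)
 finally have "b * emu (PS y) (?A (Suc p) t) <= b * ..." by (rule mlmono) simp
 also have "... = nn ?C (%w. b * (ind {w. b < ext0 f (X (en ?s) w)} w + ?H w * ext0 ?F (X (en ?s) w)))"
 by (rule ncmult[symmetric]) (rule borel_measurable_add[OF em HF])
 also have "... <= nn (PS y) (%w. ee (c - ?s) * ext0 f (X (en ?s) w))"
 unfolding ncompl
 proof (rule nmono)
 fix w
 have "1 <= ee (c - ?s)" using s by simp
 from mult_mono[OF this less_imp_le, of b "ext0 f (X (en ?s) w)"] IH
 show "b * (ind {w. b < ext0 f (X (en ?s) w)} w + ?H w * ext0 ?F (X (en ?s) w)) <= ee (c - ?s) * ext0 f (X (en ?s) w)"
 by (cases "X (en ?s) w") (auto split: spind simp: nn_integral_indicator[OF sets_P_NF[OF A]])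
 qed
 also have "... = ee (c - ?s) * PT (en ?s) f y"
 unfolding transition_def by (rule ncmult) (use mext0X[OF f] in \<open>simp add: mcongs[OF sets_P refl]\<close>)
 also have "... = en (exp c) * (ee (- ?s) * PT (en ?s) f y)"
 by (simp add: mult.assoc[symmetric] ennreal_mult[symmetric] exp_add[symmetric])
 also have "... <= en (exp c) * f y" by (intro mlmono sm s) simp
 finally show ?case .
qed simp

lemma event_ext0:
 assumes f: "f : Bor" and s: "s <= r"
 shows "{w. (b :: ennreal) < ext0 f (X s w)} : sets (NF r)"
 using msets[OF mcomp[OF mXNF[OF s] mext0[OF f]], of "{b<..}"] by (simp add: vimage_def)

text \<open>Take a level \<open>b\<close> strictly between \<open>f x\<close> and \<open>a\<close>.
  By the zero-one law, exceeding \<open>b\<close> at infinitely many of the times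
  \<open>1 / (n + 1)\<close> has probability 0 or 1, and the maximal inequality bounds this
  probability by \<open>f x / b < 1\<close>.\<close>

lemma near_upper:
 assumes f[measurable]: "f : Bor" and sm: "!!t y. 0 <= t ==> ee (- t) * PT (en t) f y <= f y"
 and a: "f x < a"
 shows "near x (f -` {..<a})"
proof -
 interpret prob_space "PS x" by (rule prob_space_P)
 obtain b where b: "f x < en b" "en b < a" by (rule rat_between[OF a])
 obtain u where u: "f x = en u" "0 <= u" using b(1) by (cases "f x") auto
 have ub: "u < b" using b(1) u by (simp add: ennreal_less_iff)
 let ?Z = "%n. {w. en b < ext0 f (Y n w)}"
 define E where "E k = (\<Union>n\<in>{k..}. ?Z n)" for k
 have Z: "?Z n : sets (NF t)" if "en (rs k) <= t" "k <= n" for n k t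
 by (rule event_ext0[OF f order_trans[OF ennreal_leI that(1)]]) (use that(2) in \<open>simp add: field_simps\<close>)
 have E: "E k : sets (NF t)" if "en (rs k) <= t" for k t
 unfolding E_def using Z[OF that] by (intro sets.countable_UN') auto
 have Zm: "?Z n : events" for n by (rule sets_P_NF[OF event_ext0[OF f]]) simp
 have Em: "E k : events" for k by (rule sets_P_NF[OF E[of k]]) simp
 have dec: "decseq E" unfolding decseq_def E_def by (intro allI impI UN_mono) auto
 have bound: "b * prob (E k) <= exp (rs k) * u" for k
 proof -
 have "en b * prob (\<Union>n\<in>{k..<k + p}. ?Z n) <= exp (rs k) * u" for p
 proof -
 \<comment> \<open>The times \<open>1 / (n + 1)\<close> decrease in \<open>n\<close>; the index
   \<open>k + (p - Suc i)\<close> lists them in increasing order, as the maximal inequality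
   expects.\<close>
 have "(\<Union>n\<in>{k..<k + p}. ?Z n) = {w. EX i<p. en b < ext0 f (X (en (1 / real (Suc (k + (p - Suc i))))) w)}"
 proof (intro set_eqI iffI)
 fix w assume "w : (\<Union>n\<in>{k..<k + p}. ?Z n)"
 then obtain n where "k <= n" "n < k + p" "w : ?Z n" by auto
 thus "w : {w. EX i<p. en b < ext0 f (X (en (1 / real (Suc (k + (p - Suc i))))) w)}"
 by (auto intro!: exI[of _ "k + p - Suc n"])
 next
 fix w assume "w : {w. EX i<p. en b < ext0 f (X (en (1 / real (Suc (k + (p - Suc i))))) w)}"
 then obtain i where "i < p" "w : ?Z (k + (p - Suc i))" by auto
 thus "w : (\<Union>n\<in>{k..<k + p}. ?Z n)" by (intro UN_I[of "k + (p - Suc i)"]) auto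
 qed
 moreover have "en b * emu (PS x) {w. EX i<p. en b < ext0 f (X (en (1 / real (Suc (k + (p - Suc i))))) w)}
 <= ee (rs k) * f x"
 by (rule maximal_inequality[OF f sm]) (auto simp: field_simps)
 ultimately show ?thesis using u by (simp add: emeasure_eq_measure ennreal_mult)
 qed
 hence "b * prob (\<Union>n\<in>{k..<k + p}. ?Z n) <= exp (rs k) * u" for p
 using ub u(2) by (simp add: ennreal_mult[symmetric] ennreal_le_iff)
 moreover have "(%p. prob (\<Union>n\<in>{k..<k + p}. ?Z n)) ->> prob (\<Union>p. \<Union>n\<in>{k..<k + p}. ?Z n)"
 proof (rule finite_Lim_measure_incseq)
 show "range (%p. \<Union>n\<in>{k..<k + p}. ?Z n) <= events" using Zm by blast
 show "incseq (%p. \<Union>n\<in>{k..<k + p}. ?Z n)" unfolding incseq_def by (intro allI impI UN_mono) auto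
 qed
 hence "(%p. b * prob (\<Union>n\<in>{k..<k + p}. ?Z n)) ->> b * prob (\<Union>p. \<Union>n\<in>{k..<k + p}. ?Z n)" by (rule tendsto_mult_left)
 moreover have "(\<Union>p. \<Union>n\<in>{k..<k + p}. ?Z n) = E k"
 proof (intro set_eqI iffI)
 fix w assume "w : E k"
 then obtain n where "k <= n" "w : ?Z n" by (auto simp: E_def)
 thus "w : (\<Union>p. \<Union>n\<in>{k..<k + p}. ?Z n)" by (intro UN_I[of "Suc n - k"] UN_I[of n]) auto
 qed (auto simp: E_def)
 ultimately show ?thesis by (auto intro: LIMSEQ_le_const2)
 qed
 have "(\<Inter>k. E k) : sets (FF 0)"
 proof (rule FF_0_I)
 fix t :: ennreal assume "0 < t"
 then obtain r where r: "0 < en r" "en r < t" by (rule rat_between) auto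
 then obtain k where "rs k < r" using reals_Archimedean[of r] by (auto simp: inverse_eq_divide)
 hence k: "en (rs k) <= t" using order_trans[OF ennreal_leI less_imp_le[OF r(2)]] by simp
 have "(\<Inter>k. E k) = (\<Inter>i\<in>{k..}. E i)"
 proof (intro antisym INT_greatest)
 fix j have "(\<Inter>i\<in>{k..}. E i) <= E (max j k)" by (intro INT_lower) simp
 also have "... <= E j" by (rule decseqD[OF dec]) simp
 finally show "(\<Inter>i\<in>{k..}. E i) <= E j" .
 qed (auto intro: INT_lower)
 also have "... : sets (NF t)"
 proof (rule sets.countable_INT')
 have "en (rs i) <= t" if "k <= i" for i
 by (rule order_trans[OF ennreal_leI k]) (use that in \<open>simp add: field_simps\<close>)
 thus "E ` {k..} <= sets (NF t)" using E by auto
 qed auto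
 finally show "(\<Inter>k. E k) : sets (FF t)" using NF_sub_FF by blast
 qed
 moreover have "~ (AE w in PS x. w : (\<Inter>k. E k))"
 proof
 assume AE: "AE w in PS x. w : (\<Inter>k. E k)"
 have "prob (E k) = 1" for k by (rule prob_Collect_eq_1[THEN iffD2, of "%w. w : E k", simplified]) (use AE Em in auto)
 hence "b <= exp (rs k) * u" for k using bound[of k] by simp
 moreover have "(%k. exp (rs k) * u) ->> exp 0 * u" by (intro tendsto_intros LIMSEQ_Suc lim_1_over_n)
 ultimately have "b <= u" by (auto intro: LIMSEQ_le_const)
 thus False using ub by simp
 qed
 ultimately have "AE w in PS x. w ~: (\<Inter>k. E k)" using blumenthal by blast
 hence "prob (\<Inter>k. E k) = 0" using Em by (subst prob_eq_0) auto
 moreover have "(%k. prob (E k)) ->> prob (\<Inter>k. E k)" by (rule finite_Lim_measure_decseq) (use Em dec in auto)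
 ultimately have lim: "(%k. prob (E k)) ->> 0" by simp
 have "prob {w. Y n w : Some ` (- (f -` {..<a}))} <= prob (E n)" for n
 using b(2) by (intro finite_measure_mono Em) (auto simp: E_def intro!: bexI[of _ n])
 hence "(%n. prob {w. Y n w : Some ` (- (f -` {..<a}))}) ->> 0"
 by (intro Lim_null_comparison[OF always_eventually[OF allI] lim]) simp
 moreover have "f -` {..<a} : sets borel" using msets[OF f, of "{..<a}"] by simp
 ultimately show ?thesis unfolding near_def by (intro conjI)
qed

end

context symmetric_hunt_process
begin

text \<open>Choose a bounded 1-potential \<open>h \<le> f\<close> with \<open>h x > a\<close>. Its
  mean at time \<open>s\<close> is at least \<open>h x - M * s\<close>, while by
  \<open>near_upper\<close> values above \<open>h x + e\<close> are rare. Values up to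
  \<open>a\<close> would pull the mean down by at least \<open>h x - a\<close> and must be rare as
  well.\<close>

lemma near_lower:
 assumes f: "excessive X P f" and a: "a < f x"
 obtains W where "W <= f -` {a<..}" "near x W"
proof -
 interpret prob_space "PS x" by (rule prob_space_P)
 obtain v :: "nat => nat => 'e => ennreal" where vm: "!!n i. v n i : Bor" and vM: "!!n i. EX M>=0. ALL y. v n i y <= en M"
 and vf: "!!y. f y = (SUP n. SUP i. RR 1 (v n i) y)" by (rule excessive_approx[OF f]) blast
 obtain k i where ni: "a < RR 1 (v k i) x" using a unfolding vf less_SUP_iff by blast
 define h where "h = RR 1 (v k i)"
 obtain M where M: "0 <= M" "!!y. v k i y <= en M" using vM[of k i] by blast
 note [measurable] = vm[of k i]
 have hm[measurable]: "h : Bor" unfolding h_def by measurable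
 have hM: "h y <= en M" for y unfolding h_def using RR_const_le[OF vm M(2), of 1 y] by simp
 have hf: "h y <= f y" for y unfolding h_def vf by (intro SUP_upper2[of k] SUP_upper) auto
 have sm: "ee (- t) * PT (en t) h y <= h y" if "0 <= t" for t y
 unfolding h_def using PT_RR_le[OF vm that, of 1 k i y] by simp
 have ah: "a < h x" using ni by (simp add: h_def)
 obtain u where u: "h x = en u" "0 <= u" using hM[of x] by (cases "h x") (auto simp: top_unique)
 obtain c where c: "a = en c" "0 <= c" using ah u by (cases a) auto
 have cu: "c < u" using ah u c by (simp add: ennreal_less_iff)
 let ?W = "h -` {a<..}"
 have W: "?W : sets borel" using msets[OF hm, of "{a<..}"] by simp
 let ?A = "%W n. {w. Y n w : Some ` (- W)}"
 have bound: "(u - c) * prob (?A ?W n) <= e + M * (rs n + prob (?A (h -` {..<en (u + e)}) n))" if e: "0 < e" for n e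
 proof -
 let ?s = "rs n" and ?V = "h -` {..<en (u + e)}"
 have V: "?V : sets borel" using msets[OF hm, of "{..<en (u + e)}"] by simp
 have ev: "?A ?W n : events" "?A ?V n : events" by (auto intro!: sets_P_NF X_event W V)
 have Xm: "(%w. ext0 h (Y n w)) : bm (PS x)"
 using mext0X[OF hm, of "en ?s"] by (subst mcongs[OF sets_P refl])
 note [measurable] = ev Xm mPTt[OF vm, of k i x]
 have le: "ee (- 1 * t) * PT (en t) (v k i) x <= 1 * en M" if "0 <= t" for t
 by (intro mult_mono PT_const_le M(2)) (use that in auto)
 have "h x = sl {0..<?s} (%t. ee (- 1 * t) * PT (en t) (v k i) x) + ee (- 1 * ?s) * PT (en ?s) h x"
 unfolding h_def by (rule RR_split[OF vm]) simp
 also have "... <= sl {0..<?s} (%t. 1 * en M) + 1 * PT (en ?s) h x"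
 proof (rule add_mono)
 show "sl {0..<?s} (%t. ee (- 1 * t) * PT (en t) (v k i) x) <= sl {0..<?s} (%t. 1 * en M)"
 by (rule nmono) (use le in \<open>simp split: spind\<close>)
 qed (intro mrmono, simp_all)
 also have "sl {0..<?s} (%t. 1 * en M) = en (M * ?s)" using M(1) by (simp add: ncmind ennreal_mult[symmetric])
 finally have lower: "en u <= en (M * ?s) + PT (en ?s) h x" unfolding u(1) by simp
 have "PT (en ?s) h x + en (u - c) * emu (PS x) (?A ?W n)
 = nn (PS x) (%w. ext0 h (Y n w) + en (u - c) * ind (?A ?W n) w)"
 unfolding transition_def ncmind[OF ev(1), symmetric]
 by (rule nadd[symmetric]) (rule Xm, rule bmtimes[OF borel_measurable_const bmind[OF ev(1)]])
 also have "... <= nn (PS x) (%w. en (u + e) + en M * ind (?A ?V n) w)"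
 proof (rule nmono)
 fix w
 show "ext0 h (Y n w) + en (u - c) * ind (?A ?W n) w <= en (u + e) + en M * ind (?A ?V n) w"
 proof (cases "Y n w")
 case (Some y)
 hence i: "ind (?A W n) w = (ind (- W) y :: ennreal)" for W by (auto split: spind)
 have "h y + en (u - c) <= en (u + e)" if "h y <= a"
 proof -
 have "h y + en (u - c) <= en c + en (u - c)" using that c by (intro add_right_mono) simp
 also have "... = en u" using cu c by (subst ennreal_plus[symmetric]) auto
 also have "... <= en (u + e)" using e by (intro ennreal_leI) simp
 finally show ?thesis .
 qed
 moreover have "h y <= en (u + e) + en M * ind (- ?V) y"
 using hM[of y] by (cases "h y < en (u + e)") (auto simp: add_increasing add_increasing2 simp del: ennreal_plus)
 ultimately show ?thesis unfolding i unfolding Some by (cases "h y <= a") (auto simp: not_le add_increasing2 simp del: ennreal_plus)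
 qed auto
 qed
 also have "... = en (u + e) + en M * emu (PS x) (?A ?V n)"
 by (subst nadd, simp, rule bmtimes[OF borel_measurable_const bmind[OF ev(2)]])
 (simp only: ncmind[OF ev(2)] nn_integral_const emeasure_space_1 mult_1_right)
 finally have "en (M * ?s) + (PT (en ?s) h x + en (u - c) * emu (PS x) (?A ?W n))
 <= en (M * ?s) + (en (u + e) + en M * emu (PS x) (?A ?V n))" by (rule add_left_mono)
 hence "en u + en (u - c) * emu (PS x) (?A ?W n) <= en (M * ?s) + (en (u + e) + en M * emu (PS x) (?A ?V n))"
 using add_right_mono[OF lower] unfolding add.assoc by (rule order_trans[rotated])
 hence "en (u + (u - c) * prob (?A ?W n)) <= en (M * ?s + (u + e + M * prob (?A ?V n)))"
 using u(2) cu M(1) e by (simp add: emeasure_eq_measure ennreal_mult)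
 hence "u + (u - c) * prob (?A ?W n) <= M * ?s + (u + e + M * prob (?A ?V n))"
 using u(2) M(1) e by (subst (asm) ennreal_le_iff) auto
 thus ?thesis by (simp add: algebra_simps)
 qed
 have "(%n. prob (?A ?W n)) ->> 0"
 proof (rule LIMSEQ_I)
 fix e :: real assume e: "0 < e"
 let ?e = "e * (u - c) / 2"
 have e': "0 < ?e" using e cu by simp
 let ?R = "%n. M * (rs n + prob (?A (h -` {..<en (u + ?e)}) n))"
 have "h x < en (u + ?e)" unfolding u(1) using e' u(2) by (simp add: ennreal_less_iff del: ennreal_plus)
 from near_upper[OF hm sm this] have "(%n. prob (?A (h -` {..<en (u + ?e)}) n)) ->> 0" by (simp only: near_def)
 hence "?R ->> M * (0 + 0)" by (intro tendsto_mult tendsto_const tendsto_add LIMSEQ_Suc[OF lim_1_over_n])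
 hence "eventually (%n. ?R n < ?e) sequentially" using e' by (intro order_tendstoD(2)) auto
 then obtain n0 where n0: "!!n. n0 <= n ==> ?R n < ?e" unfolding eventually_sequentially by blast
 have "prob (?A ?W n) < e" if "n0 <= n" for n
 proof -
 have "(u - c) * prob (?A ?W n) < (u - c) * e" using bound[OF e', of n] n0[OF that] by (simp add: mult.commute)
 thus ?thesis using cu by simp
 qed
 thus "EX n0. ALL n>=n0. norm (prob (?A ?W n) - 0) < e" by auto
 qed
 hence "near x ?W" unfolding near_def using W by blast
 moreover have "?W <= f -` {a<..}" using hf by (auto intro: less_le_trans)
 ultimately show thesis by (rule that[rotated])
qed

text \<open>Half-lines pulled back by excessive functions generate the fine topology;
  \<open>near_upper\<close> and \<open>near_lower\<close> treat the two kinds, and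
  \<open>near_Int\<close> the finite intersections.\<close>

lemma fine_open_near:
 assumes "openin (fine_topology X P) W" "x : W"
 obtains V where "V <= W" "near x V"
proof -
 have sub: "EX V<=f -` U. near x V" if f: "excessive X P f" and U: "open U" and x: "f x : U" for f U x
 using U[unfolded open_generated_order] x
 proof induction
 case UNIV
 thus ?case by (intro exI[of _ UNIV]) (simp add: near_def)
 next
 case (Int a b)
 hence "f x : a" "f x : b" by auto
 then obtain V V' where "V <= f -` a" "near x V" "V' <= f -` b" "near x V'" using Int.IH by blast
 thus ?case by (intro exI[of _ "V Int V'"]) (auto intro: near_Int)
 next
 case (UN K)
 then obtain k where "k : K" "f x : k" by auto
 with UN.IH[OF this] show ?case by (elim exE conjE) (intro exI conjI, auto)
 next
 case (Basis s)
 then consider c where "s = {..<c}" | c where "s = {c<..}" by blast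
 thus ?case
 proof cases
 case 1
 have "ee (- t) * PT (en t) f y <= f y" if t: "0 <= t" for t y
 using mult_mono[OF _ excessive_PT_le[OF f t], of "ee (- t)" 1] t by simp
 hence "near x (f -` s)" unfolding 1 by (rule near_upper[OF excessive_measurable[OF f]]) (use Basis 1 in auto)
 thus ?thesis by blast
 next
 case 2
 hence "c < f x" using Basis by simp
 then obtain V where "V <= f -` {c<..}" "near x V" by (rule near_lower[OF f])
 thus ?thesis using 2 by blast
 qed
 qed
 have "generate_topology_on {f -` U | f U. excessive X P f & open U} W"
 using assms(1) by (simp add: fine_topology_def openin_topology_generated_by_iff)
 hence "EX V<=W. near x V" using assms(2)
 proof induction
 case (Int a b)
 hence "x : a" "x : b" by auto
 then obtain V V' where "V <= a" "near x V" "V' <= b" "near x V'" using Int.IH by blast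
 thus ?case by (intro exI[of _ "V Int V'"]) (auto intro: near_Int)
 next
 case (UN K)
 then obtain k where "k : K" "x : k" by auto
 with UN.IH[OF this] show ?case by (elim exE conjE) (intro exI conjI, auto)
 next
 case (Basis s)
 then obtain f U where "s = f -` U" "excessive X P f" "open U" by blast
 thus ?case using sub[of f U x] Basis(2) by simp
 qed simp
 thus thesis using that by blast
qed

end

section \<open>Uniqueness\<close>

text \<open>Left continuity at the smaller of \<open>t\<close> and the lifetime \<open>z\<close>,
  after which the path is constant. It is needed because functionals are compared at rational times
  before death only.\<close>

lemma good_path_rational_less:
 assumes a: "good_path z a" and c: "c < a t" and t: "t < infy"
 obtains q where "q : \<rat>" "0 < q" "en q < z" "en q < t" "c < a (en q)"
proof -
 have a0: "a 0 = 0" and az: "ALL t. z <= t --> t < infy --> a t = a z" using a[unfolded good_path_def] by - (elim conjE, assumption)+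
 let ?u = "min t z"
 have au: "a ?u = a t" using az[rule_format, of t] t by (auto simp: min_def)
 have u: "?u < infy" using t by (simp add: min_less_iff_disj)
 have "?u ~= 0" using c au a0 by (metis not_less_zero)
 hence u0: "0 < ?u" by (rule zero_less_iff_neq_zero[THEN iffD2])
 have "(a \<longlongrightarrow> a ?u) (at_left ?u)" by (rule tendsto_mono[OF at_le good_path_tendsto[OF a u]]) simp
 hence "eventually (%s. c < a s) (at_left ?u)" by (rule order_tendstoD(1)) (simp only: au c)
 then obtain b where b: "b < ?u" "ALL y>b. y < ?u --> c < a y" unfolding eventually_at_left[OF u0] by blast
 obtain q where q: "q : \<rat>" "b < en q" "en q < ?u" by (rule rat_between[OF b(1)]) blast
 have "0 < en q" using q(2) by (rule le_less_trans[OF zero_le])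
 thus thesis using that[of q] b(2) q by simp
qed

lemma nn_integral_exp_Ico: "0 <= r ==> (sl {0..<r} (%t. ee (- r))) = en (r * exp (- r))"
 by (simp add: ncmind ennreal_mult mult.commute)

context revuz_functional
begin

abbreviation killed :: "'w => ennreal" where
 "killed w \<equiv> sl {t. 0 <= t & en t < lifetime X w} (%t. ee (- t) * exp_neg (B (en t) w))"

lemma phi1_le_1: "phi1 X P B x <= 1"
proof -
 have "killed w <= 1" for w
 proof -
 have "killed w <= sl {0..} (%t. ee (- 1 * t))"
 using mlmono[OF exp_neg_le_1] by (intro nmono) (auto split: spind)
 thus ?thesis by (subst (asm) nn_integral_exp_Ici) auto
 qed
 hence "phi1 X P B x <= nn (CP (PS x)) (%w. 1)" unfolding phi1_def by (intro nmono)
 thus ?thesis using prob_space.emeasure_space_1[OF prob_space_P[of "Some x"]] by (simp del: ncompl)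
qed

lemma killed_ge:
 assumes mono: "!!t. 0 < t ==> t < r ==> B (en t) w <= B (en r) w" and r: "0 < r" "en r < lifetime X w"
 shows "en (r * exp (- r)) * exp_neg (B (en r) w) <= killed w"
proof -
 have anti: "exp_neg t <= exp_neg s" if "s <= t" for s t
 using that by (cases s; cases t) (auto simp: exp_neg_def ennreal_le_iff top_unique)
 have "en (r * exp (- r)) * exp_neg (B (en r) w) = nl (%t. exp_neg (B (en r) w) * (ee (- r) * ind {0..<r} t))"
 using r(1) by (subst ncmult) (simp_all add: nn_integral_exp_Ico mult.commute)
 also have "... <= killed w"
 proof (rule nmonoAE, use AE_pos_time in eventually_elim)
 case (elim t)
 show ?case
 proof (cases "0 < t & t < r")
 case True
 hence "en t < lifetime X w" using r(2) by (intro le_less_trans[OF ennreal_leI r(2)]) simp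
 moreover have "exp_neg (B (en r) w) * ee (- r) <= exp_neg (B (en t) w) * ee (- t)"
 using True by (intro mult_mono anti mono ennreal_leI) auto
 ultimately show ?thesis using True by (simp add: mult.commute)
 qed (use elim in \<open>auto split: spind\<close>)
 qed
 finally show ?thesis .
qed

text \<open>\<open>\<phi>\<close> dominates a positive constant times the mean of
  \<open>exp_neg (B r)\<close> on survival to \<open>r\<close>. So \<open>B\<close> is infinite at
  every time \<open>1 / (n + 1)\<close> at which the path is alive, and by monotonicity from then
  on.\<close>

lemma phi1_zero_top:
 assumes 0: "phi1 X P B x = 0" and mono: "AE w in PS x. mono_on {0<..<infy} (%t. B t w)"
 shows "AE w in PS x. ALL t. 0 < t & t < infy --> B t w = infy"
proof -
 let ?C = "CP (PS x)"
 have "AE w in ?C. B (en (rs n)) w < infy --> X (en (rs n)) w = None" for n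
 proof -
 let ?r = "rs n"
 let ?f = "%w. en (?r * exp (- ?r)) * exp_neg (B (en ?r) w) * ext0 (%_. 1) (X (en ?r) w)"
 have "?f : bm (FF (en ?r))"
 by (intro bmtimes borel_measurable_const mcomp[OF adapted mexpn]
 mcomp[OF mXFF mext0]) auto
 note fm = mFFc[OF this, of "Some x"]
 have "nn ?C (%w. ?f w) <= phi1 X P B x" unfolding phi1_def
 proof (rule nmonoAE, use AE_completion[OF mono] in eventually_elim)
 case (elim w)
 show ?case
 proof (cases "X (en ?r) w")
 case (Some y)
 hence "en ?r < lifetime X w" by (simp only: lt_iff) simp
 hence "en (?r * exp (- ?r)) * exp_neg (B (en ?r) w) <= killed w"
 by (intro killed_ge mono_onD[OF elim] ennreal_leI) auto
 thus ?thesis unfolding Some ext0_simps mult_1_right .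
 qed (simp only: ext0_simps mult_zero_right zero_le)
 qed
 hence "nn ?C (%w. ?f w) = 0" unfolding 0 by simp
 hence "AE w in ?C. ?f w = 0" by (subst (asm) n0AE[OF fm])
 thus ?thesis
 proof eventually_elim
 case (elim w)
 have "0 < en (?r * exp (- ?r))" by simp
 hence "exp_neg (B (en ?r) w) = 0 | ext0 (%_. 1) (X (en ?r) w) = (0 :: ennreal)" using elim by (metis less_irrefl mult_eq_0_iff)
 thus ?case by (cases "X (en ?r) w") (auto simp: exp_neg_def split: if_splits)
 qed
 qed
 hence "AE w in PS x. ALL n. B (en (rs n)) w < infy --> X (en (rs n)) w = None"
 unfolding AE_completion_iff by (intro AEall[THEN iffD2] allI)
 thus ?thesis using mono normal[of "Some x"]
 proof (eventually_elim, intro allI impI, elim conjE)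
 fix w t assume *: "ALL n. B (en (rs n)) w < infy --> X (en (rs n)) w = None"
 and w: "mono_on {0<..<infy} (%t. B t w)" "X 0 w = Some x" and t: "0 < t" "t < (infy :: ennreal)"
 have "0 < min t (lifetime X w)" using w(2) t(1) by (simp add: lt_iff)
 then obtain n where n: "en (rs n) < min t (lifetime X w)" by (rule dn_less)
 hence "X (en (rs n)) w ~= None" by (simp only: lt_iff[symmetric] min_less_iff_conj)
 hence "B (en (rs n)) w = infy" using *[rule_format, of n] by (cases "B (en (rs n)) w < infy") (auto simp: less_top[symmetric])
 moreover have "B (en (rs n)) w <= B t w" by (rule mono_onD[OF w(1)]) (use n t in auto)
 ultimately show "B t w = infy" by (simp add: top_unique)
 qed
qed

text \<open>Off \<open>N\<close> the clock is finite before the lifetime, which is positive, so it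
  cannot be infinite at once.\<close>

lemma phi1_pos:
 assumes x: "x ~: N"
 shows "0 < phi1 X P B x"
proof (rule ccontr)
 assume "~ 0 < phi1 X P B x"
 hence "phi1 X P B x = 0" by simp
 moreover have "AE w in PS x. mono_on {0<..<infy} (%t. B t w)"
 using start_LL[OF x] by eventually_elim (auto intro!: mono_onI good_path_mono[OF good])
 ultimately have "AE w in PS x. ALL t. 0 < t & t < infy --> B t w = infy" by (rule phi1_zero_top)
 hence "AE w in PS x. False" using start_LL[OF x] normal[of "Some x"]
 proof eventually_elim
 case (elim w)
 hence "0 < lifetime X w" by (simp add: lt_iff)
 then obtain n where n: "en (rs n) < lifetime X w" by (rule dn_less)
 have "ALL t<lifetime X w. B t w < infy" using good[OF elim(2)] unfolding good_path_def by (elim conjE)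
 hence "B (en (rs n)) w < infy" using n by (elim allE impE)
 thus False using elim(1)[rule_format, of "en (rs n)"] by simp
 qed
 thus False using prob_space.AE_False[OF prob_space_P] by simp
qed

text \<open>As long as the clock is at most \<open>l\<close>, the factor \<open>exp_neg B\<close> is
  at least \<open>exp (- l)\<close>.\<close>

lemma occ_le_phi1:
 assumes y: "y ~: N" and l: "0 <= l"
 shows "nn (PS y) (%w. ee (- l) * occ (%_. 1) l w) <= phi1 X P B y"
proof -
 have "nn (CP (PS y)) (%w. ee (- l) * occ (%_. 1) l w) <= phi1 X P B y" unfolding phi1_def
 proof (rule nmonoAE, use AE_completion[OF start_LL[OF y]] in eventually_elim)
 case (elim w)
 note [measurable] = mcomp[OF menn mfX[OF borel_measurable_const[of 1], of w]]
 have "ee (- l) * occ (%_. 1) l w = nl (%t. ee (- l) * (ee (- t) * ind {..tau w l} (en t) * ext0 (%_. 1) (X (en t) w) * ind {0..} t))"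
 by (rule ncmult[symmetric]) measurable
 also have "... <= killed w"
 proof (rule nmono)
 fix t
 show "ee (- l) * (ee (- t) * ind {..tau w l} (en t) * ext0 (%_. 1) (X (en t) w) * ind {0..} t)
 <= ee (- t) * exp_neg (B (en t) w) * ind {t. 0 <= t & en t < lifetime X w} t"
 proof (cases "0 <= t & en t < lifetime X w & en t <= tau w l")
 case True
 hence Bl: "B (en t) w <= en l" using ivt_less_good[OF good[OF elim], of "en t" l] l by (simp add: not_less[symmetric])
 then obtain b where b: "B (en t) w = en b" "0 <= b" by (cases "B (en t) w") (auto simp: top_unique)
 hence "ee (- l) <= exp_neg (B (en t) w)" using Bl l by (simp add: exp_neg_def ennreal_le_iff)
 hence "ee (- t) * ee (- l) <= ee (- t) * exp_neg (B (en t) w)" by (intro mlmono zero_le)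
 thus ?thesis using True by (cases "X (en t) w") (auto simp: lt_iff mult.commute)
 next
 case False
 thus ?thesis by (cases "X (en t) w") (auto simp: lt_iff split: spind)
 qed
 qed
 finally show ?case .
 qed
 thus ?thesis by (simp only: ncompl)
qed

text \<open>\<open>\<phi>\<close> is small on a fine neighborhood of \<open>x\<close>, which the
  path leaves with vanishing probability, and \<open>\<phi> \<le> 1\<close> controls the
  rest.\<close>

lemma PT_phi1_tendsto:
 assumes d: "continuous_map (fine_topology X P) euclidean (phi1 X P B)" and x: "phi1 X P B x = 0"
 shows "(%n. PT (en (rs n)) (phi1 X P B) x) ->> 0"
proof (rule tendsto_zero_ennreal)
 interpret prob_space "PS x" by (rule prob_space_P)
 fix e :: real assume e: "0 < e"
 let ?W = "{y : topspace (fine_topology X P). phi1 X P B y : {..<en (e / 2)}}"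
 have top: "topspace (fine_topology X P) = UNIV"
 using openin_subset[OF fine_open_excessive[OF green_excessive(1), of UNIV]] by auto
 have "openin (fine_topology X P) ?W" by (rule openin_continuous_map_preimage[OF d]) (simp add: open_lessThan)
 moreover have "x : ?W" using x e by (simp add: top)
 ultimately obtain V where V: "V <= ?W" "near x V" by (rule fine_open_near)
 let ?A = "%n. {w. Y n w : Some ` (- V)}"
 have "(%n. prob (?A n)) ->> 0" using V(2) by (simp only: near_def)
 hence "eventually (%n. prob (?A n) < e / 2) sequentially" using e by (intro order_tendstoD(2)) auto
 thus "eventually (%n. PT (en (rs n)) (phi1 X P B) x < en e) sequentially"
 proof eventually_elim
 case (elim n)
 have ev: "?A n : events" using V(2) by (auto intro!: sets_P_NF X_event simp: near_def)
 have "PT (en (rs n)) (phi1 X P B) x <= nn (PS x) (%w. en (e / 2) + ind (?A n) w)"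
 unfolding transition_def
 proof (rule nmono)
 fix w
 show "ext0 (phi1 X P B) (Y n w) <= en (e / 2) + ind (?A n) w"
 proof (cases "Y n w")
 case (Some y)
 hence i: "ind (?A n) w = (ind (- V) y :: ennreal)" by (auto split: spind)
 show ?thesis unfolding i unfolding Some ext0_simps using V(1) phi1_le_1[of y] by (cases "y : V") (auto intro: add_increasing)
 qed (simp only: ext0_simps zero_le)
 qed
 also have "... = en (e / 2) + en (prob (?A n))"
 by (subst nadd, simp, rule bmind[OF ev])
 (simp only: nn_integral_indicator[OF ev] nn_integral_const emeasure_space_1 mult_1_right emeasure_eq_measure[of "?A n"])
 also have "... = en (e / 2 + prob (?A n))" using e by simp
 also have "... < en e" using elim e by (intro ennreal_lessI) auto
 finally show ?case .
 qed
qed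

end

lemma good_path_dn: "good_path z a ==> (%k. a (en (rs k))) ->> 0"
proof -
 assume a: "good_path z a"
 have a0: "a 0 = 0" using a[unfolded good_path_def] by - (elim conjE, assumption)
 have "(%k. en (rs k)) ->> en 0" by (intro tendsto_ennrealI LIMSEQ_Suc[OF lim_1_over_n])
 thus ?thesis
 using isCont_tendsto_compose[of 0 a "%k. en (rs k)"] good_path_tendsto[OF a, of 0] by (simp add: isCont_def a0)
qed

section \<open>Transfer of the comparison to every starting point\<close>

context symmetric_hunt_process
begin

context
 fixes B :: "ennreal => 'w => ennreal" and LL nu N and As :: "nat => ennreal => 'w => ennreal" and LLs and nus :: "nat => 'e measure" and Ns
 assumes pair: "!!n. revuz_pair X P \<theta> m DL L T \<E> D G (As n) (LLs n) (nus n) (Ns n) B LL nu N"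
 and sup: "!!S. S : sets borel ==> incseq (%n. emu (nus n) S)" "!!S. S : sets borel ==> emu nu S = (SUP n. emu (nus n) S)"
begin

interpretation B: revuz_functional X P \<theta> m DL L T \<E> D G B LL nu N
 using pair[of 0] by (rule revuz_pair.axioms(3))

interpretation A: revuz_functional X P \<theta> m DL L T \<E> D G "As n" "LLs n" "nus n" "Ns n" for n
 using pair[of n] by (rule revuz_pair.axioms(2))

text \<open>The conclusion of \<open>approximation\<close> as a set of paths, measurable thanks to
  the rational times. It is almost sure from almost every start, and \<open>markov_AE\<close> puts
  the path after any time \<open>1 / (k + 1)\<close> into it from every start.\<close>

private definition "cmp = {w : LL. ALL t:\<rat> Int {0<..}. X (en t) w ~= None -->
 (ALL n. As n (en t) w <= B (en t) w) & B (en t) w <= (SUP n. As n (en t) w)}"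

private lemma cmp_shift: "AE w in PS x. ALL k. Y k w ~= None --> th (en (rs k)) w : cmp"
proof (intro AEall[THEN iffD2] allI markov_AE)
 have c: "countable (\<rat> Int {0<..} :: real set)" by (rule countable_subset[OF _ countable_rat]) auto
 have [measurable]: "B (en t) : bm (FF infy)" "As n (en t) : bm (FF infy)" for t n
 by (rule mFFm[OF B.adapted] mFFm[OF A.adapted]; simp)+
 have [measurable]: "Measurable.pred (FF infy) (%w. X (en t) w ~= None)" for t
 using msets[OF mXFF[OF order_refl[THEN order_trans, OF top_greatest[folded oodef]]], of "- {None}" "en t"]
 by (simp add: pred_def vimage_def sets_cemetery_borel)
 have "cmp = LL Int (\<Inter>t\<in>\<rat> Int {0<..}. {w : space (FF infy). X (en t) w ~= None -->
 (ALL n. As n (en t) w <= B (en t) w) & B (en t) w <= (SUP n. As n (en t) w)})"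
 unfolding cmp_def by auto
 also have "... : sets (FF infy)"
 by (intro sets.Int B.LL_sets sets.countable_INT''[OF UNIV_FF c]) measurable
 finally show "cmp : sets (FF infy)" .
 show "AE y in m. AE w in PS y. w : cmp"
 proof (rule evmono[OF eventually_conj[OF approximation[OF pair sup(2,1)] B.AE_start(1)]])
 fix y assume "(AE w in PS y. ALL t:\<rat> Int {0<..}. en t < lifetime X w -->
 (ALL n. As n (en t) w <= B (en t) w) & B (en t) w <= (SUP n. As n (en t) w)) & (AE w in PS y. w : LL)"
 from this[THEN conjunct1] this[THEN conjunct2] show "AE w in PS y. w : cmp"
 by eventually_elim (simp add: cmp_def lt_iff)
 qed
qed simp_all

private lemma shift_compare:
 assumes w: "!!k. Y k w ~= None ==> th (en (rs k)) w : cmp"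
 and q: "q : \<rat>" "rs k < q" "X (en q) w ~= None"
 defines "s \<equiv> rs k"
 defines "w' \<equiv> th (en s) w"
 shows "w' : LL" "X (en (q - s)) w' ~= None" "As n (en (q - s)) w' <= B (en (q - s)) w'"
 "B (en (q - s)) w' <= (SUP n. As n (en (q - s)) w')"
proof -
 have "en s <= en q" using q(2) by (intro ennreal_leI) (simp add: s_def)
 from X_None_mono[OF _ this] q(3) have "X (en s) w ~= None" by (rule contrapos_nn[rotated])
 hence c: "w' : cmp" unfolding w'_def s_def by (rule w)
 have "X (en (q - s)) w' = X (en (q - s) + en s) w" unfolding w'_def by (rule shift) simp
 also have "... = X (en q) w" using q(2) by (subst ennreal_plus[symmetric]) (auto simp: s_def)
 finally show X: "X (en (q - s)) w' ~= None" using q(3) by simp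
 have "q - s : \<rat> Int {0<..}" using q(1,2) by (simp add: s_def)
 with c X have "w' : LL & (ALL n. As n (en (q - s)) w' <= B (en (q - s)) w') & B (en (q - s)) w' <= (SUP n. As n (en (q - s)) w')"
 unfolding cmp_def by simp
 thus "w' : LL" "As n (en (q - s)) w' <= B (en (q - s)) w'"
 "B (en (q - s)) w' <= (SUP n. As n (en (q - s)) w')" by simp_all
qed

text \<open>The inequalities hold for the path after time \<open>1 / (k + 1)\<close>. Additivity
  restores the values at that time, which tend to 0 because the clocks are continuous and start at
  0. Left continuity then passes from rational times to all \<open>t\<close>.\<close>

lemma canonical_eq:
 assumes x: "x ~: N" "!!n. x ~: Ns n"
 shows "AE w in PS x. ALL t. 0 < t & t < infy --> (SUP n. As n t w) = B t w"
proof -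
 have "AE w in PS x. ALL n. w : LLs n" using A.start_LL[OF x(2)] by (intro AEall[THEN iffD2] allI)
 thus ?thesis using cmp_shift[of x] B.start_LL[OF x(1)]
 proof (eventually_elim, intro allI impI, elim conjE)
 fix w t assume wA: "ALL n. w : LLs n" and c: "ALL k. Y k w ~= None --> th (en (rs k)) w : cmp" and wB: "w : LL"
 and t: "0 < t" "t < (infy :: ennreal)"
 have gA: "good_path (lifetime X w) (%t. As n t w)" for n using wA by (intro A.good) simp
 have gB: "good_path (lifetime X w) (%t. B t w)" using wB by (rule B.good)
 let ?s = "%k. rs k"
 have add: "EX k0. ALL k>=k0. As n (en q) w <= As n (en (?s k)) w + B (en q) w & B (en q) w <= B (en (?s k)) w + (SUP n. As n (en q) w)"
 if q: "q : \<rat>" "0 < q" "en q < lifetime X w" for q n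
 proof -
 obtain k0 where k0: "en (?s k0) < en q" using dn_less[of "en q"] q(2) by auto
 show ?thesis
 proof (intro exI[of _ k0] allI impI)
 fix k assume "k0 <= k"
 hence "?s k <= ?s k0" by (simp add: field_simps)
 also have "?s k0 < q" using k0 by (simp add: ennreal_less_iff)
 finally have k: "?s k < q" .
 note sc = shift_compare[OF c[rule_format] q(1) k q(3)[unfolded lt_iff]]
 let ?w = "th (en (?s k)) w"
 have eq: "en (?s k) + en (q - ?s k) = en q" using k by (subst ennreal_plus[symmetric]) auto
 have Bq: "B (en q) w = B (en (?s k)) w + B (en (q - ?s k)) ?w"
 using B.additive[OF wB, of "en (?s k)" "en (q - ?s k)"] unfolding eq by simp
 have Aq: "As n (en q) w = As n (en (?s k)) w + As n (en (q - ?s k)) ?w" for n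
 using A.additive[OF wA[rule_format], of "en (?s k)" "en (q - ?s k)" n] unfolding eq by simp
 have "As n (en q) w <= As n (en (?s k)) w + B (en q) w"
 unfolding Aq[of n] Bq by (intro add_left_mono order_trans[OF sc(3)] add_increasing order_refl zero_le)
 moreover have "(SUP n. As n (en (q - ?s k)) ?w) <= (SUP n. As n (en q) w)" unfolding Aq by (intro SUP_subset_mono order_refl add_increasing zero_le)
 hence "B (en q) w <= B (en (?s k)) w + (SUP n. As n (en q) w)"
 unfolding Bq by (intro add_left_mono order_trans[OF sc(4)])
 ultimately show "As n (en q) w <= As n (en (?s k)) w + B (en q) w & B (en q) w <= B (en (?s k)) w + (SUP n. As n (en q) w)" ..
 qed
 qed
 have AB: "As n (en q) w <= B (en q) w" if q: "q : \<rat>" "0 < q" "en q < lifetime X w" for q n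
 proof (rule LIMSEQ_le_const)
 show "(%k. As n (en (?s k)) w + B (en q) w) ->> B (en q) w"
 using tendsto_add[OF good_path_dn[OF gA[of n]] tendsto_const] by (simp only: add_0_left)
 show "EX k0. ALL k>=k0. As n (en q) w <= As n (en (?s k)) w + B (en q) w" using add[OF q] by blast
 qed
 have BA: "B (en q) w <= (SUP n. As n (en q) w)" if q: "q : \<rat>" "0 < q" "en q < lifetime X w" for q
 proof (rule LIMSEQ_le_const)
 show "(%k. B (en (?s k)) w + (SUP n. As n (en q) w)) ->> (SUP n. As n (en q) w)"
 using tendsto_add[OF good_path_dn[OF gB] tendsto_const] by (simp only: add_0_left)
 show "EX k0. ALL k>=k0. B (en q) w <= B (en (?s k)) w + (SUP n. As n (en q) w)" using add[OF q] by blast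
 qed
 show "(SUP n. As n t w) = B t w"
 proof (intro antisym SUP_least)
 fix n show "As n t w <= B t w"
 proof (rule ccontr)
 assume "~ As n t w <= B t w"
 hence "B t w < As n t w" by simp
 from gA this t(2) obtain q where q: "q : \<rat>" "0 < q" "en q < lifetime X w" "en q < t" "B t w < As n (en q) w"
 by (rule good_path_rational_less)
 thus False using AB[OF q(1-3), of n] good_path_mono[OF gB less_imp_le[OF q(4)] t(2)] by simp
 qed
 next
 show "B t w <= (SUP n. As n t w)"
 proof (rule ccontr)
 assume "~ B t w <= (SUP n. As n t w)"
 hence "(SUP n. As n t w) < B t w" by simp
 from gB this t(2) obtain q where q: "q : \<rat>" "0 < q" "en q < lifetime X w" "en q < t" "(SUP n. As n t w) < B (en q) w"
 by (rule good_path_rational_less)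
 have "(SUP n. As n (en q) w) <= (SUP n. As n t w)"
 using good_path_mono[OF gA less_imp_le[OF q(4)] t(2)] by (intro SUP_mono) blast
 thus False using BA[OF q(1-3)] q(5) by simp
 qed
 qed
 qed
qed

text \<open>If the path survives to \<open>q\<close> with all \<open>As n\<close> at most
  \<open>l\<close> there, the path after a short time \<open>s\<close> has \<open>B \<le> l\<close>
  for a time \<open>q / 2\<close>, hence an occupation bounded below. By \<open>occ_le_phi1\<close>
  such paths have probability at most a multiple of \<open>P_s \<phi> x\<close>, which tends to
  0.\<close>

lemma canonical_top:
 assumes x: "!!n. x ~: Ns n" and d: "continuous_map (fine_topology X P) euclidean (phi1 X P B)" "phi1 X P B x = 0"
 shows "AE w in PS x. ALL t. 0 < t & t < infy --> (SUP n. As n t w) = infy"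
proof -
 let ?s = "%k. rs k" and ?C = "CP (PS x)"
 have AL: "AE w in PS x. ALL n. w : LLs n" using A.start_LL[OF x] by (intro AEall[THEN iffD2] allI)
 have D: "AE w in ?C. X (en q) w ~= None --> ~ (SUP n. As n (en q) w) <= of_nat l" if q: "q : \<rat>" "0 < q" for q and l :: nat
 proof -
 let ?D = "{w. X (en q) w ~= None & (SUP n. As n (en q) w) <= of_nat l}"
 \<comment> \<open>\<open>c\<close> is the factor \<open>exp (- l)\<close> of
   \<open>occ_le_phi1\<close> times the occupation over a time \<open>q / 2\<close>, with the
   discount bounded below by \<open>exp (- (q / 2))\<close>. The shift takes less than
   \<open>q / 2\<close>, so these times lie before \<open>q\<close>.\<close>
 define c where "c = exp (- real l) * (q / 2 * exp (- (q / 2)))"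
 have c: "0 < c" using q(2) by (simp add: c_def)
 have [measurable]: "As n (en q) : bm (FF infy)" for n by (rule mFFm[OF A.adapted]) simp_all
 have [measurable]: "Measurable.pred (FF infy) (%w. X (en q) w ~= None)"
 using msets[OF mXFF[of "en q" infy], of "- {None}"] by (simp add: pred_def vimage_def sets_cemetery_borel)
 have "{w : space (FF infy). X (en q) w ~= None & (SUP n. As n (en q) w) <= of_nat l} : sets (FF infy)" by measurable
 hence Dm: "?D : sets ?C" using FF_sub_P by auto
 define F where "F w = ee (- real l) * B.occ (%_. 1) (real l) w" for w
 have Fm: "F : bm (FF infy)" unfolding F_def[abs_def]
 by (intro bmtimes borel_measurable_const B.measurable_occ)
 have le: "en c * emu ?C ?D <= PT (en (?s k)) (phi1 X P B) x" if k: "?s k < q / 2" for k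
 proof -
 have "en c * emu ?C ?D = nn ?C (%w. en c * ind ?D w)" by (rule ncmind[OF Dm, symmetric])
 also have "... <= nn ?C (%w. (if X (en (?s k)) w = None then 0 else F (th (en (?s k)) w)))"
 proof (rule nmonoAE, use AE_completion[OF AL] AE_completion[OF cmp_shift[of x]] in eventually_elim)
 case (elim w)
 let ?w = "th (en (?s k)) w"
 show ?case
 proof (cases "w : ?D")
 case True
 hence w: "X (en q) w ~= None" "(SUP n. As n (en q) w) <= of_nat l" by auto
 have gA: "good_path (lifetime X w) (%t. As n t w)" for n using elim(1) by (intro A.good) simp
 have kq: "?s k < q" using k q(2) by simp
 have "en (?s k) <= en q" using kq by (intro ennreal_leI) simp
 from X_None_mono[OF _ this] w(1) have Xs: "X (en (?s k)) w ~= None" by (rule contrapos_nn[rotated])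
 have wc: "?w : cmp" by (rule elim(2)[rule_format, OF Xs])
 have gw: "good_path (lifetime X ?w) (%t. B t ?w)" using wc by (intro B.good) (simp add: cmp_def)
 have tq: "X (en t) ?w ~= None & As n (en t) ?w <= As n (en q) w" if t: "0 <= t" "t < q / 2" for t n
 proof -
 have eq: "en (?s k) + en t = en (?s k + t)" using t by simp
 have tq: "en (?s k + t) <= en q" using t k by (intro ennreal_leI) simp
 have "X (en t) ?w = X (en (?s k + t)) w" unfolding eq[symmetric] by (subst add.commute) (rule shift, simp)
 moreover from X_None_mono[OF _ tq] w(1) have "X (en (?s k + t)) w ~= None" by (rule contrapos_nn[rotated])
 ultimately have "X (en t) ?w ~= None" by (simp only: not_False_eq_True)
 moreover have "As n (en t) ?w <= As n (en (?s k + t)) w"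
 unfolding eq[symmetric] using A.additive[OF elim(1)[rule_format], of "en (?s k)" "en t" n] by simp
 ultimately show ?thesis using good_path_mono[OF gA tq, of n] by (auto intro: order_trans)
 qed
 have tau: "en t <= B.tau ?w (real l)" if t: "0 <= t" "t < q / 2" for t
 proof (rule ccontr)
 assume "~ en t <= B.tau ?w (real l)"
 hence "B.tau ?w (real l) < en t" by simp
 then obtain p where p: "p : \<rat>" "0 <= p" "en p < en t" "en (real l) < B (en p) ?w" unfolding ivt_less_iff by blast
 have "B 0 ?w = 0" using gw[unfolded good_path_def] by - (elim conjE, assumption)
 hence p0: "0 < p" using p(2,4) by (cases "p = 0") auto
 have pt: "p < q / 2" using p(2,3) t by (simp add: ennreal_less_iff)
 have "B (en p) ?w <= (SUP n. As n (en p) ?w)"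
 using wc p(1) p0 tq[OF p(2) pt] by (simp add: cmp_def)
 also have "... <= (SUP n. As n (en q) w)" using tq[OF p(2) pt] by (intro SUP_mono) blast
 also have "... <= en (real l)" using w(2) by (simp add: ennat)
 finally show False using p(4) by simp
 qed
 have "en (q / 2 * exp (- (q / 2))) = sl {0..<q / 2} (%t. ee (- (q / 2)))"
 using q(2) by (intro nn_integral_exp_Ico[symmetric]) simp
 also have "... <= B.occ (%_. 1) (real l) ?w"
 proof (rule nmono)
 fix t
 show "ee (- (q / 2)) * ind {0..<q / 2} t <= ee (- t) * ind {..B.tau ?w (real l)} (en t) * ext0 (%_. 1) (X (en t) ?w) * ind {0..} t"
 using tau[of t] tq[of t] by (cases "0 <= t & t < q / 2"; cases "X (en t) ?w") (auto intro!: ennreal_leI)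
 qed
 finally have "ee (- real l) * en (q / 2 * exp (- (q / 2))) <= F ?w" unfolding F_def by (rule mlmono) simp
 also have "ee (- real l) * en (q / 2 * exp (- (q / 2))) = en c"
 unfolding c_def using q(2) by (intro ennreal_mult[symmetric]) auto
 finally show ?thesis unfolding if_not_P[OF Xs] using True by (simp del: of_nat_Suc)
 qed simp
 qed
 also have "... = PT (en (?s k)) (%y. nn (PS y) (%w. F w)) x"
 unfolding ncompl by (rule markov_PT[OF _ _ Fm]) simp_all
 also have "... <= PT (en (?s k)) (phi1 X P B) x"
 using B.AE_start(3) unfolding F_def by (intro PT_mono_AE, eventually_elim) (rule B.occ_le_phi1, simp_all)
 finally show ?thesis .
 qed
 obtain k0 where k0: "en (?s k0) < en (q / 2)" using dn_less[of "en (q / 2)"] q(2) by auto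
 have "en c * emu ?C ?D <= 0"
 proof (rule LIMSEQ_le_const[OF B.PT_phi1_tendsto[OF d]], intro exI[of _ k0] allI impI le)
 fix k assume "k0 <= k"
 hence "?s k <= ?s k0" by (simp add: field_simps)
 also have "?s k0 < q / 2" using k0 by (simp add: ennreal_less_iff)
 finally show "?s k < q / 2" .
 qed
 hence "?D : null_sets ?C" using c Dm by (auto simp: null_sets_def)
 thus ?thesis by (rule AE_I') auto
 qed
 have c: "countable (\<rat> Int {0<..} :: real set)" by (rule countable_subset[OF _ countable_rat]) auto
 have "AE w in ?C. ALL q:\<rat> Int {0<..}. ALL l::nat. X (en q) w ~= None --> ~ (SUP n. As n (en q) w) <= of_nat l"
 using D by (intro AE_ball_countable[OF c, THEN iffD2] AEall[THEN iffD2] ballI allI) auto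
 hence "AE w in PS x. ALL q:\<rat> Int {0<..}. ALL l::nat. X (en q) w ~= None --> ~ (SUP n. As n (en q) w) <= of_nat l"
 by (simp only: AE_completion_iff)
 thus ?thesis using AL normal[of "Some x"]
 proof (eventually_elim, intro allI impI, elim conjE)
 fix w t assume D: "ALL q:\<rat> Int {0<..}. ALL l::nat. X (en q) w ~= None --> ~ (SUP n. As n (en q) w) <= of_nat l"
 and wA: "ALL n. w : LLs n" and X0: "X 0 w = Some x" and t: "0 < t" "t < (infy :: ennreal)"
 have "0 < min t (lifetime X w)" using X0 t(1) by (simp add: lt_iff)
 then obtain q where q: "q : \<rat>" "0 < en q" "en q < min t (lifetime X w)" by (rule rat_between) blast
 have gA: "good_path (lifetime X w) (%t. As n t w)" for n using wA by (intro A.good) simp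
 have "X (en q) w ~= None" using q(3) by (simp only: lt_iff[symmetric] min_less_iff_conj)
 hence "~ (SUP n. As n (en q) w) <= of_nat l" for l :: nat using D q(1,2) by simp
 hence "(SUP n. As n (en q) w) = infy"
 using ennreal_Ex_less_of_nat[of "SUP n. As n (en q) w"] by (cases "(SUP n. As n (en q) w) < \<top>") (auto intro: less_imp_le simp: less_top[symmetric])
 moreover have "(SUP n. As n (en q) w) <= (SUP n. As n t w)"
 using good_path_mono[OF gA _ t(2), of "en q"] q(3) by (intro SUP_mono) (auto intro: less_imp_le)
 ultimately have "infy <= (SUP n. As n t w)" by (simp only:)
 thus "(SUP n. As n t w) = infy" unfolding oodef by (rule top_le)
 qed
qed

end

lemma PCAF_revuz_functional:
 assumes "PCAF m \<E> D X P \<theta> N B" "revuz m X P B nu" "smooth_measure m \<E> D nu"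
 obtains LL where "revuz_functional X P \<theta> m DL L T \<E> D G B LL nu N"
proof -
 obtain LL where "additive_functional X P \<theta> B LL" "!!x. x ~: N ==> AE w in PS x. w : LL" "polar m \<E> D N"
 by (rule PCAF_additive_functional[OF assms(1)]) blast
 with assms(2,3) show thesis
 by (intro that revuz_functional.intro revuz_functional_axioms.intro symmetric_hunt_process_axioms)
qed

end

theorem corollary3p3:
  fixes X :: "ennreal \<Rightarrow> 'w \<Rightarrow> 'e::{metric_space, second_countable_topology} option"
    and P :: "'e option \<Rightarrow> 'w measure"
    and \<theta> :: "ennreal \<Rightarrow> 'w \<Rightarrow> 'w"
    and m \<nu> :: "'e measure"
    and DL :: "('e \<Rightarrow> real) set" and L :: "('e \<Rightarrow> real) \<Rightarrow> 'e \<Rightarrow> real"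
    and T :: "real \<Rightarrow> ('e \<Rightarrow> real) \<Rightarrow> 'e \<Rightarrow> real"
    and \<E> :: "('e \<Rightarrow> real) \<Rightarrow> ('e \<Rightarrow> real) \<Rightarrow> real" and D :: "('e \<Rightarrow> real) set"
    and G :: "'e \<Rightarrow> 'e \<Rightarrow> ennreal"
    and N :: "'e set" and B :: "ennreal \<Rightarrow> 'w \<Rightarrow> ennreal"
  assumes "symmetric_hunt_process X P \<theta> m DL L T \<E> D G"
    and "smooth_measure m \<E> D \<nu>"
    and "PCAF m \<E> D X P \<theta> N B"
    and "N \<subseteq> singular_set X P G \<nu>"
    and "\<forall>x\<in>N. AE \<omega> in P (Some x). mono_on {0<..<\<infinity>} (\<lambda>t. B t \<omega>)"
    and "revuz m X P B \<nu>"
    and "continuous_map (fine_topology X P) euclidean (phi1 X P B)"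
  shows "N = singular_set X P G \<nu> \<and>
    (\<forall>A. canonical_functional m \<E> D X P \<theta> G \<nu> A \<longrightarrow>
       (\<forall>x. AE \<omega> in P (Some x). \<forall>t. 0 < t \<and> t < \<infinity> \<longrightarrow> A t \<omega> = B t \<omega>))"
proof -
  interpret symmetric_hunt_process X P \<theta> m DL L T \<E> D G by fact
  obtain \<Lambda> where rB: "revuz_functional X P \<theta> m DL L T \<E> D G B \<Lambda> \<nu> N"
    by (rule PCAF_revuz_functional[OF assms(3,6,2)])
  interpret B: revuz_functional X P \<theta> m DL L T \<E> D G B \<Lambda> \<nu> N by (rule rB)
  show ?thesis
  proof (intro conjI allI impI)
    show "N = singular_set X P G \<nu>"
      using assms(4) B.phi1_pos_finite_potential[OF assms(7) B.phi1_pos] by blast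
  next
    fix A x assume "canonical_functional m \<E> D X P \<theta> G \<nu> A"
    then obtain \<nu>s As where ss: "\<forall>n. strictly_smooth m \<E> D G (\<nu>s n)"
      and sup: "\<forall>S\<in>sets borel. incseq (\<lambda>n. emeasure (\<nu>s n) S) \<and> emeasure \<nu> S = (SUP n. emeasure (\<nu>s n) S)"
      and As: "\<forall>n. PCAF m \<E> D X P \<theta> {} (As n) \<and> revuz m X P (As n) (\<nu>s n)"
      and A: "\<forall>t w. A t w = (SUP n. As n t w)" unfolding canonical_functional_def by (elim exE conjE) (rule that)
    have "\<exists>\<Lambda>. revuz_functional X P \<theta> m DL L T \<E> D G (As n) \<Lambda> (\<nu>s n) {}" for n
      using As[rule_format, of n] ss[rule_format, of n, unfolded strictly_smooth_def, THEN conjunct1]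
      by (elim conjE) (rule PCAF_revuz_functional, assumption+, rule exI)
    then obtain \<Lambda>s where rA: "\<And>n. revuz_functional X P \<theta> m DL L T \<E> D G (As n) (\<Lambda>s n) (\<nu>s n) {}"
      using choice[of "\<lambda>n \<Lambda>. revuz_functional X P \<theta> m DL L T \<E> D G (As n) \<Lambda> (\<nu>s n) {}"] by blast
    have sup1: "incseq (\<lambda>n. emeasure (\<nu>s n) S)" and sup2: "emeasure \<nu> S = (SUP n. emeasure (\<nu>s n) S)" if "S \<in> sets borel" for S
      using sup that by auto
    have pair: "revuz_pair X P \<theta> m DL L T \<E> D G (As n) (\<Lambda>s n) (\<nu>s n) {} B \<Lambda> \<nu> N" for n
      by (intro revuz_pair.intro revuz_pair_axioms.intro symmetric_hunt_process_axioms rA rB) (subst sup2, assumption, rule SUP_upper, simp)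
    have "AE w in P (Some x). \<forall>t. 0 < t \<and> t < \<infinity> \<longrightarrow> (SUP n. As n t w) = B t w"
    proof (cases "x \<in> N")
      case False
      then show ?thesis by - (rule canonical_eq[OF pair sup1 sup2], simp_all)
    next
      case True
      then have "x \<notin> finite_potential_set X P G \<nu>" using assms(4) by blast
      then have 0: "phi1 X P B x = 0" using B.phi1_pos_finite_potential[OF assms(7), of x] by (cases "phi1 X P B x = 0") (auto simp: zero_less_iff_neq_zero)
      have "AE w in P (Some x). \<forall>t. 0 < t \<and> t < \<infinity> \<longrightarrow> (SUP n. As n t w) = \<infinity>"
        by (rule canonical_top[OF pair sup1 sup2 _ assms(7) 0]) simp_all
      \<comment> \<open>For \<open>x\<close> in \<open>N\<close> additivity may fail under
        \<open>P (Some x)\<close>; the assumed monotonicity is what lets \<open>\<phi> x = 0\<close>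
        force \<open>B\<close> to be infinite at once.\<close>
      moreover have "AE w in P (Some x). \<forall>t. 0 < t \<and> t < \<infinity> \<longrightarrow> B t w = \<infinity>"
        by (rule B.phi1_zero_top[OF 0]) (use assms(5) True in blast)
      ultimately show ?thesis by eventually_elim simp
    qed
    then show "AE w in P (Some x). \<forall>t. 0 < t \<and> t < \<infinity> \<longrightarrow> A t w = B t w" by (simp only: A)
  qed
qed

end
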